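(* Consider the port-Hamiltonian boundary node $(G,L,K)$ on the spaces $(\mathbb{C}^p,X,\mathbb{C}^k)$ described in the context, and assume that $\|W_{B,1}g\|_{\mathbb{C}^p}^2-\|W_Cg\|_{\mathbb{C}^k}^2\ge\langle\Xi g,g\rangle_{\mathbb{C}^{2n}}$ holds for all $g\in\ker(W_{B,2})$. Then the finite cost condition associated to the LQ optimal control problem for $(G,L,K)$ is satisfied and the optimal cost operator $\Pi$ satisfies $\Pi\le I$. Moreover, if $\|W_{B,1}g\|_{\mathbb{C}^p}^2-\|W_Cg\|_{\mathbb{C}^k}^2=\langle\Xi g,g\rangle_{\mathbb{C}^{2n}}$ holds for all $g\in\ker(W_{B,2})$ and if the partial differential equation $$\frac{\partial x}{\partial t}(\zeta,t)=P_1\frac{\partial}{\partial\zeta}(\mathcal{H}(\zeta)x(\zeta,t))+P_0(\mathcal{H}(\zeta)x(\zeta,t))$$ together with the boundary conditions $$\begin{bmatrix}\tilde W_{B,1}\\ \tilde W_{B,2}\end{bmatrix}\begin{bmatrix}\mathcal{H}(b)x(b,t)\\ \mathcal{H}(a)x(a,t)\end{bmatrix}=0$$ is strongly stable, then $\Pi=I$. In addition, the unique optimal control is given by $u^{\mathrm{opt}}(t)=0$, $t\ge0$. Furthermore, $\Pi=I$ satisfies the boundary node Riccati equation $$\langle Lx,\Pi x\rangle_X+\langle\Pi x,Lx\rangle_X+\|Gx\|_{\mathbb{C}^p}^2+\|Kx\|_{\mathbb{C}^k}^2=\|Nx\|_{\mathbb{C}^p}^2,\qquad x\in D(L),$$ with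 $N:D(L)\to\mathbb{C}^p$, $Nx=\sqrt2\,\tilde W_{B,1}\begin{bmatrix}\mathcal{H}(b)x(b)\\ \mathcal{H}(a)x(a)\end{bmatrix}$.
   Context: Port-Hamiltonian setting: $P_1=P_1^*\in\mathbb{C}^{n\times n}$ is invertible; $P_0\in\mathbb{C}^{n\times n}$; $\mathcal{H}\in L^\infty(a,b;\mathbb{C}^{n\times n})$ with $\mathcal{H}(\zeta)^*=\mathcal{H}(\zeta)\ge cI$ for some $c>0$ and a.e. $\zeta\in[a,b]$; $\tilde W_{B,1}\in\mathbb{C}^{p\times 2n}$, $\tilde W_{B,2}\in\mathbb{C}^{(n-p)\times 2n}$, $\tilde W_C\in\mathbb{C}^{k\times 2n}$. The state space is $X=L^2(a,b;\mathbb{C}^n)$ with inner product $\langle f,g\rangle_X=\langle f,\mathcal{H}g\rangle_{L^2(a,b;\mathbb{C}^n)}$. Set $$R_0=\frac{1}{\sqrt2}\begin{bmatrix}P_1&-P_1\\ I&I\end{bmatrix},\quad \Xi=\begin{bmatrix}0&I\\ I&0\end{bmatrix},\quad W_{B,1}=\tilde W_{B,1}R_0^{-1},\quad W_{B,2}=\tilde W_{B,2}R_0^{-1},\quad W_C=\tilde W_CR_0^{-1},$$ and $\tilde W_B=\begin{bmatrix}\tilde W_{B,1}\\ \tilde W_{B,2}\end{bmatrix}=[\tilde W_b\ \ \tilde W_a]$ with $\tilde W_b,\tilde W_a\in\mathbb{C}^{n\times n}$. Standing assumption: $\mathrm{rank}(\tilde W_B)=n$; in the diagonalization $P_1\mathcal{H}(\zeta)=S(\zeta)^{-1}\begin{bmatrix}\Lambda(\zeta)&0\\0&\Theta(\zeta)\end{bmatrix}S(\zeta)$,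 where $\Lambda$ and $\Theta$ are diagonal matrices containing the positive and negative eigenvalues of $P_1\mathcal{H}$ respectively, $S,\Lambda,\Theta$ are continuously differentiable; and $\tilde W_b\mathcal{H}(b)Z^+(b)\oplus\tilde W_a\mathcal{H}(a)Z^-(a)=\mathbb{C}^n$, where $Z^+(\zeta)$ (resp. $Z^-(\zeta)$) is the span of the eigenvectors of $P_1\mathcal{H}(\zeta)$ for positive (resp. negative) eigenvalues. Boundary node $(G,L,K)$ on $(\mathbb{C}^p,X,\mathbb{C}^k)$: $Lx=P_1\frac{\mathrm{d}}{\mathrm{d}\zeta}(\mathcal{H}x)+P_0(\mathcal{H}x)$, $D(L)=\{x\in X:\mathcal{H}x\in H^1(a,b;\mathbb{C}^n),\ \tilde W_{B,2}\begin{bmatrix}(\mathcal{H}x)(b)\\(\mathcal{H}x)(a)\end{bmatrix}=0\}$, $Gx=\tilde W_{B,1}\begin{bmatrix}(\mathcal{H}x)(b)\\(\mathcal{H}x)(a)\end{bmatrix}$, $Kx=\tilde W_C\begin{bmatrix}(\mathcal{H}x)(b)\\(\mathcal{H}x)(a)\end{bmatrix}$. LQ problem: minimize $J(x_0,u)=\int_0^\infty\|u(t)\|^2+\|y(t)\|^2\,\mathrm{d}t$ subject to $\dot x=Lx$, $Gx=u$, $y=Kx$, $x(0)=x_0\in X$. Here $(x,u,y)$ ranges over generalized solutions: limits of classical solutions $(x_k,u_k,y_k)$ ($x_k\in C^1([0,\infty);X)$, $x_k(t)\in D(L)$, $u_k,y_k$ continuous, equations holding for all $t\ge0$), with $x_k\to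 x$ in $X$ uniformly on bounded intervals and $u_k\to u$, $y_k\to y$ in $L^2$ on every $[0,\tau]$. Finite cost condition: for every $x_0\in X$ there is at least one input $u$ with $J(x_0,u)<\infty$. Optimal cost operator: the operator $\Pi=\Pi^*\in\mathcal{L}(X)$ with $\langle x_0,\Pi x_0\rangle_X=\inf_{u\in L^2(0,\infty;\mathbb{C}^p)}J(x_0,u)$ for all $x_0\in X$; $\Pi\le I$ means $\langle x_0,\Pi x_0\rangle_X\le\|x_0\|_X^2$ for all $x_0$. Strong stability of the PDE with the stated boundary conditions means that the semigroup $(\mathbb{T}_t)_{t\ge0}$ generated by $L_{|\ker(G)}$ is strongly stable: $\|\mathbb{T}_tx_0\|_X\to0$ as $t\to\infty$ for every $x_0\in X$.
   Formalization: For arbitrary P_0 the claim is false (n=p=k=1, P_1=H=1, P_0=α, u=x(1,t), y=x(0,t) gives Π=e^{2αζ}); the formal theorem assumes Re⟨P_0v,v⟩≤0 for all v in the first part and P_0^*=-P_0 in the "Moreover" part. *)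

theory Defs
  imports "HOL-Analysis.Analysis"
begin

definition cinner :: "complex^'m::finite \<Rightarrow> complex^'m \<Rightarrow> complex" where
  "cinner v w = (\<Sum>i\<in>UNIV. v $ i * cnj (w $ i))"

definition cadjoint :: "complex^'n::finite^'m::finite \<Rightarrow> complex^'m^'n" where
  "cadjoint A = (\<chi> i j. cnj (A $ j $ i))"

definition stack :: "complex^'n::finite \<Rightarrow> complex^'n \<Rightarrow> complex^('n + 'n)" where
  "stack v w = (\<chi> i. case i of Inl j \<Rightarrow> v $ j | Inr j \<Rightarrow> w $ j)"

definition block ::
  "complex^'n::finite^'n \<Rightarrow> complex^'n^'n \<Rightarrow> complex^'n^'n \<Rightarrow> complex^'n^'n
    \<Rightarrow> complex^('n + 'n)^('n + 'n)" where
  "block A B C D = (\<chi> r s.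
     case r of
       Inl i \<Rightarrow> (case s of Inl j \<Rightarrow> A $ i $ j | Inr j \<Rightarrow> B $ i $ j)
     | Inr i \<Rightarrow> (case s of Inl j \<Rightarrow> C $ i $ j | Inr j \<Rightarrow> D $ i $ j))"

definition Xi :: "complex^('n::finite + 'n)^('n + 'n)" where
  "Xi = block 0 (mat 1) (mat 1) 0"

text \<open>Elements of an \<open>L\<^sup>2\<close> space are represented by functions; equality of elements is
  equality almost everywhere.\<close>

definition L2 :: "real set \<Rightarrow> (real \<Rightarrow> 'e::euclidean_space) set" where
  "L2 S = {f. f \<in> borel_measurable (lebesgue_on S) \<and>
              integrable (lebesgue_on S) (\<lambda>t. (norm (f t))\<^sup>2)}"

text \<open>\<open>h\<close> is the absolutely continuous representative on \<open>[a,b]\<close> of \<open>f \<in> H\<^sup>1(a,b)\<close>, and \<open>h'\<close>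
  is its weak derivative. The function \<open>h\<close> is unique on \<open>[a,b]\<close> and \<open>h'\<close> is unique almost
  everywhere.\<close>

definition H1_rep ::
  "real \<Rightarrow> real \<Rightarrow> (real \<Rightarrow> 'e::euclidean_space) \<Rightarrow> (real \<Rightarrow> 'e) \<Rightarrow> (real \<Rightarrow> 'e) \<Rightarrow> bool" where
  "H1_rep a b f h h' \<longleftrightarrow>
     h' \<in> L2 {a..b} \<and>
     (\<forall>\<zeta>\<in>{a..b}. h \<zeta> = h a + integral\<^sup>L (lebesgue_on {a..\<zeta>}) h') \<and>
     (AE \<zeta> in lebesgue_on {a..b}. f \<zeta> = h \<zeta>)"

definition H1 :: "real \<Rightarrow> real \<Rightarrow> (real \<Rightarrow> 'e::euclidean_space) set" where
  "H1 a b = {f. \<exists>h h'. H1_rep a b f h h'}"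

definition H1_cont :: "real \<Rightarrow> real \<Rightarrow> (real \<Rightarrow> 'e::euclidean_space) \<Rightarrow> real \<Rightarrow> 'e" where
  "H1_cont a b f = (SOME h. \<exists>h'. H1_rep a b f h h')"

definition H1_deriv :: "real \<Rightarrow> real \<Rightarrow> (real \<Rightarrow> 'e::euclidean_space) \<Rightarrow> real \<Rightarrow> 'e" where
  "H1_deriv a b f = (SOME h'. \<exists>h. H1_rep a b f h h')"

definition C1_on :: "real set \<Rightarrow> (real \<Rightarrow> 'e::real_normed_vector) \<Rightarrow> bool" where
  "C1_on S f \<longleftrightarrow>
     (\<exists>f'. (\<forall>\<zeta>\<in>S. (f has_vector_derivative f' \<zeta>) (at \<zeta> within S)) \<and> continuous_on S f')"

text \<open>\<open>WB\<close> and \<open>WC\<close> act on the boundary values \<open>((\<H>x)(b), (\<H>x)(a))\<close>; the matrices acting on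
  boundary port variables are obtained by multiplying with the inverse of \<open>R0\<close> below.
  The boundary matrix \<open>WB\<close> collects all \<open>n\<close> boundary conditions. The injection \<open>inp\<close> selects
  the \<open>p\<close> rows that form \<open>WB1\<close>; the other \<open>n - p\<close> rows form \<open>WB2\<close>. Selecting rows instead of
  stacking two matrices with type-indexed numbers of rows keeps the case \<open>p = n\<close>.\<close>

record ('n::finite, 'p::finite, 'k::finite) phs =
  lo :: real
  hi :: real
  P1 :: "complex^'n^'n"
  P0 :: "complex^'n^'n"
  Ham :: "real \<Rightarrow> complex^'n^'n"
  WB :: "complex^('n + 'n)^'n"
  inp :: "'p \<Rightarrow> 'n"
  WC :: "complex^('n + 'n)^'k"

definition WB1 :: "('n::finite, 'p::finite, 'k::finite) phs \<Rightarrow> complex^('n + 'n)^'p" where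
  "WB1 \<Sigma> = (\<chi> i. WB \<Sigma> $ inp \<Sigma> i)"

text \<open>The selected rows are replaced by zero rows, which does not change the kernel.\<close>

definition WB2 :: "('n::finite, 'p::finite, 'k::finite) phs \<Rightarrow> complex^('n + 'n)^'n" where
  "WB2 \<Sigma> = (\<chi> j. if j \<in> range (inp \<Sigma>) then 0 else WB \<Sigma> $ j)"

definition Wb :: "('n::finite, 'p::finite, 'k::finite) phs \<Rightarrow> complex^'n^'n" where
  "Wb \<Sigma> = (\<chi> i j. WB \<Sigma> $ i $ Inl j)"

definition Wa :: "('n::finite, 'p::finite, 'k::finite) phs \<Rightarrow> complex^'n^'n" where
  "Wa \<Sigma> = (\<chi> i j. WB \<Sigma> $ i $ Inr j)"

definition R0 :: "('n::finite, 'p::finite, 'k::finite) phs \<Rightarrow> complex^('n + 'n)^('n + 'n)" where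
  "R0 \<Sigma> = (1 / sqrt 2) *\<^sub>R block (P1 \<Sigma>) (- P1 \<Sigma>) (mat 1) (mat 1)"

definition port_hamiltonian :: "('n::finite, 'p::finite, 'k::finite) phs \<Rightarrow> bool" where
  "port_hamiltonian \<Sigma> \<longleftrightarrow>
     lo \<Sigma> < hi \<Sigma> \<and>
     cadjoint (P1 \<Sigma>) = P1 \<Sigma> \<and> invertible (P1 \<Sigma>) \<and>
     Ham \<Sigma> \<in> borel_measurable (lebesgue_on {lo \<Sigma>..hi \<Sigma>}) \<and>
     (\<exists>M. AE \<zeta> in lebesgue_on {lo \<Sigma>..hi \<Sigma>}. norm (Ham \<Sigma> \<zeta>) \<le> M) \<and>
     (\<exists>c>0. AE \<zeta> in lebesgue_on {lo \<Sigma>..hi \<Sigma>}. cadjoint (Ham \<Sigma> \<zeta>) = Ham \<Sigma> \<zeta> \<and>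
        (\<forall>v. Re (cinner (Ham \<Sigma> \<zeta> *v v) v) \<ge> c * (norm v)\<^sup>2)) \<and>
     inj (inp \<Sigma>)"

text \<open>The blocks \<open>\<Lambda>\<close> and \<open>\<Theta>\<close> are stored in one family \<open>d\<close> of diagonal entries; \<open>J\<close> is the set of
  positions belonging to \<open>\<Lambda>\<close>.\<close>

definition C1_diagonalizable :: "('n::finite, 'p::finite, 'k::finite) phs \<Rightarrow> bool" where
  "C1_diagonalizable \<Sigma> \<longleftrightarrow>
     (\<exists>(S :: real \<Rightarrow> complex^'n^'n) (d :: real \<Rightarrow> real^'n) (J :: 'n set).
        C1_on {lo \<Sigma>..hi \<Sigma>} S \<and> C1_on {lo \<Sigma>..hi \<Sigma>} d \<and>
        (\<forall>\<zeta>\<in>{lo \<Sigma>..hi \<Sigma>}.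
           invertible (S \<zeta>) \<and>
           P1 \<Sigma> ** Ham \<Sigma> \<zeta> =
             matrix_inv (S \<zeta>) ** (\<chi> i j. if i = j then of_real (d \<zeta> $ i) else 0) ** S \<zeta> \<and>
           (\<forall>i\<in>J. d \<zeta> $ i > 0) \<and> (\<forall>i\<in>- J. d \<zeta> $ i < 0)))"

definition Zplus :: "('n::finite, 'p::finite, 'k::finite) phs \<Rightarrow> real \<Rightarrow> (complex^'n) set" where
  "Zplus \<Sigma> \<zeta> = vec.span {v. \<exists>\<mu>::real. \<mu> > 0 \<and> (P1 \<Sigma> ** Ham \<Sigma> \<zeta>) *v v = of_real \<mu> *s v}"

definition Zminus :: "('n::finite, 'p::finite, 'k::finite) phs \<Rightarrow> real \<Rightarrow> (complex^'n) set" where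
  "Zminus \<Sigma> \<zeta> = vec.span {v. \<exists>\<mu>::real. \<mu> < 0 \<and> (P1 \<Sigma> ** Ham \<Sigma> \<zeta>) *v v = of_real \<mu> *s v}"

definition standing_assumption :: "('n::finite, 'p::finite, 'k::finite) phs \<Rightarrow> bool" where
  "standing_assumption \<Sigma> \<longleftrightarrow>
     rank (WB \<Sigma>) = CARD('n) \<and>
     C1_diagonalizable \<Sigma> \<and>
     (let Yb = (\<lambda>v. Wb \<Sigma> *v (Ham \<Sigma> (hi \<Sigma>) *v v)) ` Zplus \<Sigma> (hi \<Sigma>);
          Ya = (\<lambda>v. Wa \<Sigma> *v (Ham \<Sigma> (lo \<Sigma>) *v v)) ` Zminus \<Sigma> (lo \<Sigma>)
      in {v + w | v w. v \<in> Yb \<and> w \<in> Ya} = UNIV \<and> Yb \<inter> Ya = {0})"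

type_synonym 'n state = "real \<Rightarrow> complex^'n"

definition X :: "('n::finite, 'p::finite, 'k::finite) phs \<Rightarrow> 'n state set" where
  "X \<Sigma> = L2 {lo \<Sigma>..hi \<Sigma>}"

definition eqX :: "('n::finite, 'p::finite, 'k::finite) phs \<Rightarrow> 'n state \<Rightarrow> 'n state \<Rightarrow> bool" where
  "eqX \<Sigma> f g \<longleftrightarrow> (AE \<zeta> in lebesgue_on {lo \<Sigma>..hi \<Sigma>}. f \<zeta> = g \<zeta>)"

definition innerX :: "('n::finite, 'p::finite, 'k::finite) phs \<Rightarrow> 'n state \<Rightarrow> 'n state \<Rightarrow> complex" where
  "innerX \<Sigma> f g = (LINT \<zeta>|lebesgue_on {lo \<Sigma>..hi \<Sigma>}. cinner (f \<zeta>) (Ham \<Sigma> \<zeta> *v g \<zeta>))"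

definition normX :: "('n::finite, 'p::finite, 'k::finite) phs \<Rightarrow> 'n state \<Rightarrow> real" where
  "normX \<Sigma> f = sqrt (Re (innerX \<Sigma> f f))"

definition HX :: "('n::finite, 'p::finite, 'k::finite) phs \<Rightarrow> 'n state \<Rightarrow> 'n state" where
  "HX \<Sigma> x = (\<lambda>\<zeta>. Ham \<Sigma> \<zeta> *v x \<zeta>)"

text \<open>The point values are those of the absolutely continuous representative of \<open>\<H>x\<close>.\<close>

definition bdry :: "('n::finite, 'p::finite, 'k::finite) phs \<Rightarrow> 'n state \<Rightarrow> complex^('n + 'n)" where
  "bdry \<Sigma> x = stack (H1_cont (lo \<Sigma>) (hi \<Sigma>) (HX \<Sigma> x) (hi \<Sigma>))
                    (H1_cont (lo \<Sigma>) (hi \<Sigma>) (HX \<Sigma> x) (lo \<Sigma>))"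

definition domL :: "('n::finite, 'p::finite, 'k::finite) phs \<Rightarrow> 'n state set" where
  "domL \<Sigma> = {x \<in> X \<Sigma>. HX \<Sigma> x \<in> H1 (lo \<Sigma>) (hi \<Sigma>) \<and> WB2 \<Sigma> *v bdry \<Sigma> x = 0}"

definition opL :: "('n::finite, 'p::finite, 'k::finite) phs \<Rightarrow> 'n state \<Rightarrow> 'n state" where
  "opL \<Sigma> x = (\<lambda>\<zeta>. P1 \<Sigma> *v H1_deriv (lo \<Sigma>) (hi \<Sigma>) (HX \<Sigma> x) \<zeta> + P0 \<Sigma> *v HX \<Sigma> x \<zeta>)"

definition opG :: "('n::finite, 'p::finite, 'k::finite) phs \<Rightarrow> 'n state \<Rightarrow> complex^'p" where
  "opG \<Sigma> x = WB1 \<Sigma> *v bdry \<Sigma> x"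

definition opK :: "('n::finite, 'p::finite, 'k::finite) phs \<Rightarrow> 'n state \<Rightarrow> complex^'k" where
  "opK \<Sigma> x = WC \<Sigma> *v bdry \<Sigma> x"

definition bounded_linear_X ::
  "('n::finite, 'p::finite, 'k::finite) phs \<Rightarrow> ('n state \<Rightarrow> 'n state) \<Rightarrow> bool" where
  "bounded_linear_X \<Sigma> T \<longleftrightarrow>
     (\<forall>f\<in>X \<Sigma>. T f \<in> X \<Sigma>) \<and>
     (\<forall>f\<in>X \<Sigma>. \<forall>g\<in>X \<Sigma>. \<forall>c d. eqX \<Sigma> (T (\<lambda>\<zeta>. c *s f \<zeta> + d *s g \<zeta>)) (\<lambda>\<zeta>. c *s T f \<zeta> + d *s T g \<zeta>)) \<and>
     (\<exists>C. \<forall>f\<in>X \<Sigma>. normX \<Sigma> (T f) \<le> C * normX \<Sigma> f)"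

definition C1_X ::
  "('n::finite, 'p::finite, 'k::finite) phs \<Rightarrow> (real \<Rightarrow> 'n state) \<Rightarrow> (real \<Rightarrow> 'n state) \<Rightarrow> bool" where
  "C1_X \<Sigma> x x' \<longleftrightarrow>
     (\<forall>t\<ge>0. x t \<in> X \<Sigma> \<and> x' t \<in> X \<Sigma> \<and>
        ((\<lambda>s. normX \<Sigma> (\<lambda>\<zeta>. (x s \<zeta> - x t \<zeta>) /\<^sub>R (s - t) - x' t \<zeta>)) \<longlongrightarrow> 0) (at t within {0..}) \<and>
        ((\<lambda>s. normX \<Sigma> (\<lambda>\<zeta>. x' s \<zeta> - x' t \<zeta>)) \<longlongrightarrow> 0) (at t within {0..}))"

definition classical_solution ::
  "('n::finite, 'p::finite, 'k::finite) phs
    \<Rightarrow> (real \<Rightarrow> 'n state) \<Rightarrow> (real \<Rightarrow> complex^'p) \<Rightarrow> (real \<Rightarrow> complex^'k) \<Rightarrow> bool" where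
  "classical_solution \<Sigma> x u y \<longleftrightarrow>
     continuous_on {0..} u \<and> continuous_on {0..} y \<and>
     (\<exists>x'. C1_X \<Sigma> x x' \<and>
        (\<forall>t\<ge>0. x t \<in> domL \<Sigma> \<and> eqX \<Sigma> (x' t) (opL \<Sigma> (x t)) \<and>
                opG \<Sigma> (x t) = u t \<and> y t = opK \<Sigma> (x t)))"

definition generalized_solution ::
  "('n::finite, 'p::finite, 'k::finite) phs
    \<Rightarrow> (real \<Rightarrow> 'n state) \<Rightarrow> (real \<Rightarrow> complex^'p) \<Rightarrow> (real \<Rightarrow> complex^'k) \<Rightarrow> bool" where
  "generalized_solution \<Sigma> x u y \<longleftrightarrow>
     (\<forall>t\<ge>0. x t \<in> X \<Sigma>) \<and>
     (\<forall>\<tau>\<ge>0. u \<in> L2 {0..\<tau>} \<and> y \<in> L2 {0..\<tau>}) \<and>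
     (\<exists>xs us ys. (\<forall>m::nat. classical_solution \<Sigma> (xs m) (us m) (ys m)) \<and>
        (\<forall>\<tau>\<ge>0.
           uniform_limit {0..\<tau>} (\<lambda>m t. normX \<Sigma> (\<lambda>\<zeta>. xs m t \<zeta> - x t \<zeta>)) (\<lambda>t. 0) sequentially \<and>
           (\<lambda>m. LINT t|lebesgue_on {0..\<tau>}. (norm (us m t - u t))\<^sup>2) \<longlonglongrightarrow> 0 \<and>
           (\<lambda>m. LINT t|lebesgue_on {0..\<tau>}. (norm (ys m t - y t))\<^sup>2) \<longlonglongrightarrow> 0))"

text \<open>The state and the output need not be given as functions of \<open>x0\<close> and \<open>u\<close>: the infimum runs
  over all generalized solutions with initial state \<open>x0\<close> and input \<open>u\<close>, and it is \<open>\<infinity>\<close> if there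
  is none.\<close>

definition cost ::
  "('n::finite, 'p::finite, 'k::finite) phs \<Rightarrow> 'n state \<Rightarrow> (real \<Rightarrow> complex^'p) \<Rightarrow> ennreal" where
  "cost \<Sigma> x0 u =
     (INF (x, y) \<in> {(x, y). generalized_solution \<Sigma> x u y \<and> eqX \<Sigma> (x 0) x0}.
        \<integral>\<^sup>+ t. ennreal ((norm (u t))\<^sup>2 + (norm (y t))\<^sup>2) \<partial>lebesgue_on {0..})"

definition finite_cost_condition :: "('n::finite, 'p::finite, 'k::finite) phs \<Rightarrow> bool" where
  "finite_cost_condition \<Sigma> \<longleftrightarrow> (\<forall>x0\<in>X \<Sigma>. \<exists>u. cost \<Sigma> x0 u < \<infinity>)"

definition optimal_cost :: "('n::finite, 'p::finite, 'k::finite) phs \<Rightarrow> 'n state \<Rightarrow> ennreal" where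
  "optimal_cost \<Sigma> x0 = (INF u \<in> L2 {0..}. cost \<Sigma> x0 u)"

text \<open>The comparison is made in \<^typ>\<open>ereal\<close>: it forces the infimum to be finite, and no negative
  value is truncated.\<close>

definition optimal_cost_operator ::
  "('n::finite, 'p::finite, 'k::finite) phs \<Rightarrow> ('n state \<Rightarrow> 'n state) \<Rightarrow> bool" where
  "optimal_cost_operator \<Sigma> Popt \<longleftrightarrow>
     bounded_linear_X \<Sigma> Popt \<and>
     (\<forall>f\<in>X \<Sigma>. \<forall>g\<in>X \<Sigma>. innerX \<Sigma> f (Popt g) = innerX \<Sigma> (Popt f) g) \<and>
     (\<forall>x0\<in>X \<Sigma>. ereal (Re (innerX \<Sigma> x0 (Popt x0))) = enn2ereal (optimal_cost \<Sigma> x0))"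

definition optimal_control ::
  "('n::finite, 'p::finite, 'k::finite) phs \<Rightarrow> 'n state \<Rightarrow> (real \<Rightarrow> complex^'p) \<Rightarrow> bool" where
  "optimal_control \<Sigma> x0 u \<longleftrightarrow> u \<in> L2 {0..} \<and> cost \<Sigma> x0 u = optimal_cost \<Sigma> x0"

definition boundary_node_Riccati ::
  "('n::finite, 'p::finite, 'k::finite) phs \<Rightarrow> ('n state \<Rightarrow> 'n state) \<Rightarrow> ('n state \<Rightarrow> complex^'p)
    \<Rightarrow> bool" where
  "boundary_node_Riccati \<Sigma> Popt N \<longleftrightarrow>
     (\<forall>x\<in>domL \<Sigma>.
        innerX \<Sigma> (opL \<Sigma> x) (Popt x) + innerX \<Sigma> (Popt x) (opL \<Sigma> x)
          + of_real ((norm (opG \<Sigma> x))\<^sup>2) + of_real ((norm (opK \<Sigma> x))\<^sup>2)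
        = of_real ((norm (N x))\<^sup>2))"

definition C0_semigroup ::
  "('n::finite, 'p::finite, 'k::finite) phs \<Rightarrow> (real \<Rightarrow> 'n state \<Rightarrow> 'n state) \<Rightarrow> bool" where
  "C0_semigroup \<Sigma> T \<longleftrightarrow>
     (\<forall>t\<ge>0. bounded_linear_X \<Sigma> (T t)) \<and>
     (\<forall>f\<in>X \<Sigma>. eqX \<Sigma> (T 0 f) f) \<and>
     (\<forall>s\<ge>0. \<forall>t\<ge>0. \<forall>f\<in>X \<Sigma>. eqX \<Sigma> (T (s + t) f) (T s (T t f))) \<and>
     (\<forall>f\<in>X \<Sigma>. ((\<lambda>t. normX \<Sigma> (\<lambda>\<zeta>. T t f \<zeta> - f \<zeta>)) \<longlongrightarrow> 0) (at_right 0))"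

definition generator_graph ::
  "('n::finite, 'p::finite, 'k::finite) phs \<Rightarrow> (real \<Rightarrow> 'n state \<Rightarrow> 'n state)
    \<Rightarrow> ('n state \<times> 'n state) set" where
  "generator_graph \<Sigma> T =
     {(f, g). f \<in> X \<Sigma> \<and> g \<in> X \<Sigma> \<and>
        ((\<lambda>t. normX \<Sigma> (\<lambda>\<zeta>. (T t f \<zeta> - f \<zeta>) /\<^sub>R t - g \<zeta>)) \<longlongrightarrow> 0) (at_right 0)}"

definition strongly_stable :: "('n::finite, 'p::finite, 'k::finite) phs \<Rightarrow> bool" where
  "strongly_stable \<Sigma> \<longleftrightarrow>
     (\<exists>T. C0_semigroup \<Sigma> T \<and>
        generator_graph \<Sigma> T =
          {(f, g). f \<in> domL \<Sigma> \<and> opG \<Sigma> f = 0 \<and> g \<in> X \<Sigma> \<and> eqX \<Sigma> g (opL \<Sigma> f)} \<and>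
        (\<forall>f\<in>X \<Sigma>. ((\<lambda>t. normX \<Sigma> (T t f)) \<longlongrightarrow> 0) at_top))"

end

(* The assumed inequality makes the squared energy norm a storage function: along classical
   solutions, |x(t)|^2 + int |y|^2 <= |x(0)|^2 + int |u|^2. Hence L restricted to ker G is
   dissipative. For l > 0 the resolvent equation (l - L)x = g is a linear ordinary differential
   equation for Hx with n boundary conditions; dissipativity makes the boundary matrix injective,
   so the restriction is m-dissipative. Its Yosida approximations yield classical solutions with
   zero input for a dense set of initial states, and limits of them are generalized solutions with
   zero input and output energy at most |x(0)|^2. This gives the finite cost condition and the
   bound by the identity.

   The optimal cost satisfies the parallelogram law, because sums and differences of solutions are
   solutions, and it is bounded by the squared energy norm. By Jordan-von Neumann it comes from a
   bounded symmetric bilinear form, and the Riesz theorem gives the operator. Its complex linearity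
   follows from the invariance of the cost under multiplication by i.

   In the lossless case the energy inequality is an equality. If the input is square integrable,
   then the solution from time s on differs from a zero-input orbit by at most the remaining input
   energy, so strong stability forces x(t) -> 0 and the cost equals |x(0)|^2 + 2 int |u|^2. *)

theory Submission
  imports Defs
begin

text \<open>The boundary inequality controls only the boundary flux in the power balance. The
  interior adds twice the integral of the real part of \<open>cinner (P0 \<Sigma> *v v) v\<close>
  with v = Hx, which that inequality does not see. Hence the theorem asks that \<open>P0\<close> be
  dissipative, and skew-adjoint in the lossless part, where this term has to vanish. Every L2 space
  that occurs (states, inputs and outputs on finite or infinite time intervals) is embedded by zero
  extension in one real Hilbert space \<open>l2\<close> of functions on the line. The energy form
  and the generator are continued off the state interval, by the plain inner product and by zero, so
  that coercivity and the range condition hold on all of \<open>l2\<close>. Classical solutions need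
  continuous outputs, that is, orbits continuous in the graph norm, which bounds the boundary
  values. The Yosida limits get this from initial data in the domain of the square of the generator.
  The semigroup given by strong stability is only assumed strongly continuous at time 0; there it
  comes from a bound near time 0, which the uniform boundedness principle supplies.\<close>

section \<open>Square-integrable functions: closure properties and completeness\<close>

lemma borel_measurable_bilinear:
  fixes b :: "'a::euclidean_space \<Rightarrow> 'b::euclidean_space \<Rightarrow> 'c::euclidean_space"
  assumes b: "bounded_bilinear b" and f: "f \<in> borel_measurable M" and g: "g \<in> borel_measurable M"
  shows "(\<lambda>t. b (f t) (g t)) \<in> borel_measurable M"
proof -
  have "continuous_on UNIV (\<lambda>p. b (fst p) (snd p))"
    by (intro bounded_bilinear.continuous_on[OF b] continuous_intros)
  then show ?thesis
    using borel_measurable_continuous_Pair[OF f g, of b] by simp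
qed

lemma L2_measurable: "f \<in> L2 S \<Longrightarrow> f \<in> borel_measurable (lebesgue_on S)"
  and L2_integrable: "f \<in> L2 S \<Longrightarrow> integrable (lebesgue_on S) (\<lambda>t. (norm (f t))\<^sup>2)"
  by (auto simp: L2_def)

lemma L2_bilinear_integrable:
  fixes b :: "'a::euclidean_space \<Rightarrow> 'b::euclidean_space \<Rightarrow> 'c::euclidean_space"
  assumes b: "bounded_bilinear b" and f: "f \<in> L2 S" and g: "g \<in> L2 S"
  shows "integrable (lebesgue_on S) (\<lambda>t. b (f t) (g t))"
proof -
  obtain K where K: "K > 0" "\<And>x y. norm (b x y) \<le> norm x * norm y * K"
    using bounded_bilinear.pos_bounded[OF b] by blast
  show ?thesis
  proof (rule Bochner_Integration.integrable_bound)
    show "integrable (lebesgue_on S) (\<lambda>t. K * ((norm (f t))\<^sup>2 + (norm (g t))\<^sup>2))"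
      by (intro integrable_mult_right Bochner_Integration.integrable_add L2_integrable f g)
    show "(\<lambda>t. b (f t) (g t)) \<in> borel_measurable (lebesgue_on S)"
      by (rule borel_measurable_bilinear[OF b L2_measurable[OF f] L2_measurable[OF g]])
    show "AE t in lebesgue_on S. norm (b (f t) (g t)) \<le> norm (K * ((norm (f t))\<^sup>2 + (norm (g t))\<^sup>2))"
    proof (intro AE_I2)
      fix t
      have *: "norm (f t) * norm (g t) \<le> (norm (f t))\<^sup>2 + (norm (g t))\<^sup>2"
        using sum_squares_bound[of "norm (f t)" "norm (g t)"]
          mult_nonneg_nonneg[OF norm_ge_zero[of "f t"] norm_ge_zero[of "g t"]] by linarith
      have "norm (b (f t) (g t)) \<le> K * (norm (f t) * norm (g t))"
        using K(2)[of "f t" "g t"] by (simp add: mult.commute)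
      also have "\<dots> \<le> K * ((norm (f t))\<^sup>2 + (norm (g t))\<^sup>2)"
        using * K(1) by (intro mult_left_mono) auto
      finally show "norm (b (f t) (g t)) \<le> norm (K * ((norm (f t))\<^sup>2 + (norm (g t))\<^sup>2))"
        by simp
    qed
  qed
qed

lemma L2_inner_integrable:
  "f \<in> L2 S \<Longrightarrow> g \<in> L2 S \<Longrightarrow> integrable (lebesgue_on S) (\<lambda>t. f t \<bullet> g t)"
  by (rule L2_bilinear_integrable[OF bounded_bilinear_inner])

lemma L2_zero [simp]: "(\<lambda>t. 0) \<in> L2 S"
  by (simp add: L2_def)

lemma L2_bound:
  fixes f :: "real \<Rightarrow> 'a::euclidean_space" and g :: "real \<Rightarrow> 'b::euclidean_space"
  assumes g: "g \<in> L2 S" and f: "f \<in> borel_measurable (lebesgue_on S)"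
    and le: "AE t in lebesgue_on S. norm (f t) \<le> C * norm (g t)"
  shows "f \<in> L2 S"
proof -
  have "integrable (lebesgue_on S) (\<lambda>t. (norm (f t))\<^sup>2)"
  proof (rule Bochner_Integration.integrable_bound)
    show "integrable (lebesgue_on S) (\<lambda>t. C\<^sup>2 * (norm (g t))\<^sup>2)"
      by (intro integrable_mult_right L2_integrable g)
    show "(\<lambda>t. (norm (f t))\<^sup>2) \<in> borel_measurable (lebesgue_on S)"
      using f by simp
    show "AE t in lebesgue_on S. norm ((norm (f t))\<^sup>2) \<le> norm (C\<^sup>2 * (norm (g t))\<^sup>2)"
      using le
    proof eventually_elim
      case (elim t)
      then have "(norm (f t))\<^sup>2 \<le> (C * norm (g t))\<^sup>2"
        by (intro power_mono) auto
      then show ?case by (simp add: power_mult_distrib)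
    qed
  qed
  with f show ?thesis by (simp add: L2_def)
qed

lemma L2_add:
  assumes f: "f \<in> L2 S" and g: "g \<in> L2 S"
  shows "(\<lambda>t. f t + g t) \<in> L2 S"
proof -
  have "(norm (f t + g t))\<^sup>2 = (norm (f t))\<^sup>2 + 2 * (f t \<bullet> g t) + (norm (g t))\<^sup>2" for t
    by (simp add: power2_norm_eq_inner inner_add inner_commute)
  then show ?thesis
    using f g L2_inner_integrable[OF f g] by (auto simp: L2_def)
qed

lemma L2_linear:
  assumes h: "bounded_linear h" and f: "f \<in> L2 S"
  shows "(\<lambda>t. h (f t)) \<in> L2 S"
proof -
  obtain K where K: "\<And>x. norm (h x) \<le> norm x * K"
    using bounded_linear.bounded[OF h] by blast
  have "h \<in> borel_measurable borel"
    by (intro borel_measurable_continuous_onI linear_continuous_on h)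
  then have "(\<lambda>t. h (f t)) \<in> borel_measurable (lebesgue_on S)"
    using f measurable_compose[of f "lebesgue_on S" borel h borel] by (simp add: L2_def)
  then show ?thesis
    using K by (intro L2_bound[OF f, of _ K]) (auto simp: mult.commute)
qed

lemma L2_scaleR: "f \<in> L2 S \<Longrightarrow> (\<lambda>t. c *\<^sub>R f t) \<in> L2 S"
  by (rule L2_linear[OF bounded_linear_scaleR_right])

lemma L2_uminus: "f \<in> L2 S \<Longrightarrow> (\<lambda>t. - f t) \<in> L2 S"
  using L2_scaleR[of f S "-1"] by simp

lemma L2_diff: "f \<in> L2 S \<Longrightarrow> g \<in> L2 S \<Longrightarrow> (\<lambda>t. f t - g t) \<in> L2 S"
  using L2_add[of f S "\<lambda>t. - g t"] L2_uminus[of g S] by simp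

text \<open>Riesz-Fischer. The rate in \<open>fast\<close> gives convergence almost everywhere, and
  Fatou's lemma turns the Cauchy condition into convergence in the mean. The passage to a fast
  subsequence is left to the caller.\<close>

lemma L2_complete:
  fixes f :: "nat \<Rightarrow> real \<Rightarrow> 'e::euclidean_space"
  assumes f: "\<And>n. f n \<in> L2 S"
    and fast: "\<And>n. (LINT t|lebesgue_on S. (norm (f (Suc n) t - f n t))\<^sup>2) \<le> (1/8)^n"
    and cauchy: "\<And>e. e > 0 \<Longrightarrow> \<exists>N. \<forall>m\<ge>N. \<forall>n\<ge>N. (LINT t|lebesgue_on S. (norm (f m t - f n t))\<^sup>2) \<le> e"
  shows "\<exists>g. g \<in> L2 S \<and> (\<lambda>n. LINT t|lebesgue_on S. (norm (f n t - g t))\<^sup>2) \<longlonglongrightarrow> 0"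
proof -
  let ?M = "lebesgue_on S"
  have meas[measurable]: "f n \<in> borel_measurable ?M" for n using f by (simp add: L2_def)
  have d: "(\<lambda>t. f m t - f n t) \<in> L2 S" for m n by (intro L2_diff f)
  have di: "integrable ?M (\<lambda>t. (norm (f m t - f n t))\<^sup>2)" for m n
    by (rule L2_integrable[OF d])
  have nn: "(\<integral>\<^sup>+t. ennreal ((norm (f m t - f n t))\<^sup>2) \<partial>?M) =
      ennreal (LINT t|?M. (norm (f m t - f n t))\<^sup>2)" for m n
    by (intro nn_integral_eq_integral di) auto
  \<comment> \<open>The weight 4^n still leaves a summable series against the rate (1/8)^n, and
    finiteness of \<open>G t\<close> forces the increments at t below a multiple of 2^(-n).\<close>
  define G where "G t = (\<Sum>n. ennreal (4^n * (norm (f (Suc n) t - f n t))\<^sup>2))" for t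
  have "(\<integral>\<^sup>+t. G t \<partial>?M) = (\<Sum>n. \<integral>\<^sup>+t. ennreal (4^n * (norm (f (Suc n) t - f n t))\<^sup>2) \<partial>?M)"
    unfolding G_def by (intro nn_integral_suminf) auto
  also have "\<dots> \<le> (\<Sum>n. ennreal ((1/2)^n))"
  proof (intro suminf_le)
    fix n
    have "(\<integral>\<^sup>+t. ennreal (4^n * (norm (f (Suc n) t - f n t))\<^sup>2) \<partial>?M)
        = ennreal (LINT t|?M. 4^n * (norm (f (Suc n) t - f n t))\<^sup>2)"
      by (intro nn_integral_eq_integral) (use di in auto)
    also have "\<dots> \<le> ennreal (4^n * (1/8)^n)"
      using fast[of n] by (intro ennreal_leI) simp
    also have "(4^n * (1/8)^n :: real) = (1/2)^n"
      by (simp add: power_mult_distrib[symmetric])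
    finally show "(\<integral>\<^sup>+t. ennreal (4^n * (norm (f (Suc n) t - f n t))\<^sup>2) \<partial>?M) \<le> ennreal ((1/2)^n)" .
  qed auto
  also have "\<dots> < \<infinity>"
    by (subst suminf_ennreal2) auto
  finally have "AE t in ?M. G t \<noteq> \<infinity>"
    by (intro nn_integral_PInf_AE) (auto simp: G_def)
  then have conv: "AE t in ?M. convergent (\<lambda>n. f n t)"
  proof eventually_elim
    case (elim t)
    then obtain c where c: "c \<ge> 0" "G t = ennreal c"
      by (cases "G t") auto
    have bnd: "4^n * (norm (f (Suc n) t - f n t))\<^sup>2 \<le> c" for n
    proof -
      have "ennreal (4^n * (norm (f (Suc n) t - f n t))\<^sup>2) \<le> G t"
        unfolding G_def
        by (rule order_trans[OF _ sum_le_suminf[of _ "{n}"]]) auto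
      then show ?thesis using c by simp
    qed
    have "norm (f (Suc n) t - f n t) \<le> sqrt c * (1/2)^n" for n
    proof -
      have "(2^n * norm (f (Suc n) t - f n t))\<^sup>2 \<le> c"
      proof -
        have "((2::real)^n)\<^sup>2 = 4^n"
          by (simp only: power_even_eq[symmetric]) (simp add: power_mult)
        then show ?thesis using bnd[of n] by (simp only: power_mult_distrib)
      qed
      then have "2^n * norm (f (Suc n) t - f n t) \<le> sqrt c"
        by (simp add: real_le_rsqrt)
      then show ?thesis by (simp add: power_one_over field_simps)
    qed
    then have "summable (\<lambda>n. f (Suc n) t - f n t)"
      by (rule summable_comparison_test'[of "\<lambda>n. sqrt c * (1/2)^n" 0, rotated])
        (auto intro!: summable_mult summable_geometric)
    then have "convergent (\<lambda>n. \<Sum>i<n. f (Suc i) t - f i t)"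
      by (simp add: summable_iff_convergent)
    then have "convergent (\<lambda>n. f n t - f 0 t)"
      using sum_lessThan_telescope[of "\<lambda>i. f i t"] by simp
    then obtain l where "(\<lambda>n. f n t - f 0 t) \<longlonglongrightarrow> l"
      by (auto simp: convergent_def)
    then have "(\<lambda>n. (f n t - f 0 t) + f 0 t) \<longlonglongrightarrow> l + f 0 t"
      by (rule tendsto_add[OF _ tendsto_const])
    then show ?case
      unfolding convergent_def by auto
  qed
  define g where "g t = lim (\<lambda>n. f n t)" for t
  have g[measurable]: "g \<in> borel_measurable ?M"
    unfolding g_def by (rule borel_measurable_lim_metric[OF meas])
  have lim: "AE t in ?M. (\<lambda>n. f n t) \<longlonglongrightarrow> g t"
    using conv by eventually_elim (simp add: g_def convergent_LIMSEQ_iff)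
  have fatou: "(\<integral>\<^sup>+t. ennreal ((norm (f n t - g t))\<^sup>2) \<partial>?M) \<le> ennreal e"
    if N: "\<forall>m\<ge>N. (LINT t|?M. (norm (f m t - f n t))\<^sup>2) \<le> e" for n N e
  proof -
    have "(\<integral>\<^sup>+t. ennreal ((norm (f n t - g t))\<^sup>2) \<partial>?M)
        = (\<integral>\<^sup>+t. liminf (\<lambda>m. ennreal ((norm (f m t - f n t))\<^sup>2)) \<partial>?M)"
    proof (rule nn_integral_cong_AE, use lim in eventually_elim)
      case (elim t)
      then have "(\<lambda>m. ennreal ((norm (f m t - f n t))\<^sup>2)) \<longlonglongrightarrow> ennreal ((norm (g t - f n t))\<^sup>2)"
        by (intro tendsto_ennrealI tendsto_intros)
      from lim_imp_Liminf[OF trivial_limit_sequentially this] show ?case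
        by (simp add: norm_minus_commute)
    qed
    also have "\<dots> \<le> liminf (\<lambda>m. \<integral>\<^sup>+t. ennreal ((norm (f m t - f n t))\<^sup>2) \<partial>?M)"
      by (intro nn_integral_liminf) auto
    also have "\<dots> \<le> ennreal e"
    proof -
      have "eventually (\<lambda>m. (\<integral>\<^sup>+t. ennreal ((norm (f m t - f n t))\<^sup>2) \<partial>?M) \<le> ennreal e) sequentially"
        using N unfolding nn by (intro eventually_sequentiallyI[of N] ennreal_leI) auto
      then have "limsup (\<lambda>m. \<integral>\<^sup>+t. ennreal ((norm (f m t - f n t))\<^sup>2) \<partial>?M) \<le> ennreal e"
        by (rule Limsup_bounded)
      then show ?thesis
        by (rule order_trans[OF Liminf_le_Limsup, rotated]) simp
    qed
    finally show ?thesis .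
  qed
  \<comment> \<open>Fatou puts \<open>g\<close> at finite distance from a single \<open>f N\<close>;
    the other differences follow because L2 is a vector space.\<close>
  have gd: "(\<lambda>t. f n t - g t) \<in> L2 S" for n
  proof -
    obtain N where "\<forall>m\<ge>N. \<forall>k\<ge>N. (LINT t|?M. (norm (f m t - f k t))\<^sup>2) \<le> 1" using cauchy[of 1] by auto
    then have "(\<integral>\<^sup>+t. ennreal ((norm (f N t - g t))\<^sup>2) \<partial>?M) \<le> ennreal 1"
      by (intro fatou[of N]) auto
    then have "(\<integral>\<^sup>+t. ennreal ((norm (f N t - g t))\<^sup>2) \<partial>?M) < \<infinity>"
      by (rule le_less_trans) simp
    then have "(\<lambda>t. f N t - g t) \<in> L2 S"
      by (auto simp: L2_def intro!: integrableI_bounded)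
    from L2_add[OF d[of n N] this] show ?thesis by simp
  qed
  have "(\<lambda>t. f 0 t - (f 0 t - g t)) \<in> L2 S"
    by (intro L2_diff f gd)
  then have gL: "g \<in> L2 S" by simp
  moreover have "(\<lambda>n. LINT t|?M. (norm (f n t - g t))\<^sup>2) \<longlonglongrightarrow> 0"
  proof (rule LIMSEQ_I)
    fix r :: real assume r: "r > 0"
    then obtain N where N: "\<forall>m\<ge>N. \<forall>n\<ge>N. (LINT t|?M. (norm (f m t - f n t))\<^sup>2) \<le> r/2"
      using cauchy[of "r/2"] by auto
    show "\<exists>no. \<forall>n\<ge>no. norm ((LINT t|?M. (norm (f n t - g t))\<^sup>2) - 0) < r"
    proof (intro exI allI impI)
      fix n assume n: "n \<ge> N"
      have "ennreal (LINT t|?M. (norm (f n t - g t))\<^sup>2) = (\<integral>\<^sup>+t. ennreal ((norm (f n t - g t))\<^sup>2) \<partial>?M)"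
        by (intro nn_integral_eq_integral[symmetric] L2_integrable gd) auto
      also have "\<dots> \<le> ennreal (r/2)" using N n by (intro fatou[of N]) auto
      finally have "(LINT t|?M. (norm (f n t - g t))\<^sup>2) \<le> r/2" using r by simp
      moreover have "(LINT t|?M. (norm (f n t - g t))\<^sup>2) \<ge> 0" by simp
      ultimately show "norm ((LINT t|?M. (norm (f n t - g t))\<^sup>2) - 0) < r" using r by simp
    qed
  qed
  ultimately show ?thesis by blast
qed

section \<open>The Hilbert space of square-integrable functions on the line\<close>

text \<open>Reflexive on square-integrable functions only. The quotient is therefore partial, and
  its elements are exactly the classes of such functions.\<close>

definition l2rel :: "(real \<Rightarrow> 'e::euclidean_space) \<Rightarrow> (real \<Rightarrow> 'e) \<Rightarrow> bool" where
  "l2rel f g \<longleftrightarrow> f \<in> L2 UNIV \<and> g \<in> L2 UNIV \<and> (AE t in lebesgue. f t = g t)"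

lemma part_equivp_l2rel: "part_equivp l2rel"
proof (rule part_equivpI)
  show "\<exists>x::real \<Rightarrow> 'e::euclidean_space. l2rel x x"
    by (rule exI[of _ "\<lambda>t. 0"]) (simp add: l2rel_def)
  show "symp l2rel"
    by (rule sympI) (auto simp: l2rel_def elim: eventually_mono)
  show "transp l2rel"
  proof (rule transpI)
    fix f g h :: "real \<Rightarrow> 'e::euclidean_space"
    assume fg: "l2rel f g" and gh: "l2rel g h"
    have "AE t in lebesgue. f t = h t"
      using fg gh by (auto simp: l2rel_def elim: eventually_elim2)
    then show "l2rel f h" using fg gh by (simp add: l2rel_def)
  qed
qed

quotient_type (overloaded) 'e l2 = "real \<Rightarrow> 'e::euclidean_space" / partial: l2rel
  by (rule part_equivp_l2rel)

instantiation l2 :: (euclidean_space) real_inner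
begin

lift_definition zero_l2 :: "'a l2" is "\<lambda>t. 0" by (simp add: l2rel_def)

lift_definition plus_l2 :: "'a l2 \<Rightarrow> 'a l2 \<Rightarrow> 'a l2" is "\<lambda>f g t. f t + g t"
proof -
  fix f f' g g' :: "real \<Rightarrow> 'a" assume a: "l2rel f f'" "l2rel g g'"
  have "AE t in lebesgue. f t + g t = f' t + g' t"
    using a by (auto simp: l2rel_def elim: eventually_elim2)
  then show "l2rel (\<lambda>t. f t + g t) (\<lambda>t. f' t + g' t)"
    using a by (simp add: l2rel_def L2_add)
qed

lift_definition scaleR_l2 :: "real \<Rightarrow> 'a l2 \<Rightarrow> 'a l2" is "\<lambda>c f t. c *\<^sub>R f t"
  by (auto simp: l2rel_def L2_scaleR elim: eventually_mono)

lift_definition uminus_l2 :: "'a l2 \<Rightarrow> 'a l2" is "\<lambda>f t. - f t"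
  by (auto simp: l2rel_def L2_uminus elim: eventually_mono)

lift_definition minus_l2 :: "'a l2 \<Rightarrow> 'a l2 \<Rightarrow> 'a l2" is "\<lambda>f g t. f t - g t"
proof -
  fix f f' g g' :: "real \<Rightarrow> 'a" assume a: "l2rel f f'" "l2rel g g'"
  have "AE t in lebesgue. f t - g t = f' t - g' t"
    using a by (auto simp: l2rel_def elim: eventually_elim2)
  then show "l2rel (\<lambda>t. f t - g t) (\<lambda>t. f' t - g' t)"
    using a by (simp add: l2rel_def L2_diff)
qed

lift_definition inner_l2 :: "'a l2 \<Rightarrow> 'a l2 \<Rightarrow> real" is "\<lambda>f g. LINT t|lebesgue. f t \<bullet> g t"
proof -
  fix f f' g g' :: "real \<Rightarrow> 'a" assume a: "l2rel f f'" "l2rel g g'"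
  have "AE t in lebesgue. f t \<bullet> g t = f' t \<bullet> g' t"
    using a by (auto simp: l2rel_def elim: eventually_elim2)
  then show "(LINT t|lebesgue. f t \<bullet> g t) = (LINT t|lebesgue. f' t \<bullet> g' t)"
    using a L2_inner_integrable[of f UNIV g] L2_inner_integrable[of f' UNIV g']
    by (intro integral_cong_AE) (auto simp: l2rel_def lebesgue_on_UNIV_eq)
qed

definition norm_l2 :: "'a l2 \<Rightarrow> real" where "norm_l2 F = sqrt (F \<bullet> F)"
definition sgn_l2 :: "'a l2 \<Rightarrow> 'a l2" where "sgn_l2 F = scaleR (inverse (norm F)) F"
definition dist_l2 :: "'a l2 \<Rightarrow> 'a l2 \<Rightarrow> real" where "dist_l2 F G = norm (F - G)"
definition uniformity_l2 :: "('a l2 \<times> 'a l2) filter"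
  where "uniformity_l2 = (INF e\<in>{0<..}. principal {(F, G). dist F G < e})"
definition open_l2 :: "'a l2 set \<Rightarrow> bool"
  where "open_l2 U \<longleftrightarrow> (\<forall>F\<in>U. eventually (\<lambda>(F', G). F' = F \<longrightarrow> G \<in> U) uniformity)"

instance
proof
  fix F G H :: "'a l2" and r s :: real
  show "F + G + H = F + (G + H)"
    by transfer (auto simp: l2rel_def L2_add add.assoc)
  show "F + G = G + F"
    by transfer (auto simp: l2rel_def L2_add add.commute)
  show "0 + F = F"
    by transfer (auto simp: l2rel_def)
  show "- F + F = 0"
    by transfer (auto simp: l2rel_def)
  show "F - G = F + - G"
    by transfer (auto simp: l2rel_def L2_diff)
  show "r *\<^sub>R (F + G) = r *\<^sub>R F + r *\<^sub>R G"
    by transfer (auto simp: l2rel_def L2_add L2_scaleR scaleR_add_right)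
  show "(r + s) *\<^sub>R F = r *\<^sub>R F + s *\<^sub>R F"
    by transfer (auto simp: l2rel_def L2_add L2_scaleR scaleR_add_left)
  show "r *\<^sub>R s *\<^sub>R F = (r * s) *\<^sub>R F"
    by transfer (auto simp: l2rel_def L2_scaleR)
  show "1 *\<^sub>R F = F"
    by transfer (auto simp: l2rel_def)
  show "dist F G = norm (F - G)" by (rule dist_l2_def)
  show "sgn F = scaleR (inverse (norm F)) F" by (rule sgn_l2_def)
  show "(uniformity :: ('a l2 \<times> 'a l2) filter) = (INF e\<in>{0<..}. principal {(F, G). dist F G < e})"
    by (rule uniformity_l2_def)
  show "open U \<longleftrightarrow> (\<forall>F\<in>U. \<forall>\<^sub>F (F', G) in uniformity. F' = F \<longrightarrow> G \<in> U)" for U :: "'a l2 set"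
    by (rule open_l2_def)
  show "F \<bullet> G = G \<bullet> F"
    by transfer (simp add: inner_commute)
  show "(F + G) \<bullet> H = F \<bullet> H + G \<bullet> H"
  proof transfer
    fix f g h :: "real \<Rightarrow> 'a" assume "l2rel f f" "l2rel g g" "l2rel h h"
    then show "(LINT t|lebesgue. (f t + g t) \<bullet> h t) = (LINT t|lebesgue. f t \<bullet> h t) + (LINT t|lebesgue. g t \<bullet> h t)"
      using L2_inner_integrable[of f UNIV h] L2_inner_integrable[of g UNIV h]
      by (simp add: l2rel_def lebesgue_on_UNIV_eq inner_add_left)
  qed
  show "(r *\<^sub>R F) \<bullet> G = r * (F \<bullet> G)"
    by transfer simp
  show "0 \<le> F \<bullet> F"
    by transfer simp
  show "F \<bullet> F = 0 \<longleftrightarrow> F = 0"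
  proof transfer
    fix f :: "real \<Rightarrow> 'a" assume f: "l2rel f f"
    then have "integrable lebesgue (\<lambda>t. f t \<bullet> f t)"
      using L2_inner_integrable[of f UNIV f] by (simp add: l2rel_def lebesgue_on_UNIV_eq)
    then show "(LINT t|lebesgue. f t \<bullet> f t) = 0 \<longleftrightarrow> l2rel f (\<lambda>t. 0)"
      using f by (subst integral_nonneg_eq_0_iff_AE) (auto simp: l2rel_def)
  qed
  show "norm F = sqrt (F \<bullet> F)" by (rule norm_l2_def)
qed

end

lemma rep_l2_L2 [simp]: "rep_l2 F \<in> L2 UNIV"
  and abs_rep_l2 [simp]: "abs_l2 (rep_l2 F) = F"
  using Quotient_rep_reflp[OF Quotient_l2, of F] Quotient_abs_rep[OF Quotient_l2, of F]
  by (auto simp: l2rel_def)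

lemma abs_l2_eq_iff:
  "f \<in> L2 UNIV \<Longrightarrow> g \<in> L2 UNIV \<Longrightarrow> abs_l2 f = abs_l2 g \<longleftrightarrow> (AE t in lebesgue. f t = g t)"
  using Quotient_rel[OF Quotient_l2, of f g] by (auto simp: l2rel_def)

lemma abs_l2_add: "f \<in> L2 UNIV \<Longrightarrow> g \<in> L2 UNIV \<Longrightarrow> abs_l2 f + abs_l2 g = abs_l2 (\<lambda>t. f t + g t)"
  by (rule plus_l2.abs_eq) (auto simp: eq_onp_def l2rel_def)

lemma abs_l2_diff: "f \<in> L2 UNIV \<Longrightarrow> g \<in> L2 UNIV \<Longrightarrow> abs_l2 f - abs_l2 g = abs_l2 (\<lambda>t. f t - g t)"
  by (rule minus_l2.abs_eq) (auto simp: eq_onp_def l2rel_def)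

lemma abs_l2_scaleR: "f \<in> L2 UNIV \<Longrightarrow> c *\<^sub>R abs_l2 f = abs_l2 (\<lambda>t. c *\<^sub>R f t)"
  by (rule scaleR_l2.abs_eq) (auto simp: eq_onp_def l2rel_def)

lemma abs_l2_inner: "f \<in> L2 UNIV \<Longrightarrow> g \<in> L2 UNIV \<Longrightarrow> abs_l2 f \<bullet> abs_l2 g = (LINT t|lebesgue. f t \<bullet> g t)"
  by (rule inner_l2.abs_eq) (auto simp: eq_onp_def l2rel_def)

lemma abs_l2_norm: "f \<in> L2 UNIV \<Longrightarrow> (norm (abs_l2 f))\<^sup>2 = (LINT t|lebesgue. (norm (f t))\<^sup>2)"
  by (simp only: power2_norm_eq_inner abs_l2_inner)

instance l2 :: (euclidean_space) complete_space
proof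
  fix F :: "nat \<Rightarrow> 'a l2" assume F: "Cauchy F"
  have "\<exists>N. \<forall>m\<ge>N. \<forall>n\<ge>N. norm (F m - F n) < (1/4)^k" for k :: nat
    using CauchyD[OF F, of "(1/4)^k"] by simp
  then obtain N where N: "\<And>k m n. m \<ge> N k \<Longrightarrow> n \<ge> N k \<Longrightarrow> norm (F m - F n) < (1/4)^k"
    by metis
  \<comment> \<open>Strictly increasing and at least \<open>N k\<close>, without any monotonicity of
    \<open>N\<close>.\<close>
  define r where "r k = (\<Sum>i\<le>k. N i) + k" for k
  have r: "strict_mono r"
    by (rule strict_monoI_Suc) (simp add: r_def)
  have rN: "r k \<ge> N k" for k
    using member_le_sum[of k "{..k}" N] by (simp add: r_def)
  define f where "f k = rep_l2 (F (r k))" for k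
  have f: "f k \<in> L2 UNIV" for k by (simp add: f_def)
  have nrm: "(LINT t|lebesgue_on UNIV. (norm (f m t - f n t))\<^sup>2) = (norm (F (r m) - F (r n)))\<^sup>2" for m n
    using abs_l2_norm[OF L2_diff[OF f f], of m n] abs_l2_diff[OF f f, of m n]
    by (simp add: lebesgue_on_UNIV_eq f_def)
  have "\<exists>g. g \<in> L2 UNIV \<and> (\<lambda>n. LINT t|lebesgue_on UNIV. (norm (f n t - g t))\<^sup>2) \<longlonglongrightarrow> 0"
  proof (rule L2_complete[OF f])
    fix n
    have "norm (F (r (Suc n)) - F (r n)) \<le> (1/4)^n"
      using rN[of n] strict_mono_leD[OF r, of n "Suc n"] by (intro less_imp_le[OF N[of n]]) auto
    then have "(norm (F (r (Suc n)) - F (r n)))\<^sup>2 \<le> ((1/4)^n)\<^sup>2"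
      by (rule power_mono) simp
    also have "((1/4::real)^n)\<^sup>2 = ((1/4)^2)^n"
      by (simp only: power_mult[symmetric] mult.commute)
    \<comment> \<open>Distances below (1/4)^n have squares below (1/16)^n, which is the reason for
      the rate 1/4 above.\<close>
    also have "\<dots> \<le> (1/8)^n"
      by (rule power_mono) (simp_all add: power2_eq_square)
    finally show "(LINT t|lebesgue_on UNIV. (norm (f (Suc n) t - f n t))\<^sup>2) \<le> (1/8)^n"
      unfolding nrm .
  next
    fix e :: real assume "e > 0"
    then obtain M where M: "\<And>m n. m \<ge> M \<Longrightarrow> n \<ge> M \<Longrightarrow> norm (F m - F n) < sqrt e"
      using CauchyD[OF F, of "sqrt e"] by auto
    show "\<exists>N. \<forall>m\<ge>N. \<forall>n\<ge>N. (LINT t|lebesgue_on UNIV. (norm (f m t - f n t))\<^sup>2) \<le> e"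
      unfolding nrm
    proof (intro exI allI impI)
      fix m n assume "m \<ge> M" "n \<ge> M"
      then have "norm (F (r m) - F (r n)) < sqrt e"
        using seq_suble[OF r, of m] seq_suble[OF r, of n] by (intro M) linarith+
      then have "(norm (F (r m) - F (r n)))\<^sup>2 \<le> (sqrt e)\<^sup>2"
        by (intro power_mono) auto
      then show "(norm (F (r m) - F (r n)))\<^sup>2 \<le> e" using \<open>e > 0\<close> by simp
    qed
  qed
  then obtain g where g: "g \<in> L2 UNIV" and lim: "(\<lambda>n. LINT t|lebesgue. (norm (f n t - g t))\<^sup>2) \<longlonglongrightarrow> 0"
    by (auto simp: lebesgue_on_UNIV_eq)
  have "(LINT t|lebesgue. (norm (f n t - g t))\<^sup>2) = (norm (F (r n) - abs_l2 g))\<^sup>2" for n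
    using abs_l2_norm[OF L2_diff[OF f g], of n] abs_l2_diff[OF f g, of n] by (simp add: f_def)
  with lim have "(\<lambda>n. (norm (F (r n) - abs_l2 g))\<^sup>2) \<longlonglongrightarrow> 0" by simp
  then have "(\<lambda>n. sqrt ((norm (F (r n) - abs_l2 g))\<^sup>2)) \<longlonglongrightarrow> sqrt 0"
    by (rule tendsto_real_sqrt)
  then have "(\<lambda>n. F (r n) - abs_l2 g) \<longlonglongrightarrow> 0"
    by (simp add: tendsto_norm_zero_iff)
  then have "(F \<circ> r) \<longlonglongrightarrow> abs_l2 g"
    by (simp add: LIM_zero_iff o_def)
  then show "convergent F"
    using Cauchy_converges_subseq[OF F r] by (auto simp: convergent_def)
qed

instance l2 :: (euclidean_space) banach ..

section \<open>Square-integrable functions on a measurable set\<close>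

lemma L2_restrict:
  assumes S: "S \<in> sets lebesgue" and f: "f \<in> L2 UNIV"
  shows "f \<in> L2 S"
proof -
  have "f \<in> borel_measurable lebesgue" "integrable lebesgue (\<lambda>t. (norm (f t))\<^sup>2)"
    using f by (auto simp: L2_def lebesgue_on_UNIV_eq)
  then show ?thesis
    using S integrable_mult_indicator[OF S, of "\<lambda>t. (norm (f t))\<^sup>2"]
    by (auto simp: L2_def integrable_restrict_space intro!: measurable_restrict_space1)
qed

lemma L2_extend:
  assumes S: "S \<in> sets lebesgue" and f: "f \<in> L2 S"
  shows "(\<lambda>t. if t \<in> S then f t else 0) \<in> L2 UNIV"
proof -
  have "(\<lambda>t. if t \<in> S then f t else 0) \<in> borel_measurable lebesgue"
    using f S borel_measurable_restrict_space_iff[of S lebesgue f]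
    by (simp add: L2_def indicator_scaleR_eq_if)
  moreover have "integrable lebesgue (\<lambda>t. indicator S t *\<^sub>R (norm (f t))\<^sup>2)"
    using f S by (simp add: L2_def integrable_restrict_space)
  then have "integrable lebesgue (\<lambda>t. (norm (if t \<in> S then f t else 0))\<^sup>2)"
    by (rule Bochner_Integration.integrable_cong[THEN iffD1, rotated 2]) (auto simp: indicator_def)
  ultimately show ?thesis by (simp add: L2_def lebesgue_on_UNIV_eq)
qed

text \<open>Extension by zero lets a single complete space serve the state interval and all time
  intervals. The identification of functions that agree almost everywhere is carried by equality in
  \<open>l2\<close>.\<close>

definition emb :: "real set \<Rightarrow> (real \<Rightarrow> 'e::euclidean_space) \<Rightarrow> 'e l2" where
  "emb S f = abs_l2 (\<lambda>t. if t \<in> S then f t else 0)"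

lemma rep_L2: "S \<in> sets lebesgue \<Longrightarrow> rep_l2 F \<in> L2 S"
  by (rule L2_restrict) auto

lemma AE_lebesgue_on_iff: "S \<in> sets lebesgue \<Longrightarrow> (AE t in lebesgue_on S. P t) \<longleftrightarrow> (AE t in lebesgue. t \<in> S \<longrightarrow> P t)"
  by (subst AE_restrict_space_iff) auto

context
  fixes S :: "real set"
  assumes S: "S \<in> sets lebesgue"
begin

lemma emb_eq_iff:
  assumes "f \<in> L2 S" "g \<in> L2 S"
  shows "emb S f = emb S g \<longleftrightarrow> (AE t in lebesgue_on S. f t = g t)"
  unfolding emb_def AE_lebesgue_on_iff[OF S]
  by (subst abs_l2_eq_iff) (auto intro!: L2_extend[OF S] assms elim: eventually_mono split: if_splits)

lemma emb_add: "f \<in> L2 S \<Longrightarrow> g \<in> L2 S \<Longrightarrow> emb S (\<lambda>t. f t + g t) = emb S f + emb S g"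
  unfolding emb_def by (subst abs_l2_add) (auto intro!: L2_extend[OF S] arg_cong[where f = abs_l2])

lemma emb_diff: "f \<in> L2 S \<Longrightarrow> g \<in> L2 S \<Longrightarrow> emb S (\<lambda>t. f t - g t) = emb S f - emb S g"
  unfolding emb_def by (subst abs_l2_diff) (auto intro!: L2_extend[OF S] arg_cong[where f = abs_l2])

lemma emb_scaleR: "f \<in> L2 S \<Longrightarrow> emb S (\<lambda>t. c *\<^sub>R f t) = c *\<^sub>R emb S f"
  unfolding emb_def by (subst abs_l2_scaleR) (auto intro!: L2_extend[OF S] arg_cong[where f = abs_l2])

lemma emb_inner:
  assumes "f \<in> L2 S" "g \<in> L2 S"
  shows "emb S f \<bullet> emb S g = (LINT t|lebesgue_on S. f t \<bullet> g t)"
proof -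
  have "emb S f \<bullet> emb S g = (LINT t|lebesgue. indicator S t *\<^sub>R (f t \<bullet> g t))"
    unfolding emb_def
    by (subst abs_l2_inner) (auto intro!: L2_extend[OF S] assms Bochner_Integration.integral_cong)
  then show ?thesis using S by (simp add: integral_restrict_space)
qed

lemma emb_norm: "f \<in> L2 S \<Longrightarrow> (norm (emb S f))\<^sup>2 = (LINT t|lebesgue_on S. (norm (f t))\<^sup>2)"
  by (simp only: power2_norm_eq_inner emb_inner)

lemma rep_emb:
  assumes "f \<in> L2 S"
  shows "AE t in lebesgue_on S. rep_l2 (emb S f) t = f t"
proof -
  have "abs_l2 (rep_l2 (emb S f)) = abs_l2 (\<lambda>t. if t \<in> S then f t else 0)"
    by (simp add: emb_def)
  then show ?thesis
    unfolding AE_lebesgue_on_iff[OF S]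
    by (subst (asm) abs_l2_eq_iff) (auto intro!: L2_extend[OF S] assms elim: eventually_mono)
qed

lemma emb_rep_emb: "f \<in> L2 S \<Longrightarrow> emb S (rep_l2 (emb S f)) = emb S f"
  using rep_emb by (subst emb_eq_iff) (auto intro: rep_L2[OF S])

end

section \<open>Volterra equations\<close>

lemma at_within_Ici_eq:
  fixes t :: real
  assumes "a \<le> t" "t < b"
  shows "at t within {a..} = at t within {a..b}"
proof (rule at_within_nhd[of t "{..<b}"])
  show "{a..} \<inter> {..<b} - {t} = {a..b} \<inter> {..<b} - {t}" by auto
qed (use assms in auto)

lemma continuous_on_Ici_if_Icc:
  fixes f :: "real \<Rightarrow> 'a::topological_space"
  assumes "\<And>b. continuous_on {a..b} f"
  shows "continuous_on {a..} f"
proof (unfold continuous_on_eq_continuous_within, rule ballI)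
  fix t :: real assume t: "t \<in> {a..}"
  have "continuous (at t within {a..t+1}) f"
    using assms[of "t+1"] t by (auto simp: continuous_on_eq_continuous_within)
  then show "continuous (at t within {a..}) f"
    using at_within_Ici_eq[of a t "t+1"] t by simp
qed

lemma continuous_on_indefinite_integral_Ici:
  fixes g :: "real \<Rightarrow> 'a::banach"
  assumes "continuous_on {a..} g"
  shows "continuous_on {a..} (\<lambda>t. integral {a..t} g)"
proof (rule continuous_on_Ici_if_Icc, rule indefinite_integral_continuous_1)
  show "g integrable_on {a..b}" for b
    by (rule integrable_continuous_real, rule continuous_on_subset[OF assms]) auto
qed

text \<open>Picard iteration on the whole half-line: successive iterates differ by at most C (M (t -
  a))^j / j! on bounded intervals, so the telescoping series converges uniformly there. The kernel
  is abstract so that the lemma serves both bounded operators on a Banach space and time-dependent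
  matrices.\<close>

lemma volterra:
  fixes k :: "real \<Rightarrow> 'a::banach \<Rightarrow> 'a"
  assumes diff: "\<And>s x y. s \<ge> a \<Longrightarrow> k s (x - y) = k s x - k s y"
    and bnd: "\<And>s x. s \<ge> a \<Longrightarrow> norm (k s x) \<le> M * norm x" and M: "M \<ge> 0"
    and cont: "\<And>v. continuous_on {a..} v \<Longrightarrow> continuous_on {a..} (\<lambda>s. k s (v s))"
    and h0: "continuous_on {a..} h0"
  shows "\<exists>h. continuous_on {a..} h \<and> (\<forall>t\<ge>a. h t = h0 t + integral {a..t} (\<lambda>s. k s (h s)))"
proof -
  define f where "f = rec_nat h0 (\<lambda>_ v t. h0 t + integral {a..t} (\<lambda>s. k s (v s)))"
  have f0: "f 0 = h0" and fS: "f (Suc j) = (\<lambda>t. h0 t + integral {a..t} (\<lambda>s. k s (f j s)))" for j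
    by (simp_all add: f_def)
  have cf: "continuous_on {a..} (f j)" for j
  proof (induction j)
    case 0 then show ?case by (simp add: f0 h0)
  next
    case (Suc j)
    show ?case unfolding fS
      by (intro continuous_on_add h0 continuous_on_indefinite_integral_Ici cont Suc)
  qed
  have int: "(\<lambda>s. k s (v s)) integrable_on {a..t}" if "continuous_on {a..} v" for v t
    by (rule integrable_continuous_real, rule continuous_on_subset[OF cont[OF that]]) auto
  have kdiff: "integral {a..t} (\<lambda>s. k s (v s)) - integral {a..t} (\<lambda>s. k s (w s))
      = integral {a..t} (\<lambda>s. k s (v s - w s))"
    if "continuous_on {a..} v" "continuous_on {a..} w" for v w t
    unfolding Henstock_Kurzweil_Integration.integral_diff[OF int[OF that(1)] int[OF that(2)], symmetric]
    by (intro Henstock_Kurzweil_Integration.integral_cong) (simp add: diff)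
  have est: "norm (f (Suc j) t - f j t) \<le> C * ((M * (t - a))^j / fact j)"
    if C: "\<And>s. s \<in> {a..T} \<Longrightarrow> norm (f 1 s - f 0 s) \<le> C" and t: "t \<in> {a..T}" for C T t j
    using t
  proof (induction j arbitrary: t)
    case 0 then show ?case using C by simp
  next
    case (Suc j)
    have ds: "((\<lambda>s. (M * (s - a))^Suc j / fact (Suc j)) has_vector_derivative M * ((M * (s - a))^j / fact j)) (at s within {a..t})" for s
      by (rule has_real_derivative_iff_has_vector_derivative[THEN iffD1])
        (auto intro!: derivative_eq_intros simp: field_simps simp del: power_Suc fact_Suc, simp add: field_simps)
    have I: "((\<lambda>s. M * ((M * (s - a))^j / fact j)) has_integral (M * (t - a))^Suc j / fact (Suc j)) {a..t}"
      using fundamental_theorem_of_calculus[of a t, OF _ ds] Suc.prems by simp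
    note I' = has_integral_mult_right[OF I, of C]
    have "f (Suc (Suc j)) t - f (Suc j) t = integral {a..t} (\<lambda>s. k s (f (Suc j) s - f j s))"
      using kdiff[OF cf cf, of t "Suc j" j] by (simp add: fS)
    also have "norm \<dots> \<le> integral {a..t} (\<lambda>s. C * (M * ((M * (s - a))^j / fact j)))"
    proof (rule integral_norm_bound_integral)
      show "(\<lambda>s. k s (f (Suc j) s - f j s)) integrable_on {a..t}"
        by (intro int continuous_on_diff cf)
      show "(\<lambda>s. C * (M * ((M * (s - a))^j / fact j))) integrable_on {a..t}"
        by (rule has_integral_integrable[OF I'])
      fix s assume s: "s \<in> {a..t}"
      have "norm (k s (f (Suc j) s - f j s)) \<le> M * norm (f (Suc j) s - f j s)"
        using s by (intro bnd) auto
      also have "\<dots> \<le> M * (C * ((M * (s - a))^j / fact j))"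
        using s Suc.prems by (intro mult_left_mono Suc.IH M) auto
      finally show "norm (k s (f (Suc j) s - f j s)) \<le> C * (M * ((M * (s - a))^j / fact j))"
        by (simp add: mult.left_commute)
    qed
    also have "\<dots> = C * ((M * (t - a))^Suc j / fact (Suc j))"
      by (rule integral_unique[OF I'])
    finally show ?case .
  qed
  \<comment> \<open>The limit of the iterates written as a telescoping series, so that the
    Weierstrass test applies.\<close>
  define h where "h t = h0 t + (\<Sum>i. f (Suc i) t - f i t)" for t
  have ul: "uniform_limit {a..T} f h sequentially" for T
  proof -
    have "compact ((\<lambda>s. norm (f 1 s - f 0 s)) ` {a..T})"
      by (intro compact_continuous_image compact_Icc continuous_on_norm continuous_on_diff
          continuous_on_subset[OF cf]) auto
    then obtain C where C: "\<And>s. s \<in> {a..T} \<Longrightarrow> norm (f 1 s - f 0 s) \<le> C"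
      by (meson bounded_imp_bdd_above compact_imp_bounded bdd_above.E imageI)
    define w where "w j = \<bar>C\<bar> * ((M * (T - a))^j / fact j)" for j
    have "summable (\<lambda>j. (M * (T - a))^j /\<^sub>R fact j)"
      by (rule summable_exp_generic)
    then have sw: "summable w"
      unfolding w_def by (intro summable_mult) (simp add: divide_inverse mult.commute)
    have le: "norm (f (Suc j) t - f j t) \<le> w j" if t: "t \<in> {a..T}" for j t
    proof -
      have "norm (f (Suc j) t - f j t) \<le> C * ((M * (t - a))^j / fact j)"
        by (rule est[OF C t])
      also have "\<dots> \<le> w j"
        unfolding w_def using t M by (intro mult_mono divide_right_mono power_mono mult_left_mono) auto
      finally show ?thesis .
    qed
    have "uniform_limit {a..T} (\<lambda>n t. \<Sum>i<n. f (Suc i) t - f i t) (\<lambda>t. \<Sum>i. f (Suc i) t - f i t) sequentially"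
      by (rule Weierstrass_m_test[OF le sw])
    then have "uniform_limit {a..T} (\<lambda>n t. h0 t + (\<Sum>i<n. f (Suc i) t - f i t)) h sequentially"
      unfolding h_def by (intro uniform_limit_add uniform_limit_const)
    moreover have "h0 t + (\<Sum>i<n. f (Suc i) t - f i t) = f n t" for n t
      using sum_lessThan_telescope[of "\<lambda>i. f i t" n] by (simp add: f0)
    ultimately show ?thesis by simp
  qed
  have ch: "continuous_on {a..} h"
    by (rule continuous_on_Ici_if_Icc, rule uniform_limit_theorem[OF _ ul])
      (auto intro!: always_eventually continuous_on_subset[OF cf])
  moreover have "h t = h0 t + integral {a..t} (\<lambda>s. k s (h s))" if t: "t \<ge> a" for t
  proof (rule LIMSEQ_unique)
    show "(\<lambda>n. f (Suc n) t) \<longlonglongrightarrow> h t"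
      using tendsto_uniform_limitI[OF ul[of t], of t] t by (intro LIMSEQ_Suc) auto
    show "(\<lambda>n. f (Suc n) t) \<longlonglongrightarrow> h0 t + integral {a..t} (\<lambda>s. k s (h s))"
    proof (rule LIMSEQ_I)
      fix r :: real assume r: "r > 0"
      \<comment> \<open>Makes M e (t - a) at most r / 2; the summand 1 keeps the denominator
        positive when M (t - a) = 0.\<close>
      define e where "e = r / (2 * (M * (t - a) + 1))"
      have Mt: "M * (t - a) \<ge> 0" using M t by simp
      then have e: "e > 0" using r by (simp add: e_def)
      obtain N where N: "\<And>n s. n \<ge> N \<Longrightarrow> s \<in> {a..t} \<Longrightarrow> norm (f n s - h s) < e"
        using uniform_limitD[OF ul[of t] e] unfolding eventually_sequentially dist_norm by blast
      show "\<exists>no. \<forall>n\<ge>no. norm (f (Suc n) t - (h0 t + integral {a..t} (\<lambda>s. k s (h s)))) < r"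
      proof (intro exI allI impI)
        fix n assume n: "n \<ge> N"
        have "f (Suc n) t - (h0 t + integral {a..t} (\<lambda>s. k s (h s))) = integral {a..t} (\<lambda>s. k s (f n s - h s))"
          using kdiff[OF cf ch, of t n] by (simp add: fS)
        also have "norm \<dots> \<le> M * e * (t - a)"
        proof (rule integral_bound[OF t])
          show "continuous_on {a..t} (\<lambda>s. k s (f n s - h s))"
            by (rule continuous_on_subset[of "{a..}"]) (auto intro!: cont continuous_on_diff cf ch)
          fix s assume s: "s \<in> {a..t}"
          have "norm (k s (f n s - h s)) \<le> M * norm (f n s - h s)" using s by (intro bnd) auto
          also have "\<dots> \<le> M * e" using N[OF n s] M by (intro mult_left_mono) auto
          finally show "norm (k s (f n s - h s)) \<le> M * e" .
        qed
        also have "\<dots> \<le> (M * (t - a) + 1) * e" using e by (simp add: algebra_simps)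
        also have "\<dots> = r / 2" using Mt by (simp add: e_def divide_simps)
        also have "\<dots> < r" using r by simp
        finally show "norm (f (Suc n) t - (h0 t + integral {a..t} (\<lambda>s. k s (h s)))) < r" .
      qed
    qed
  qed
  ultimately show ?thesis by blast
qed

text \<open>The orbit of the exponential of \<open>B\<close>, obtained from the integral equation u
  = x + \<integral> B u; continuity of the integrand makes the integral differentiable.\<close>

lemma bounded_linear_orbit:
  fixes B :: "'a::banach \<Rightarrow> 'a"
  assumes B: "bounded_linear B"
  shows "\<exists>u. u 0 = x \<and> (\<forall>t\<ge>0. (u has_vector_derivative B (u t)) (at t within {0..}))"
proof -
  obtain K where K: "K \<ge> 0" "\<And>x. norm (B x) \<le> K * norm x"
    using bounded_linear.nonneg_bounded[OF B] by (auto simp: mult.commute)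
  have c: "continuous_on S v \<Longrightarrow> continuous_on S (\<lambda>s. B (v s))" for S :: "real set" and v
    by (rule bounded_linear.continuous_on[OF B])
  obtain u :: "real \<Rightarrow> 'a" where u: "continuous_on {0..} u" "\<And>t. t \<ge> 0 \<Longrightarrow> u t = x + integral {0..t} (\<lambda>s. B (u s))"
    using volterra[of 0 "\<lambda>s. B" K "\<lambda>t. x"] K c by (auto simp: linear_diff[OF bounded_linear.linear[OF B]])
  have "(u has_vector_derivative B (u t)) (at t within {0..})" if t: "t \<ge> 0" for t
  proof -
    have "((\<lambda>r. integral {0..r} (\<lambda>s. B (u s))) has_vector_derivative B (u t)) (at t within {0..t+1})"
      by (rule integral_has_vector_derivative) (use t in \<open>auto intro!: c continuous_on_subset[OF u(1)]\<close>)
    from has_vector_derivative_add[OF has_vector_derivative_const[of x] this]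
    have "((\<lambda>r. x + integral {0..r} (\<lambda>s. B (u s))) has_vector_derivative B (u t)) (at t within {0..})"
      using at_within_Ici_eq[of 0 t "t+1"] t by (simp only: add_0_left)
    then show ?thesis
      by (rule has_vector_derivative_transform[rotated 2]) (use t u(2) in auto)
  qed
  moreover have "u 0 = x" using u(2)[of 0] by simp
  ultimately show ?thesis by blast
qed

section \<open>Banach spaces with an equivalent inner product\<close>

text \<open>A form separate from the inner product of the type: the energy is weighted by
  \<open>Ham\<close> and depends on the system, whereas \<open>l2\<close> carries the unweighted
  inner product. Coercivity and boundedness make the two topologies agree.\<close>

locale energy =
  fixes ip :: "'a::banach \<Rightarrow> 'a \<Rightarrow> real"
  assumes bil: "bounded_bilinear ip"
    and sym: "ip x y = ip y x"
    and coercive: "\<exists>c>0. \<forall>x. c * (norm x)\<^sup>2 \<le> ip x x"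
begin

lemmas ip_simps =
  bounded_bilinear.add_left[OF bil] bounded_bilinear.add_right[OF bil]
  bounded_bilinear.diff_left[OF bil] bounded_bilinear.diff_right[OF bil]
  bounded_bilinear.scaleR_left[OF bil] bounded_bilinear.scaleR_right[OF bil]
  bounded_bilinear.minus_left[OF bil] bounded_bilinear.minus_right[OF bil]
  bounded_bilinear.zero_left[OF bil] bounded_bilinear.zero_right[OF bil]

definition en :: "'a \<Rightarrow> real" where "en x = sqrt (ip x x)"

lemma ip_nonneg [simp]: "0 \<le> ip x x"
  using coercive by (meson less_imp_le mult_nonneg_nonneg order_trans zero_le_power2)

lemma ip_pos: "x \<noteq> 0 \<Longrightarrow> 0 < ip x x"
  using coercive by (meson less_le_trans mult_pos_pos zero_less_norm_iff zero_less_power)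

lemma ip_eq_0_iff [simp]: "ip x x = 0 \<longleftrightarrow> x = 0"
  using ip_pos[of x] by (cases "x = 0") (auto simp: ip_simps)

lemma en_nonneg [simp]: "0 \<le> en x" by (simp add: en_def)

lemma en_zero [simp]: "en 0 = 0" by (simp add: en_def ip_simps)

lemma en_sq: "(en x)\<^sup>2 = ip x x" by (simp add: en_def)

lemma ip_cauchy: "ip x y \<le> en x * en y"
proof (cases "y = 0")
  case False
  define r where "r = ip x y / ip y y"
  have "0 \<le> ip (x - r *\<^sub>R y) (x - r *\<^sub>R y)" by simp
  also have "\<dots> = ip x x - 2 * r * ip x y + r * r * ip y y"
    by (simp add: ip_simps sym[of y x] algebra_simps)
  also have "\<dots> = ip x x - (ip x y)\<^sup>2 / ip y y"
    using ip_pos[OF False] by (simp add: r_def field_simps power2_eq_square)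
  finally have "(ip x y)\<^sup>2 \<le> (en x * en y)\<^sup>2"
    using ip_pos[OF False] by (simp add: power_mult_distrib en_sq field_simps)
  then show ?thesis by (rule power2_le_imp_le) simp
qed (simp add: ip_simps)

lemma en_triangle: "en (x + y) \<le> en x + en y"
proof (rule power2_le_imp_le)
  show "(en (x + y))\<^sup>2 \<le> (en x + en y)\<^sup>2"
    using ip_cauchy[of x y] by (simp add: en_sq power2_sum ip_simps sym[of y x])
qed simp

lemma en_scaleR: "en (r *\<^sub>R x) = \<bar>r\<bar> * en x"
proof -
  have "ip (r *\<^sub>R x) (r *\<^sub>R x) = r\<^sup>2 * ip x x" by (simp add: ip_simps power2_eq_square)
  then show ?thesis by (simp add: en_def real_sqrt_mult)
qed

lemma en_minus: "en (- x) = en x" by (simp add: en_def ip_simps)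

lemma en_diff_commute: "en (x - y) = en (y - x)"
  using en_minus[of "x - y"] by simp

lemma en_triangle_diff: "en (x - z) \<le> en (x - y) + en (y - z)"
  using en_triangle[of "x - y" "y - z"] by simp

lemma norm_le_en: "\<exists>C>0. \<forall>x. norm x \<le> C * en x"
proof -
  obtain c where c: "c > 0" "\<And>x. c * (norm x)\<^sup>2 \<le> ip x x" using coercive by blast
  have "norm x \<le> 1 / sqrt c * en x" for x
  proof (rule power2_le_imp_le)
    show "(norm x)\<^sup>2 \<le> (1 / sqrt c * en x)\<^sup>2"
      using c(2)[of x] c(1) by (simp add: power_mult_distrib power_divide en_sq field_simps)
  qed (use c in simp)
  then show ?thesis using c(1) by (intro exI[of _ "1 / sqrt c"]) auto
qed

lemma en_le_norm: "\<exists>C>0. \<forall>x. en x \<le> C * norm x"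
proof -
  obtain K where K: "K > 0" "\<And>x y. norm (ip x y) \<le> norm x * norm y * K"
    using bounded_bilinear.pos_bounded[OF bil] by blast
  have "en x \<le> sqrt K * norm x" for x
  proof (rule power2_le_imp_le)
    show "(en x)\<^sup>2 \<le> (sqrt K * norm x)\<^sup>2"
      using K(2)[of x x] K(1) by (simp add: power_mult_distrib en_sq power2_eq_square[of "norm x"] mult.commute)
  qed (use K in simp)
  then show ?thesis using K(1) by (intro exI[of _ "sqrt K"]) auto
qed

lemma tendsto_iff_en: "(f \<longlongrightarrow> l) F \<longleftrightarrow> ((\<lambda>x. en (f x - l)) \<longlongrightarrow> 0) F"
proof
  obtain C where C: "C > 0" "\<And>x. en x \<le> C * norm x" using en_le_norm by blast
  assume "(f \<longlongrightarrow> l) F"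
  then have "((\<lambda>x. C * norm (f x - l)) \<longlongrightarrow> C * 0) F"
    by (intro tendsto_mult tendsto_const tendsto_norm_zero LIM_zero)
  then have "((\<lambda>x. C * norm (f x - l)) \<longlongrightarrow> 0) F" by simp
  then show "((\<lambda>x. en (f x - l)) \<longlongrightarrow> 0) F"
    by (rule Lim_null_comparison[rotated]) (simp add: C)
next
  obtain C where C: "C > 0" "\<And>x. norm x \<le> C * en x" using norm_le_en by blast
  assume "((\<lambda>x. en (f x - l)) \<longlongrightarrow> 0) F"
  then have "((\<lambda>x. C * en (f x - l)) \<longlongrightarrow> C * 0) F"
    by (intro tendsto_mult tendsto_const)
  then have "((\<lambda>x. C * en (f x - l)) \<longlongrightarrow> 0) F" by simp
  then have "((\<lambda>x. f x - l) \<longlongrightarrow> 0) F"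
    by (rule Lim_null_comparison[rotated]) (simp add: C)
  then show "(f \<longlongrightarrow> l) F" by (simp add: LIM_zero_iff)
qed

lemma tendsto_en: "(f \<longlongrightarrow> l) F \<Longrightarrow> ((\<lambda>x. en (f x)) \<longlongrightarrow> en l) F"
  unfolding en_def by (intro tendsto_real_sqrt bounded_bilinear.tendsto[OF bil])

text \<open>The vector is the difference of \<open>z0\<close> and its nearest point in
  \<open>S\<close> for the energy. A minimizing sequence is Cauchy by the parallelogram law, because
  midpoints stay in \<open>S\<close>; coercivity carries this over to the complete norm.\<close>

lemma orthogonal_exists:
  assumes S: "subspace S" "closed S" and z0: "z0 \<notin> S"
  shows "\<exists>z. z \<noteq> 0 \<and> (\<forall>s\<in>S. ip z s = 0)"
proof -
  define q where "q x = ip x x" for x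
  define d where "d = (INF s\<in>S. q (z0 - s))"
  have S0: "0 \<in> S" using S(1) by (simp add: subspace_def)
  have bdd: "bdd_below ((\<lambda>s. q (z0 - s)) ` S)" by (rule bdd_belowI[of _ 0]) (auto simp: q_def)
  have d_le: "d \<le> q (z0 - s)" if "s \<in> S" for s
    unfolding d_def by (rule cINF_lower[OF bdd that])
  have "\<exists>s\<in>S. q (z0 - s) < d + 1 / (Suc n)" for n :: nat
    using cINF_less_iff[OF _ bdd, of "d + 1 / (Suc n)"] S0 by (auto simp: d_def)
  then obtain s where s: "\<And>n. s n \<in> S" "\<And>n. q (z0 - s n) < d + 1 / (Suc n)" by metis
  have par: "q (s m - s n) \<le> 2 * (1 / Suc m) + 2 * (1 / Suc n)" for m n
  proof -
    have "(1/2) *\<^sub>R (s m + s n) \<in> S" using S(1) s(1) by (simp add: subspace_add subspace_scale)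
    then have "d \<le> q (z0 - (1/2) *\<^sub>R (s m + s n))" by (rule d_le)
    moreover have "q (s m - s n) = 2 * q (z0 - s m) + 2 * q (z0 - s n) - 4 * q (z0 - (1/2) *\<^sub>R (s m + s n))"
      by (simp add: q_def ip_simps sym[of "s m" z0] sym[of "s n" z0] sym[of "s n" "s m"] algebra_simps)
    ultimately show ?thesis using s(2)[of m] s(2)[of n] by argo
  qed
  obtain C where C: "C > 0" "\<And>x. norm x \<le> C * en x" using norm_le_en by blast
  have "Cauchy s"
  proof (rule CauchyI)
    fix e :: real assume e: "e > 0"
    obtain N :: nat where N: "1 / Suc N < (e / C)\<^sup>2 / 4"
      using nat_approx_posE[of "(e / C)\<^sup>2 / 4"] e C by auto
    show "\<exists>M. \<forall>m\<ge>M. \<forall>n\<ge>M. norm (s m - s n) < e"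
    proof (intro exI allI impI)
      fix m n assume mn: "m \<ge> N" "n \<ge> N"
      have "1 / Suc m \<le> 1 / Suc N" "1 / Suc n \<le> 1 / Suc N"
        using mn by (auto intro!: divide_left_mono)
      then have "(en (s m - s n))\<^sup>2 < (e / C)\<^sup>2"
        using par[of m n] N by (simp add: en_sq q_def)
      then have "en (s m - s n) < e / C"
        by (rule power2_less_imp_less) (use e C in simp)
      then have "C * en (s m - s n) < e" using C(1) by (simp add: field_simps)
      then show "norm (s m - s n) < e" using C(2)[of "s m - s n"] by simp
    qed
  qed
  then obtain l where l: "s \<longlonglongrightarrow> l" by (auto simp: Cauchy_convergent_iff convergent_def)
  have lS: "l \<in> S" using closed_sequentially[OF S(2) _ l] s(1) by blast
  define z where "z = z0 - l"
  have "z \<noteq> 0" using lS z0 by (auto simp: z_def)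
  have l1: "(\<lambda>n. q (z0 - s n)) \<longlonglongrightarrow> q z"
    unfolding q_def z_def by (intro bounded_bilinear.tendsto[OF bil] tendsto_intros l)
  have l2: "(\<lambda>n. d + 1 / (Suc n)) \<longlonglongrightarrow> d + 0"
    by (intro tendsto_intros LIMSEQ_Suc[OF lim_1_over_n, unfolded of_nat_Suc[symmetric]])
  have "q z \<le> d + 0"
    by (rule LIMSEQ_le[OF l1 l2]) (intro exI[of _ 0] allI impI less_imp_le s(2))
  then have qz: "q z \<le> d" by simp
  have "ip z t = 0" if t: "t \<in> S" for t
  proof (cases "t = 0")
    case False
    \<comment> \<open>The multiple of t that minimizes the distance along t. Minimality of z then
      leaves no room for a nonzero component.\<close>
    define r where "r = ip z t / ip t t"
    have "l + r *\<^sub>R t \<in> S" using S(1) lS t by (simp add: subspace_add subspace_scale)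
    then have "q z \<le> q (z0 - (l + r *\<^sub>R t))" using d_le qz by fastforce
    also have "z0 - (l + r *\<^sub>R t) = z - r *\<^sub>R t" by (simp add: z_def)
    also have "q (z - r *\<^sub>R t) = q z - 2 * r * ip z t + r * r * ip t t"
      by (simp add: q_def ip_simps sym[of t z] algebra_simps)
    also have "\<dots> = q z - (ip z t)\<^sup>2 / ip t t"
      using ip_pos[OF False] by (simp add: r_def field_simps power2_eq_square)
    finally show ?thesis using ip_pos[OF False]
      by (simp add: divide_le_0_iff)
  qed (simp add: ip_simps)
  with \<open>z \<noteq> 0\<close> show ?thesis by blast
qed

text \<open>The kernel of \<open>\<phi>\<close> has codimension one, so a vector z orthogonal to it
  represents \<open>\<phi>\<close> up to the factor \<phi>(z) / ip(z, z).\<close>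

lemma riesz:
  assumes \<phi>: "bounded_linear (\<phi> :: 'a \<Rightarrow> real)"
  shows "\<exists>y. \<forall>x. \<phi> x = ip x y"
proof (cases "\<forall>x. \<phi> x = 0")
  case True
  then show ?thesis by (intro exI[of _ 0]) (simp add: ip_simps)
next
  case False
  interpret \<phi>: bounded_linear \<phi> by (rule \<phi>)
  define S where "S = {x. \<phi> x = 0}"
  have "subspace S" by (auto simp: S_def subspace_def \<phi>.add \<phi>.scaleR \<phi>.zero)
  moreover have "closed S"
    unfolding S_def by (intro closed_Collect_eq continuous_on_const linear_continuous_on \<phi>)
  moreover obtain z0 where "z0 \<notin> S" using False by (auto simp: S_def)
  ultimately obtain z where z: "z \<noteq> 0" "\<And>s. s \<in> S \<Longrightarrow> ip z s = 0"
    using orthogonal_exists[of S z0] by blast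
  have \<phi>z: "\<phi> z \<noteq> 0" using z ip_pos[of z] by (auto simp: S_def)
  have "\<phi> x = ip x ((\<phi> z / ip z z) *\<^sub>R z)" for x
  proof -
    have "x - (\<phi> x / \<phi> z) *\<^sub>R z \<in> S" using \<phi>z by (simp add: S_def \<phi>.diff \<phi>.scaleR)
    then have "ip z (x - (\<phi> x / \<phi> z) *\<^sub>R z) = 0" by (rule z(2))
    then have "ip x z = \<phi> x / \<phi> z * ip z z" by (simp add: ip_simps sym[of z x])
    then show ?thesis using \<phi>z ip_pos[OF z(1)] z(1) by (simp add: ip_simps)
  qed
  then show ?thesis by blast
qed

text \<open>Formally the derivative of \<open>en (v t)\<close> is
  \<open>ip (v' t) (v t) / en (v t)\<close>, hence at most c. Since \<open>en\<close> is not
  differentiable at 0, the argument is run for sqrt(ip(v, v) + e^2), and e tends to 0 at the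
  end.\<close>

lemma energy_growth:
  assumes v: "\<And>t. t \<ge> 0 \<Longrightarrow> (v has_vector_derivative v' t) (at t within {0..})"
    and le: "\<And>t. t \<ge> 0 \<Longrightarrow> ip (v' t) (v t) \<le> c * en (v t)" and c: "c \<ge> 0" and t: "t \<ge> 0"
  shows "en (v t) \<le> en (v 0) + c * t"
proof (rule field_le_epsilon)
  fix e :: real assume e: "e > 0"
  define \<psi> where "\<psi> s = sqrt (ip (v s) (v s) + e\<^sup>2)" for s
  have pos: "ip (v s) (v s) + e\<^sup>2 > 0" for s using e by (intro add_nonneg_pos) auto
  have der: "(\<psi> has_real_derivative ip (v' s) (v s) / \<psi> s) (at s within {0..})" if "s \<ge> 0" for s
  proof -
    have "((\<lambda>s. ip (v s) (v s)) has_vector_derivative ip (v s) (v' s) + ip (v' s) (v s)) (at s within {0..})"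
      by (rule bounded_bilinear.has_vector_derivative[OF bil v v]) (use that in auto)
    then have "((\<lambda>s. ip (v s) (v s)) has_real_derivative 2 * ip (v' s) (v s)) (at s within {0..})"
      by (simp add: has_real_derivative_iff_has_vector_derivative sym[of "v s"])
    then show ?thesis
      unfolding \<psi>_def using pos[of s]
      by (auto intro!: derivative_eq_intros simp: field_simps)
  qed
  have "\<psi> t - c * t \<le> \<psi> 0 - c * 0"
  proof (rule DERIV_nonpos_imp_decreasing_open[OF t])
    fix s assume s: "0 < s" "s < t"
    have "at s within {0..} = at s" using s by (intro at_within_interior) auto
    then have "((\<lambda>s. \<psi> s - c * s) has_real_derivative ip (v' s) (v s) / \<psi> s - c) (at s)"
      using der[of s] s by (auto intro!: derivative_eq_intros)
    moreover have "ip (v' s) (v s) / \<psi> s - c \<le> 0"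
    proof -
      have "en (v s) \<le> \<psi> s" by (simp add: en_def \<psi>_def)
      then have "c * en (v s) \<le> c * \<psi> s" using c by (rule mult_left_mono)
      moreover have "\<psi> s > 0" using pos[of s] by (simp add: \<psi>_def)
      moreover have "ip (v' s) (v s) \<le> c * en (v s)" using le[of s] s by simp
      ultimately show ?thesis by (simp add: pos_divide_le_eq)
    qed
    ultimately show "\<exists>y. ((\<lambda>s. \<psi> s - c * s) has_real_derivative y) (at s) \<and> y \<le> 0" by blast
  next
    have "continuous_on {0..} \<psi>"
      using der by (auto simp: continuous_on_eq_continuous_within intro: has_field_derivative_imp_has_derivative has_derivative_continuous)
    then show "continuous_on {0..t} (\<lambda>s. \<psi> s - c * s)"
      by (intro continuous_intros) (auto intro: continuous_on_subset)
  qed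
  moreover have "en (v t) \<le> \<psi> t" by (simp add: en_def \<psi>_def)
  moreover have "\<psi> 0 \<le> en (v 0) + e"
    using sqrt_add_le_add_sqrt[of "ip (v 0) (v 0)" "e\<^sup>2"] e by (simp add: en_def \<psi>_def)
  ultimately show "en (v t) \<le> en (v 0) + c * t + e" by simp
qed

end

section \<open>Maximal dissipative operators\<close>

locale m_dissipative = energy ip for ip :: "'a::banach \<Rightarrow> 'a \<Rightarrow> real" +
  fixes D :: "'a set" and A :: "'a \<Rightarrow> 'a"
  assumes sub: "subspace D"
    and A_add: "x \<in> D \<Longrightarrow> y \<in> D \<Longrightarrow> A (x + y) = A x + A y"
    and A_scaleR: "x \<in> D \<Longrightarrow> A (r *\<^sub>R x) = r *\<^sub>R A x"
    and diss: "x \<in> D \<Longrightarrow> ip (A x) x \<le> 0"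
    and range: "l > 0 \<Longrightarrow> \<exists>x\<in>D. l *\<^sub>R x - A x = y"
begin

lemma D_simps: "0 \<in> D" "x \<in> D \<Longrightarrow> y \<in> D \<Longrightarrow> x + y \<in> D" "x \<in> D \<Longrightarrow> y \<in> D \<Longrightarrow> x - y \<in> D"
    "x \<in> D \<Longrightarrow> r *\<^sub>R x \<in> D"
  using sub by (simp_all add: subspace_0 subspace_add subspace_diff subspace_scale)

lemma A_diff: "x \<in> D \<Longrightarrow> y \<in> D \<Longrightarrow> A (x - y) = A x - A y"
  using A_add[of x "(-1) *\<^sub>R y"] A_scaleR[of y "-1"] D_simps(4)[of y "-1"] by simp

definition R :: "real \<Rightarrow> 'a \<Rightarrow> 'a" where
  "R l y = (SOME x. x \<in> D \<and> l *\<^sub>R x - A x = y)"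

lemma R_D: "l > 0 \<Longrightarrow> R l y \<in> D" and R_eq: "l > 0 \<Longrightarrow> l *\<^sub>R R l y - A (R l y) = y"
  using someI_ex[of "\<lambda>x. x \<in> D \<and> l *\<^sub>R x - A x = y"] range[of l y] unfolding R_def by auto

lemma A_R: "l > 0 \<Longrightarrow> A (R l y) = l *\<^sub>R R l y - y"
  using R_eq[of l y] by (simp add: algebra_simps)

lemma en_resolvent_le: "l > 0 \<Longrightarrow> x \<in> D \<Longrightarrow> l * en x \<le> en (l *\<^sub>R x - A x)"
proof (cases "x = 0")
  case False
  assume l: "l > 0" and x: "x \<in> D"
  have "l * (en x)\<^sup>2 \<le> ip (l *\<^sub>R x - A x) x"
    using diss[OF x] by (simp add: ip_simps en_sq)
  also have "\<dots> \<le> en (l *\<^sub>R x - A x) * en x" by (rule ip_cauchy)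
  finally have "l * en x * en x \<le> en (l *\<^sub>R x - A x) * en x" by (simp add: power2_eq_square)
  moreover have "en x > 0" using ip_pos[OF False] by (simp add: en_def)
  ultimately show ?thesis by simp
qed simp

lemma resolvent_inj:
  assumes l: "l > 0" and D: "x \<in> D" "y \<in> D" and eq: "l *\<^sub>R x - A x = l *\<^sub>R y - A y"
  shows "x = y"
proof -
  have "l *\<^sub>R (x - y) - A (x - y) = 0" using eq D by (simp add: A_diff algebra_simps)
  then have "l * en (x - y) \<le> 0" using en_resolvent_le[OF l D_simps(3)[OF D]] by simp
  then have "en (x - y) = 0"
    using l en_nonneg[of "x - y"] by (simp add: mult_le_0_iff)
  then have "ip (x - y) (x - y) = 0" by (simp add: en_def)
  then show ?thesis by simp
qed

lemma R_I: "l > 0 \<Longrightarrow> x \<in> D \<Longrightarrow> l *\<^sub>R x - A x = y \<Longrightarrow> R l y = x"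
  by (rule resolvent_inj[of l]) (simp_all add: R_D R_eq)

lemma en_R: "l > 0 \<Longrightarrow> en (R l y) \<le> en y / l"
  using en_resolvent_le[of l "R l y"] R_D[of l y] R_eq[of l y] by (simp add: pos_le_divide_eq mult.commute)

lemma R_add: "l > 0 \<Longrightarrow> R l (x + y) = R l x + R l y"
  by (rule R_I) (simp_all add: D_simps R_D A_add A_R algebra_simps)

lemma R_scaleR: "l > 0 \<Longrightarrow> R l (r *\<^sub>R x) = r *\<^sub>R R l x"
  by (rule R_I) (simp_all add: D_simps R_D A_scaleR A_R algebra_simps)

lemma bounded_linear_R: assumes l: "l > 0" shows "bounded_linear (R l)"
proof -
  obtain C1 where C1: "C1 > 0" "\<And>x. norm x \<le> C1 * en x" using norm_le_en by blast
  obtain C2 where C2: "C2 > 0" "\<And>x. en x \<le> C2 * norm x" using en_le_norm by blast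
  show ?thesis
  proof (rule bounded_linear_intro[of _ "C1 * C2 / l"])
    fix x
    have "norm (R l x) \<le> C1 * (en x / l)"
      using C1(2)[of "R l x"] mult_left_mono[OF en_R[OF l, of x] less_imp_le[OF C1(1)]] by linarith
    also have "\<dots> \<le> C1 * (C2 * norm x / l)"
      using C1(1) C2(2)[of x] l by (intro mult_left_mono divide_right_mono) auto
    finally show "norm (R l x) \<le> norm x * (C1 * C2 / l)" by (simp add: field_simps)
  qed (simp_all add: R_add[OF l] R_scaleR[OF l])
qed

lemma R_diff: "l > 0 \<Longrightarrow> R l (x - y) = R l x - R l y"
  using linear_diff[OF bounded_linear.linear[OF bounded_linear_R]] .

lemma R_A: "l > 0 \<Longrightarrow> x \<in> D \<Longrightarrow> R l (A x) = A (R l x)"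
  using R_diff[of l "l *\<^sub>R x" "l *\<^sub>R x - A x"] R_I[of l x "l *\<^sub>R x - A x"]
  by (simp add: A_R R_scaleR)

text \<open>\<open>A\<close> commutes with \<open>R m\<close> on \<open>D\<close>, so
  \<open>R m (R l y)\<close> solves the equation whose unique solution is
  \<open>R l (R m y)\<close>.\<close>

lemma R_commute: assumes l: "l > 0" and m: "m > 0" shows "R l (R m y) = R m (R l y)"
proof (rule R_I[OF l])
  have "A (R m (R l y)) = R m (A (R l y))" using R_A[OF m R_D[OF l]] by simp
  then have "l *\<^sub>R R m (R l y) - A (R m (R l y)) = R m (l *\<^sub>R R l y - A (R l y))"
    by (simp add: R_diff[OF m] R_scaleR[OF m])
  then show "l *\<^sub>R R m (R l y) - A (R m (R l y)) = R m y" by (simp add: R_eq[OF l])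
qed (rule R_D[OF m])

text \<open>If z is orthogonal to \<open>D\<close>, solve w - A w = z. Pairing with w, which lies in
  \<open>D\<close>, gives ip(w, w) = ip(A w, w), and dissipativity leaves only w = 0 and z =
  0.\<close>

lemma dense_D: "closure D = UNIV"
proof (rule ccontr)
  have cs: "subspace (closure D)"
    unfolding subspace_def
  proof (intro conjI ballI allI)
    show "0 \<in> closure D" using D_simps(1) closure_subset by blast
    fix x y assume "x \<in> closure D" "y \<in> closure D"
    then obtain f g where fg: "\<And>n. f n \<in> D" "f \<longlonglongrightarrow> x" "\<And>n. g n \<in> D" "g \<longlonglongrightarrow> y"
      unfolding closure_sequential by blast
    show "x + y \<in> closure D"
      unfolding closure_sequential
      by (rule exI[of _ "\<lambda>n. f n + g n"]) (simp add: fg D_simps tendsto_add)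
    show "r *\<^sub>R x \<in> closure D" for r
      unfolding closure_sequential
      by (rule exI[of _ "\<lambda>n. r *\<^sub>R f n"]) (simp add: fg D_simps tendsto_scaleR)
  qed
  assume "closure D \<noteq> UNIV"
  then obtain z0 where "z0 \<notin> closure D" by blast
  from orthogonal_exists[OF cs closed_closure this]
  obtain z where z: "z \<noteq> 0" "\<And>s. s \<in> closure D \<Longrightarrow> ip z s = 0" by blast
  obtain w where w: "w \<in> D" "1 *\<^sub>R w - A w = z" using range[of 1 z] by auto
  have "ip z w = 0" using w z(2) closure_subset by blast
  then have "ip w w = ip (A w) w" using w(2)[symmetric] by (simp add: ip_simps)
  then have "ip w w \<le> 0" using diss[OF w(1)] by simp
  then have "w = 0" using ip_pos[of w] by (cases "w = 0") auto
  then have "z = 0" using w(2) A_scaleR[OF D_simps(1), of 0] by simp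
  then show False using z(1) by simp
qed

lemma dense_approx: "e > 0 \<Longrightarrow> \<exists>x\<in>D. en (y - x) < e"
proof -
  assume e: "e > 0"
  obtain f where f: "\<And>n. f n \<in> D" "f \<longlonglongrightarrow> y"
    using dense_D closure_sequential[of y D] by auto
  have "eventually (\<lambda>n. en (f n - y) < e) sequentially"
    using order_tendstoD(2)[OF tendsto_iff_en[THEN iffD1, OF f(2)] e] .
  then obtain n where "en (f n - y) < e" by (auto simp: eventually_sequentially)
  then show ?thesis using f(1) en_diff_commute by metis
qed

text \<open>The shift by one keeps every parameter in the resolvent set, including the one at index
  0.\<close>

definition lam :: "nat \<Rightarrow> real" where "lam n = real (Suc n)"

lemma lam_pos [simp]: "lam n > 0" by (simp add: lam_def)

lemma en_lam_R: "en (lam n *\<^sub>R R (lam n) y) \<le> en y"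
proof -
  have "lam n * en (R (lam n) y) \<le> lam n * (en y / lam n)"
    by (rule mult_left_mono[OF en_R]) (simp_all add: less_imp_le)
  then show ?thesis by (simp add: en_scaleR less_imp_le lam_def)
qed

text \<open>On \<open>D\<close> the error is \<open>R (lam n) (A x)\<close>, of order 1 / lam n. The
  operators are contractions for the energy, so density extends the convergence to all
  vectors.\<close>

lemma lam_R_tendsto: "(\<lambda>n. lam n *\<^sub>R R (lam n) y) \<longlonglongrightarrow> y"
  unfolding tendsto_iff_en
proof (rule LIMSEQ_I)
  fix e :: real assume e: "e > 0"
  obtain x where x: "x \<in> D" "en (y - x) < e / 3" using dense_approx[of "e/3" y] e by auto
  obtain N :: nat where N: "N > 0" "en (A x) / N < e / 3"
  proof -
    obtain N :: nat where "real N > en (A x) / (e / 3)" using reals_Archimedean2 by blast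
    then have "N > 0 \<and> en (A x) / N < e / 3" using e en_nonneg[of "A x"]
      by (cases "N = 0") (auto simp: field_simps)
    then show ?thesis using that by blast
  qed
  show "\<exists>no. \<forall>n\<ge>no. norm (en (lam n *\<^sub>R R (lam n) y - y) - 0) < e"
  proof (intro exI allI impI)
    fix n assume n: "n \<ge> N"
    let ?r = "\<lambda>z. lam n *\<^sub>R R (lam n) z"
    have "?r x - x = R (lam n) (A x)" using R_A[OF lam_pos x(1), of n] A_R[OF lam_pos, of n x] by simp
    then have "en (?r x - x) \<le> en (A x) / lam n" using en_R[OF lam_pos, of n "A x"] by simp
    also have "\<dots> \<le> en (A x) / N" using n N(1) by (intro divide_left_mono) (auto simp: lam_def)
    finally have 1: "en (?r x - x) < e / 3" using N(2) by linarith
    have "?r y - ?r x = ?r (y - x)" by (simp add: R_diff scaleR_diff_right)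
    then have 2: "en (?r y - ?r x) < e / 3" using en_lam_R[of n "y - x"] x(2) by simp
    have "en (?r y - y) \<le> en (?r y - ?r x) + (en (?r x - x) + en (x - y))"
      using en_triangle_diff[of "?r y" y "?r x"] en_triangle_diff[of "?r x" y x] by simp
    then show "norm (en (?r y - y) - 0) < e" using 1 2 x(2) en_diff_commute[of x y] by simp
  qed
qed

text \<open>The Yosida approximation of \<open>A\<close>, in the form that is visibly bounded on the
  whole space.\<close>

definition Y :: "nat \<Rightarrow> 'a \<Rightarrow> 'a" where "Y n x = lam n *\<^sub>R (lam n *\<^sub>R R (lam n) x - x)"

lemma Y_eq: "Y n x = lam n *\<^sub>R A (R (lam n) x)" by (simp add: Y_def A_R)

lemma Y_D: "x \<in> D \<Longrightarrow> Y n x = lam n *\<^sub>R R (lam n) (A x)" by (simp add: Y_eq R_A)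

lemma bounded_linear_Y: "bounded_linear (Y n)"
  unfolding Y_def
  by (intro bounded_linear_compose[OF bounded_linear_scaleR_right] bounded_linear_sub bounded_linear_R
      bounded_linear_ident lam_pos)

lemma Y_diff: "Y n (x - y) = Y n x - Y n y"
  using linear_diff[OF bounded_linear.linear[OF bounded_linear_Y]] .

lemma Y_commute: "Y n (Y m x) = Y m (Y n x)"
  by (simp add: Y_def R_diff R_scaleR R_commute[of "lam n" "lam m"] algebra_simps)

lemma Y_diss: "ip (Y n x) x \<le> 0"
proof -
  define r where "r = R (lam n) x"
  have x: "x = lam n *\<^sub>R r - A r" by (simp add: r_def R_eq)
  \<comment> \<open>With r the resolvent of x, the value splits into lam^2 ip(A r, r) and - lam ip(A
    r, A r), neither of which is positive.\<close>
  have "ip (Y n x) x = ip (lam n *\<^sub>R A r) (lam n *\<^sub>R r - A r)"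
    by (simp only: Y_eq r_def[symmetric] x[symmetric])
  then have "ip (Y n x) x = lam n * (lam n * ip (A r) r - ip (A r) (A r))"
    by (simp add: ip_simps algebra_simps)
  moreover have "lam n * ip (A r) r \<le> 0"
    using diss[OF R_D[OF lam_pos], of n x] by (intro mult_nonneg_nonpos) (auto simp: r_def less_imp_le)
  moreover have "0 \<le> ip (A r) (A r)" by simp
  moreover from calculation have "lam n * (lam n * ip (A r) r - ip (A r) (A r)) \<le> 0"
    by (intro mult_nonneg_nonpos) (auto simp: less_imp_le intro: order_trans[OF _ ip_nonneg])
  ultimately show ?thesis by simp
qed

lemma Y_scaleR: "Y n (r *\<^sub>R x) = r *\<^sub>R Y n x"
  by (simp add: Y_def R_scaleR scaleR_diff_right mult.commute mult.left_commute)

lemma Y_R: "l > 0 \<Longrightarrow> Y n (R l x) = R l (Y n x)"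
  by (simp add: Y_def R_diff R_scaleR R_commute[of l "lam n"])

lemma Y_tendsto: "x \<in> D \<Longrightarrow> (\<lambda>n. Y n x) \<longlonglongrightarrow> A x"
  by (simp add: Y_D lam_R_tendsto)

text \<open>\<open>z n\<close> is the image of \<open>z n - A (z n)\<close> under the bounded
  operator \<open>R 1\<close>, and this relation survives the limit.\<close>

lemma A_closed:
  assumes z: "\<And>n. z n \<in> D" "z \<longlonglongrightarrow> u" "(\<lambda>n. A (z n)) \<longlonglongrightarrow> w"
  shows "u \<in> D" "A u = w"
proof -
  have "(\<lambda>n. R 1 (z n - A (z n))) \<longlonglongrightarrow> R 1 (u - w)"
    by (intro bounded_linear.tendsto[OF bounded_linear_R] tendsto_diff z) simp
  moreover have "R 1 (z n - A (z n)) = z n" for n by (rule R_I) (simp_all add: z)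
  ultimately have "z \<longlonglongrightarrow> R 1 (u - w)" by simp
  with z(2) have u: "u = R 1 (u - w)" by (rule LIMSEQ_unique)
  then show "u \<in> D" using R_D[of 1] by (metis zero_less_one)
  have "A u = 1 *\<^sub>R u - (u - w)" using A_R[of 1 "u - w"] u by simp
  then show "A u = w" by simp
qed

lemma Y_orbit_growth:
  assumes u: "\<And>t. t \<ge> 0 \<Longrightarrow> (u has_vector_derivative Y n (u t)) (at t within {0..})"
    and t: "t \<ge> 0"
  shows "en (u t) \<le> en (u 0)"
  using energy_growth[OF u, of 0 t] t Y_diss by simp

text \<open>The Yosida approximations commute, so the difference of two of them, applied to an orbit,
  is again an orbit and stays below its initial value.\<close>

lemma Y_orbit_diff:
  assumes u: "\<And>t. t \<ge> 0 \<Longrightarrow> (u has_vector_derivative Y n (u t)) (at t within {0..})"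
    and v: "\<And>t. t \<ge> 0 \<Longrightarrow> (v has_vector_derivative Y m (v t)) (at t within {0..})"
    and t: "t \<ge> 0"
  shows "en (u t - v t) \<le> en (u 0 - v 0) + en (Y n (v 0) - Y m (v 0)) * t"
proof (rule energy_growth[of "\<lambda>t. u t - v t" "\<lambda>t. Y n (u t) - Y m (v t)"])
  fix s :: real assume s: "s \<ge> 0"
  show "((\<lambda>t. u t - v t) has_vector_derivative Y n (u s) - Y m (v s)) (at s within {0..})"
    by (intro has_vector_derivative_diff u v s)
  have "((\<lambda>t. Y n (v t) - Y m (v t)) has_vector_derivative Y n (Y m (v r)) - Y m (Y m (v r))) (at r within {0..})"
    if "r \<ge> 0" for r
    by (intro has_vector_derivative_diff bounded_linear.has_vector_derivative[OF bounded_linear_Y] v that)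
  then have "((\<lambda>t. Y n (v t) - Y m (v t)) has_vector_derivative Y m (Y n (v r) - Y m (v r))) (at r within {0..})"
    if "r \<ge> 0" for r
    using that by (simp add: Y_diff Y_commute[of n m])
  then have g: "en (Y n (v s) - Y m (v s)) \<le> en (Y n (v 0) - Y m (v 0))"
    by (rule Y_orbit_growth[of "\<lambda>t. Y n (v t) - Y m (v t)" m s]) (use s in auto)
  have "Y n (u s) - Y m (v s) = Y n (u s - v s) + (Y n (v s) - Y m (v s))" by (simp add: Y_diff)
  then have "ip (Y n (u s) - Y m (v s)) (u s - v s)
      = ip (Y n (u s - v s)) (u s - v s) + ip (Y n (v s) - Y m (v s)) (u s - v s)"
    by (simp only: bounded_bilinear.add_left[OF bil])
  also have "\<dots> \<le> 0 + en (Y n (v s) - Y m (v s)) * en (u s - v s)"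
    by (intro add_mono Y_diss ip_cauchy)
  also have "\<dots> \<le> en (Y n (v 0) - Y m (v 0)) * en (u s - v s)"
    using mult_right_mono[OF g en_nonneg[of "u s - v s"]] by simp
  finally show "ip (Y n (u s) - Y m (v s)) (u s - v s) \<le> en (Y n (v 0) - Y m (v 0)) * en (u s - v s)" .
qed (simp_all add: t)

lemma tendsto_Cauchy_en:
  assumes "f \<longlonglongrightarrow> l" "e > 0"
  shows "\<exists>N. \<forall>m\<ge>N. \<forall>n\<ge>N. en (f m - f n) < e"
proof -
  obtain C where C: "C > 0" "\<And>x. en x \<le> C * norm x" using en_le_norm by blast
  obtain N where N: "\<forall>m\<ge>N. \<forall>n\<ge>N. norm (f m - f n) < e / C"
    using CauchyD[OF LIMSEQ_imp_Cauchy[OF assms(1)], of "e / C"] assms(2) C(1) by auto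
  have "en (f m - f n) < e" if "m \<ge> N" "n \<ge> N" for m n
  proof -
    have "C * norm (f m - f n) < e" using N that C(1) by (simp add: field_simps)
    then show ?thesis using C(2)[of "f m - f n"] by simp
  qed
  then show ?thesis by blast
qed

lemma uniform_limit_en_Cauchy:
  assumes c: "\<And>e. e > 0 \<Longrightarrow> \<exists>N. \<forall>m\<ge>N. \<forall>n\<ge>N. \<forall>t\<in>S. en (f m t - f n t) < e"
  shows "uniform_limit S f (\<lambda>t. lim (\<lambda>n. f n t)) sequentially"
proof -
  obtain C where C: "C > 0" "\<And>x. norm x \<le> C * en x" using norm_le_en by blast
  have "uniformly_Cauchy_on S f"
    unfolding uniformly_Cauchy_on_def
  proof (intro allI impI)
    fix e :: real assume e: "e > 0"
    then obtain N where N: "\<forall>m\<ge>N. \<forall>n\<ge>N. \<forall>t\<in>S. en (f m t - f n t) < e / C"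
      using c[of "e / C"] C(1) by auto
    show "\<exists>M. \<forall>x\<in>S. \<forall>m\<ge>M. \<forall>n\<ge>M. dist (f m x) (f n x) < e"
    proof (intro exI ballI allI impI)
      fix x m n assume *: "x \<in> S" "m \<ge> N" "n \<ge> N"
      have "norm (f m x - f n x) \<le> C * en (f m x - f n x)" by (rule C(2))
      also have "\<dots> < e" using N * C(1) by (simp add: field_simps)
      finally show "dist (f m x) (f n x) < e" by (simp add: dist_norm)
    qed
  qed
  then have "uniformly_convergent_on S f" by (rule Cauchy_uniformly_convergent)
  then show ?thesis by (simp add: uniformly_convergent_uniform_limit_iff)
qed

text \<open>Both the Yosida orbits and their derivatives must converge uniformly on bounded
  intervals. The derivatives \<open>Y n (u n t)\<close> are Yosida orbits again, so the same
  difference estimate applies to them, with initial values that are under control because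
  \<open>A x\<close> lies in \<open>D\<close>. Closedness of \<open>A\<close> identifies the limit
  of the derivatives.\<close>

theorem orbit_exists:
  assumes x: "x \<in> D" "A x \<in> D"
  shows "\<exists>u. u 0 = x \<and> (\<forall>t\<ge>0. u t \<in> D \<and> (u has_vector_derivative A (u t)) (at t within {0..})) \<and>
    continuous_on {0..} (\<lambda>t. A (u t))"
proof -
  have "\<forall>n. \<exists>u. u 0 = x \<and> (\<forall>t\<ge>0. (u has_vector_derivative Y n (u t)) (at t within {0..}))"
    using bounded_linear_orbit[OF bounded_linear_Y] by blast
  then obtain u where u0: "\<And>n. u n 0 = x"
    and u: "\<And>n t. t \<ge> 0 \<Longrightarrow> (u n has_vector_derivative Y n (u n t)) (at t within {0..})"
    by metis
  have Yu: "((\<lambda>t. Y n (u n t)) has_vector_derivative Y n (Y n (u n t))) (at t within {0..})" if "t \<ge> 0" for n t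
    by (rule bounded_linear.has_vector_derivative[OF bounded_linear_Y u[OF that]])
  \<comment> \<open>Formulated for an arbitrary family of Yosida orbits because it is used for
    \<open>u\<close> and for its derivatives.\<close>
  have est: "\<exists>N. \<forall>m\<ge>N. \<forall>n\<ge>N. \<forall>t\<in>{0..T}. en (v m t - v n t) < e"
    if e: "e > 0" and v: "\<And>n t. t \<ge> 0 \<Longrightarrow> (v n has_vector_derivative Y n (v n t)) (at t within {0..})"
      and v0: "\<And>e. e > 0 \<Longrightarrow> \<exists>N. \<forall>m\<ge>N. \<forall>n\<ge>N. en (v m 0 - v n 0) < e"
      and Yv0: "\<And>e. e > 0 \<Longrightarrow> \<exists>N. \<forall>m\<ge>N. \<forall>n\<ge>N. en (Y m (v n 0) - Y n (v n 0)) < e"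
    for e T v
  proof -
    define e1 where "e1 = e / (2 * (\<bar>T\<bar> + 1))"
    have e1: "e1 > 0" "e1 * \<bar>T\<bar> \<le> e / 2" using e by (auto simp: e1_def field_simps)
    obtain N1 where N1: "\<forall>m\<ge>N1. \<forall>n\<ge>N1. en (v m 0 - v n 0) < e / 2" using v0[of "e/2"] e by auto
    obtain N2 where N2: "\<forall>m\<ge>N2. \<forall>n\<ge>N2. en (Y m (v n 0) - Y n (v n 0)) < e1" using Yv0[OF e1(1)] by auto
    have "en (v m t - v n t) < e" if mn: "m \<ge> max N1 N2" "n \<ge> max N1 N2" and t: "t \<in> {0..T}" for m n t
    proof -
      have "en (v m t - v n t) \<le> en (v m 0 - v n 0) + en (Y m (v n 0) - Y n (v n 0)) * t"
        using t by (intro Y_orbit_diff v) auto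
      moreover have "en (Y m (v n 0) - Y n (v n 0)) * t \<le> e1 * \<bar>T\<bar>"
        using N2 mn t e1 by (intro mult_mono) (auto intro: less_imp_le)
      moreover have "en (v m 0 - v n 0) < e / 2" using N1 mn by simp
      ultimately show ?thesis using e1(2) by linarith
    qed
    then show ?thesis by blast
  qed
  define U where "U t = lim (\<lambda>n. u n t)" for t
  define W where "W t = lim (\<lambda>n. Y n (u n t))" for t
  have Yx: "\<exists>N. \<forall>m\<ge>N. \<forall>n\<ge>N. en (Y m y - Y n y) < e" if "y \<in> D" "e > 0" for y e
    using tendsto_Cauchy_en[OF Y_tendsto[OF that(1)] that(2)] .
  have U: "uniform_limit {0..T} u U sequentially" for T
    unfolding U_def
  proof (rule uniform_limit_en_Cauchy, rule est[of _ u])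
    show "\<exists>N. \<forall>m\<ge>N. \<forall>n\<ge>N. en (u m 0 - u n 0) < e" if "e > 0" for e
      using that by (simp add: u0)
    show "\<exists>N. \<forall>m\<ge>N. \<forall>n\<ge>N. en (Y m (u n 0) - Y n (u n 0)) < e" if "e > 0" for e
      using Yx[OF x(1) that] by (simp add: u0)
  qed (use u in auto)
  have W: "uniform_limit {0..T} (\<lambda>n t. Y n (u n t)) W sequentially" for T
    unfolding W_def
  proof (rule uniform_limit_en_Cauchy, rule est[of _ "\<lambda>n t. Y n (u n t)"])
    show "\<exists>N. \<forall>m\<ge>N. \<forall>n\<ge>N. en (Y m (u m 0) - Y n (u n 0)) < e" if "e > 0" for e
      using Yx[OF x(1) that] by (simp add: u0)
    show "\<exists>N. \<forall>m\<ge>N. \<forall>n\<ge>N. en (Y m (Y n (u n 0)) - Y n (Y n (u n 0))) < e" if "e > 0" for e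
    proof -
      obtain N where N: "\<forall>m\<ge>N. \<forall>n\<ge>N. en (Y m (A x) - Y n (A x)) < e" using Yx[OF x(2) \<open>e > 0\<close>] by blast
      \<comment> \<open>The inner \<open>Y n x\<close> equals the contraction
        \<open>lam n *\<^sub>R R (lam n)\<close> applied to \<open>A x\<close>. It commutes with the
        outer operators, so the difference is bounded by that of \<open>Y m\<close> and
        \<open>Y n\<close> at \<open>A x\<close>.\<close>
      have "en (Y m (Y n x) - Y n (Y n x)) \<le> en (Y m (A x) - Y n (A x))" for m n
      proof -
        have "Y m (Y n x) = lam n *\<^sub>R R (lam n) (Y m (A x))" for m n
          unfolding Y_D[OF x(1), of n] by (simp only: Y_scaleR Y_R[OF lam_pos])
        then have "Y m (Y n x) - Y n (Y n x) = lam n *\<^sub>R R (lam n) (Y m (A x) - Y n (A x))"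
          by (simp add: R_diff scaleR_diff_right)
        then show ?thesis using en_lam_R[of n "Y m (A x) - Y n (A x)"] by simp
      qed
      then show ?thesis using N unfolding u0 by (meson le_less_trans)
    qed
  qed (use Yu in auto)
  have Ut: "(\<lambda>n. u n t) \<longlonglongrightarrow> U t" and Wt: "(\<lambda>n. Y n (u n t)) \<longlonglongrightarrow> W t" if "t \<ge> 0" for t
    using tendsto_uniform_limitI[OF U[of t], of t] tendsto_uniform_limitI[OF W[of t], of t] that by auto
  have "(U has_vector_derivative W t) (at t within {0..})" if t: "t \<ge> 0" for t
  proof -
    have "\<exists>g. \<forall>s\<in>{0..t+1}. (\<lambda>n. u n s) \<longlonglongrightarrow> g s \<and>
        (g has_derivative (\<lambda>h. h *\<^sub>R W s)) (at s within {0..t+1})"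
    proof (rule has_derivative_sequence)
      show "convex {0..t+1}" by simp
      show "(u n has_derivative (\<lambda>h. h *\<^sub>R Y n (u n s))) (at s within {0..t+1})" if "s \<in> {0..t+1}" for n s
        using has_vector_derivative_within_subset[OF u[of s n], of "{0..t+1}"] that
        by (auto simp: has_vector_derivative_def)
      show "\<forall>\<^sub>F n in sequentially. \<forall>s\<in>{0..t+1}. \<forall>h. norm (h *\<^sub>R Y n (u n s) - h *\<^sub>R W s) \<le> e * norm h"
        if "e > 0" for e
        using uniform_limitD[OF W[of "t+1"] that]
      proof eventually_elim
        case (elim n)
        have "norm (h *\<^sub>R Y n (u n s) - h *\<^sub>R W s) \<le> e * norm h" if "s \<in> {0..t+1}" for s h
        proof -
          have "norm (h *\<^sub>R Y n (u n s) - h *\<^sub>R W s) = \<bar>h\<bar> * norm (Y n (u n s) - W s)"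
            by (simp flip: scaleR_diff_right)
          also have "\<dots> \<le> \<bar>h\<bar> * e"
            using elim that by (intro mult_left_mono) (auto simp: dist_norm intro: less_imp_le)
          finally show ?thesis by (simp add: mult.commute)
        qed
        then show ?case by blast
      qed
      show "0 \<in> {0..t+1}" using t by simp
      show "(\<lambda>n. u n 0) \<longlonglongrightarrow> x" by (simp add: u0)
    qed
    then obtain g where g: "\<forall>s\<in>{0..t+1}. (\<lambda>n. u n s) \<longlonglongrightarrow> g s \<and>
        (g has_derivative (\<lambda>h. h *\<^sub>R W s)) (at s within {0..t+1})" by blast
    have "g s = U s" if "s \<in> {0..t+1}" for s
      using LIMSEQ_unique[of "\<lambda>n. u n s" "g s" "U s"] g Ut[of s] that by auto
    moreover have "(g has_vector_derivative W t) (at t within {0..t+1})"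
      using g t by (auto simp: has_vector_derivative_def)
    ultimately have "(U has_vector_derivative W t) (at t within {0..t+1})"
      by (intro has_vector_derivative_transform[where f = g and g = U]) (use t in auto)
    then show ?thesis using at_within_Ici_eq[of 0 t "t+1"] t by simp
  qed
  moreover have UD: "U t \<in> D" and AU: "A (U t) = W t" if t: "t \<ge> 0" for t
  proof -
    \<comment> \<open>\<open>u n t\<close> itself need not lie in \<open>D\<close>. Its image under
      \<open>lam n *\<^sub>R R (lam n)\<close> does, is mapped by \<open>A\<close> to
      \<open>Y n (u n t)\<close>, and differs from \<open>u n t\<close> by
      \<open>Y n (u n t) / lam n\<close>, which tends to 0.\<close>
    define z where "z n = lam n *\<^sub>R R (lam n) (u n t)" for n
    have z: "z n \<in> D" "A (z n) = Y n (u n t)" for n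
      by (simp_all add: z_def D_simps R_D A_scaleR Y_eq)
    have "(\<lambda>n. inverse (lam n) *\<^sub>R Y n (u n t)) \<longlonglongrightarrow> 0 *\<^sub>R W t"
      unfolding lam_def by (intro tendsto_scaleR Wt t LIMSEQ_inverse_real_of_nat)
    from tendsto_add[OF Ut[OF t] this]
    have "(\<lambda>n. u n t + inverse (lam n) *\<^sub>R Y n (u n t)) \<longlonglongrightarrow> U t" by simp
    moreover have "z = (\<lambda>n. u n t + inverse (lam n) *\<^sub>R Y n (u n t))"
    proof
      fix n
      have "lam n \<noteq> 0" using lam_pos[of n] by linarith
      then show "z n = u n t + inverse (lam n) *\<^sub>R Y n (u n t)" by (simp add: Y_def z_def)
    qed
    ultimately have zl: "z \<longlonglongrightarrow> U t" by simp
    show "U t \<in> D" "A (U t) = W t"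
      using A_closed[OF z(1) zl] Wt[OF t] by (simp_all add: z(2))
  qed
  moreover have "continuous_on {0..} (\<lambda>t. A (U t))"
  proof (rule continuous_on_Ici_if_Icc)
    fix b :: real
    have "continuous_on {0..b} W"
    proof (rule uniform_limit_theorem[OF _ W])
      have "continuous_on {0..b} (\<lambda>t. Y n (u n t))" for n
        by (rule continuous_on_vector_derivative[of _ _ "\<lambda>s. Y n (Y n (u n s))"])
          (auto intro!: has_vector_derivative_within_subset[OF Yu])
      then show "\<forall>\<^sub>F n in sequentially. continuous_on {0..b} (\<lambda>t. Y n (u n t))" by simp
    qed simp
    then show "continuous_on {0..b} (\<lambda>t. A (U t))"
      by (rule continuous_on_eq) (simp add: AU)
  qed
  moreover have "U 0 = x" by (simp add: U_def u0)
  ultimately show ?thesis by (intro exI[of _ U]) auto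
qed

text \<open>\<open>lam n *\<^sub>R R (lam n)\<close> maps \<open>D\<close> into the domain of the
  square of \<open>A\<close> and converges strongly to the identity.\<close>

lemma dense_orbit_data: "e > 0 \<Longrightarrow> \<exists>x\<in>D. A x \<in> D \<and> en (y - x) < e"
proof -
  assume e: "e > 0"
  obtain x where x: "x \<in> D" "en (y - x) < e / 2" using dense_approx[of "e/2" y] e by auto
  have "(\<lambda>n. en (lam n *\<^sub>R R (lam n) x - x)) \<longlonglongrightarrow> 0"
    by (rule tendsto_iff_en[THEN iffD1, OF lam_R_tendsto])
  then have "eventually (\<lambda>n. en (lam n *\<^sub>R R (lam n) x - x) < e / 2) sequentially"
    by (rule order_tendstoD) (use e in simp)
  then obtain n where n: "en (lam n *\<^sub>R R (lam n) x - x) < e / 2" by (auto simp: eventually_sequentially)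
  have "A (lam n *\<^sub>R R (lam n) x) = lam n *\<^sub>R R (lam n) (A x)"
    using R_A[OF lam_pos x(1), of n] by (simp add: A_scaleR R_D)
  then have "lam n *\<^sub>R R (lam n) x \<in> D" "A (lam n *\<^sub>R R (lam n) x) \<in> D" by (simp_all add: D_simps R_D)
  moreover have "en (y - lam n *\<^sub>R R (lam n) x) < e"
    using en_triangle_diff[of y "lam n *\<^sub>R R (lam n) x" x] x(2) n en_diff_commute[of x] by simp
  ultimately show ?thesis by blast
qed

end

section \<open>Uniform boundedness and quadratic forms\<close>

text \<open>The proof is the gliding hump of Sokal: among \<open>x + w\<close> and \<open>x - w\<close>, one has an image that is
  at least as long as the image of \<open>w\<close>.\<close>

lemma uniform_boundedness:
  fixes T :: "nat \<Rightarrow> 'a::banach \<Rightarrow> 'b::real_normed_vector"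
  assumes T: "\<And>n. bounded_linear (T n)" and bdd: "\<And>x. \<exists>K. \<forall>n. norm (T n x) \<le> K"
  shows "\<exists>M. \<forall>n x. norm (T n x) \<le> M * norm x"
proof (rule ccontr)
  assume neg: "\<nexists>M. \<forall>n x. norm (T n x) \<le> M * norm x"
  have "\<exists>n. onorm (T n) > M" for M
  proof (rule ccontr)
    assume "\<nexists>n. onorm (T n) > M"
    then have "norm (T n x) \<le> M * norm x" for n x
      using onorm[OF T, of n x] mult_right_mono[of "onorm (T n)" M "norm x"] by (force simp: not_less)
    with neg show False by blast
  qed
  then have "\<forall>k::nat. \<exists>n. onorm (T n) > 4^k" by blast
  \<comment> \<open>Operator norms above 4^k against steps of length 3^(-k): the image gained at
    step k is of order (4/3)^k.\<close>
  then obtain n where n: "\<And>k::nat. onorm (T (n k)) > 4^k" by metis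
  have "\<exists>y. norm (y - x) \<le> (1/3)^k \<and> norm (T (n k) y) \<ge> 2/3 * (1/3)^k * onorm (T (n k))" for x k
  proof -
    interpret S: bounded_linear "T (n k)" by (rule T)
    have pos: "onorm (T (n k)) > 0" using n[of k] by (rule less_trans[rotated]) simp
    have "\<exists>z. norm (T (n k) z) > 2/3 * onorm (T (n k)) * norm z"
    proof (rule ccontr)
      assume "\<nexists>z. norm (T (n k) z) > 2/3 * onorm (T (n k)) * norm z"
      then have "onorm (T (n k)) \<le> 2/3 * onorm (T (n k))"
        using pos by (intro onorm_bound) (auto simp: not_less)
      with pos show False by simp
    qed
    then obtain z where z: "norm (T (n k) z) > 2/3 * onorm (T (n k)) * norm z" by blast
    then have z0: "norm z > 0" by (cases "z = 0") (auto simp: S.zero)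
    define w where "w = ((1/3)^k / norm z) *\<^sub>R z"
    have nw: "norm w = (1/3)^k" using z0 by (simp add: w_def)
    have "norm (T (n k) w) = (1/3)^k / norm z * norm (T (n k) z)"
      using z0 by (simp add: w_def S.scaleR)
    also have "\<dots> \<ge> (1/3)^k / norm z * (2/3 * onorm (T (n k)) * norm z)"
      using z z0 by (intro mult_left_mono) auto
    finally have Tw: "norm (T (n k) w) \<ge> 2/3 * (1/3)^k * onorm (T (n k))" using z0 by (simp add: field_simps)
    have "T (n k) (x + w) - T (n k) (x - w) = 2 *\<^sub>R T (n k) w"
      by (simp add: S.add S.diff scaleR_2)
    then have "2 * norm (T (n k) w) \<le> norm (T (n k) (x + w)) + norm (T (n k) (x - w))"
      using norm_triangle_ineq4[of "T (n k) (x + w)" "T (n k) (x - w)"] by simp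
    then have "norm (T (n k) w) \<le> norm (T (n k) (x + w)) \<or> norm (T (n k) w) \<le> norm (T (n k) (x - w))"
      by linarith
    then show ?thesis
    proof
      assume "norm (T (n k) w) \<le> norm (T (n k) (x + w))"
      then show ?thesis using Tw nw by (intro exI[of _ "x + w"]) auto
    next
      assume "norm (T (n k) w) \<le> norm (T (n k) (x - w))"
      then show ?thesis using Tw nw by (intro exI[of _ "x - w"]) auto
    qed
  qed
  then obtain g where g: "\<And>x k. norm (g x k - x) \<le> (1/3)^k"
    "\<And>x k. norm (T (n k) (g x k)) \<ge> 2/3 * (1/3)^k * onorm (T (n k))" by metis
  define x where "x = rec_nat 0 (\<lambda>k y. g y k)"
  have xS: "x (Suc k) = g (x k) k" for k by (simp add: x_def)
  have d: "norm (x (Suc k + m) - x (Suc k)) \<le> 1/2 * (1/3)^k * (1 - (1/3)^m)" for k m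
  proof (induction m)
    case (Suc m)
    have "norm (x (Suc k + Suc m) - x (Suc k))
        \<le> norm (x (Suc (Suc k + m)) - x (Suc k + m)) + norm (x (Suc k + m) - x (Suc k))"
      using norm_triangle_ineq[of "x (Suc (Suc k + m)) - x (Suc k + m)" "x (Suc k + m) - x (Suc k)"] by simp
    also have "norm (x (Suc (Suc k + m)) - x (Suc k + m)) \<le> (1/3)^(Suc k + m)"
      unfolding xS[of "Suc k + m"] by (rule g)
    finally show ?case using Suc.IH by (simp add: power_add algebra_simps)
  qed simp
  have d': "norm (x j - x (Suc k)) \<le> 1/2 * (1/3)^k" if "j \<ge> Suc k" for j k
  proof -
    have "norm (x j - x (Suc k)) \<le> 1/2 * (1/3)^k * (1 - (1/3)^(j - Suc k))"
      using d[of k "j - Suc k"] that by simp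
    also have "\<dots> \<le> 1/2 * (1/3)^k * 1" by (intro mult_left_mono) auto
    finally show ?thesis by simp
  qed
  have "Cauchy x"
  proof (rule CauchyI)
    fix e :: real assume e: "e > 0"
    obtain k where k: "(1/3::real)^k < e" using real_arch_pow_inv[of e "1/3"] e by auto
    show "\<exists>M. \<forall>m\<ge>M. \<forall>j\<ge>M. norm (x m - x j) < e"
    proof (intro exI allI impI)
      fix m j assume mj: "m \<ge> Suc k" "j \<ge> Suc k"
      have "norm (x m - x j) \<le> norm (x m - x (Suc k)) + norm (x j - x (Suc k))"
        using norm_triangle_ineq4[of "x m - x (Suc k)" "x j - x (Suc k)"] by simp
      then show "norm (x m - x j) < e" using d'[OF mj(1)] d'[OF mj(2)] k by simp
    qed
  qed
  then obtain l where l: "x \<longlonglongrightarrow> l" by (auto simp: Cauchy_convergent_iff convergent_def)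
  have lk: "norm (l - x (Suc k)) \<le> 1/2 * (1/3)^k" for k
    by (rule Lim_bounded[OF tendsto_norm[OF tendsto_diff[OF l tendsto_const]]]) (use d' in auto)
  \<comment> \<open>Step k secures 2/3 of the product of (1/3)^k and the operator norm, and all
    later steps together move the point by at most half of (1/3)^k. The difference 2/3 - 1/2 = 1/6
    remains.\<close>
  have big: "norm (T (n k) l) \<ge> 1/6 * (4/3)^k" for k
  proof -
    interpret S: bounded_linear "T (n k)" by (rule T)
    have "norm (T (n k) (x (Suc k))) \<le> norm (T (n k) l) + norm (T (n k) (l - x (Suc k)))"
      using norm_triangle_ineq4[of "T (n k) l" "T (n k) (l - x (Suc k))"] by (simp add: S.diff)
    moreover have "norm (T (n k) (l - x (Suc k))) \<le> onorm (T (n k)) * (1/2 * (1/3)^k)"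
      using onorm[OF T, of "n k" "l - x (Suc k)"] mult_left_mono[OF lk onorm_pos_le[OF T]] by (rule order_trans)
    moreover have "norm (T (n k) (x (Suc k))) \<ge> 2/3 * (1/3)^k * onorm (T (n k))"
      unfolding xS by (rule g)
    ultimately have "norm (T (n k) l) \<ge> 1/6 * ((1/3)^k * onorm (T (n k)))" by (simp add: algebra_simps)
    moreover have "(1/3)^k * onorm (T (n k)) \<ge> (1/3)^k * 4^k"
      using n[of k] by (intro mult_left_mono) auto
    moreover have "(1/3)^k * 4^k = (4/3::real)^k" by (simp add: power_mult_distrib[symmetric])
    ultimately show ?thesis by linarith
  qed
  obtain K where K: "\<And>n. norm (T n l) \<le> K" using bdd[of l] by blast
  obtain k where "6 * K < (4/3::real)^k" using real_arch_pow[of "4/3" "6 * K"] by auto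
  then show False using big[of k] K[of "n k"] by simp
qed

text \<open>Subtracting the linear function leaves an additive h that vanishes on the integers. It
  is thus determined by fractional parts and bounded everywhere, which contradicts h(n r) = n h(r)
  unless h = 0.\<close>

lemma additive_bounded_linear_real:
  fixes g :: "real \<Rightarrow> real"
  assumes add: "\<And>r s. g (r + s) = g r + g s" and bdd: "\<And>r. \<bar>r\<bar> \<le> 1 \<Longrightarrow> \<bar>g r\<bar> \<le> K"
  shows "g r = r * g 1"
proof -
  define h where "h r = g r - r * g 1" for r
  have hadd: "h (r + s) = h r + h s" for r s by (simp add: h_def add algebra_simps)
  have h0: "h 0 = 0" using hadd[of 0 0] by simp
  have hm: "h (- r) = - h r" for r using hadd[of r "- r"] h0 by simp
  have hn: "h (real n * r) = real n * h r" for n r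
    by (induction n) (simp_all add: h0 hadd algebra_simps)
  have h1: "h 1 = 0" by (simp add: h_def)
  have hi: "h (of_int i) = 0" for i
    by (cases i rule: int_cases2) (use hn[of _ 1] h1 hm in auto)
  have bd: "\<bar>h r\<bar> \<le> K + \<bar>g 1\<bar>" for r
  proof -
    have "h r = h (frac r)" using hadd[of "frac r" "of_int \<lfloor>r\<rfloor>"] hi by (simp add: frac_def)
    moreover have f: "\<bar>frac r\<bar> \<le> 1" using frac_lt_1[of r] by simp
    have "\<bar>h (frac r)\<bar> \<le> \<bar>g (frac r)\<bar> + \<bar>frac r\<bar> * \<bar>g 1\<bar>"
      unfolding h_def abs_mult[symmetric] by (rule abs_triangle_ineq4)
    moreover have "\<bar>frac r\<bar> * \<bar>g 1\<bar> \<le> 1 * \<bar>g 1\<bar>" by (rule mult_right_mono[OF f]) simp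
    ultimately show ?thesis using bdd[OF f] by simp
  qed
  have "h r = 0"
  proof (rule ccontr)
    assume "h r \<noteq> 0"
    then obtain n :: nat where "real n * \<bar>h r\<bar> > K + \<bar>g 1\<bar>"
      using ex_less_of_nat_mult[of "\<bar>h r\<bar>" "K + \<bar>g 1\<bar>"] by auto
    then show False using bd[of "real n * r"] by (simp add: hn abs_mult)
  qed
  then show ?thesis by (simp add: h_def)
qed

text \<open>Polarization. The parallelogram law yields additivity alone; homogeneity over the reals
  comes from boundedness of \<open>V\<close>, through additive functions bounded on [-1, 1].\<close>

lemma jordan_von_neumann:
  fixes V :: "'a::real_normed_vector \<Rightarrow> real"
  assumes par: "\<And>x y. V (x + y) + V (x - y) = 2 * V x + 2 * V y"
    and nn: "\<And>x. 0 \<le> V x" and le: "\<And>x. V x \<le> C * (norm x)\<^sup>2"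
  shows "\<exists>B. bounded_bilinear B \<and> (\<forall>x y. B x y = B y x) \<and> (\<forall>x. B x x = V x)"
proof -
  define B where "B x y = (V (x + y) - V (x - y)) / 4" for x y
  have V0: "V 0 = 0" using par[of 0 0] by simp
  have Vm: "V (- x) = V x" for x using par[of 0 x] V0 by simp
  have sym: "B x y = B y x" for x y using Vm[of "x - y"] by (simp add: B_def add.commute)
  have B0: "B 0 y = 0" for y by (simp add: B_def Vm)
  have half: "B x z + B y z = B (x + y) (2 *\<^sub>R z) / 2" for x y z
  proof -
    have e: "x + z + (y + z) = x + y + 2 *\<^sub>R z" "x + z - (y + z) = x - y"
      "x - z + (y - z) = x + y - 2 *\<^sub>R z" "x - z - (y - z) = x - y"
      by (simp_all add: scaleR_2 algebra_simps)
    have "V (x + y + 2 *\<^sub>R z) - V (x + y - 2 *\<^sub>R z) = 2 * V (x + z) + 2 * V (y + z) - 2 * V (x - z) - 2 * V (y - z)"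
      using par[of "x + z" "y + z"] par[of "x - z" "y - z"] unfolding e by simp
    then show ?thesis unfolding B_def by (simp add: field_simps)
  qed
  \<comment> \<open>The instance of \<open>half\<close> with second vector 0 rewrites its right-hand
    side for x + y as \<open>B (x + y) z\<close>, which removes the doubled argument.\<close>
  have add: "B (x + y) z = B x z + B y z" for x y z
    using half[of x z y] half[of "x + y" z 0] B0 by simp
  have diag: "B x x = V x" for x
    using par[of x x] V0 by (simp add: B_def)
  have C: "0 \<le> C * (norm x)\<^sup>2" for x :: 'a using nn[of x] le[of x] by linarith
  have bd: "\<bar>B x y\<bar> \<le> C * (norm x + norm y)\<^sup>2 / 4" for x y
  proof -
    \<comment> \<open>The sign of \<open>C\<close> is only known through a nonzero vector, which
      forces the case distinction.\<close>
    have *: "V w \<le> C * (norm x + norm y)\<^sup>2" if w: "norm w \<le> norm x + norm y" for w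
    proof (cases "w = 0")
      case True
      show ?thesis
      proof (cases "norm x + norm y = 0")
        case False
        have "0 \<le> C"
          using C[of x] C[of y] False by (auto simp: zero_le_mult_iff)
        then show ?thesis using True V0 by simp
      qed (use True V0 in simp)
    next
      case False
      then have "0 \<le> C" using C[of w] by (simp add: zero_le_mult_iff)
      then have "C * (norm w)\<^sup>2 \<le> C * (norm x + norm y)\<^sup>2"
        using w by (intro mult_left_mono power_mono) auto
      then show ?thesis using le[of w] by simp
    qed
    have "V (x + y) \<le> C * (norm x + norm y)\<^sup>2" "V (x - y) \<le> C * (norm x + norm y)\<^sup>2"
      by (rule *, rule norm_triangle_ineq) (rule *, rule norm_triangle_ineq4)
    then show ?thesis using nn[of "x + y"] nn[of "x - y"] by (simp add: B_def abs_le_iff)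
  qed
  have scale: "B (r *\<^sub>R x) y = r * B x y" for r x y
  proof -
    have "B (r *\<^sub>R x) y = r * B (1 *\<^sub>R x) y"
    proof (rule additive_bounded_linear_real[of "\<lambda>r. B (r *\<^sub>R x) y" "\<bar>C\<bar> * (norm x + norm y)\<^sup>2 / 4"])
      show "B ((r + s) *\<^sub>R x) y = B (r *\<^sub>R x) y + B (s *\<^sub>R x) y" for r s
        by (simp add: scaleR_left_distrib add)
      fix r :: real assume r: "\<bar>r\<bar> \<le> 1"
      have "C * (norm (r *\<^sub>R x) + norm y)\<^sup>2 \<le> \<bar>C\<bar> * (norm x + norm y)\<^sup>2"
        using mult_right_mono[OF r norm_ge_zero[of x]] by (intro mult_mono power_mono) auto
      then show "\<bar>B (r *\<^sub>R x) y\<bar> \<le> \<bar>C\<bar> * (norm x + norm y)\<^sup>2 / 4" using bd[of "r *\<^sub>R x" y] by simp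
    qed
    then show ?thesis by simp
  qed
  have "bounded_bilinear B"
  proof
    fix x y z :: 'a and r :: real
    show "B (x + y) z = B x z + B y z" by (rule add)
    show "B x (y + z) = B x y + B x z" using add[of y z x] by (simp add: sym[of x])
    show "B (r *\<^sub>R x) y = r *\<^sub>R B x y" by (simp add: scale)
    show "B x (r *\<^sub>R y) = r *\<^sub>R B x y" using scale[of r y x] by (simp add: sym[of x])
    show "\<exists>K. \<forall>x y. norm (B x y) \<le> norm x * norm y * K"
    proof (intro exI allI)
      fix x y :: 'a
      show "norm (B x y) \<le> norm x * norm y * C"
      proof (cases "x = 0 \<or> y = 0")
        case True
        then show ?thesis using B0 sym[of x 0] by auto
      next
        case False
        \<comment> \<open>For unit vectors the bound \<open>bd\<close> reads C (1 + 1)^2 / 4 = C;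
          homogeneity then gives a bound with constant \<open>C\<close> in general.\<close>
        define a b where "a = x /\<^sub>R norm x" and "b = y /\<^sub>R norm y"
        have "norm a = 1" "norm b = 1" using False by (auto simp: a_def b_def)
        then have "\<bar>B a b\<bar> \<le> C" using bd[of a b] by simp
        moreover have "B x y = norm x * norm y * B a b"
        proof -
          have "x = norm x *\<^sub>R a" "y = norm y *\<^sub>R b" using False by (auto simp: a_def b_def)
          then have "B x y = B (norm x *\<^sub>R a) (norm y *\<^sub>R b)" by simp
          also have "\<dots> = norm x * (norm y * B a b)"
            by (simp only: scale sym[of a "norm y *\<^sub>R b"] sym[of b a])
          finally show ?thesis by simp
        qed
        ultimately show ?thesis by (simp add: abs_mult mult_left_mono)
      qed
    qed
  qed
  then show ?thesis using sym diag by blast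
qed

text \<open>Makes an operator out of a value function: the polarized form is represented by a vector
  for each second argument, and nondegeneracy of \<open>ip\<close> makes the choice of that vector
  linear.\<close>

lemma (in energy) quadratic_form_operator:
  assumes par: "\<And>x y. V (x + y) + V (x - y) = 2 * V x + 2 * V y"
    and nn: "\<And>x. 0 \<le> V x" and le: "\<And>x. V x \<le> ip x x"
  shows "\<exists>P. bounded_linear P \<and> (\<forall>x y. ip x (P y) = ip (P x) y) \<and> (\<forall>x. ip x (P x) = V x)"
proof -
  obtain K where K: "\<And>x y. norm (ip x y) \<le> norm x * norm y * K"
    using bounded_bilinear.bounded[OF bil] by blast
  have "V x \<le> K * (norm x)\<^sup>2" for x
    using le[of x] K[of x x] by (simp add: power2_eq_square mult.commute)
  then obtain B where B: "bounded_bilinear B" "\<And>x y. B x y = B y x" "\<And>x. B x x = V x"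
    using jordan_von_neumann[OF par nn, of K] by blast
  have "\<exists>p. \<forall>x. B x y = ip x p" for y
    by (rule riesz[OF bounded_bilinear.bounded_linear_left[OF B(1)]])
  then obtain P where P: "\<And>x y. B x y = ip x (P y)" by metis
  have uniq: "a = b" if "\<And>x. ip x a = ip x b" for a b
    using that[of "a - b"] ip_eq_0_iff[of "a - b"] by (simp add: ip_simps del: ip_eq_0_iff)
  obtain c where c: "c > 0" "\<And>x. c * (norm x)\<^sup>2 \<le> ip x x" using coercive by blast
  obtain L where L0: "0 \<le> L" and L: "\<And>x y. norm (B x y) \<le> norm x * norm y * L"
    using bounded_bilinear.nonneg_bounded[OF B(1)] by blast
  have "bounded_linear P"
  proof (rule bounded_linear_intro[of _ "L / c"])
    show "P (x + y) = P x + P y" for x y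
      by (rule uniq) (simp add: P[symmetric] ip_simps bounded_bilinear.add_right[OF B(1)])
    show "P (r *\<^sub>R x) = r *\<^sub>R P x" for r x
      by (rule uniq) (simp add: P[symmetric] ip_simps bounded_bilinear.scaleR_right[OF B(1)])
    fix y
    show "norm (P y) \<le> norm y * (L / c)"
    proof (cases "P y = 0")
      case False
      have "norm (P y) * (c * norm (P y)) \<le> norm (P y) * (norm y * L)"
        using c(2)[of "P y"] L[of "P y" y] P[of "P y" y] by (simp add: power2_eq_square mult_ac)
      then have "c * norm (P y) \<le> norm y * L" using False by simp
      then show ?thesis using c(1) by (simp add: pos_le_divide_eq mult.commute)
    next
      case True
      then show ?thesis using L0 c(1) by simp
    qed
  qed
  moreover have "ip x (P y) = ip (P x) y" for x y
    using P[of x y] P[of y x] B(2)[of x y] sym[of y "P x"] by simp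
  moreover have "ip x (P x) = V x" for x using P[of x x] B(3)[of x] by simp
  ultimately show ?thesis by blast
qed

section \<open>Complex vectors and matrices\<close>

lemma Re_cinner: "Re (cinner v w) = v \<bullet> w"
  by (simp add: cinner_def inner_vec_def inner_complex_def Re_sum)

lemma cinner_add_left: "cinner (u + v) w = cinner u w + cinner v w"
  by (simp add: cinner_def sum.distrib algebra_simps)

lemma cinner_add_right: "cinner w (u + v) = cinner w u + cinner w v"
  by (simp add: cinner_def sum.distrib algebra_simps)

lemma cinner_scale_left: "cinner (c *s v) w = c * cinner v w"
  by (simp add: cinner_def sum_distrib_left mult.assoc)

lemma cinner_scale_right: "cinner w (c *s v) = cnj c * cinner w v"
  by (simp add: cinner_def sum_distrib_left mult.left_commute)

lemma cnj_cinner: "cnj (cinner v w) = cinner w v"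
  by (simp add: cinner_def mult.commute)

lemma cinner_cadjoint: "cinner (A *v v) w = cinner v (cadjoint A *v w)"
proof -
  have "cinner (A *v v) w = (\<Sum>i\<in>UNIV. \<Sum>j\<in>UNIV. A $ i $ j * v $ j * cnj (w $ i))"
    by (simp add: cinner_def matrix_vector_mult_def sum_distrib_right)
  also have "\<dots> = (\<Sum>j\<in>UNIV. \<Sum>i\<in>UNIV. A $ i $ j * v $ j * cnj (w $ i))"
    by (rule sum.swap)
  also have "\<dots> = cinner v (cadjoint A *v w)"
    by (simp add: cinner_def matrix_vector_mult_def cadjoint_def sum_distrib_left mult_ac)
  finally show ?thesis .
qed

lemma inner_selfadjoint: "cadjoint A = A \<Longrightarrow> (A *v v) \<bullet> w = v \<bullet> (A *v w)"
  using cinner_cadjoint[of A v w] by (simp flip: Re_cinner)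

lemma of_real_scale: "complex_of_real r *s v = r *\<^sub>R v" for v :: "complex^'n"
  unfolding vec_eq_iff vector_smult_component vector_scaleR_component by (simp add: scaleR_conv_of_real)

lemma bounded_bilinear_mv: "bounded_bilinear (\<lambda>(A::complex^'n^'m) x. A *v x)"
  unfolding bilinear_conv_bounded_bilinear[symmetric] bilinear_def
  by (auto intro!: linearI simp: vec_eq_iff matrix_vector_mult_def algebra_simps sum.distrib scaleR_sum_right)

lemma bounded_bilinear_mm: "bounded_bilinear (\<lambda>(A::complex^'n^'m) (B::complex^'k^'n). A ** B)"
  unfolding bilinear_conv_bounded_bilinear[symmetric] bilinear_def
  by (auto intro!: linearI simp: vec_eq_iff matrix_matrix_mult_def algebra_simps sum.distrib scaleR_sum_right)

lemma bounded_linear_mv: "bounded_linear ((*v) (A::complex^'n^'m))"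
  by (rule bounded_bilinear.bounded_linear_right[OF bounded_bilinear_mv])

lemma bounded_linear_scale: "bounded_linear ((*s) c :: complex^'n \<Rightarrow> _)"
proof -
  have "(*s) c = (*v) ((\<chi> i j. if i = j then c else 0) :: complex^'n^'n)"
    by (rule ext) (simp add: vec_eq_iff matrix_vector_mult_def mat_def if_distrib[of "\<lambda>x. x * _"] cong: if_cong)
  then show ?thesis by (simp add: bounded_linear_mv)
qed

lemma mv_scale: "A *v (c *s v) = c *s (A *v v)" for A :: "complex^'n^'m"
  by (simp add: vector_scalar_commute)

lemma matrix_inv_mm: "invertible A \<Longrightarrow> A ** matrix_inv A = mat 1 \<and> matrix_inv A ** A = mat 1"
  unfolding matrix_inv_def invertible_def by (rule someI_ex)

lemma matrix_inv_component:
  fixes A :: "complex^'n^'n"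
  assumes A: "invertible A"
  shows "matrix_inv A $ i $ j = det (\<chi> p q. if q = i then axis j 1 $ p else A $ p $ q) / det A"
proof -
  have "A *v (matrix_inv A *v axis j 1) = axis j 1"
    by (simp add: matrix_vector_mul_assoc matrix_inv_mm[OF A])
  then have "matrix_inv A *v axis j 1 = (\<chi> k. det (\<chi> p q. if q = k then axis j 1 $ p else A $ p $ q) / det A)"
    using A by (subst (asm) cramer) (simp_all add: invertible_det_nz)
  moreover have "(matrix_inv A *v axis j 1) $ i = matrix_inv A $ i $ j"
    by (simp add: matrix_vector_mult_def axis_def if_distrib[of "\<lambda>x. _ * x"] cong: if_cong)
  ultimately show ?thesis by simp
qed

text \<open>By Cramer's rule the entries of the inverse are quotients of determinants, which are
  polynomials in the entries.\<close>

lemma continuous_on_matrix_inv: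
  fixes S :: "real \<Rightarrow> complex^'n^'n"
  assumes S: "continuous_on I S" and inv: "\<And>t. t \<in> I \<Longrightarrow> invertible (S t)"
  shows "continuous_on I (\<lambda>t. matrix_inv (S t))"
proof -
  have c: "continuous_on I (\<lambda>t. S t $ p $ q)" for p q
    by (intro continuous_intros S)
  have d: "continuous_on I (\<lambda>t. det (M t))" if "\<And>p q. continuous_on I (\<lambda>t. M t $ p $ q)"
    for M :: "real \<Rightarrow> complex^'n^'n"
    unfolding det_def by (intro continuous_on_sum continuous_on_mult continuous_on_const continuous_on_prod that)
  have *: "continuous_on I (\<lambda>t. det (\<chi> p q. if q = i then axis j 1 $ p else S t $ p $ q) / det (S t))" for i j
  proof (intro continuous_on_divide d)
    show "continuous_on I (\<lambda>t. (\<chi> p q. if q = i then axis j 1 $ p else S t $ p $ q) $ p $ q)" for p q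
      by (cases "q = i") (simp_all add: c continuous_on_const)
  qed (use inv c in \<open>auto simp: invertible_det_nz\<close>)
  have "continuous_on I (\<lambda>t. matrix_inv (S t) $ i $ j)" for i j
    by (rule continuous_on_eq[OF *[of i j]]) (simp add: matrix_inv_component inv)
  then have "continuous_on I (\<lambda>t. \<chi> i j. matrix_inv (S t) $ i $ j)"
    by (intro continuous_on_vec_lambda)
  then show ?thesis by simp
qed

lemma mv_matrix_inv: "invertible A \<Longrightarrow> A *v (matrix_inv A *v v) = v"
  and matrix_inv_mv: "invertible A \<Longrightarrow> matrix_inv A *v (A *v v) = v" for A :: "complex^'n^'n"
  by (simp_all add: matrix_vector_mul_assoc matrix_inv_mm)

lemma invertible_diagonal:
  fixes d :: "'n::finite \<Rightarrow> complex"
  assumes "\<And>i. d i \<noteq> 0"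
  shows "invertible (\<chi> i j. if i = j then d i else 0)"
  unfolding invertible_right_inverse
  using assms
  by (intro exI[of _ "\<chi> i j. if i = j then 1 / d i else 0"])
    (auto simp: vec_eq_iff matrix_matrix_mult_def mat_def if_distrib[of "\<lambda>x. x * _"] if_distrib[of "\<lambda>x. _ * x"] cong: if_cong)

section \<open>Indefinite integrals\<close>

text \<open>All integrals over subintervals vanish. The Henstock lemma bounds the sum of the
  deviations between Riemann terms and these integrals, and here that sum is the Riemann sum of
  \<open>norm (f t)\<close>. So the integral of the norm is 0.\<close>

lemma AE_zero_if_indefinite_integral_zero:
  fixes f :: "real \<Rightarrow> 'e::euclidean_space"
  assumes f: "integrable (lebesgue_on {a..b}) f"
    and zero: "\<And>t. t \<in> {a..b} \<Longrightarrow> integral\<^sup>L (lebesgue_on {a..t}) f = 0"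
  shows "AE t in lebesgue_on {a..b}. f t = 0"
proof -
  have fi: "f integrable_on cbox a b"
    using integrable_on_lebesgue_on[OF f] by simp
  have z: "integral {a..t} f = 0" if "t \<in> {a..b}" for t
  proof -
    have "integrable (lebesgue_on {a..t}) f"
      using f that by (intro integrable_subinterval[OF f]) auto
    then show ?thesis using zero[OF that] by (simp add: lebesgue_integral_eq_integral)
  qed
  have zi: "integral {c..d} f = 0" if "a \<le> c" "c \<le> d" "d \<le> b" for c d
  proof -
    have "f integrable_on {a..d}"
      using fi that by (intro integrable_on_subinterval[of f "cbox a b"]) auto
    then have "integral {a..c} f + integral {c..d} f = integral {a..d} f"
      by (intro Henstock_Kurzweil_Integration.integral_combine that)
    then show ?thesis using z[of c] z[of d] that by simp
  qed
  have "((\<lambda>t. norm (f t)) has_integral 0) (cbox a b)"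
    unfolding has_integral
  proof (intro allI impI)
    fix e :: real assume e: "e > 0"
    obtain \<gamma> where \<gamma>: "gauge \<gamma>" "\<And>p. \<lbrakk>p tagged_partial_division_of (cbox a b); \<gamma> fine p\<rbrakk> \<Longrightarrow>
        sum (\<lambda>(x,k). norm(measure lborel k *\<^sub>R f x - integral k f)) p < e"
      using Henstock_lemma[OF fi e] by blast
    show "\<exists>\<gamma>. gauge \<gamma> \<and> (\<forall>p. p tagged_division_of cbox a b \<and> \<gamma> fine p \<longrightarrow>
        norm ((\<Sum>(x, k)\<in>p. measure lborel k *\<^sub>R norm (f x)) - 0) < e)"
    proof (rule exI[of _ \<gamma>], intro conjI allI impI, rule \<gamma>(1))
      fix p assume p: "p tagged_division_of cbox a b \<and> \<gamma> fine p"
      have "norm ((\<Sum>(x, k)\<in>p. measure lborel k *\<^sub>R norm (f x)) - 0) = \<bar>\<Sum>(x, k)\<in>p. measure lborel k *\<^sub>R norm (f x)\<bar>"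
        by simp
      also have "\<dots> = (\<Sum>(x, k)\<in>p. measure lborel k *\<^sub>R norm (f x))"
        by (intro abs_of_nonneg sum_nonneg) auto
      also have "\<dots> = (\<Sum>(x, k)\<in>p. norm (measure lborel k *\<^sub>R f x - integral k f))"
      proof (rule sum.cong[OF refl], clarify)
        fix x k assume xk: "(x, k) \<in> p"
        obtain c d where k: "k = cbox c d" using p xk by (meson tagged_division_ofD(4))
        have "k \<subseteq> cbox a b" "x \<in> k" using p xk by (meson tagged_division_ofD(2,3))+
        then have "integral k f = 0" using zi[of c d] unfolding k by auto
        then show "measure lborel k *\<^sub>R norm (f x) = norm (measure lborel k *\<^sub>R f x - integral k f)" by simp
      qed
      also have "\<dots> < e"
        using p by (intro \<gamma>(2)) (auto simp: tagged_division_of_def)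
      finally show "norm ((\<Sum>(x, k)\<in>p. measure lborel k *\<^sub>R norm (f x)) - 0) < e" .
    qed
  qed
  then have "integral {a..b} (\<lambda>t. norm (f t)) = 0" by (simp add: integral_unique)
  then have "integral\<^sup>L (lebesgue_on {a..b}) (\<lambda>t. norm (f t)) = 0"
    using f by (simp add: lebesgue_integral_eq_integral)
  then show ?thesis
    using f by (subst (asm) integral_nonneg_eq_0_iff_AE) auto
qed

lemma finite_measure_lebesgue_on_Icc: "finite_measure (lebesgue_on {a..b::real})"
  by (rule finite_measureI) (simp add: emeasure_restrict_space emeasure_lborel_Icc_eq)

lemma L2_Icc_integrable:
  fixes f :: "real \<Rightarrow> 'e::euclidean_space"
  assumes "f \<in> L2 {a..b}"
  shows "integrable (lebesgue_on {a..b}) f"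
proof (rule Bochner_Integration.integrable_bound)
  interpret finite_measure "lebesgue_on {a..b}" by (rule finite_measure_lebesgue_on_Icc)
  show "integrable (lebesgue_on {a..b}) (\<lambda>t. 1 + (norm (f t))\<^sup>2)"
    using L2_integrable[OF assms] by simp
  show "AE t in lebesgue_on {a..b}. norm (f t) \<le> norm (1 + (norm (f t))\<^sup>2)"
  proof (intro AE_I2)
    fix t
    have "2 * norm (f t) \<le> 1 + (norm (f t))\<^sup>2"
      using sum_squares_bound[of 1 "norm (f t)"] by simp
    then have "norm (f t) \<le> 1 + (norm (f t))\<^sup>2" using norm_ge_zero[of "f t"] by linarith
    then show "norm (f t) \<le> norm (1 + (norm (f t))\<^sup>2)" by simp
  qed
qed (rule L2_measurable[OF assms])

lemma continuous_imp_L2: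
  fixes f :: "real \<Rightarrow> 'e::euclidean_space"
  assumes f: "continuous_on {a..b} f"
  shows "f \<in> L2 {a..b}"
proof -
  have "f \<in> borel_measurable (lebesgue_on {a..b})"
    using f by (intro continuous_imp_measurable_on_sets_lebesgue) auto
  moreover have "integrable (lebesgue_on {a..b}) (\<lambda>t. (norm (f t))\<^sup>2)"
    by (intro continuous_imp_integrable_real continuous_intros f)
  ultimately show ?thesis by (simp add: L2_def)
qed

text \<open>Integration by parts for absolutely continuous functions: by symmetry, the integral of
  \<open>B (f s) (f t)\<close> over the square is twice the integral over a triangle.\<close>

lemma bilinear_integral_square:
  fixes f :: "real \<Rightarrow> 'e::euclidean_space" and B :: "'e \<Rightarrow> 'e \<Rightarrow> real"
  assumes f: "f \<in> L2 {a..b}" and B: "bounded_bilinear B" and sym: "\<And>x y. B x y = B y x"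
  shows "B (integral\<^sup>L (lebesgue_on {a..b}) f) (integral\<^sup>L (lebesgue_on {a..b}) f)
      = 2 * (LINT t|lebesgue_on {a..b}. B (f t) (integral\<^sup>L (lebesgue_on {a..t}) f))"
proof -
  let ?M = "lebesgue_on {a..b}"
  interpret M: finite_measure ?M by (rule finite_measure_lebesgue_on_Icc)
  interpret pair_sigma_finite ?M ?M ..
  note fi = L2_Icc_integrable[OF f]
  have fm[measurable]: "f \<in> borel_measurable ?M" using f by (simp add: L2_def)
  obtain K where K: "K > 0" "\<And>x y. norm (B x y) \<le> norm x * norm y * K"
    using bounded_bilinear.pos_bounded[OF B] by blast
  have id[measurable]: "(\<lambda>x. x) \<in> measurable ?M borel"
    by (rule measurable_restrict_space1, rule measurable_completion) simp
  have Bm: "(\<lambda>p. B (f (fst p)) (f (snd p))) \<in> borel_measurable (?M \<Otimes>\<^sub>M ?M)"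
    by (rule borel_measurable_bilinear[OF B]) measurable
  have Bi: "integrable (?M \<Otimes>\<^sub>M ?M) (\<lambda>(s, t). B (f s) (f t))"
  proof (rule Fubini_integrable)
    show "(\<lambda>(s, t). B (f s) (f t)) \<in> borel_measurable (?M \<Otimes>\<^sub>M ?M)"
      using Bm by (simp add: case_prod_beta)
    have "integrable ?M (\<lambda>t. B (f s) (f t))" for s
      by (rule integrable_bounded_linear[OF bounded_bilinear.bounded_linear_right[OF B] fi])
    then show "AE s in ?M. integrable ?M (\<lambda>t. case (s, t) of (s, t) \<Rightarrow> B (f s) (f t))" by simp
    show "integrable ?M (\<lambda>s. LINT t|?M. norm (case (s, t) of (s, t) \<Rightarrow> B (f s) (f t)))"
    proof (rule Bochner_Integration.integrable_bound)
      show "integrable ?M (\<lambda>s. norm (f s) * ((LINT t|?M. norm (f t)) * K))"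
        using fi by simp
      show "(\<lambda>s. LINT t|?M. norm (case (s, t) of (s, t) \<Rightarrow> B (f s) (f t))) \<in> borel_measurable ?M"
        using Bm by (intro M.borel_measurable_lebesgue_integral) (simp add: case_prod_beta)
      show "AE s in ?M. norm (LINT t|?M. norm (case (s, t) of (s, t) \<Rightarrow> B (f s) (f t)))
          \<le> norm (norm (f s) * ((LINT t|?M. norm (f t)) * K))"
      proof (intro AE_I2)
        fix s
        have "(LINT t|?M. norm (B (f s) (f t))) \<le> (LINT t|?M. norm (f s) * K * norm (f t))"
        proof (rule integral_mono)
          show "integrable ?M (\<lambda>t. norm (B (f s) (f t)))"
            by (intro integrable_norm integrable_bounded_linear[OF bounded_bilinear.bounded_linear_right[OF B] fi])
          show "integrable ?M (\<lambda>t. norm (f s) * K * norm (f t))" using fi by simp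
          show "norm (B (f s) (f t)) \<le> norm (f s) * K * norm (f t)" for t
            using K(2)[of "f s" "f t"] by (simp add: mult_ac)
        qed
        then show "norm (LINT t|?M. norm (case (s, t) of (s, t) \<Rightarrow> B (f s) (f t)))
          \<le> norm (norm (f s) * ((LINT t|?M. norm (f t)) * K))"
          using K(1) by (simp add: abs_mult mult_ac)
      qed
    qed
  qed
  have le_sets: "{p \<in> space (?M \<Otimes>\<^sub>M ?M). fst p \<le> snd p} \<in> sets (?M \<Otimes>\<^sub>M ?M)" by measurable
  \<comment> \<open>The diagonal is assigned to \<open>T\<close>. Integrating \<open>T\<close> over
    its first variable first, and \<open>T'\<close> over its second, gives the same iterated
    integral by symmetry of \<open>B\<close>.\<close>
  define T where "T s t = indicat_real {p. fst p \<le> snd p} (s, t) * B (f s) (f t)" for s t :: real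
  define T' where "T' s t = indicat_real {p. snd p < fst p} (s, t) * B (f s) (f t)" for s t :: real
  have Ti: "integrable (?M \<Otimes>\<^sub>M ?M) (\<lambda>(s, t). T s t)" "integrable (?M \<Otimes>\<^sub>M ?M) (\<lambda>(s, t). T' s t)"
  proof -
    have "(\<lambda>p. indicat_real {p. fst p \<le> snd p} p) \<in> borel_measurable (?M \<Otimes>\<^sub>M ?M)"
      "(\<lambda>p. indicat_real {p. snd p < fst p} p) \<in> borel_measurable (?M \<Otimes>\<^sub>M ?M)"
      unfolding indicator_def mem_Collect_eq of_bool_def by measurable
    then have m: "(\<lambda>(s, t). T s t) \<in> borel_measurable (?M \<Otimes>\<^sub>M ?M)" "(\<lambda>(s, t). T' s t) \<in> borel_measurable (?M \<Otimes>\<^sub>M ?M)"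
      using Bm by (simp_all add: T_def T'_def case_prod_beta)
    show "integrable (?M \<Otimes>\<^sub>M ?M) (\<lambda>(s, t). T s t)" "integrable (?M \<Otimes>\<^sub>M ?M) (\<lambda>(s, t). T' s t)"
      by (rule Bochner_Integration.integrable_bound[OF Bi m(1)], simp add: T_def case_prod_beta indicator_def)
        (rule Bochner_Integration.integrable_bound[OF Bi m(2)], simp add: T'_def case_prod_beta indicator_def)
  qed
  have sub: "integral\<^sup>L ?M (\<lambda>s. indicat_real {..t} s *\<^sub>R f s) = integral\<^sup>L (lebesgue_on {a..t}) f" if "t \<in> {a..b}" for t
  proof -
    have "integral\<^sup>L ?M (\<lambda>s. indicat_real {..t} s *\<^sub>R f s)
        = integral\<^sup>L lebesgue (\<lambda>s. indicator {a..b} s *\<^sub>R indicat_real {..t} s *\<^sub>R f s)"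
      by (simp add: integral_restrict_space)
    also have "\<dots> = integral\<^sup>L lebesgue (\<lambda>s. indicator {a..t} s *\<^sub>R f s)"
      using that by (intro Bochner_Integration.integral_cong) (auto simp: indicator_def)
    finally show ?thesis by (simp add: integral_restrict_space)
  qed
  \<comment> \<open>The strict inequality in \<open>T'\<close> loses one point, which is a null
    set.\<close>
  have sub': "integral\<^sup>L ?M (\<lambda>s. indicat_real {..<t} s *\<^sub>R f s) = integral\<^sup>L (lebesgue_on {a..t}) f" if "t \<in> {a..b}" for t
  proof -
    have "AE s in lebesgue_on {a..b}. s \<noteq> t"
      unfolding AE_lebesgue_on_iff[of "{a..b}", simplified]
      by (rule eventually_mono[OF AE_not_in[of "{t}" lebesgue]]) auto
    then have "integral\<^sup>L ?M (\<lambda>s. indicat_real {..<t} s *\<^sub>R f s) = integral\<^sup>L ?M (\<lambda>s. indicat_real {..t} s *\<^sub>R f s)"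
      using fm by (intro integral_cong_AE) (auto elim!: eventually_mono simp: indicator_def less_le)
    then show ?thesis using sub[OF that] by simp
  qed
  have I1: "(LINT t|?M. LINT s|?M. T s t) = (LINT t|?M. B (f t) (integral\<^sup>L (lebesgue_on {a..t}) f))"
  proof (rule Bochner_Integration.integral_cong[OF refl])
    fix t assume "t \<in> space ?M"
    then have t: "t \<in> {a..b}" by simp
    have i: "integrable ?M (\<lambda>s. indicat_real {..t} s *\<^sub>R f s)"
      by (rule Bochner_Integration.integrable_bound[OF fi]) (auto simp: indicator_def)
    have "(LINT s|?M. T s t) = (LINT s|?M. B (f t) (indicat_real {..t} s *\<^sub>R f s))"
      by (intro Bochner_Integration.integral_cong)
        (auto simp: T_def indicator_def sym[of _ "f t"] bounded_bilinear.zero_right[OF B])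
    also have "\<dots> = B (f t) (LINT s|?M. indicat_real {..t} s *\<^sub>R f s)"
      by (rule integral_bounded_linear[OF bounded_bilinear.bounded_linear_right[OF B] i])
    finally show "(LINT s|?M. T s t) = B (f t) (integral\<^sup>L (lebesgue_on {a..t}) f)" using sub[OF t] by simp
  qed
  have I2: "(LINT s|?M. LINT t|?M. T' s t) = (LINT t|?M. B (f t) (integral\<^sup>L (lebesgue_on {a..t}) f))"
  proof (rule Bochner_Integration.integral_cong[OF refl])
    fix s assume "s \<in> space ?M"
    then have s: "s \<in> {a..b}" by simp
    have i: "integrable ?M (\<lambda>t. indicat_real {..<s} t *\<^sub>R f t)"
      by (rule Bochner_Integration.integrable_bound[OF fi]) (auto simp: indicator_def)
    have "(LINT t|?M. T' s t) = (LINT t|?M. B (f s) (indicat_real {..<s} t *\<^sub>R f t))"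
      by (intro Bochner_Integration.integral_cong)
        (auto simp: T'_def indicator_def bounded_bilinear.zero_right[OF B])
    also have "\<dots> = B (f s) (LINT t|?M. indicat_real {..<s} t *\<^sub>R f t)"
      by (rule integral_bounded_linear[OF bounded_bilinear.bounded_linear_right[OF B] i])
    finally show "(LINT t|?M. T' s t) = B (f s) (integral\<^sup>L (lebesgue_on {a..s}) f)" using sub'[OF s] by simp
  qed
  have "B (integral\<^sup>L ?M f) (integral\<^sup>L ?M f) = (LINT s|?M. B (f s) (integral\<^sup>L ?M f))"
    by (rule integral_bounded_linear[OF bounded_bilinear.bounded_linear_left[OF B] fi, symmetric])
  also have "\<dots> = (LINT s|?M. LINT t|?M. B (f s) (f t))"
    by (intro Bochner_Integration.integral_cong refl
        integral_bounded_linear[OF bounded_bilinear.bounded_linear_right[OF B] fi, symmetric])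
  also have "\<dots> = integral\<^sup>L (?M \<Otimes>\<^sub>M ?M) (\<lambda>(s, t). B (f s) (f t))"
    by (rule integral_fst'[OF Bi, unfolded case_prod_conv])
  also have "(\<lambda>(s, t). B (f s) (f t)) = (\<lambda>p. (case p of (s, t) \<Rightarrow> T s t) + (case p of (s, t) \<Rightarrow> T' s t))"
    by (rule ext) (auto simp: T_def T'_def indicator_def)
  also have "integral\<^sup>L (?M \<Otimes>\<^sub>M ?M) \<dots> = integral\<^sup>L (?M \<Otimes>\<^sub>M ?M) (\<lambda>(s, t). T s t) + integral\<^sup>L (?M \<Otimes>\<^sub>M ?M) (\<lambda>(s, t). T' s t)"
    by (rule Bochner_Integration.integral_add[OF Ti])
  also have "integral\<^sup>L (?M \<Otimes>\<^sub>M ?M) (\<lambda>(s, t). T s t) = (LINT t|?M. LINT s|?M. T s t)"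
    by (rule integral_snd[OF Ti(1), symmetric])
  also have "integral\<^sup>L (?M \<Otimes>\<^sub>M ?M) (\<lambda>(s, t). T' s t) = (LINT s|?M. LINT t|?M. T' s t)"
    by (rule integral_fst'[OF Ti(2), unfolded case_prod_conv, symmetric])
  finally show ?thesis unfolding I1 I2 by simp
qed

section \<open>Absolutely continuous representatives\<close>

lemma L2_subset:
  fixes f :: "real \<Rightarrow> 'e::euclidean_space"
  assumes f: "f \<in> L2 T" and ST: "S \<subseteq> T" "S \<in> sets lebesgue" "T \<in> sets lebesgue"
  shows "f \<in> L2 S"
proof -
  have "(\<lambda>t. if t \<in> T then f t else 0) \<in> L2 S"
    by (rule L2_restrict[OF ST(2) L2_extend[OF ST(3) f]])
  moreover have "f \<in> L2 S \<longleftrightarrow> (\<lambda>t. if t \<in> T then f t else 0) \<in> L2 S"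
    unfolding L2_def mem_Collect_eq
    using ST(1) by (intro conj_cong measurable_cong Bochner_Integration.integrable_cong) auto
  ultimately show ?thesis by simp
qed

lemma AE_lebesgue_on_subset:
  assumes "AE t in lebesgue_on T. P t" "S \<subseteq> T" "S \<in> sets lebesgue" "T \<in> sets lebesgue"
  shows "AE t in lebesgue_on S. P t"
  using assms by (auto simp: AE_lebesgue_on_iff elim!: eventually_mono)

lemma continuous_eq_if_AE_eq:
  fixes h k :: "real \<Rightarrow> 'e::euclidean_space"
  assumes ab: "a < b" and c: "continuous_on {a..b} h" "continuous_on {a..b} k"
    and eq: "AE t in lebesgue_on {a..b}. h t = k t" and t: "t \<in> {a..b}"
  shows "h t = k t"
proof -
  have cn: "continuous_on {a..b} (\<lambda>t. norm (h t - k t))" by (intro continuous_intros c)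
  have "integral\<^sup>L (lebesgue_on {a..b}) (\<lambda>t. norm (h t - k t)) = 0"
    by (rule integral_eq_zero_AE) (use eq in \<open>auto elim: eventually_mono\<close>)
  then have "integral (cbox a b) (\<lambda>t. norm (h t - k t)) = 0"
    using lebesgue_integral_eq_integral[OF continuous_imp_integrable_real[OF cn]] by simp
  then have "\<forall>t\<in>cbox a b. norm (h t - k t) = 0"
    using ab cn by (subst (asm) integral_cbox_eq_0_iff) auto
  then show ?thesis using t by auto
qed

lemma H1_rep_L2: "H1_rep a b f h h' \<Longrightarrow> h' \<in> L2 {a..b}"
  and H1_rep_eq: "H1_rep a b f h h' \<Longrightarrow> t \<in> {a..b} \<Longrightarrow> h t = h a + integral\<^sup>L (lebesgue_on {a..t}) h'"
  and H1_rep_AE: "H1_rep a b f h h' \<Longrightarrow> AE t in lebesgue_on {a..b}. f t = h t"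
  unfolding H1_rep_def by blast+

lemma H1_rep_continuous:
  fixes h :: "real \<Rightarrow> 'e::euclidean_space"
  assumes h: "H1_rep a b f h h'"
  shows "continuous_on {a..b} h"
proof -
  have "continuous_on {a..b} (\<lambda>t. h a + integral\<^sup>L (lebesgue_on {a..t}) h')"
    by (rule continuous_on_add[OF continuous_on_const
          indefinite_integral_continuous_real[OF L2_Icc_integrable[OF H1_rep_L2[OF h]]]])
  then show ?thesis by (rule continuous_on_eq) (simp add: H1_rep_eq[OF h, symmetric])
qed

text \<open>The representatives are continuous, so agreement almost everywhere is agreement on the
  interval. Then the difference of the derivatives has zero indefinite integral.\<close>

lemma H1_rep_unique:
  fixes h k :: "real \<Rightarrow> 'e::euclidean_space"
  assumes ab: "a < b" and h: "H1_rep a b f h h'" and k: "H1_rep a b f k k'"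
  shows "t \<in> {a..b} \<Longrightarrow> h t = k t" and "AE t in lebesgue_on {a..b}. h' t = k' t"
proof -
  have "AE t in lebesgue_on {a..b}. h t = k t"
    using H1_rep_AE[OF h] H1_rep_AE[OF k] by eventually_elim simp
  then show eq: "t \<in> {a..b} \<Longrightarrow> h t = k t" for t
    using continuous_eq_if_AE_eq[OF ab H1_rep_continuous[OF h] H1_rep_continuous[OF k]] by blast
  note h'i = L2_Icc_integrable[OF H1_rep_L2[OF h]] and k'i = L2_Icc_integrable[OF H1_rep_L2[OF k]]
  have "AE t in lebesgue_on {a..b}. h' t - k' t = 0"
  proof (rule AE_zero_if_indefinite_integral_zero)
    show "integrable (lebesgue_on {a..b}) (\<lambda>t. h' t - k' t)" using h'i k'i by simp
    fix t assume t: "t \<in> {a..b}"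
    have "integrable (lebesgue_on {a..t}) h'" "integrable (lebesgue_on {a..t}) k'"
      using t by (auto intro!: integrable_subinterval[OF h'i] integrable_subinterval[OF k'i])
    then show "(LINT t|lebesgue_on {a..t}. h' t - k' t) = 0"
      using H1_rep_eq[OF h t] H1_rep_eq[OF k t] eq[OF t] eq[of a] ab by simp
  qed
  then show "AE t in lebesgue_on {a..b}. h' t = k' t" by eventually_elim simp
qed

lemma H1_rep_cong:
  assumes "AE t in lebesgue_on {a..b}. f t = g t"
  shows "H1_rep a b f = H1_rep a b g"
proof -
  have "(AE t in lebesgue_on {a..b}. f t = h t) \<longleftrightarrow> (AE t in lebesgue_on {a..b}. g t = h t)" for h
    using assms by (auto elim: eventually_elim2)
  then show ?thesis by (intro ext) (simp add: H1_rep_def)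
qed

lemma H1_rep_add:
  fixes h k :: "real \<Rightarrow> 'e::euclidean_space"
  assumes h: "H1_rep a b f h h'" and k: "H1_rep a b g k k'"
  shows "H1_rep a b (\<lambda>t. f t + g t) (\<lambda>t. h t + k t) (\<lambda>t. h' t + k' t)"
  unfolding H1_rep_def
proof (intro conjI ballI)
  show "(\<lambda>t. h' t + k' t) \<in> L2 {a..b}" by (intro L2_add H1_rep_L2[OF h] H1_rep_L2[OF k])
  show "AE t in lebesgue_on {a..b}. f t + g t = h t + k t"
    using H1_rep_AE[OF h] H1_rep_AE[OF k] by eventually_elim simp
  fix t assume t: "t \<in> {a..b}"
  have "integrable (lebesgue_on {a..t}) h'" "integrable (lebesgue_on {a..t}) k'"
    using t by (auto intro!: integrable_subinterval[OF L2_Icc_integrable[OF H1_rep_L2[OF h]]]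
        integrable_subinterval[OF L2_Icc_integrable[OF H1_rep_L2[OF k]]])
  then show "h t + k t = h a + k a + (LINT t|lebesgue_on {a..t}. h' t + k' t)"
    using H1_rep_eq[OF h t] H1_rep_eq[OF k t] by (simp add: algebra_simps)
qed

lemma H1_rep_linear:
  fixes h :: "real \<Rightarrow> 'e::euclidean_space" and L :: "'e \<Rightarrow> 'd::euclidean_space"
  assumes h: "H1_rep a b f h h'" and L: "bounded_linear L"
  shows "H1_rep a b (\<lambda>t. L (f t)) (\<lambda>t. L (h t)) (\<lambda>t. L (h' t))"
  unfolding H1_rep_def
proof (intro conjI ballI)
  show "(\<lambda>t. L (h' t)) \<in> L2 {a..b}" by (intro L2_linear[OF L] H1_rep_L2[OF h])
  show "AE t in lebesgue_on {a..b}. L (f t) = L (h t)"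
    using H1_rep_AE[OF h] by eventually_elim simp
  fix t assume t: "t \<in> {a..b}"
  have "integrable (lebesgue_on {a..t}) h'"
    using t by (auto intro!: integrable_subinterval[OF L2_Icc_integrable[OF H1_rep_L2[OF h]]])
  then show "L (h t) = L (h a) + (LINT t|lebesgue_on {a..t}. L (h' t))"
    using integral_bounded_linear[OF L, of "lebesgue_on {a..t}" h']
      arg_cong[OF H1_rep_eq[OF h t], of L] linear_add[OF bounded_linear.linear[OF L]] by simp
qed

text \<open>\<open>H1_cont\<close> and \<open>H1_deriv\<close> are two independent choices.
  Uniqueness is what makes them fit together.\<close>

lemma H1_rep_cont_deriv:
  fixes f :: "real \<Rightarrow> 'e::euclidean_space"
  assumes ab: "a < b" and f: "f \<in> H1 a b"
  shows "H1_rep a b f (H1_cont a b f) (H1_deriv a b f)"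
proof -
  have "\<exists>h'. H1_rep a b f (H1_cont a b f) h'"
    unfolding H1_cont_def using f unfolding H1_def mem_Collect_eq by (rule someI_ex)
  then obtain h' where h: "H1_rep a b f (H1_cont a b f) h'" ..
  have "\<exists>h'. \<exists>h. H1_rep a b f h h'" using f by (auto simp: H1_def)
  then have "\<exists>h. H1_rep a b f h (H1_deriv a b f)"
    unfolding H1_deriv_def by (rule someI_ex)
  then obtain h2 where h2: "H1_rep a b f h2 (H1_deriv a b f)" ..
  have "H1_cont a b f t = H1_cont a b f a + integral\<^sup>L (lebesgue_on {a..t}) (H1_deriv a b f)" if "t \<in> {a..b}" for t
  proof -
    have "H1_cont a b f t = h2 t" by (rule H1_rep_unique(1)[OF ab h h2 that])
    moreover have "H1_cont a b f a = h2 a" by (rule H1_rep_unique(1)[OF ab h h2]) (use ab in simp)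
    ultimately show ?thesis using H1_rep_eq[OF h2 that] by simp
  qed
  then show ?thesis using H1_rep_L2[OF h2] H1_rep_AE[OF h] unfolding H1_rep_def by blast
qed

text \<open>Integration by parts for B(h, h). With h = h(a) + J, where J is the indefinite integral
  of \<open>h'\<close>, the cross term is immediate and the term quadratic in J is the integral over
  a square.\<close>

lemma H1_rep_bilinear:
  fixes h :: "real \<Rightarrow> 'e::euclidean_space" and B :: "'e \<Rightarrow> 'e \<Rightarrow> real"
  assumes ab: "a \<le> b" and h: "H1_rep a b f h h'" and B: "bounded_bilinear B" and sym: "\<And>x y. B x y = B y x"
  shows "B (h b) (h b) - B (h a) (h a) = 2 * (LINT t|lebesgue_on {a..b}. B (h' t) (h t))"
proof -
  let ?M = "lebesgue_on {a..b}"
  define J where "J t = integral\<^sup>L (lebesgue_on {a..t}) h'" for t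
  note h'L = H1_rep_L2[OF h] and h'i = L2_Icc_integrable[OF H1_rep_L2[OF h]]
  have hJ: "h t = h a + J t" if "t \<in> {a..b}" for t using H1_rep_eq[OF h that] by (simp add: J_def)
  have "continuous_on {a..b} J"
    unfolding J_def by (rule indefinite_integral_continuous_real[OF h'i])
  then have JL: "J \<in> L2 {a..b}" by (rule continuous_imp_L2)
  have "(LINT t|?M. B (h' t) (h t)) = (LINT t|?M. B (h' t) (h a) + B (h' t) (J t))"
  proof (rule Bochner_Integration.integral_cong[OF refl])
    fix t assume "t \<in> space ?M"
    then show "B (h' t) (h t) = B (h' t) (h a) + B (h' t) (J t)"
      using hJ[of t] by (simp add: bounded_bilinear.add_right[OF B, symmetric])
  qed
  also have "\<dots> = (LINT t|?M. B (h' t) (h a)) + (LINT t|?M. B (h' t) (J t))"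
    by (rule Bochner_Integration.integral_add[OF
          integrable_bounded_linear[OF bounded_bilinear.bounded_linear_left[OF B] h'i]
          L2_bilinear_integrable[OF B h'L JL]])
  also have "(LINT t|?M. B (h' t) (h a)) = B (J b) (h a)"
    unfolding J_def by (rule integral_bounded_linear[OF bounded_bilinear.bounded_linear_left[OF B] h'i])
  also have "2 * (B (J b) (h a) + (LINT t|?M. B (h' t) (J t))) = 2 * B (J b) (h a) + B (J b) (J b)"
    using bilinear_integral_square[OF h'L B sym] by (simp add: J_def)
  finally show ?thesis
    using hJ[of b] ab by (simp add: bounded_bilinear.add_left[OF B] bounded_bilinear.add_right[OF B] sym[of "h a" "J b"])
qed

lemma H1_rep_subinterval:
  fixes h :: "real \<Rightarrow> 'e::euclidean_space"
  assumes h: "H1_rep a b f h h'" and t: "t \<in> {a..b}"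
  shows "H1_rep a t f h h'"
  unfolding H1_rep_def
proof (intro conjI ballI)
  show "h' \<in> L2 {a..t}" using t by (intro L2_subset[OF H1_rep_L2[OF h]]) auto
  show "AE s in lebesgue_on {a..t}. f s = h s"
    using t by (intro AE_lebesgue_on_subset[OF H1_rep_AE[OF h]]) auto
  show "h s = h a + integral\<^sup>L (lebesgue_on {a..s}) h'" if "s \<in> {a..t}" for s
    using t that by (intro H1_rep_eq[OF h]) auto
qed

text \<open>A trace inequality: the squared norm varies by a controlled amount over the interval, so
  a value at one point is compared with the mean over all points.\<close>

lemma H1_rep_bound:
  fixes h :: "real \<Rightarrow> 'e::euclidean_space"
  assumes ab: "a < b" and h: "H1_rep a b f h h'" and t: "t \<in> {a..b}"
  shows "(norm (h t))\<^sup>2 \<le> (1 / (b - a) + 2) * (LINT s|lebesgue_on {a..b}. (norm (h s))\<^sup>2)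
    + 2 * (LINT s|lebesgue_on {a..b}. (norm (h' s))\<^sup>2)"
proof -
  let ?M = "lebesgue_on {a..b}"
  define N where "N = (LINT s|?M. (norm (h s))\<^sup>2) + (LINT s|?M. (norm (h' s))\<^sup>2)"
  have hL: "h \<in> L2 {a..b}" by (rule continuous_imp_L2[OF H1_rep_continuous[OF h]])
  have h'L: "h' \<in> L2 {a..b}" by (rule H1_rep_L2[OF h])
  have b: "\<bar>(norm (h s))\<^sup>2 - (norm (h a))\<^sup>2\<bar> \<le> N" if s: "s \<in> {a..b}" for s
  proof -
    have "(norm (h s))\<^sup>2 - (norm (h a))\<^sup>2 = 2 * (LINT r|lebesgue_on {a..s}. h' r \<bullet> h r)"
      using H1_rep_bilinear[OF _ H1_rep_subinterval[OF h s] bounded_bilinear_inner inner_commute] s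
      by (simp add: power2_norm_eq_inner)
    also have "\<dots> = 2 * (LINT r|?M. indicator {a..s} r *\<^sub>R (h' r \<bullet> h r))"
    proof -
      have "(LINT r|?M. indicator {a..s} r *\<^sub>R (h' r \<bullet> h r))
          = (LINT r|lebesgue. indicator {a..b} r *\<^sub>R (indicator {a..s} r *\<^sub>R (h' r \<bullet> h r)))"
        by (subst integral_restrict_space) auto
      also have "\<dots> = (LINT r|lebesgue. indicator {a..s} r *\<^sub>R (h' r \<bullet> h r))"
        using s by (intro Bochner_Integration.integral_cong) (auto simp: indicator_def)
      finally show ?thesis by (simp add: integral_restrict_space)
    qed
    finally have e: "(norm (h s))\<^sup>2 - (norm (h a))\<^sup>2 = (LINT r|?M. 2 * (indicator {a..s} r *\<^sub>R (h' r \<bullet> h r)))"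
      by simp
    have "\<bar>LINT r|?M. 2 * (indicator {a..s} r *\<^sub>R (h' r \<bullet> h r))\<bar> \<le> (LINT r|?M. (norm (h r))\<^sup>2 + (norm (h' r))\<^sup>2)"
    proof (rule integral_abs_bound[THEN order_trans], rule integral_mono)
      have ii: "integrable ?M (\<lambda>r. h' r \<bullet> h r)" by (rule L2_inner_integrable[OF h'L hL])
      show "integrable ?M (\<lambda>r. \<bar>2 * (indicator {a..s} r *\<^sub>R (h' r \<bullet> h r))\<bar>)"
        by (intro integrable_abs integrable_mult_right integrable_mult_indicator ii)
          (use s in \<open>auto simp: sets_restrict_space_iff\<close>)
      show "integrable ?M (\<lambda>r. (norm (h r))\<^sup>2 + (norm (h' r))\<^sup>2)"
        by (intro Bochner_Integration.integrable_add L2_integrable hL h'L)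
      show "\<bar>2 * (indicator {a..s} r *\<^sub>R (h' r \<bullet> h r))\<bar> \<le> (norm (h r))\<^sup>2 + (norm (h' r))\<^sup>2" for r
      proof -
        have "2 * \<bar>h' r \<bullet> h r\<bar> \<le> 2 * (norm (h' r) * norm (h r))" using Cauchy_Schwarz_ineq2 by (intro mult_left_mono) auto
        also have "\<dots> \<le> (norm (h' r))\<^sup>2 + (norm (h r))\<^sup>2"
          using sum_squares_bound[of "norm (h' r)" "norm (h r)"] by (simp add: mult.assoc)
        finally show ?thesis by (auto simp: indicator_def abs_mult add.commute)
      qed
    qed
    also have "\<dots> = N" unfolding N_def by (intro Bochner_Integration.integral_add L2_integrable hL h'L)
    finally show ?thesis using e by simp
  qed
  \<comment> \<open>Both t and s are compared with the left end point, hence the factor 2;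
    integrating over s produces the mean.\<close>
  have le: "(norm (h t))\<^sup>2 \<le> (norm (h s))\<^sup>2 + 2 * N" if "s \<in> {a..b}" for s
    using b[OF t] b[OF that] by linarith
  have "(LINT s|?M. (norm (h t))\<^sup>2) \<le> (LINT s|?M. (norm (h s))\<^sup>2 + 2 * N)"
  proof (rule integral_mono)
    interpret finite_measure ?M by (rule finite_measure_lebesgue_on_Icc)
    show "integrable ?M (\<lambda>s. (norm (h t))\<^sup>2)" by simp
    show "integrable ?M (\<lambda>s. (norm (h s))\<^sup>2 + 2 * N)" using L2_integrable[OF hL] by simp
  qed (use le in auto)
  also have "\<dots> = (LINT s|?M. (norm (h s))\<^sup>2) + (b - a) * (2 * N)"
  proof -
    interpret finite_measure ?M by (rule finite_measure_lebesgue_on_Icc)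
    show ?thesis using ab L2_integrable[OF hL] by (simp add: measure_restrict_space)
  qed
  also have "(LINT s|?M. (norm (h t))\<^sup>2) = (b - a) * (norm (h t))\<^sup>2"
    using ab by (simp add: measure_restrict_space)
  finally have "(norm (h t))\<^sup>2 \<le> ((LINT s|?M. (norm (h s))\<^sup>2) + (b - a) * (2 * N)) / (b - a)"
    using ab by (simp add: pos_le_divide_eq mult.commute)
  also have "\<dots> = (1 / (b - a) + 2) * (LINT s|?M. (norm (h s))\<^sup>2) + 2 * (LINT s|?M. (norm (h' s))\<^sup>2)"
    using ab by (simp add: N_def field_simps)
  finally show ?thesis .
qed

section \<open>Estimates, pairings and representatives in \<open>l2\<close>\<close>

lemma emb_norm_le:
  assumes S: "S \<in> sets lebesgue" and f: "f \<in> L2 S" and g: "g \<in> L2 S"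
    and le: "AE t in lebesgue_on S. norm (f t) \<le> C * norm (g t)" and C: "C \<ge> 0"
  shows "norm (emb S f) \<le> C * norm (emb S g)"
proof (rule power2_le_imp_le)
  have "(norm (emb S f))\<^sup>2 = (LINT t|lebesgue_on S. (norm (f t))\<^sup>2)" by (rule emb_norm[OF S f])
  also have "\<dots> \<le> (LINT t|lebesgue_on S. C\<^sup>2 * (norm (g t))\<^sup>2)"
  proof (rule integral_mono_AE)
    show "AE t in lebesgue_on S. (norm (f t))\<^sup>2 \<le> C\<^sup>2 * (norm (g t))\<^sup>2"
      using le
    proof eventually_elim
      case (elim t)
      then have "(norm (f t))\<^sup>2 \<le> (C * norm (g t))\<^sup>2" by (intro power_mono) auto
      then show ?case by (simp add: power_mult_distrib)
    qed
  qed (use f g in \<open>auto simp: L2_def\<close>)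
  also have "\<dots> = (C * norm (emb S g))\<^sup>2" by (simp add: power_mult_distrib emb_norm[OF S g])
  finally show "(norm (emb S f))\<^sup>2 \<le> (C * norm (emb S g))\<^sup>2" .
qed (use C in simp)

lemma inner_emb_right:
  assumes S: "S \<in> sets lebesgue" and g: "g \<in> L2 S"
  shows "F \<bullet> emb S g = (LINT t|lebesgue_on S. rep_l2 F t \<bullet> g t)"
proof -
  have "F \<bullet> emb S g = abs_l2 (rep_l2 F) \<bullet> emb S g" by simp
  also have "\<dots> = (LINT t|lebesgue. rep_l2 F t \<bullet> (if t \<in> S then g t else 0))"
    unfolding emb_def by (rule abs_l2_inner[OF rep_l2_L2 L2_extend[OF S g]])
  also have "\<dots> = (LINT t|lebesgue. indicator S t *\<^sub>R (rep_l2 F t \<bullet> g t))"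
    by (intro Bochner_Integration.integral_cong) auto
  finally show ?thesis using S by (simp add: integral_restrict_space)
qed

lemma rep_l2_add: "AE t in lebesgue. rep_l2 (F + G) t = rep_l2 F t + rep_l2 G t"
proof -
  have "abs_l2 (rep_l2 (F + G)) = abs_l2 (rep_l2 F) + abs_l2 (rep_l2 G)" by simp
  then have "abs_l2 (rep_l2 (F + G)) = abs_l2 (\<lambda>t. rep_l2 F t + rep_l2 G t)"
    by (simp only: abs_l2_add[OF rep_l2_L2 rep_l2_L2])
  then show ?thesis by (subst (asm) abs_l2_eq_iff) (auto intro: L2_add)
qed

lemma rep_l2_scaleR: "AE t in lebesgue. rep_l2 (r *\<^sub>R F) t = r *\<^sub>R rep_l2 F t"
proof -
  have "abs_l2 (rep_l2 (r *\<^sub>R F)) = r *\<^sub>R abs_l2 (rep_l2 F)" by simp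
  then have "abs_l2 (rep_l2 (r *\<^sub>R F)) = abs_l2 (\<lambda>t. r *\<^sub>R rep_l2 F t)"
    by (simp only: abs_l2_scaleR[OF rep_l2_L2])
  then show ?thesis by (subst (asm) abs_l2_eq_iff) (auto intro: L2_scaleR)
qed

lemma AE_lebesgue_imp_on: "S \<in> sets lebesgue \<Longrightarrow> AE t in lebesgue. P t \<Longrightarrow> AE t in lebesgue_on S. P t"
  by (auto simp: AE_lebesgue_on_iff elim: eventually_mono)

section \<open>Boundary port variables\<close>

lemma sum_UNIV_sum: "(\<Sum>i\<in>(UNIV :: ('a::finite + 'b::finite) set). f i) = (\<Sum>i\<in>UNIV. f (Inl i)) + (\<Sum>i\<in>UNIV. f (Inr i))"
  by (simp add: UNIV_Plus_UNIV[symmetric] sum.Plus del: UNIV_Plus_UNIV)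

lemma block_stack: "block A B C D *v stack v w = stack (A *v v + B *v w) (C *v v + D *v w)"
  by (simp add: vec_eq_iff block_def stack_def matrix_vector_mult_def sum_UNIV_sum split: sum.split)

lemma cinner_stack: "cinner (stack v w) (stack v' w') = cinner v v' + cinner w w'"
  by (simp add: cinner_def stack_def sum_UNIV_sum)

lemma stack_add: "stack v w + stack v' w' = stack (v + v') (w + w')"
  by (simp add: vec_eq_iff stack_def split: sum.split)

lemma stack_scale: "c *s stack v w = stack (c *s v) (c *s w)"
  by (simp add: vec_eq_iff stack_def split: sum.split)

lemma stack_surj: "\<exists>v w. x = stack v w"
  by (rule exI[of _ "\<chi> i. x $ Inl i"], rule exI[of _ "\<chi> i. x $ Inr i"])
    (simp add: vec_eq_iff stack_def split: sum.split)

lemma stack_eq_iff: "stack v w = stack v' w' \<longleftrightarrow> v = v' \<and> w = w'"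
  by (auto simp: vec_eq_iff stack_def split: sum.splits)

lemma norm_stack_le: "norm (stack v w) \<le> norm v + norm w"
proof (rule power2_le_imp_le)
  have "(norm (stack v w))\<^sup>2 = (norm v)\<^sup>2 + (norm w)\<^sup>2"
    by (simp only: power2_norm_eq_inner) (simp add: cinner_stack flip: Re_cinner)
  then show "(norm (stack v w))\<^sup>2 \<le> (norm v + norm w)\<^sup>2" by (simp add: power2_sum)
qed simp

lemma R0_stack: "R0 \<Sigma> *v stack v w = (1 / sqrt 2) *\<^sub>R stack (P1 \<Sigma> *v v - P1 \<Sigma> *v w) (v + w)"
proof -
  have m: "(- M) *v x = - (M *v x)" for M :: "complex^'a^'a" and x
    using bounded_bilinear.minus_left[OF bounded_bilinear_mv] .
  show ?thesis
    unfolding R0_def bounded_bilinear.scaleR_left[OF bounded_bilinear_mv] block_stack by (simp add: m)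
qed

lemma invertible_R0:
  fixes \<Sigma> :: "('n::finite, 'p::finite, 'k::finite) phs"
  assumes P1: "invertible (P1 \<Sigma>)"
  shows "invertible (R0 \<Sigma>)"
  unfolding invertible_left_inverse matrix_left_invertible_ker
proof (intro allI impI)
  fix x assume x: "R0 \<Sigma> *v x = 0"
  obtain v w where vw: "x = stack v w" using stack_surj by blast
  have s0: "stack 0 0 = (0 :: complex^('n + 'n))" by (simp add: vec_eq_iff stack_def split: sum.split)
  have "stack (P1 \<Sigma> *v v - P1 \<Sigma> *v w) (v + w) = stack 0 0"
    using x unfolding vw R0_stack s0 by simp
  then have 1: "P1 \<Sigma> *v v = P1 \<Sigma> *v w" "v + w = 0" by (auto simp: stack_eq_iff)
  then have "v = w" using matrix_inv_mv[OF P1] by metis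
  then have "2 *\<^sub>R v = 0" using 1(2) by (simp add: scaleR_2)
  then show "x = 0" using \<open>v = w\<close> by (simp add: vw s0)
qed

text \<open>In the port variables, flow P1 (v - w) and effort v + w up to the factor 1 / sqrt 2, the
  form of \<open>Xi\<close> is their real inner product. Self-adjointness of \<open>P1\<close>
  cancels the mixed terms and leaves the boundary flux produced by integration by parts.\<close>

lemma Xi_R0:
  fixes \<Sigma> :: "('n::finite, 'p::finite, 'k::finite) phs"
  assumes P1: "cadjoint (P1 \<Sigma>) = P1 \<Sigma>"
  shows "Re (cinner (Xi *v (R0 \<Sigma> *v stack v w)) (R0 \<Sigma> *v stack v w)) = (P1 \<Sigma> *v v) \<bullet> v - (P1 \<Sigma> *v w) \<bullet> w"
proof -
  define p q where "p = P1 \<Sigma> *v v - P1 \<Sigma> *v w" and "q = v + w"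
  have "Xi *v stack p q = stack q p"
    by (simp add: Xi_def block_stack)
  then have "Re (cinner (Xi *v (R0 \<Sigma> *v stack v w)) (R0 \<Sigma> *v stack v w)) = ((1 / sqrt 2) *\<^sub>R stack q p) \<bullet> ((1 / sqrt 2) *\<^sub>R stack p q)"
    by (simp add: R0_stack p_def q_def Re_cinner bounded_bilinear.scaleR_right[OF bounded_bilinear_mv])
  also have "\<dots> = (stack q p \<bullet> stack p q) / 2" by simp
  also have "\<dots> = (q \<bullet> p + p \<bullet> q) / 2" by (simp add: cinner_stack flip: Re_cinner)
  also have "\<dots> = p \<bullet> q" by (simp add: inner_commute)
  also have "\<dots> = (P1 \<Sigma> *v v) \<bullet> v - (P1 \<Sigma> *v w) \<bullet> w"
    using inner_selfadjoint[OF P1, of v w] inner_commute[of v "P1 \<Sigma> *v w"]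
    by (simp add: p_def q_def inner_simps)
  finally show ?thesis .
qed

section \<open>The boundary node\<close>

text \<open>\<open>power\<close> bounds the boundary part of the power balance and
  \<open>P0_diss\<close> its interior part.\<close>

locale port_hamiltonian_node =
  fixes \<Sigma> :: "('n::finite, 'p::finite, 'k::finite) phs"
  assumes ph: "port_hamiltonian \<Sigma>"
    and st: "standing_assumption \<Sigma>"
    and P0_diss: "\<And>v. Re (cinner (P0 \<Sigma> *v v) v) \<le> 0"
    and power: "\<And>g. (WB2 \<Sigma> ** matrix_inv (R0 \<Sigma>)) *v g = 0 \<Longrightarrow>
           (norm ((WB1 \<Sigma> ** matrix_inv (R0 \<Sigma>)) *v g))\<^sup>2
             - (norm ((WC \<Sigma> ** matrix_inv (R0 \<Sigma>)) *v g))\<^sup>2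
           \<ge> Re (cinner (Xi *v g) g)"
begin

abbreviation I :: "real set" where "I \<equiv> {lo \<Sigma>..hi \<Sigma>}"

lemma I_sets: "I \<in> sets lebesgue" by simp

lemma lo_hi: "lo \<Sigma> < hi \<Sigma>" and P1_sym: "cadjoint (P1 \<Sigma>) = P1 \<Sigma>" and P1_inv: "invertible (P1 \<Sigma>)"
  and Ham_meas: "Ham \<Sigma> \<in> borel_measurable (lebesgue_on I)"
  using ph unfolding port_hamiltonian_def by blast+

lemma Ham_bound: "\<exists>M\<ge>0. AE \<zeta> in lebesgue_on I. \<forall>v. norm (Ham \<Sigma> \<zeta> *v v) \<le> M * norm v"
proof -
  obtain K where K: "K > 0" "\<And>(A::complex^'n^'n) x. norm (A *v x) \<le> norm A * norm x * K"
    using bounded_bilinear.pos_bounded[OF bounded_bilinear_mv] by blast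
  obtain M where M: "AE \<zeta> in lebesgue_on I. norm (Ham \<Sigma> \<zeta>) \<le> M"
    using ph unfolding port_hamiltonian_def by blast
  have "AE \<zeta> in lebesgue_on I. \<forall>v. norm (Ham \<Sigma> \<zeta> *v v) \<le> \<bar>M\<bar> * K * norm v"
    using M
  proof eventually_elim
    case (elim \<zeta>)
    show ?case
    proof
      fix v :: "complex^'n"
      have "norm (Ham \<Sigma> \<zeta>) * norm v * K \<le> \<bar>M\<bar> * norm v * K"
        using elim K(1) by (intro mult_right_mono) auto
      then show "norm (Ham \<Sigma> \<zeta> *v v) \<le> \<bar>M\<bar> * K * norm v" using K(2)[of "Ham \<Sigma> \<zeta>" v] by (simp add: mult_ac)
    qed
  qed
  then show ?thesis using K(1) by (intro exI[of _ "\<bar>M\<bar> * K"]) auto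
qed

lemma Ham_coercive: "\<exists>c>0. AE \<zeta> in lebesgue_on I. cadjoint (Ham \<Sigma> \<zeta>) = Ham \<Sigma> \<zeta> \<and>
    (\<forall>v. v \<bullet> (Ham \<Sigma> \<zeta> *v v) \<ge> c * (norm v)\<^sup>2)"
  using ph unfolding port_hamiltonian_def by (auto simp: Re_cinner inner_commute)

text \<open>\<open>Ham\<close> is assumed measurable and bounded only, but the smooth
  diagonalization expresses it as \<open>P1\<close> inverse times a continuous matrix whose
  eigenvalues are nonzero. Continuity of its inverse gives the resolvent equation continuous
  coefficients.\<close>

lemma Ham_continuous: "continuous_on I (Ham \<Sigma>)" and Ham_inv: "\<zeta> \<in> I \<Longrightarrow> invertible (Ham \<Sigma> \<zeta>)"
proof -
  obtain S :: "real \<Rightarrow> complex^'n^'n" and d :: "real \<Rightarrow> real^'n" and J :: "'n set" where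
    S: "C1_on I S" and d: "C1_on I d" and
    all: "\<forall>\<zeta>\<in>I. invertible (S \<zeta>) \<and> P1 \<Sigma> ** Ham \<Sigma> \<zeta> =
             matrix_inv (S \<zeta>) ** (\<chi> i j. if i = j then of_real (d \<zeta> $ i) else 0) ** S \<zeta> \<and>
           (\<forall>i\<in>J. d \<zeta> $ i > 0) \<and> (\<forall>i\<in>- J. d \<zeta> $ i < 0)"
    using st unfolding standing_assumption_def C1_diagonalizable_def by blast
  have *: "invertible (S \<zeta>)"
      "P1 \<Sigma> ** Ham \<Sigma> \<zeta> =
             matrix_inv (S \<zeta>) ** (\<chi> i j. if i = j then of_real (d \<zeta> $ i) else 0) ** S \<zeta>"
      "i \<in> J \<Longrightarrow> d \<zeta> $ i > 0" "i \<in> - J \<Longrightarrow> d \<zeta> $ i < 0" if "\<zeta> \<in> I" for \<zeta> i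
    using all that by blast+
  have C1c: "C1_on I f \<Longrightarrow> continuous_on I f" for f :: "real \<Rightarrow> 'z::real_normed_vector"
    unfolding C1_on_def by (blast intro: continuous_on_vector_derivative)
  define Dg where "Dg \<zeta> = ((\<chi> i j. if i = j then of_real (d \<zeta> $ i) else 0) :: complex^'n^'n)" for \<zeta>
  have Dc: "continuous_on I Dg"
    unfolding Dg_def
  proof (intro continuous_on_vec_lambda)
    show "continuous_on I (\<lambda>\<zeta>. if i = j then complex_of_real (d \<zeta> $ i) else 0)" for i j
      by (cases "i = j") (auto intro!: continuous_intros C1c[OF d])
  qed
  have H: "Ham \<Sigma> \<zeta> = matrix_inv (P1 \<Sigma>) ** (matrix_inv (S \<zeta>) ** Dg \<zeta> ** S \<zeta>)" if "\<zeta> \<in> I" for \<zeta>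
    using arg_cong[OF *(2)[OF that], of "\<lambda>A. matrix_inv (P1 \<Sigma>) ** A"] matrix_inv_mm[OF P1_inv]
    by (simp add: matrix_mul_assoc Dg_def)
  have "continuous_on I (\<lambda>\<zeta>. matrix_inv (P1 \<Sigma>) ** (matrix_inv (S \<zeta>) ** Dg \<zeta> ** S \<zeta>))"
    by (intro bounded_bilinear.continuous_on[OF bounded_bilinear_mm] continuous_on_const Dc C1c[OF S]
        continuous_on_matrix_inv *(1))
  then show "continuous_on I (Ham \<Sigma>)" by (rule continuous_on_eq) (simp add: H)
  show "invertible (Ham \<Sigma> \<zeta>)" if z: "\<zeta> \<in> I"
  proof -
    have mi: "invertible (matrix_inv A)" if "invertible A" for A :: "complex^'n^'n"
      using matrix_inv_mm[OF that] unfolding invertible_def by blast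
    have "d \<zeta> $ i \<noteq> 0" for i using *(3,4)[OF z, of i] by (cases "i \<in> J") auto
    then have "invertible (Dg \<zeta>)" unfolding Dg_def by (intro invertible_diagonal) simp
    then show ?thesis unfolding H[OF z] by (intro invertible_mult mi P1_inv *(1) z)
  qed
qed

lemma X_L2: "X \<Sigma> = L2 I" by (simp add: X_def)

lemma HX_L2: "f \<in> X \<Sigma> \<Longrightarrow> HX \<Sigma> f \<in> L2 I"
proof -
  assume f: "f \<in> X \<Sigma>"
  obtain M where M: "AE \<zeta> in lebesgue_on I. \<forall>v. norm (Ham \<Sigma> \<zeta> *v v) \<le> M * norm v" using Ham_bound by blast
  show ?thesis
  proof (rule L2_bound)
    show "f \<in> L2 I" using f by (simp add: X_L2)
    show "HX \<Sigma> f \<in> borel_measurable (lebesgue_on I)"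
      unfolding HX_def using f
      by (intro borel_measurable_bilinear[OF bounded_bilinear_mv Ham_meas]) (simp add: X_L2 L2_measurable)
    show "AE t in lebesgue_on I. norm (HX \<Sigma> f t) \<le> M * norm (f t)"
      using M by eventually_elim (simp add: HX_def)
  qed
qed

lemma bounded_bilinear_cinner: "bounded_bilinear (cinner :: complex^'z \<Rightarrow> _)"
  unfolding bilinear_conv_bounded_bilinear[symmetric] bilinear_def
  using cinner_scale_left[of "complex_of_real _"] cinner_scale_right[of _ "complex_of_real _"]
  by (auto intro!: linearI simp: cinner_add_left cinner_add_right of_real_scale scaleR_conv_of_real)

lemma innerX_integrable:
  "f \<in> X \<Sigma> \<Longrightarrow> g \<in> X \<Sigma> \<Longrightarrow> integrable (lebesgue_on I) (\<lambda>\<zeta>. cinner (f \<zeta>) (HX \<Sigma> g \<zeta>))"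
  by (rule L2_bilinear_integrable[OF bounded_bilinear_cinner _ HX_L2]) (simp_all add: X_L2)

lemma innerX_HX: "innerX \<Sigma> f g = (LINT \<zeta>|lebesgue_on I. cinner (f \<zeta>) (HX \<Sigma> g \<zeta>))"
  by (simp add: innerX_def HX_def)

lemma Re_innerX: "f \<in> X \<Sigma> \<Longrightarrow> g \<in> X \<Sigma> \<Longrightarrow> Re (innerX \<Sigma> f g) = (LINT \<zeta>|lebesgue_on I. f \<zeta> \<bullet> HX \<Sigma> g \<zeta>)"
  unfolding innerX_HX by (subst integral_Re[symmetric]) (simp_all add: innerX_integrable Re_cinner)

lemma innerX_scale_left: "innerX \<Sigma> (\<lambda>\<zeta>. c *s f \<zeta>) g = c * innerX \<Sigma> f g"
  by (simp add: innerX_def cinner_scale_left)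

lemma innerX_scale_right: "innerX \<Sigma> f (\<lambda>\<zeta>. c *s g \<zeta>) = cnj c * innerX \<Sigma> f g"
  by (simp add: innerX_def mv_scale cinner_scale_right)

lemma cnj_innerX:
  assumes f: "f \<in> X \<Sigma>" and g: "g \<in> X \<Sigma>"
  shows "cnj (innerX \<Sigma> f g) = innerX \<Sigma> g f"
proof -
  obtain c where c: "AE \<zeta> in lebesgue_on I. cadjoint (Ham \<Sigma> \<zeta>) = Ham \<Sigma> \<zeta> \<and> (\<forall>v. v \<bullet> (Ham \<Sigma> \<zeta> *v v) \<ge> c * (norm v)\<^sup>2)"
    using Ham_coercive by blast
  have "innerX \<Sigma> g f = (LINT \<zeta>|lebesgue_on I. cnj (cinner (f \<zeta>) (HX \<Sigma> g \<zeta>)))"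
    unfolding innerX_HX
  proof (rule integral_cong_AE)
    show "(\<lambda>\<zeta>. cinner (g \<zeta>) (HX \<Sigma> f \<zeta>)) \<in> borel_measurable (lebesgue_on I)"
      using innerX_integrable[OF g f] by simp
    show "(\<lambda>\<zeta>. cnj (cinner (f \<zeta>) (HX \<Sigma> g \<zeta>))) \<in> borel_measurable (lebesgue_on I)"
      by (rule measurable_compose[OF borel_measurable_integrable[OF innerX_integrable[OF f g]]])
        (intro borel_measurable_continuous_onI continuous_intros)
    show "AE \<zeta> in lebesgue_on I. cinner (g \<zeta>) (HX \<Sigma> f \<zeta>) = cnj (cinner (f \<zeta>) (HX \<Sigma> g \<zeta>))"
      using c
    proof eventually_elim
      case (elim \<zeta>)
      have "cinner (g \<zeta>) (HX \<Sigma> f \<zeta>) = cinner (HX \<Sigma> g \<zeta>) (f \<zeta>)"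
        using elim cinner_cadjoint[of "Ham \<Sigma> \<zeta>" "g \<zeta>" "f \<zeta>"] by (simp add: HX_def)
      then show ?case by (simp add: cnj_cinner)
    qed
  qed
  then show ?thesis by (simp add: innerX_HX)
qed

lemma X_add: "f \<in> X \<Sigma> \<Longrightarrow> g \<in> X \<Sigma> \<Longrightarrow> (\<lambda>\<zeta>. f \<zeta> + g \<zeta>) \<in> X \<Sigma>"
  by (simp add: X_L2 L2_add)

lemma X_diff: "f \<in> X \<Sigma> \<Longrightarrow> g \<in> X \<Sigma> \<Longrightarrow> (\<lambda>\<zeta>. f \<zeta> - g \<zeta>) \<in> X \<Sigma>"
  by (simp add: X_L2 L2_diff)

lemma X_scale: "f \<in> X \<Sigma> \<Longrightarrow> (\<lambda>\<zeta>. c *s f \<zeta>) \<in> X \<Sigma>"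
  by (simp add: X_L2 L2_linear[OF bounded_linear_scale])

lemma HX_add: "HX \<Sigma> (\<lambda>\<zeta>. f \<zeta> + g \<zeta>) = (\<lambda>\<zeta>. HX \<Sigma> f \<zeta> + HX \<Sigma> g \<zeta>)"
  by (simp add: HX_def matrix_vector_right_distrib)

lemma HX_scale: "HX \<Sigma> (\<lambda>\<zeta>. c *s f \<zeta>) = (\<lambda>\<zeta>. c *s HX \<Sigma> f \<zeta>)"
  by (simp add: HX_def mv_scale)

lemma HX_scaleR: "HX \<Sigma> (\<lambda>\<zeta>. r *\<^sub>R f \<zeta>) = (\<lambda>\<zeta>. r *\<^sub>R HX \<Sigma> f \<zeta>)"
  using HX_scale[of "complex_of_real r" f] by (simp add: of_real_scale)

lemma HX_AE: "AE \<zeta> in lebesgue_on I. f \<zeta> = g \<zeta> \<Longrightarrow> AE \<zeta> in lebesgue_on I. HX \<Sigma> f \<zeta> = HX \<Sigma> g \<zeta>"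
  by (auto simp: HX_def elim: eventually_mono)

section \<open>The energy inner product\<close>

definition MH :: "(complex^'n) l2 \<Rightarrow> (complex^'n) l2" where
  "MH F = emb I (HX \<Sigma> (rep_l2 F)) + (F - emb I (rep_l2 F))"

text \<open>Outside of the interval the energy form is completed by the form of the ambient space.\<close>

definition ip :: "(complex^'n) l2 \<Rightarrow> (complex^'n) l2 \<Rightarrow> real" where
  "ip F G = F \<bullet> MH G"

lemma rep_X [simp]: "rep_l2 F \<in> X \<Sigma>"
  by (simp add: X_L2 rep_L2)

lemma emb_rep_add: "emb I (rep_l2 (F + G)) = emb I (rep_l2 F) + emb I (rep_l2 G :: real \<Rightarrow> complex^'n)"
  using AE_lebesgue_imp_on[OF I_sets rep_l2_add[of F G]]
  by (simp add: rep_L2 emb_add[OF I_sets, symmetric] emb_eq_iff[OF I_sets] L2_add)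

lemma emb_rep_scaleR: "emb I (rep_l2 (r *\<^sub>R F)) = r *\<^sub>R emb I (rep_l2 F :: real \<Rightarrow> complex^'n)"
  using AE_lebesgue_imp_on[OF I_sets rep_l2_scaleR[of r F]]
  by (simp add: rep_L2 emb_scaleR[OF I_sets, symmetric] emb_eq_iff[OF I_sets] L2_scaleR)

lemma emb_HX_rep_add: "emb I (HX \<Sigma> (rep_l2 (F + G))) = emb I (HX \<Sigma> (rep_l2 F)) + emb I (HX \<Sigma> (rep_l2 G))"
  using HX_AE[OF AE_lebesgue_imp_on[OF I_sets rep_l2_add[of F G]]]
  by (simp add: emb_add[OF I_sets, symmetric] emb_eq_iff[OF I_sets] L2_add HX_L2 HX_add)

lemma emb_HX_rep_scaleR: "emb I (HX \<Sigma> (rep_l2 (r *\<^sub>R F))) = r *\<^sub>R emb I (HX \<Sigma> (rep_l2 F))"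
  using HX_AE[OF AE_lebesgue_imp_on[OF I_sets rep_l2_scaleR[of r F]]]
  by (simp add: emb_scaleR[OF I_sets, symmetric] emb_eq_iff[OF I_sets] L2_scaleR HX_L2 HX_scaleR)

text \<open>Restriction to the interval is an orthogonal projection of \<open>l2\<close>: the
  squared norm of the restriction equals its inner product with \<open>F\<close>.\<close>

lemma norm_emb_rep_le: "norm (emb I (rep_l2 F)) \<le> norm (F :: (complex^'n) l2)"
proof (cases "norm (emb I (rep_l2 F)) = 0")
  case False
  have "norm (emb I (rep_l2 F)) * norm (emb I (rep_l2 F)) = F \<bullet> emb I (rep_l2 F)"
    by (simp only: inner_emb_right[OF I_sets rep_L2[OF I_sets]] emb_norm[OF I_sets rep_L2[OF I_sets], symmetric, unfolded power2_norm_eq_inner]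
      power2_norm_eq_inner[symmetric] power2_eq_square[symmetric] emb_norm[OF I_sets rep_L2[OF I_sets]])
  also have "\<dots> \<le> norm F * norm (emb I (rep_l2 F))" by (rule norm_cauchy_schwarz)
  finally show ?thesis using False by simp
qed (simp del: norm_eq_zero)

lemma norm_emb_HX_le: "\<exists>M\<ge>0. \<forall>f\<in>X \<Sigma>. norm (emb I (HX \<Sigma> f)) \<le> M * norm (emb I f)"
proof -
  obtain M where M: "M \<ge> 0" "AE \<zeta> in lebesgue_on I. \<forall>v. norm (Ham \<Sigma> \<zeta> *v v) \<le> M * norm v" using Ham_bound by blast
  have "norm (emb I (HX \<Sigma> f)) \<le> M * norm (emb I f)" if "f \<in> X \<Sigma>" for f
  proof (rule emb_norm_le[OF I_sets HX_L2[OF that] _ _ M(1)])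
    show "f \<in> L2 I" using that by (simp add: X_L2)
    show "AE t in lebesgue_on I. norm (HX \<Sigma> f t) \<le> M * norm (f t)"
      using M(2) by eventually_elim (simp add: HX_def)
  qed
  with M(1) show ?thesis by blast
qed

lemma bounded_linear_MH: "bounded_linear MH"
proof -
  obtain M where M: "M \<ge> 0" "\<And>f. f \<in> X \<Sigma> \<Longrightarrow> norm (emb I (HX \<Sigma> f)) \<le> M * norm (emb I f)"
    using norm_emb_HX_le by blast
  show ?thesis
  proof (rule bounded_linear_intro[of _ "M + 2"])
    show "MH (F + G) = MH F + MH G" for F G
      by (simp add: MH_def emb_rep_add emb_HX_rep_add)
    show "MH (r *\<^sub>R F) = r *\<^sub>R MH F" for r F
      by (simp add: MH_def emb_rep_scaleR emb_HX_rep_scaleR algebra_simps)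
    fix F
    have "norm (MH F) \<le> norm (emb I (HX \<Sigma> (rep_l2 F))) + (norm F + norm (emb I (rep_l2 F)))"
      unfolding MH_def by (rule norm_triangle_le) (simp add: norm_triangle_ineq4)
    also have "\<dots> \<le> M * norm F + (norm F + norm F)"
      using M(2)[of "rep_l2 F"] mult_left_mono[OF norm_emb_rep_le[of F] M(1)] norm_emb_rep_le[of F] by simp
    finally show "norm (MH F) \<le> norm F * (M + 2)" by (simp add: algebra_simps)
  qed
qed

lemma ip_alt: "ip F G = (LINT \<zeta>|lebesgue_on I. rep_l2 F \<zeta> \<bullet> HX \<Sigma> (rep_l2 G) \<zeta>)
    + (F \<bullet> G - (LINT \<zeta>|lebesgue_on I. rep_l2 F \<zeta> \<bullet> rep_l2 G \<zeta>))"
  by (simp add: ip_def MH_def inner_add_right inner_diff_right inner_emb_right HX_L2 rep_L2)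

lemma energy_ip: "energy ip"
proof (rule energy.intro)
  show "bounded_bilinear ip"
    unfolding ip_def
    by (rule bounded_bilinear.comp[OF bounded_bilinear_inner bounded_linear_ident bounded_linear_MH])
  show "ip F G = ip G F" for F G
  proof -
    have "(LINT \<zeta>|lebesgue_on I. rep_l2 F \<zeta> \<bullet> HX \<Sigma> (rep_l2 G) \<zeta>) = (LINT \<zeta>|lebesgue_on I. rep_l2 G \<zeta> \<bullet> HX \<Sigma> (rep_l2 F) \<zeta>)"
      using arg_cong[OF cnj_innerX[of "rep_l2 F" "rep_l2 G"], of Re] by (simp add: Re_innerX)
    then show ?thesis by (simp add: ip_alt inner_commute)
  qed
  obtain c where c: "c > 0" "AE \<zeta> in lebesgue_on I. cadjoint (Ham \<Sigma> \<zeta>) = Ham \<Sigma> \<zeta> \<and> (\<forall>v. v \<bullet> (Ham \<Sigma> \<zeta> *v v) \<ge> c * (norm v)\<^sup>2)"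
    using Ham_coercive by blast
  \<comment> \<open>The form is bounded below by c on the interval and by 1 outside, whence the
    minimum.\<close>
  show "\<exists>c>0. \<forall>F. c * (norm F)\<^sup>2 \<le> ip F F"
  proof (intro exI[of _ "min c 1"] conjI allI)
    show "min c 1 > 0" using c by simp
    fix F :: "(complex^'n) l2"
    define p where "p = (norm (emb I (rep_l2 F)))\<^sup>2"
    have p: "p = (LINT \<zeta>|lebesgue_on I. rep_l2 F \<zeta> \<bullet> rep_l2 F \<zeta>)"
      unfolding p_def emb_norm[OF I_sets rep_L2[OF I_sets]] by (simp only: power2_norm_eq_inner)
    have "c * p = (LINT \<zeta>|lebesgue_on I. c * (rep_l2 F \<zeta> \<bullet> rep_l2 F \<zeta>))"
      by (simp add: p)
    also have "\<dots> \<le> (LINT \<zeta>|lebesgue_on I. rep_l2 F \<zeta> \<bullet> HX \<Sigma> (rep_l2 F) \<zeta>)"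
    proof (rule integral_mono_AE)
      show "integrable (lebesgue_on I) (\<lambda>\<zeta>. c * (rep_l2 F \<zeta> \<bullet> rep_l2 F \<zeta>))"
        by (rule integrable_mult_right[OF L2_inner_integrable[OF rep_L2[OF I_sets] rep_L2[OF I_sets]]])
      show "integrable (lebesgue_on I) (\<lambda>\<zeta>. rep_l2 F \<zeta> \<bullet> HX \<Sigma> (rep_l2 F) \<zeta>)"
        by (rule L2_inner_integrable[OF rep_L2[OF I_sets] HX_L2[OF rep_X]])
      show "AE \<zeta> in lebesgue_on I. c * (rep_l2 F \<zeta> \<bullet> rep_l2 F \<zeta>) \<le> rep_l2 F \<zeta> \<bullet> HX \<Sigma> (rep_l2 F) \<zeta>"
        using c(2) by eventually_elim (simp add: HX_def power2_norm_eq_inner)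
    qed
    finally have 1: "ip F F \<ge> c * p + ((norm F)\<^sup>2 - p)"
      by (simp only: ip_alt p[symmetric] power2_norm_eq_inner)
    have 2: "p \<le> (norm F)\<^sup>2" unfolding p_def by (rule power_mono[OF norm_emb_rep_le]) simp
    have "min c 1 * (norm F)\<^sup>2 = min c 1 * p + min c 1 * ((norm F)\<^sup>2 - p)" by (simp add: algebra_simps)
    also have "\<dots> \<le> c * p + 1 * ((norm F)\<^sup>2 - p)"
      using 2 by (intro add_mono mult_right_mono) (auto simp: p_def)
    finally show "min c 1 * (norm F)\<^sup>2 \<le> ip F F" using 1 by simp
  qed
qed

sublocale E: energy ip by (rule energy_ip)

lemma ip_emb_right:
  assumes g: "g \<in> X \<Sigma>"
  shows "ip F (emb I g) = (LINT \<zeta>|lebesgue_on I. rep_l2 F \<zeta> \<bullet> HX \<Sigma> g \<zeta>)"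
proof -
  have gL: "g \<in> L2 I" using g by (simp add: X_L2)
  have "emb I (HX \<Sigma> (rep_l2 (emb I g))) = emb I (HX \<Sigma> g)"
    using HX_AE[OF rep_emb[OF I_sets gL]] by (simp add: emb_eq_iff[OF I_sets] HX_L2 g)
  then show ?thesis
    by (simp add: ip_def MH_def emb_rep_emb[OF I_sets gL] inner_emb_right HX_L2 g)
qed

lemma ip_emb:
  assumes f: "f \<in> X \<Sigma>" and g: "g \<in> X \<Sigma>"
  shows "ip (emb I f) (emb I g) = Re (innerX \<Sigma> f g)"
proof -
  have fL: "f \<in> L2 I" using f by (simp add: X_L2)
  have "(LINT \<zeta>|lebesgue_on I. rep_l2 (emb I f) \<zeta> \<bullet> HX \<Sigma> g \<zeta>) = (LINT \<zeta>|lebesgue_on I. f \<zeta> \<bullet> HX \<Sigma> g \<zeta>)"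
  proof (rule integral_cong_AE)
    show "(\<lambda>\<zeta>. rep_l2 (emb I f) \<zeta> \<bullet> HX \<Sigma> g \<zeta>) \<in> borel_measurable (lebesgue_on I)"
      using L2_inner_integrable[OF rep_L2[OF I_sets] HX_L2[OF g]] by simp
    show "(\<lambda>\<zeta>. f \<zeta> \<bullet> HX \<Sigma> g \<zeta>) \<in> borel_measurable (lebesgue_on I)"
      using L2_inner_integrable[OF fL HX_L2[OF g]] by simp
    show "AE \<zeta> in lebesgue_on I. rep_l2 (emb I f) \<zeta> \<bullet> HX \<Sigma> g \<zeta> = f \<zeta> \<bullet> HX \<Sigma> g \<zeta>"
      using rep_emb[OF I_sets fL] by eventually_elim simp
  qed
  then show ?thesis using f g by (simp add: ip_emb_right Re_innerX)
qed

lemma en_emb: "f \<in> X \<Sigma> \<Longrightarrow> E.en (emb I f) = normX \<Sigma> f"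
  by (simp add: E.en_def normX_def ip_emb)

lemma eqX_iff: "f \<in> X \<Sigma> \<Longrightarrow> g \<in> X \<Sigma> \<Longrightarrow> eqX \<Sigma> f g \<longleftrightarrow> emb I f = emb I g"
  by (simp add: eqX_def X_L2 emb_eq_iff)

end

section \<open>Linear ordinary differential equations\<close>

lemma H1_rep_zero: "H1_rep a b (\<lambda>t. 0) (\<lambda>t. 0) (\<lambda>t. 0 :: 'e::euclidean_space)"
  by (simp add: H1_rep_def)

lemma H1_rep_sum:
  fixes f :: "'i \<Rightarrow> real \<Rightarrow> 'e::euclidean_space"
  assumes "finite A" "\<And>i. i \<in> A \<Longrightarrow> H1_rep a b (f i) (h i) (h' i)"
  shows "H1_rep a b (\<lambda>t. \<Sum>i\<in>A. f i t) (\<lambda>t. \<Sum>i\<in>A. h i t) (\<lambda>t. \<Sum>i\<in>A. h' i t)"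
  using assms
proof (induction A rule: finite_induct)
  case empty
  show ?case using H1_rep_zero by simp
next
  case (insert x F)
  then show ?case using H1_rep_add[of a b "f x" "h x" "h' x"] by simp
qed

text \<open>The inhomogeneity is merely square-integrable, so its indefinite integral, which is
  continuous, is moved into the free term of a Volterra equation.\<close>

lemma linear_ode:
  fixes Q :: "real \<Rightarrow> complex^'n^'n"
  assumes ab: "a < b" and Q: "continuous_on {a..b} Q" and r: "r \<in> L2 {a..b}"
  shows "\<exists>h. h a = c \<and> H1_rep a b h h (\<lambda>t. Q t *v h t + r t)"
proof -
  \<comment> \<open>The coefficient is frozen beyond \<open>b\<close>, because the Volterra equation
    is posed on a half-line.\<close>
  define q where "q s = Q (min s b)" for s
  have cl: "continuous_on {a..} (\<lambda>s. min s b)" by (intro continuous_intros)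
  have im: "(\<lambda>s. min s b) ` {a..} \<subseteq> {a..b}" using ab by auto
  have qc: "continuous_on {a..} q"
    unfolding q_def by (rule continuous_on_compose2[OF Q cl im])
  obtain K where K: "K > 0" "\<And>(A::complex^'n^'n) x. norm (A *v x) \<le> norm A * norm x * K"
    using bounded_bilinear.pos_bounded[OF bounded_bilinear_mv] by blast
  have "bounded (Q ` {a..b})" by (rule compact_imp_bounded[OF compact_continuous_image[OF Q compact_Icc]])
  then obtain M where M: "\<And>s. s \<in> {a..b} \<Longrightarrow> norm (Q s) \<le> M" unfolding bounded_iff by blast
  have qb: "norm (q s *v x) \<le> (\<bar>M\<bar> * K) * norm x" if "s \<ge> a" for s x
  proof -
    have "norm (q s) \<le> \<bar>M\<bar>" using M[of "min s b"] that ab by (auto simp: q_def)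
    then have "norm (q s) * norm x * K \<le> \<bar>M\<bar> * norm x * K" using K(1) by (intro mult_right_mono) auto
    then show ?thesis using K(2)[of "q s" x] by (simp add: mult_ac)
  qed
  define J where "J t = integral\<^sup>L (lebesgue_on {a..t}) r" for t
  have Jc: "continuous_on {a..b} J"
    unfolding J_def by (rule indefinite_integral_continuous_real[OF L2_Icc_integrable[OF r]])
  have h0: "continuous_on {a..} (\<lambda>t. c + J (min t b))"
    by (rule continuous_on_add[OF continuous_on_const continuous_on_compose2[OF Jc cl im]])
  obtain h where hc: "continuous_on {a..} h"
    and h: "\<forall>t\<ge>a. h t = (c + J (min t b)) + integral {a..t} (\<lambda>s. q s *v h s)"
    using volterra[of a "\<lambda>s x. q s *v x" "\<bar>M\<bar> * K" "\<lambda>t. c + J (min t b)"] qb K(1) h0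
      bounded_bilinear.continuous_on[OF bounded_bilinear_mv qc]
    by (auto simp: bounded_bilinear.diff_right[OF bounded_bilinear_mv])
  have hcI: "continuous_on {a..b} h" by (rule continuous_on_subset[OF hc]) auto
  have Qh: "continuous_on {a..b} (\<lambda>t. Q t *v h t)"
    by (rule bounded_bilinear.continuous_on[OF bounded_bilinear_mv Q hcI])
  have eq: "h t = c + (LINT s|lebesgue_on {a..t}. Q s *v h s + r s)" if t: "t \<in> {a..b}" for t
  proof -
    have i1: "integrable (lebesgue_on {a..t}) (\<lambda>s. Q s *v h s)"
      using t by (intro continuous_imp_integrable_real continuous_on_subset[OF Qh]) auto
    have i2: "integrable (lebesgue_on {a..t}) r"
      using t by (intro integrable_subinterval[OF L2_Icc_integrable[OF r]]) auto
    have "integral {a..t} (\<lambda>s. q s *v h s) = integral {a..t} (\<lambda>s. Q s *v h s)"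
      using t by (intro Henstock_Kurzweil_Integration.integral_cong) (simp add: q_def)
    also have "\<dots> = integral\<^sup>L (lebesgue_on {a..t}) (\<lambda>s. Q s *v h s)"
      using i1 by (simp add: lebesgue_integral_eq_integral)
    finally show ?thesis
      using h[rule_format, of t] t Bochner_Integration.integral_add[OF i1 i2] by (simp add: J_def min_absorb1)
  qed
  have ha: "h a = c"
    using h[rule_format, of a] ab integral_restrict_space[of "{a..a}" lebesgue r]
      has_integral_integral_lebesgue_on[of "{a..a}" r] L2_subset[OF r, of "{a..a}"] L2_Icc_integrable[of r a a]
    by (auto simp: J_def lebesgue_integral_eq_integral)
  have "H1_rep a b h h (\<lambda>t. Q t *v h t + r t)"
    unfolding H1_rep_def
    using eq ha by (auto intro: L2_add[OF continuous_imp_L2[OF Qh] r])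
  with ha show ?thesis by blast
qed

context port_hamiltonian_node
begin

section \<open>The domain of the main operator\<close>

lemma domL_X: "x \<in> domL \<Sigma> \<Longrightarrow> x \<in> X \<Sigma>" by (simp add: domL_def)

lemma domL_rep: "x \<in> domL \<Sigma> \<Longrightarrow>
    H1_rep (lo \<Sigma>) (hi \<Sigma>) (HX \<Sigma> x) (H1_cont (lo \<Sigma>) (hi \<Sigma>) (HX \<Sigma> x)) (H1_deriv (lo \<Sigma>) (hi \<Sigma>) (HX \<Sigma> x))"
  by (rule H1_rep_cont_deriv[OF lo_hi]) (simp add: domL_def)

lemma opL_X: "x \<in> domL \<Sigma> \<Longrightarrow> opL \<Sigma> x \<in> X \<Sigma>"
  unfolding opL_def X_L2
  by (rule L2_add[OF L2_linear[OF bounded_linear_mv H1_rep_L2[OF domL_rep]] L2_linear[OF bounded_linear_mv HX_L2[OF domL_X]]])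

text \<open>The operators refer to chosen representatives. By uniqueness, any representative may be
  used to verify membership and to compute boundary values and \<open>opL\<close>.\<close>

lemma domL_I:
  assumes x: "x \<in> X \<Sigma>" and h: "H1_rep (lo \<Sigma>) (hi \<Sigma>) (HX \<Sigma> x) h h'"
    and bc: "WB2 \<Sigma> *v stack (h (hi \<Sigma>)) (h (lo \<Sigma>)) = 0"
  shows "x \<in> domL \<Sigma>" "bdry \<Sigma> x = stack (h (hi \<Sigma>)) (h (lo \<Sigma>))"
    "AE \<zeta> in lebesgue_on I. opL \<Sigma> x \<zeta> = P1 \<Sigma> *v h' \<zeta> + P0 \<Sigma> *v HX \<Sigma> x \<zeta>"
proof -
  have H1: "HX \<Sigma> x \<in> H1 (lo \<Sigma>) (hi \<Sigma>)" using h by (auto simp: H1_def)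
  note hh = H1_rep_cont_deriv[OF lo_hi H1]
  show b: "bdry \<Sigma> x = stack (h (hi \<Sigma>)) (h (lo \<Sigma>))"
    using H1_rep_unique(1)[OF lo_hi hh h, of "hi \<Sigma>"] H1_rep_unique(1)[OF lo_hi hh h, of "lo \<Sigma>"] lo_hi
    by (simp add: bdry_def)
  show "x \<in> domL \<Sigma>" using x H1 bc b by (simp add: domL_def)
  show "AE \<zeta> in lebesgue_on I. opL \<Sigma> x \<zeta> = P1 \<Sigma> *v h' \<zeta> + P0 \<Sigma> *v HX \<Sigma> x \<zeta>"
    using H1_rep_unique(2)[OF lo_hi hh h] by eventually_elim (simp add: opL_def)
qed

lemma domL_add:
  assumes x: "x \<in> domL \<Sigma>" and y: "y \<in> domL \<Sigma>"
  shows "(\<lambda>\<zeta>. x \<zeta> + y \<zeta>) \<in> domL \<Sigma>" "bdry \<Sigma> (\<lambda>\<zeta>. x \<zeta> + y \<zeta>) = bdry \<Sigma> x + bdry \<Sigma> y"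
    "eqX \<Sigma> (opL \<Sigma> (\<lambda>\<zeta>. x \<zeta> + y \<zeta>)) (\<lambda>\<zeta>. opL \<Sigma> x \<zeta> + opL \<Sigma> y \<zeta>)"
proof -
  note h = H1_rep_add[OF domL_rep[OF x] domL_rep[OF y], folded HX_add]
  have bc: "WB2 \<Sigma> *v stack (H1_cont (lo \<Sigma>) (hi \<Sigma>) (HX \<Sigma> x) (hi \<Sigma>) + H1_cont (lo \<Sigma>) (hi \<Sigma>) (HX \<Sigma> y) (hi \<Sigma>))
      (H1_cont (lo \<Sigma>) (hi \<Sigma>) (HX \<Sigma> x) (lo \<Sigma>) + H1_cont (lo \<Sigma>) (hi \<Sigma>) (HX \<Sigma> y) (lo \<Sigma>)) = 0"
    using x y by (simp add: stack_add[symmetric] matrix_vector_right_distrib domL_def bdry_def)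
  note D = domL_I[OF X_add[OF domL_X[OF x] domL_X[OF y]] h bc]
  show "(\<lambda>\<zeta>. x \<zeta> + y \<zeta>) \<in> domL \<Sigma>" by (rule D(1))
  show "bdry \<Sigma> (\<lambda>\<zeta>. x \<zeta> + y \<zeta>) = bdry \<Sigma> x + bdry \<Sigma> y"
    unfolding D(2) by (simp add: bdry_def stack_add)
  show "eqX \<Sigma> (opL \<Sigma> (\<lambda>\<zeta>. x \<zeta> + y \<zeta>)) (\<lambda>\<zeta>. opL \<Sigma> x \<zeta> + opL \<Sigma> y \<zeta>)"
    unfolding eqX_def using D(3)
    by eventually_elim (simp add: opL_def HX_add matrix_vector_right_distrib)
qed

lemma domL_scale:
  assumes x: "x \<in> domL \<Sigma>"
  shows "(\<lambda>\<zeta>. c *s x \<zeta>) \<in> domL \<Sigma>" "bdry \<Sigma> (\<lambda>\<zeta>. c *s x \<zeta>) = c *s bdry \<Sigma> x"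
    "eqX \<Sigma> (opL \<Sigma> (\<lambda>\<zeta>. c *s x \<zeta>)) (\<lambda>\<zeta>. c *s opL \<Sigma> x \<zeta>)"
proof -
  note h = H1_rep_linear[OF domL_rep[OF x] bounded_linear_scale[of c], folded HX_scale]
  have bc: "WB2 \<Sigma> *v stack (c *s H1_cont (lo \<Sigma>) (hi \<Sigma>) (HX \<Sigma> x) (hi \<Sigma>)) (c *s H1_cont (lo \<Sigma>) (hi \<Sigma>) (HX \<Sigma> x) (lo \<Sigma>)) = 0"
    using x by (simp add: stack_scale[symmetric] mv_scale domL_def bdry_def)
  note D = domL_I[OF X_scale[OF domL_X[OF x]] h bc]
  show "(\<lambda>\<zeta>. c *s x \<zeta>) \<in> domL \<Sigma>" by (rule D(1))
  show "bdry \<Sigma> (\<lambda>\<zeta>. c *s x \<zeta>) = c *s bdry \<Sigma> x"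
    unfolding D(2) by (simp add: bdry_def stack_scale)
  show "eqX \<Sigma> (opL \<Sigma> (\<lambda>\<zeta>. c *s x \<zeta>)) (\<lambda>\<zeta>. c *s opL \<Sigma> x \<zeta>)"
    unfolding eqX_def using D(3)
    by eventually_elim (simp add: opL_def HX_scale mv_scale vector_add_ldistrib)
qed

lemma domL_cong:
  assumes x: "x \<in> domL \<Sigma>" and y: "y \<in> X \<Sigma>" and eq: "eqX \<Sigma> y x"
  shows "y \<in> domL \<Sigma>" "bdry \<Sigma> y = bdry \<Sigma> x" "eqX \<Sigma> (opL \<Sigma> y) (opL \<Sigma> x)"
proof -
  have hx: "AE \<zeta> in lebesgue_on I. HX \<Sigma> y \<zeta> = HX \<Sigma> x \<zeta>" using HX_AE eq by (simp add: eqX_def)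
  have h: "H1_rep (lo \<Sigma>) (hi \<Sigma>) (HX \<Sigma> y) (H1_cont (lo \<Sigma>) (hi \<Sigma>) (HX \<Sigma> x)) (H1_deriv (lo \<Sigma>) (hi \<Sigma>) (HX \<Sigma> x))"
    using domL_rep[OF x] by (simp only: H1_rep_cong[OF hx])
  have bc: "WB2 \<Sigma> *v stack (H1_cont (lo \<Sigma>) (hi \<Sigma>) (HX \<Sigma> x) (hi \<Sigma>)) (H1_cont (lo \<Sigma>) (hi \<Sigma>) (HX \<Sigma> x) (lo \<Sigma>)) = 0"
    using x by (simp add: domL_def bdry_def)
  note D = domL_I[OF y h bc]
  show "y \<in> domL \<Sigma>" by (rule D(1))
  show "bdry \<Sigma> y = bdry \<Sigma> x" unfolding D(2) by (simp add: bdry_def)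
  show "eqX \<Sigma> (opL \<Sigma> y) (opL \<Sigma> x)"
    unfolding eqX_def using D(3) hx by eventually_elim (simp add: opL_def)
qed

lemma opG_add: "x \<in> domL \<Sigma> \<Longrightarrow> y \<in> domL \<Sigma> \<Longrightarrow> opG \<Sigma> (\<lambda>\<zeta>. x \<zeta> + y \<zeta>) = opG \<Sigma> x + opG \<Sigma> y"
  and opK_add: "x \<in> domL \<Sigma> \<Longrightarrow> y \<in> domL \<Sigma> \<Longrightarrow> opK \<Sigma> (\<lambda>\<zeta>. x \<zeta> + y \<zeta>) = opK \<Sigma> x + opK \<Sigma> y"
  and opG_scale: "x \<in> domL \<Sigma> \<Longrightarrow> opG \<Sigma> (\<lambda>\<zeta>. c *s x \<zeta>) = c *s opG \<Sigma> x"
  and opK_scale: "x \<in> domL \<Sigma> \<Longrightarrow> opK \<Sigma> (\<lambda>\<zeta>. c *s x \<zeta>) = c *s opK \<Sigma> x"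
  by (simp_all add: opG_def opK_def domL_add domL_scale matrix_vector_right_distrib mv_scale)

text \<open>The weight in \<open>innerX\<close> turns the second argument into Hx, so that only Hx
  and its derivative occur. Integration by parts with the symmetric form of \<open>P1\<close> gives
  the boundary flux, rewritten in port variables.\<close>

lemma power_balance:
  assumes x: "x \<in> domL \<Sigma>"
  shows "2 * Re (innerX \<Sigma> (opL \<Sigma> x) x)
      = Re (cinner (Xi *v (R0 \<Sigma> *v bdry \<Sigma> x)) (R0 \<Sigma> *v bdry \<Sigma> x))
        + 2 * (LINT \<zeta>|lebesgue_on I. Re (cinner (P0 \<Sigma> *v HX \<Sigma> x \<zeta>) (HX \<Sigma> x \<zeta>)))"
proof -
  let ?h = "H1_cont (lo \<Sigma>) (hi \<Sigma>) (HX \<Sigma> x)" and ?h' = "H1_deriv (lo \<Sigma>) (hi \<Sigma>) (HX \<Sigma> x)"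
  define B where "B v w = (P1 \<Sigma> *v v) \<bullet> w" for v w
  have B: "bounded_bilinear B"
    unfolding B_def by (rule bounded_bilinear.comp[OF bounded_bilinear_inner bounded_linear_mv bounded_linear_ident])
  have Bsym: "B v w = B w v" for v w
    using inner_selfadjoint[OF P1_sym, of v w] by (simp add: B_def inner_commute)
  note h = domL_rep[OF x]
  note hx = HX_L2[OF domL_X[OF x]]
  have i1: "integrable (lebesgue_on I) (\<lambda>\<zeta>. B (?h' \<zeta>) (HX \<Sigma> x \<zeta>))"
    by (rule L2_bilinear_integrable[OF B H1_rep_L2[OF h] hx])
  have i2: "integrable (lebesgue_on I) (\<lambda>\<zeta>. (P0 \<Sigma> *v HX \<Sigma> x \<zeta>) \<bullet> HX \<Sigma> x \<zeta>)"
    by (rule L2_inner_integrable[OF L2_linear[OF bounded_linear_mv hx] hx])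
  have "Re (innerX \<Sigma> (opL \<Sigma> x) x) = (LINT \<zeta>|lebesgue_on I. B (?h' \<zeta>) (HX \<Sigma> x \<zeta>) + (P0 \<Sigma> *v HX \<Sigma> x \<zeta>) \<bullet> HX \<Sigma> x \<zeta>)"
    by (simp only: Re_innerX[OF opL_X[OF x] domL_X[OF x]]) (simp add: opL_def B_def inner_add_left)
  also have "\<dots> = (LINT \<zeta>|lebesgue_on I. B (?h' \<zeta>) (HX \<Sigma> x \<zeta>)) + (LINT \<zeta>|lebesgue_on I. (P0 \<Sigma> *v HX \<Sigma> x \<zeta>) \<bullet> HX \<Sigma> x \<zeta>)"
    by (rule Bochner_Integration.integral_add[OF i1 i2])
  also have "(LINT \<zeta>|lebesgue_on I. B (?h' \<zeta>) (HX \<Sigma> x \<zeta>)) = (LINT \<zeta>|lebesgue_on I. B (?h' \<zeta>) (?h \<zeta>))"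
  proof (rule integral_cong_AE)
    show "(\<lambda>\<zeta>. B (?h' \<zeta>) (HX \<Sigma> x \<zeta>)) \<in> borel_measurable (lebesgue_on I)" using i1 by simp
    show "(\<lambda>\<zeta>. B (?h' \<zeta>) (?h \<zeta>)) \<in> borel_measurable (lebesgue_on I)"
      by (rule borel_measurable_integrable[OF L2_bilinear_integrable[OF B H1_rep_L2[OF h]
              continuous_imp_L2[OF H1_rep_continuous[OF h]]]])
    show "AE \<zeta> in lebesgue_on I. B (?h' \<zeta>) (HX \<Sigma> x \<zeta>) = B (?h' \<zeta>) (?h \<zeta>)"
      using H1_rep_AE[OF h] by eventually_elim simp
  qed
  finally have "2 * Re (innerX \<Sigma> (opL \<Sigma> x) x) = 2 * (LINT \<zeta>|lebesgue_on I. B (?h' \<zeta>) (?h \<zeta>))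
      + 2 * (LINT \<zeta>|lebesgue_on I. (P0 \<Sigma> *v HX \<Sigma> x \<zeta>) \<bullet> HX \<Sigma> x \<zeta>)" by simp
  also have "2 * (LINT \<zeta>|lebesgue_on I. B (?h' \<zeta>) (?h \<zeta>)) = B (?h (hi \<Sigma>)) (?h (hi \<Sigma>)) - B (?h (lo \<Sigma>)) (?h (lo \<Sigma>))"
    using H1_rep_bilinear[OF less_imp_le[OF lo_hi] h B Bsym] by simp
  also have "\<dots> = Re (cinner (Xi *v (R0 \<Sigma> *v bdry \<Sigma> x)) (R0 \<Sigma> *v bdry \<Sigma> x))"
    by (simp add: B_def bdry_def Xi_R0[OF P1_sym])
  finally show ?thesis by (simp add: Re_cinner)
qed

lemma R0_inv_mv: "(W ** matrix_inv (R0 \<Sigma>)) *v (R0 \<Sigma> *v v) = W *v v"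
  using matrix_inv_mv[OF invertible_R0[OF P1_inv], of v] by (simp add: matrix_vector_mul_assoc[symmetric])

text \<open>The assumed inequality is applied to the port variables
  \<open>R0 \<Sigma> *v bdry \<Sigma> x\<close>; these satisfy its kernel condition by the boundary
  condition built into \<open>domL\<close>.\<close>

lemma dissipation:
  assumes x: "x \<in> domL \<Sigma>"
  shows "2 * Re (innerX \<Sigma> (opL \<Sigma> x) x) \<le> (norm (opG \<Sigma> x))\<^sup>2 - (norm (opK \<Sigma> x))\<^sup>2"
proof -
  have "WB2 \<Sigma> *v bdry \<Sigma> x = 0" using x by (simp add: domL_def)
  then have "Re (cinner (Xi *v (R0 \<Sigma> *v bdry \<Sigma> x)) (R0 \<Sigma> *v bdry \<Sigma> x)) \<le> (norm (opG \<Sigma> x))\<^sup>2 - (norm (opK \<Sigma> x))\<^sup>2"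
    using power[of "R0 \<Sigma> *v bdry \<Sigma> x"] by (simp add: R0_inv_mv opG_def opK_def)
  moreover have "(LINT \<zeta>|lebesgue_on I. Re (cinner (P0 \<Sigma> *v HX \<Sigma> x \<zeta>) (HX \<Sigma> x \<zeta>))) \<le> 0"
    using Bochner_Integration.integral_nonneg[of "lebesgue_on I" "\<lambda>\<zeta>. - Re (cinner (P0 \<Sigma> *v HX \<Sigma> x \<zeta>) (HX \<Sigma> x \<zeta>))"] P0_diss
    by simp
  ultimately show ?thesis using power_balance[OF x] by simp
qed

text \<open>Boundary values are controlled by the graph norm: the derivative of Hx is recovered from
  \<open>opL \<Sigma> x\<close> by inverting \<open>P1\<close>, and the trace inequality applies.
  This is what makes outputs of smooth orbits continuous.\<close>

lemma trace_bound:
  "\<exists>C\<ge>0. \<forall>x\<in>domL \<Sigma>. norm (bdry \<Sigma> x) \<le> C * (norm (emb I x) + norm (emb I (opL \<Sigma> x)))"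
proof -
  obtain M where M: "M \<ge> 0" "\<And>f. f \<in> X \<Sigma> \<Longrightarrow> norm (emb I (HX \<Sigma> f)) \<le> M * norm (emb I f)"
    using norm_emb_HX_le by blast
  obtain K1 where K1: "K1 > 0" "\<And>v. norm (matrix_inv (P1 \<Sigma>) *v v) \<le> norm v * K1"
    using bounded_linear.pos_bounded[OF bounded_linear_mv] by blast
  obtain K0 where K0: "K0 > 0" "\<And>v. norm (P0 \<Sigma> *v v) \<le> norm v * K0"
    using bounded_linear.pos_bounded[OF bounded_linear_mv] by blast
  \<comment> \<open>\<open>c\<close> dominates both coefficients of \<open>H1_rep_bound\<close>, and
    the factor 2 in \<open>C\<close> counts the two end points.\<close>
  define c where "c = max (1 / (hi \<Sigma> - lo \<Sigma>) + 2) 2"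
  define C where "C = 2 * (sqrt c * (M + K1 * (1 + K0 * M)))"
  have c: "c \<ge> 0" by (simp add: c_def)
  have "norm (bdry \<Sigma> x) \<le> C * (norm (emb I x) + norm (emb I (opL \<Sigma> x)))" if x: "x \<in> domL \<Sigma>" for x
  proof -
    let ?h = "H1_cont (lo \<Sigma>) (hi \<Sigma>) (HX \<Sigma> x)" and ?h' = "H1_deriv (lo \<Sigma>) (hi \<Sigma>) (HX \<Sigma> x)"
    define e where "e = norm (emb I x) + norm (emb I (opL \<Sigma> x))"
    note h = domL_rep[OF x]
    have hL: "?h \<in> L2 I" by (rule continuous_imp_L2[OF H1_rep_continuous[OF h]])
    have h'L: "?h' \<in> L2 I" by (rule H1_rep_L2[OF h])
    note hxL = HX_L2[OF domL_X[OF x]]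
    have "emb I ?h = emb I (HX \<Sigma> x)"
      using H1_rep_AE[OF h] by (subst emb_eq_iff[OF I_sets hL hxL]) (auto elim: eventually_mono)
    then have n1: "norm (emb I ?h) \<le> M * norm (emb I x)" using M(2)[OF domL_X[OF x]] by simp
    have P0L: "(\<lambda>\<zeta>. P0 \<Sigma> *v HX \<Sigma> x \<zeta>) \<in> L2 I" by (rule L2_linear[OF bounded_linear_mv hxL])
    have oL: "opL \<Sigma> x \<in> L2 I" using opL_X[OF x] by (simp add: X_L2)
    have "norm (emb I ?h') \<le> K1 * norm (emb I (\<lambda>\<zeta>. opL \<Sigma> x \<zeta> - P0 \<Sigma> *v HX \<Sigma> x \<zeta>))"
    proof (rule emb_norm_le[OF I_sets h'L L2_diff[OF oL P0L] _ less_imp_le[OF K1(1)]])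
      have "norm (?h' t) \<le> K1 * norm (opL \<Sigma> x t - P0 \<Sigma> *v HX \<Sigma> x t)" for t
        using K1(2)[of "P1 \<Sigma> *v ?h' t"] matrix_inv_mv[OF P1_inv] by (simp add: opL_def mult.commute)
      then show "AE t in lebesgue_on I. norm (?h' t) \<le> K1 * norm (opL \<Sigma> x t - P0 \<Sigma> *v HX \<Sigma> x t)" by simp
    qed
    also have "norm (emb I (\<lambda>\<zeta>. opL \<Sigma> x \<zeta> - P0 \<Sigma> *v HX \<Sigma> x \<zeta>)) \<le> norm (emb I (opL \<Sigma> x)) + norm (emb I (\<lambda>\<zeta>. P0 \<Sigma> *v HX \<Sigma> x \<zeta>))"
      unfolding emb_diff[OF I_sets oL P0L] by (rule norm_triangle_ineq4)
    also have "norm (emb I (\<lambda>\<zeta>. P0 \<Sigma> *v HX \<Sigma> x \<zeta>)) \<le> K0 * norm (emb I (HX \<Sigma> x))"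
      using K0 by (intro emb_norm_le[OF I_sets P0L hxL]) (auto simp: mult.commute)
    also have "norm (emb I (HX \<Sigma> x)) \<le> M * norm (emb I x)" by (rule M(2)[OF domL_X[OF x]])
    finally have "norm (emb I ?h') \<le> K1 * (norm (emb I (opL \<Sigma> x)) + K0 * (M * norm (emb I x)))"
      using K0(1) K1(1) by simp
    also have "\<dots> \<le> K1 * (e + K0 * (M * e))"
      using K0(1) K1(1) M(1) by (intro mult_left_mono add_mono) (auto simp: e_def)
    finally have n2: "norm (emb I ?h') \<le> K1 * (1 + K0 * M) * e" by (simp add: algebra_simps)
    have n1': "norm (emb I ?h) \<le> M * e" using n1 mult_left_mono[of "norm (emb I x)" e M] M(1) by (simp add: e_def)
    have b: "norm (?h t) \<le> sqrt c * (M + K1 * (1 + K0 * M)) * e" if t: "t \<in> I" for t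
    proof (rule power2_le_imp_le)
      have e0: "e \<ge> 0" by (simp add: e_def)
      have p: "(norm (emb I ?h))\<^sup>2 + (norm (emb I ?h'))\<^sup>2 \<le> (norm (emb I ?h) + norm (emb I ?h'))\<^sup>2"
        by (simp add: power2_sum)
      have "(norm (?h t))\<^sup>2 \<le> (1 / (hi \<Sigma> - lo \<Sigma>) + 2) * (norm (emb I ?h))\<^sup>2 + 2 * (norm (emb I ?h'))\<^sup>2"
        using H1_rep_bound[OF lo_hi h t] by (simp add: emb_norm[OF I_sets hL] emb_norm[OF I_sets h'L])
      also have "\<dots> \<le> c * (norm (emb I ?h))\<^sup>2 + c * (norm (emb I ?h'))\<^sup>2"
        by (intro add_mono mult_right_mono) (auto simp: c_def)
      also have "\<dots> \<le> c * (norm (emb I ?h) + norm (emb I ?h'))\<^sup>2"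
        using mult_left_mono[OF p c] by (simp add: distrib_left)
      also have "\<dots> \<le> c * (M * e + K1 * (1 + K0 * M) * e)\<^sup>2"
        using n1' n2 c by (intro mult_left_mono power_mono add_mono) auto
      also have "\<dots> = (sqrt c * (M + K1 * (1 + K0 * M)) * e)\<^sup>2"
        using c by (simp add: power_mult_distrib distrib_right[symmetric])
      finally show "(norm (?h t))\<^sup>2 \<le> (sqrt c * (M + K1 * (1 + K0 * M)) * e)\<^sup>2" .
      show "0 \<le> sqrt c * (M + K1 * (1 + K0 * M)) * e" using c e0 M(1) K0(1) K1(1) by simp
    qed
    have "norm (bdry \<Sigma> x) \<le> norm (?h (hi \<Sigma>)) + norm (?h (lo \<Sigma>))"
      unfolding bdry_def by (rule norm_stack_le)
    also have "\<dots> \<le> C * e" using b[of "hi \<Sigma>"] b[of "lo \<Sigma>"] lo_hi by (simp add: C_def)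
    finally show ?thesis by (simp add: e_def)
  qed
  moreover have "C \<ge> 0" using c M(1) K0(1) K1(1) by (simp add: C_def)
  ultimately show ?thesis by blast
qed

section \<open>The resolvent equation\<close>

lemma WB_zero: "WB \<Sigma> *v \<beta> = 0 \<Longrightarrow> WB1 \<Sigma> *v \<beta> = 0 \<and> WB2 \<Sigma> *v \<beta> = 0"
  by (auto simp: vec_eq_iff WB1_def WB2_def matrix_vector_mult_def)

text \<open>Coefficient of the resolvent equation in the unknown h = Hx: solving l x - L x = g for
  h' gives h' = Q h - P1^(-1) g.\<close>

definition Q :: "real \<Rightarrow> real \<Rightarrow> complex^'n^'n" where
  "Q l \<zeta> = matrix_inv (P1 \<Sigma>) ** (l *\<^sub>R matrix_inv (Ham \<Sigma> \<zeta>) - P0 \<Sigma>)"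

lemma Q_continuous: "continuous_on I (Q l)"
  unfolding Q_def
  by (intro bounded_bilinear.continuous_on[OF bounded_bilinear_mm] continuous_on_const continuous_on_diff
      continuous_on_scaleR continuous_on_matrix_inv Ham_continuous Ham_inv)

lemma resolvent_from_ode:
  assumes h: "H1_rep (lo \<Sigma>) (hi \<Sigma>) h h (\<lambda>t. Q l t *v h t - matrix_inv (P1 \<Sigma>) *v g t)"
    and bc: "WB \<Sigma> *v stack (h (hi \<Sigma>)) (h (lo \<Sigma>)) = 0"
  defines "x \<equiv> (\<lambda>\<zeta>. matrix_inv (Ham \<Sigma> \<zeta>) *v h \<zeta>)"
  shows "x \<in> domL \<Sigma>" "opG \<Sigma> x = 0" "AE \<zeta> in lebesgue_on I. l *\<^sub>R x \<zeta> - opL \<Sigma> x \<zeta> = g \<zeta>"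
proof -
  have "continuous_on I x"
    unfolding x_def
    by (intro bounded_bilinear.continuous_on[OF bounded_bilinear_mv] continuous_on_matrix_inv Ham_continuous
        Ham_inv H1_rep_continuous[OF h])
  then have xX: "x \<in> X \<Sigma>" unfolding X_L2 by (rule continuous_imp_L2)
  have hx: "HX \<Sigma> x \<zeta> = h \<zeta>" if "\<zeta> \<in> I" for \<zeta>
    using mv_matrix_inv[OF Ham_inv[OF that]] by (simp add: HX_def x_def)
  then have "AE \<zeta> in lebesgue_on I. HX \<Sigma> x \<zeta> = h \<zeta>" by (intro AE_I2) simp
  from H1_rep_cong[OF this] h
  have hr: "H1_rep (lo \<Sigma>) (hi \<Sigma>) (HX \<Sigma> x) h (\<lambda>t. Q l t *v h t - matrix_inv (P1 \<Sigma>) *v g t)" by simp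
  note D = domL_I[OF xX hr conjunct2[OF WB_zero[OF bc]]]
  show "x \<in> domL \<Sigma>" by (rule D(1))
  show "opG \<Sigma> x = 0" using WB_zero[OF bc] by (simp add: opG_def D(2))
  have "AE \<zeta> in lebesgue_on I. \<zeta> \<in> I" by (rule AE_I2) simp
  then show "AE \<zeta> in lebesgue_on I. l *\<^sub>R x \<zeta> - opL \<Sigma> x \<zeta> = g \<zeta>"
    using D(3)
  proof eventually_elim
    case (elim \<zeta>)
    have "P1 \<Sigma> *v (Q l \<zeta> *v h \<zeta> - matrix_inv (P1 \<Sigma>) *v g \<zeta>) = (l *\<^sub>R matrix_inv (Ham \<Sigma> \<zeta>) - P0 \<Sigma>) *v h \<zeta> - g \<zeta>"
      unfolding Q_def bounded_bilinear.diff_right[OF bounded_bilinear_mv] matrix_vector_mul_assoc[symmetric]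
      by (simp only: mv_matrix_inv[OF P1_inv])
    then have "opL \<Sigma> x \<zeta> = l *\<^sub>R x \<zeta> - g \<zeta>"
      using elim hx[of \<zeta>]
      by (simp add: x_def bounded_bilinear.diff_left[OF bounded_bilinear_mv] bounded_bilinear.scaleR_left[OF bounded_bilinear_mv])
    then show ?case by simp
  qed
qed

text \<open>Such an x satisfies l ip(x, x) = Re innerX(L x, x), and the right-hand side is not
  positive when the input vanishes.\<close>

lemma kernel_trivial:
  assumes l: "l > 0" and x: "x \<in> domL \<Sigma>" and G: "opG \<Sigma> x = 0"
    and eq: "AE \<zeta> in lebesgue_on I. l *\<^sub>R x \<zeta> - opL \<Sigma> x \<zeta> = 0"
  shows "AE \<zeta> in lebesgue_on I. x \<zeta> = 0"
proof -
  note xX = domL_X[OF x]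
  have xL: "x \<in> L2 I" using xX by (simp add: X_L2)
  have lx: "(\<lambda>\<zeta>. l *\<^sub>R x \<zeta>) \<in> X \<Sigma>" using xL by (simp add: X_L2 L2_scaleR)
  have "eqX \<Sigma> (opL \<Sigma> x) (\<lambda>\<zeta>. l *\<^sub>R x \<zeta>)" unfolding eqX_def using eq by eventually_elim simp
  then have "emb I (opL \<Sigma> x) = l *\<^sub>R emb I x"
    using eqX_iff[OF opL_X[OF x] lx] emb_scaleR[OF I_sets xL] by simp
  then have "Re (innerX \<Sigma> (opL \<Sigma> x) x) = l * ip (emb I x) (emb I x)"
    using ip_emb[OF opL_X[OF x] xX] by (simp add: E.ip_simps)
  moreover have "Re (innerX \<Sigma> (opL \<Sigma> x) x) \<le> 0"
  proof -
    have "2 * Re (innerX \<Sigma> (opL \<Sigma> x) x) \<le> 0 - (norm (opK \<Sigma> x))\<^sup>2" using dissipation[OF x] G by simp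
    moreover have "0 \<le> (norm (opK \<Sigma> x))\<^sup>2" by simp
    ultimately show ?thesis by linarith
  qed
  ultimately have "ip (emb I x) (emb I x) \<le> 0" using l by (simp add: mult_le_0_iff)
  then have "emb I x = 0" using E.ip_pos[of "emb I x"] by (cases "emb I x = 0") auto
  moreover have "emb I (\<lambda>\<zeta>. 0 :: complex^'n) = 0"
    using emb_scaleR[OF I_sets xL, of 0] by simp
  ultimately have "emb I x = emb I (\<lambda>\<zeta>. 0)" by simp
  then show ?thesis using emb_eq_iff[OF I_sets xL L2_zero] by simp
qed

lemma resolvent_solution:
  assumes l: "l > 0" and g: "g \<in> X \<Sigma>"
  shows "\<exists>x\<in>domL \<Sigma>. opG \<Sigma> x = 0 \<and> (AE \<zeta> in lebesgue_on I. l *\<^sub>R x \<zeta> - opL \<Sigma> x \<zeta> = g \<zeta>)"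
proof -
  have "\<forall>i::'n. \<exists>h. h (lo \<Sigma>) = axis i 1 \<and> H1_rep (lo \<Sigma>) (hi \<Sigma>) h h (\<lambda>t. Q l t *v h t + 0)"
    using linear_ode[OF lo_hi Q_continuous L2_zero] by blast
  then obtain \<phi> where \<phi>0: "\<And>i::'n. \<phi> i (lo \<Sigma>) = axis i 1"
    and \<phi>: "\<And>i. H1_rep (lo \<Sigma>) (hi \<Sigma>) (\<phi> i) (\<phi> i) (\<lambda>t. Q l t *v \<phi> i t)"
    by (auto simp: choice_iff)
  define s where "s c t = (\<Sum>i\<in>UNIV. c $ i *s \<phi> i t)" for c :: "complex^'n" and t
  have s0: "s c (lo \<Sigma>) = c" for c
    by (simp add: s_def \<phi>0 vec_eq_iff axis_def if_distrib[of "\<lambda>x. _ * x"] cong: if_cong)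
  have s: "H1_rep (lo \<Sigma>) (hi \<Sigma>) (s c) (s c) (\<lambda>t. Q l t *v s c t)" for c
  proof -
    have "H1_rep (lo \<Sigma>) (hi \<Sigma>) (s c) (s c) (\<lambda>t. \<Sum>i\<in>UNIV. c $ i *s (Q l t *v \<phi> i t))"
      unfolding s_def by (intro H1_rep_sum H1_rep_linear[OF \<phi> bounded_linear_scale]) simp
    moreover have "(\<Sum>i\<in>UNIV. c $ i *s (Q l t *v \<phi> i t)) = Q l t *v s c t" for t
      unfolding s_def linear_sum[OF bounded_linear.linear[OF bounded_linear_mv]] by (simp add: mv_scale)
    ultimately show ?thesis by simp
  qed
  \<comment> \<open>Column i holds the boundary conditions evaluated on the i-th fundamental
    solution. A kernel vector of \<open>N\<close> gives a solution of the homogeneous resolvent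
    problem, which vanishes.\<close>
  define N where "N = ((\<chi> j i. (WB \<Sigma> *v stack (\<phi> i (hi \<Sigma>)) (axis i 1)) $ j) :: complex^'n^'n)"
  have N: "N *v c = WB \<Sigma> *v stack (s c (hi \<Sigma>)) c" for c
  proof -
    have st: "stack (\<Sum>i\<in>A. f i) (\<Sum>i\<in>A. k i) = (\<Sum>i\<in>A. stack (f i) (k i))" if "finite A" for A and f k :: "'n \<Rightarrow> complex^'n"
      using that by (induction A rule: finite_induct)
        (simp_all add: stack_add[symmetric], simp add: vec_eq_iff stack_def split: sum.split)
    have "stack (s c (hi \<Sigma>)) c = stack (\<Sum>i\<in>UNIV. c $ i *s \<phi> i (hi \<Sigma>)) (\<Sum>i\<in>UNIV. c $ i *s axis i 1)"
      using s0[of c] by (simp add: s_def \<phi>0)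
    also have "\<dots> = (\<Sum>i\<in>UNIV. c $ i *s stack (\<phi> i (hi \<Sigma>)) (axis i 1))"
      by (simp add: st stack_scale)
    finally have eq: "WB \<Sigma> *v stack (s c (hi \<Sigma>)) c = (\<Sum>i\<in>UNIV. c $ i *s (WB \<Sigma> *v stack (\<phi> i (hi \<Sigma>)) (axis i 1)))"
      by (simp add: linear_sum[OF bounded_linear.linear[OF bounded_linear_mv]] mv_scale)
    have "(N *v c) $ j = (WB \<Sigma> *v stack (s c (hi \<Sigma>)) c) $ j" for j
    proof -
      have "(N *v c) $ j = (\<Sum>i\<in>UNIV. N $ j $ i * c $ i)" by (simp only: matrix_vector_mult_def vec_lambda_beta)
      also have "\<dots> = (\<Sum>i\<in>UNIV. c $ i * (WB \<Sigma> *v stack (\<phi> i (hi \<Sigma>)) (axis i 1)) $ j)"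
        by (simp add: N_def mult.commute)
      finally show ?thesis by (simp add: eq)
    qed
    then show ?thesis unfolding vec_eq_iff by blast
  qed
  have "invertible N"
    unfolding invertible_left_inverse matrix_left_invertible_ker
  proof (intro allI impI)
    fix c assume "N *v c = 0"
    then have bc: "WB \<Sigma> *v stack (s c (hi \<Sigma>)) (s c (lo \<Sigma>)) = 0" by (simp add: N s0)
    have h: "H1_rep (lo \<Sigma>) (hi \<Sigma>) (s c) (s c) (\<lambda>t. Q l t *v s c t - matrix_inv (P1 \<Sigma>) *v 0)" using s by simp
    note R = resolvent_from_ode[OF h bc]
    have "AE \<zeta> in lebesgue_on I. matrix_inv (Ham \<Sigma> \<zeta>) *v s c \<zeta> = 0"
      by (rule kernel_trivial[OF l R])
    moreover have "AE \<zeta> in lebesgue_on I. \<zeta> \<in> I" by (rule AE_I2) simp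
    ultimately have "AE \<zeta> in lebesgue_on I. s c \<zeta> = 0"
    proof eventually_elim
      case (elim \<zeta>)
      then show ?case using mv_matrix_inv[OF Ham_inv[of \<zeta>], of "s c \<zeta>"] by simp
    qed
    then have "s c (lo \<Sigma>) = 0"
      using continuous_eq_if_AE_eq[OF lo_hi H1_rep_continuous[OF s] continuous_on_const, of c 0 "lo \<Sigma>"] lo_hi by simp
    then show "c = 0" by (simp add: s0)
  qed
  have rL: "(\<lambda>t. - (matrix_inv (P1 \<Sigma>) *v g t)) \<in> L2 I"
    using g by (intro L2_uminus L2_linear[OF bounded_linear_mv]) (simp add: X_L2)
  obtain p where p0: "p (lo \<Sigma>) = 0" and p: "H1_rep (lo \<Sigma>) (hi \<Sigma>) p p (\<lambda>t. Q l t *v p t + - (matrix_inv (P1 \<Sigma>) *v g t))"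
    using linear_ode[OF lo_hi Q_continuous rL, of 0] by blast
  \<comment> \<open>The initial value whose homogeneous solution cancels the boundary defect of the
    particular solution \<open>p\<close>, which starts at 0.\<close>
  define c where "c = matrix_inv N *v (- (WB \<Sigma> *v stack (p (hi \<Sigma>)) 0))"
  have Nc: "N *v c = - (WB \<Sigma> *v stack (p (hi \<Sigma>)) 0)"
    unfolding c_def by (rule mv_matrix_inv[OF \<open>invertible N\<close>])
  define h where "h t = s c t + p t" for t
  have h: "H1_rep (lo \<Sigma>) (hi \<Sigma>) h h (\<lambda>t. Q l t *v h t - matrix_inv (P1 \<Sigma>) *v g t)"
    using H1_rep_add[OF s p] by (simp add: h_def[abs_def] matrix_vector_right_distrib add_diff_eq)
  have "WB \<Sigma> *v stack (h (hi \<Sigma>)) (h (lo \<Sigma>)) = 0"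
    using Nc by (simp add: h_def s0 p0 stack_add[of "s c (hi \<Sigma>)" c "p (hi \<Sigma>)" 0, simplified, symmetric] matrix_vector_right_distrib N)
  from resolvent_from_ode[OF h this] show ?thesis by blast
qed

text \<open>Membership constrains \<open>F\<close> on the interval only, and \<open>A0\<close>
  discards the rest. The generator is thus continued by zero to the complement, where it is
  trivially dissipative.\<close>

definition D0 :: "(complex^'n) l2 set" where
  "D0 = {F. rep_l2 F \<in> domL \<Sigma> \<and> opG \<Sigma> (rep_l2 F) = 0}"

definition A0 :: "(complex^'n) l2 \<Rightarrow> (complex^'n) l2" where
  "A0 F = emb I (opL \<Sigma> (rep_l2 F))"

lemma D0_I:
  assumes f: "f \<in> domL \<Sigma>" "opG \<Sigma> f = 0" and F: "emb I (rep_l2 F) = emb I f"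
  shows "F \<in> D0" "A0 F = emb I (opL \<Sigma> f)"
proof -
  have eq: "eqX \<Sigma> (rep_l2 F) f" using F by (simp add: eqX_iff domL_X f)
  note c = domL_cong[OF f(1) rep_X eq]
  show "F \<in> D0" using c f(2) by (simp add: D0_def opG_def)
  show "A0 F = emb I (opL \<Sigma> f)" using c(3) by (simp add: A0_def eqX_iff[OF opL_X[OF c(1)] opL_X[OF f(1)], symmetric])
qed

lemma m_dissipative_A0: "m_dissipative ip D0 A0"
proof (intro m_dissipative.intro m_dissipative_axioms.intro)
  show "energy ip" by (rule energy_ip)
  have add: "F + G \<in> D0" "A0 (F + G) = A0 F + A0 G" if "F \<in> D0" "G \<in> D0" for F G
  proof -
    have FG: "rep_l2 F \<in> domL \<Sigma>" "rep_l2 G \<in> domL \<Sigma>" "opG \<Sigma> (rep_l2 F) = 0" "opG \<Sigma> (rep_l2 G) = 0"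
      using that by (auto simp: D0_def)
    note d = domL_add[OF FG(1,2)]
    have e: "emb I (rep_l2 (F + G)) = emb I (\<lambda>\<zeta>. rep_l2 F \<zeta> + rep_l2 G \<zeta>)"
      by (simp add: emb_rep_add emb_add rep_L2)
    have G0: "opG \<Sigma> (\<lambda>\<zeta>. rep_l2 F \<zeta> + rep_l2 G \<zeta>) = 0" by (simp add: opG_add FG)
    show "F + G \<in> D0" by (rule D0_I(1)[OF d(1) G0 e])
    have "A0 (F + G) = emb I (\<lambda>\<zeta>. opL \<Sigma> (rep_l2 F) \<zeta> + opL \<Sigma> (rep_l2 G) \<zeta>)"
      using d(3) D0_I(2)[OF d(1) G0 e] by (simp add: eqX_iff opL_X d(1) X_add FG)
    then show "A0 (F + G) = A0 F + A0 G"
      using opL_X[OF FG(1)] opL_X[OF FG(2)] by (simp add: A0_def emb_add[OF I_sets] X_L2)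
  qed
  have scale: "r *\<^sub>R F \<in> D0" "A0 (r *\<^sub>R F) = r *\<^sub>R A0 F" if "F \<in> D0" for r F
  proof -
    have F: "rep_l2 F \<in> domL \<Sigma>" "opG \<Sigma> (rep_l2 F) = 0" using that by (auto simp: D0_def)
    note d = domL_scale[OF F(1), of "complex_of_real r", unfolded of_real_scale]
    have e: "emb I (rep_l2 (r *\<^sub>R F)) = emb I (\<lambda>\<zeta>. r *\<^sub>R rep_l2 F \<zeta>)"
      by (simp add: emb_rep_scaleR emb_scaleR rep_L2)
    have G0: "opG \<Sigma> (\<lambda>\<zeta>. r *\<^sub>R rep_l2 F \<zeta>) = 0"
      using opG_scale[OF F(1), of "complex_of_real r"] F(2) by (simp add: of_real_scale)
    show "r *\<^sub>R F \<in> D0" by (rule D0_I(1)[OF d(1) G0 e])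
    have "A0 (r *\<^sub>R F) = emb I (\<lambda>\<zeta>. r *\<^sub>R opL \<Sigma> (rep_l2 F) \<zeta>)"
      using d(3) D0_I(2)[OF d(1) G0 e] X_scale[OF opL_X[OF F(1)], of "complex_of_real r"]
      by (simp add: eqX_iff opL_X d(1) of_real_scale)
    then show "A0 (r *\<^sub>R F) = r *\<^sub>R A0 F"
      using opL_X[OF F(1)] by (simp add: A0_def emb_scaleR[OF I_sets] X_L2)
  qed
  have z: "0 \<in> D0"
  proof -
    obtain x where "x \<in> domL \<Sigma>" "opG \<Sigma> x = 0"
      using resolvent_solution[of 1 "\<lambda>\<zeta>. 0"] by (auto simp: X_L2)
    then have "emb I x \<in> D0" by (intro D0_I(1)[of x]) (simp_all add: emb_rep_emb domL_X[unfolded X_L2])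
    from scale(1)[OF this, of 0] show ?thesis by simp
  qed
  show "subspace D0" using z add(1) scale(1) by (simp add: subspace_def)
  show "A0 (F + G) = A0 F + A0 G" if "F \<in> D0" "G \<in> D0" for F G by (rule add(2)[OF that])
  show "A0 (r *\<^sub>R F) = r *\<^sub>R A0 F" if "F \<in> D0" for F r by (rule scale(2)[OF that])
  show "ip (A0 F) F \<le> 0" if "F \<in> D0" for F
  proof -
    have F: "rep_l2 F \<in> domL \<Sigma>" "opG \<Sigma> (rep_l2 F) = 0" using that by (auto simp: D0_def)
    have "ip (A0 F) F = ip F (emb I (opL \<Sigma> (rep_l2 F)))" by (simp add: A0_def E.sym)
    also have "\<dots> = Re (innerX \<Sigma> (rep_l2 F) (opL \<Sigma> (rep_l2 F)))"
      by (simp add: ip_emb_right opL_X F Re_innerX)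
    also have "\<dots> = Re (innerX \<Sigma> (opL \<Sigma> (rep_l2 F)) (rep_l2 F))"
      using arg_cong[OF cnj_innerX[OF rep_X opL_X[OF F(1)], of F], of Re] by simp
    also have "\<dots> \<le> 0"
    proof -
      have "2 * Re (innerX \<Sigma> (opL \<Sigma> (rep_l2 F)) (rep_l2 F)) \<le> 0 - (norm (opK \<Sigma> (rep_l2 F)))\<^sup>2"
        using dissipation[OF F(1)] F(2) by simp
      moreover have "0 \<le> (norm (opK \<Sigma> (rep_l2 F)))\<^sup>2" by simp
      ultimately show ?thesis by linarith
    qed
    finally show ?thesis .
  qed
  show "\<exists>F\<in>D0. l *\<^sub>R F - A0 F = G" if l: "l > 0" for l G
  proof -
    obtain x where x: "x \<in> domL \<Sigma>" "opG \<Sigma> x = 0" "AE \<zeta> in lebesgue_on I. l *\<^sub>R x \<zeta> - opL \<Sigma> x \<zeta> = rep_l2 G \<zeta>"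
      using resolvent_solution[OF l rep_X[of G]] by blast
    have xL: "x \<in> L2 I" "opL \<Sigma> x \<in> L2 I" using domL_X[OF x(1)] opL_X[OF x(1)] by (simp_all add: X_L2)
    define P where "P = emb I (rep_l2 G)"
    have PP: "emb I (rep_l2 P) = P" unfolding P_def by (rule emb_rep_emb[OF I_sets rep_L2[OF I_sets]])
    \<comment> \<open>On the interval the resolvent equation has the solution x. Outside it the
      operator is zero, so the equation is solved by dividing the remainder of \<open>G\<close> by
      \<open>l\<close>.\<close>
    define F where "F = emb I x + (1 / l) *\<^sub>R (G + (-1) *\<^sub>R P)"
    have "emb I (rep_l2 F) = emb I x"
      unfolding F_def emb_rep_add emb_rep_scaleR PP by (simp add: P_def emb_rep_emb[OF I_sets xL(1)])
    note F = D0_I[OF x(1,2) this]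
    have "l *\<^sub>R emb I x - emb I (opL \<Sigma> x) = P"
      unfolding P_def emb_scaleR[OF I_sets xL(1), symmetric] emb_diff[OF I_sets L2_scaleR[OF xL(1)] xL(2), symmetric]
      using x(3) by (subst emb_eq_iff[OF I_sets L2_diff[OF L2_scaleR[OF xL(1)] xL(2)] rep_L2[OF I_sets]])
    then have "l *\<^sub>R F - A0 F = G" using l unfolding F(2) by (simp add: F_def algebra_simps)
    with F(1) show ?thesis by blast
  qed
qed

sublocale A: m_dissipative ip D0 A0 by (rule m_dissipative_A0)

end

section \<open>Square-integrable functions of time\<close>

text \<open>Monotone convergence along the horizons [0, n]. Solutions are known to be
  square-integrable on bounded intervals only, whereas the cost lives on the half-line.\<close>

lemma nn_integral_Ici_SUP:
  fixes g :: "real \<Rightarrow> 'e::euclidean_space"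
  assumes g: "\<And>T. T \<ge> 0 \<Longrightarrow> g \<in> L2 {0..T}"
  shows "g \<in> borel_measurable (lebesgue_on {0..})"
    and "(\<integral>\<^sup>+t. ennreal ((norm (g t))\<^sup>2) \<partial>lebesgue_on {0..})
      = (SUP n. ennreal (LINT t|lebesgue_on {0..real n}. (norm (g t))\<^sup>2))"
proof -
  have m: "(\<lambda>t. indicator {0..real n} t *\<^sub>R g t) \<in> borel_measurable lebesgue" for n
    using L2_measurable[OF g[of "real n"]] borel_measurable_restrict_space_iff[of "{0..real n}" lebesgue g] by simp
  have lim: "(\<lambda>n. indicator {0..real n} t *\<^sub>R g t) \<longlonglongrightarrow> indicator {0..} t *\<^sub>R g t" for t
  proof -
    obtain N :: nat where N: "t \<le> real N" using real_arch_simple by blast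
    have "eventually (\<lambda>n. indicator {0..real n} t *\<^sub>R g t = indicator {0..} t *\<^sub>R g t) sequentially"
      using N by (intro eventually_sequentiallyI[of N]) (auto simp: indicator_def)
    then show ?thesis by (rule tendsto_eventually)
  qed
  have "(\<lambda>t. indicator {0..} t *\<^sub>R g t) \<in> borel_measurable lebesgue"
    by (rule borel_measurable_LIMSEQ_metric[OF m lim])
  then show "g \<in> borel_measurable (lebesgue_on {0..})"
    by (subst borel_measurable_restrict_space_iff) auto
  have e: "(\<integral>\<^sup>+t. ennreal ((norm (g t))\<^sup>2) * indicator {0..real n} t \<partial>lebesgue)
      = ennreal (LINT t|lebesgue_on {0..real n}. (norm (g t))\<^sup>2)" for n
    by (subst nn_integral_eq_integral[symmetric])
      (auto simp: nn_integral_restrict_space intro!: L2_integrable g)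
  have s: "ennreal ((norm (g t))\<^sup>2) * indicator {0..} t = (SUP n. ennreal ((norm (g t))\<^sup>2) * indicator {0..real n} t)" for t
  proof (rule antisym)
    obtain N :: nat where N: "t \<le> real N" using real_arch_simple by blast
    show "ennreal ((norm (g t))\<^sup>2) * indicator {0..} t \<le> (SUP n. ennreal ((norm (g t))\<^sup>2) * indicator {0..real n} t)"
      by (rule SUP_upper2[of N]) (use N in \<open>auto simp: indicator_def\<close>)
    show "(SUP n. ennreal ((norm (g t))\<^sup>2) * indicator {0..real n} t) \<le> ennreal ((norm (g t))\<^sup>2) * indicator {0..} t"
      by (rule SUP_least) (auto simp: indicator_def)
  qed
  have mm: "(\<lambda>t. ennreal ((norm (g t))\<^sup>2) * indicator {0..real n} t) \<in> borel_measurable lebesgue" for n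
  proof -
    have "(\<lambda>t. ennreal ((norm (indicator {0..real n} t *\<^sub>R g t))\<^sup>2)) \<in> borel_measurable lebesgue"
      using m by measurable
    moreover have "(\<lambda>t. ennreal ((norm (indicator {0..real n} t *\<^sub>R g t))\<^sup>2)) = (\<lambda>t. ennreal ((norm (g t))\<^sup>2) * indicator {0..real n} t)"
      by (rule ext) (auto simp: indicator_def)
    ultimately show ?thesis by (simp only:)
  qed
  have "(\<integral>\<^sup>+t. ennreal ((norm (g t))\<^sup>2) \<partial>lebesgue_on {0..}) = (\<integral>\<^sup>+t. ennreal ((norm (g t))\<^sup>2) * indicator {0..} t \<partial>lebesgue)"
    by (simp add: nn_integral_restrict_space)
  also have "\<dots> = (SUP n. \<integral>\<^sup>+t. ennreal ((norm (g t))\<^sup>2) * indicator {0..real n} t \<partial>lebesgue)"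
    unfolding s
    by (rule nn_integral_monotone_convergence_SUP[OF _ mm])
      (auto simp: incseq_def le_fun_def indicator_def)
  finally show "(\<integral>\<^sup>+t. ennreal ((norm (g t))\<^sup>2) \<partial>lebesgue_on {0..})
      = (SUP n. ennreal (LINT t|lebesgue_on {0..real n}. (norm (g t))\<^sup>2))"
    unfolding e .
qed

lemma L2_Ici_I:
  fixes g :: "real \<Rightarrow> 'e::euclidean_space"
  assumes g: "\<And>T. T \<ge> 0 \<Longrightarrow> g \<in> L2 {0..T}"
    and le: "\<And>T. T \<ge> 0 \<Longrightarrow> (LINT t|lebesgue_on {0..T}. (norm (g t))\<^sup>2) \<le> c" and c: "c \<ge> 0"
  shows "g \<in> L2 {0..}" "(LINT t|lebesgue_on {0..}. (norm (g t))\<^sup>2) \<le> c"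
proof -
  have m: "g \<in> borel_measurable (lebesgue_on {0..})" by (rule nn_integral_Ici_SUP(1)) (rule g)
  have S: "(\<integral>\<^sup>+t. ennreal ((norm (g t))\<^sup>2) \<partial>lebesgue_on {0..})
      = (SUP n. ennreal (LINT t|lebesgue_on {0..real n}. (norm (g t))\<^sup>2))"
    by (rule nn_integral_Ici_SUP(2)) (rule g)
  have nn: "(\<integral>\<^sup>+t. ennreal ((norm (g t))\<^sup>2) \<partial>lebesgue_on {0..}) \<le> ennreal c"
    unfolding S by (rule SUP_least) (simp add: le ennreal_leI)
  then have "(\<integral>\<^sup>+t. ennreal ((norm (g t))\<^sup>2) \<partial>lebesgue_on {0..}) < \<infinity>"
    by (rule le_less_trans) simp
  then have i: "integrable (lebesgue_on {0..}) (\<lambda>t. (norm (g t))\<^sup>2)"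
    using m by (intro integrableI_bounded) auto
  then show "g \<in> L2 {0..}" using m by (simp add: L2_def)
  have "ennreal (LINT t|lebesgue_on {0..}. (norm (g t))\<^sup>2) \<le> ennreal c"
    using nn by (subst nn_integral_eq_integral[symmetric]) (use i in auto)
  then show "(LINT t|lebesgue_on {0..}. (norm (g t))\<^sup>2) \<le> c" using c by simp
qed

lemma L2_LINT_mono:
  fixes g :: "real \<Rightarrow> 'e::euclidean_space"
  assumes g: "g \<in> L2 T" and ST: "S \<subseteq> T" "S \<in> sets lebesgue" "T \<in> sets lebesgue"
  shows "(LINT t|lebesgue_on S. (norm (g t))\<^sup>2) \<le> (LINT t|lebesgue_on T. (norm (g t))\<^sup>2)"
proof -
  have i: "integrable lebesgue (\<lambda>t. indicator S t *\<^sub>R (norm (g t))\<^sup>2)" "integrable lebesgue (\<lambda>t. indicator T t *\<^sub>R (norm (g t))\<^sup>2)"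
    using L2_integrable[OF L2_subset[OF g ST]] L2_integrable[OF g] ST
    by (simp_all add: integrable_restrict_space)
  have "(LINT t|lebesgue. indicator S t *\<^sub>R (norm (g t))\<^sup>2) \<le> (LINT t|lebesgue. indicator T t *\<^sub>R (norm (g t))\<^sup>2)"
    by (rule integral_mono[OF i]) (use ST in \<open>auto simp: indicator_def\<close>)
  then show ?thesis using ST by (simp add: integral_restrict_space)
qed

text \<open>Cutting off outside \<open>S\<close> is an orthogonal projection that fixes every
  \<open>emb S (f n)\<close>. So it does not increase the distance to \<open>F\<close> and has to
  fix the limit as well.\<close>

lemma L2_closed_emb:
  fixes f :: "nat \<Rightarrow> real \<Rightarrow> 'e::euclidean_space"
  assumes S: "S \<in> sets lebesgue" and f: "\<And>n. f n \<in> L2 S" and lim: "(\<lambda>n. emb S (f n)) \<longlonglongrightarrow> F"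
  shows "emb S (rep_l2 F) = F"
proof -
  have *: "norm (emb S (f n) - emb S (rep_l2 F)) \<le> norm (emb S (f n) - F)" for n
  proof -
    define g where "g = (\<lambda>t. f n t - rep_l2 F t)"
    have g: "g \<in> L2 S" unfolding g_def by (rule L2_diff[OF f rep_L2[OF S]])
    let ?G = "emb S (f n) - F"
    have "norm (emb S g) * norm (emb S g) = emb S g \<bullet> emb S g" by (simp add: power2_norm_eq_inner[symmetric] power2_eq_square)
    also have "\<dots> = ?G \<bullet> emb S g"
    proof -
      have "F \<bullet> emb S g = (LINT t|lebesgue_on S. rep_l2 F t \<bullet> g t)" by (rule inner_emb_right[OF S g])
      also have "\<dots> = emb S (rep_l2 F) \<bullet> emb S g" by (rule emb_inner[OF S rep_L2[OF S] g, symmetric])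
      finally show ?thesis by (simp add: g_def emb_diff[OF S f rep_L2[OF S]] inner_diff_left)
    qed
    also have "\<dots> \<le> norm ?G * norm (emb S g)" by (rule norm_cauchy_schwarz)
    finally have le: "norm (emb S g) * norm (emb S g) \<le> norm ?G * norm (emb S g)" .
    have "norm (emb S g) \<le> norm ?G"
    proof (cases "emb S g = 0")
      case False
      then have "0 < norm (emb S g)" by simp
      from mult_right_le_imp_le[OF le this] show ?thesis .
    qed simp
    then show ?thesis by (simp add: g_def emb_diff[OF S f rep_L2[OF S]])
  qed
  have "(\<lambda>n. norm (emb S (f n) - F)) \<longlonglongrightarrow> 0" using lim by (simp add: tendsto_norm_zero LIM_zero)
  then have "(\<lambda>n. emb S (f n) - emb S (rep_l2 F)) \<longlonglongrightarrow> 0"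
    by (rule Lim_null_comparison[rotated]) (simp add: *)
  then have "(\<lambda>n. emb S (f n)) \<longlonglongrightarrow> emb S (rep_l2 F)" by (simp add: LIM_zero_iff)
  from LIMSEQ_unique[OF this lim] show ?thesis .
qed

text \<open>Bridge to \<open>C1_X\<close> and \<open>generator_graph\<close>, which speak of
  difference quotients.\<close>

lemma has_vector_derivative_iff_quotient:
  "(f has_vector_derivative d) (at t within S) \<longleftrightarrow> ((\<lambda>s. (f s - f t) /\<^sub>R (s - t)) \<longlongrightarrow> d) (at t within S)"
  for f :: "real \<Rightarrow> 'a::real_normed_vector"
proof -
  have e: "norm ((1 / norm (s - t)) *\<^sub>R (f s - (f t + (s - t) *\<^sub>R d))) = norm ((f s - f t) /\<^sub>R (s - t) - d)" if "s \<noteq> t" for s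
  proof -
    have "(f s - f t) /\<^sub>R (s - t) - d = (1 / (s - t)) *\<^sub>R (f s - (f t + (s - t) *\<^sub>R d))"
      using that by (simp add: scaleR_diff_right scaleR_add_right divide_inverse diff_diff_eq)
    then show ?thesis by (simp only: norm_scaleR) (simp add: divide_inverse)
  qed
  have "(f has_vector_derivative d) (at t within S) \<longleftrightarrow>
      ((\<lambda>s. norm ((1 / norm (s - t)) *\<^sub>R (f s - (f t + (s - t) *\<^sub>R d)))) \<longlongrightarrow> 0) (at t within S)"
    by (simp only: has_vector_derivative_def has_derivative_within bounded_linear_scaleR_left tendsto_norm_zero_iff simp_thms)
  also have "\<dots> \<longleftrightarrow> ((\<lambda>s. norm ((f s - f t) /\<^sub>R (s - t) - d)) \<longlongrightarrow> 0) (at t within S)"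
    by (rule Lim_cong_within) (use e in auto)
  finally show ?thesis by (simp add: tendsto_norm_zero_iff LIM_zero_iff)
qed

context port_hamiltonian_node
begin

section \<open>Classical solutions\<close>

lemma emb_X_simps:
  "f \<in> X \<Sigma> \<Longrightarrow> g \<in> X \<Sigma> \<Longrightarrow> emb I (\<lambda>\<zeta>. f \<zeta> + g \<zeta>) = emb I f + emb I g"
  "f \<in> X \<Sigma> \<Longrightarrow> g \<in> X \<Sigma> \<Longrightarrow> emb I (\<lambda>\<zeta>. f \<zeta> - g \<zeta>) = emb I f - emb I g"
  "f \<in> X \<Sigma> \<Longrightarrow> emb I (\<lambda>\<zeta>. r *\<^sub>R f \<zeta>) = r *\<^sub>R emb I f"
  "f \<in> X \<Sigma> \<Longrightarrow> emb I (rep_l2 (emb I f)) = emb I f"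
  by (simp_all add: X_L2 emb_add emb_diff emb_scaleR emb_rep_emb)

lemma normX_diff: "f \<in> X \<Sigma> \<Longrightarrow> g \<in> X \<Sigma> \<Longrightarrow> normX \<Sigma> (\<lambda>\<zeta>. f \<zeta> - g \<zeta>) = E.en (emb I f - emb I g)"
  by (simp add: en_emb[symmetric] X_diff emb_X_simps)

lemma quotient_normX:
  assumes "f \<in> X \<Sigma>" "g \<in> X \<Sigma>" "h \<in> X \<Sigma>"
  shows "normX \<Sigma> (\<lambda>\<zeta>. (f \<zeta> - g \<zeta>) /\<^sub>R r - h \<zeta>) = E.en ((emb I f - emb I g) /\<^sub>R r - emb I h)"
proof -
  have q: "(\<lambda>\<zeta>. (f \<zeta> - g \<zeta>) /\<^sub>R r) \<in> X \<Sigma>" using assms by (simp add: X_L2 L2_scaleR L2_diff)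
  show ?thesis using assms by (simp add: normX_diff[OF q assms(3)] emb_X_simps X_diff)
qed

lemma tendsto_within_cong: "(\<And>s. s \<in> S \<Longrightarrow> f s = g s) \<Longrightarrow> (f \<longlongrightarrow> l) (at t within S) \<longleftrightarrow> (g \<longlongrightarrow> l) (at t within S)"
  by (rule Lim_cong_within) auto

lemma C1_X_iff:
  assumes x: "\<And>t. t \<ge> 0 \<Longrightarrow> x t \<in> X \<Sigma>" and x': "\<And>t. t \<ge> 0 \<Longrightarrow> x' t \<in> X \<Sigma>"
  shows "C1_X \<Sigma> x x' \<longleftrightarrow>
    (\<forall>t\<ge>0. ((\<lambda>s. emb I (x s)) has_vector_derivative emb I (x' t)) (at t within {0..})) \<and>
    continuous_on {0..} (\<lambda>t. emb I (x' t))"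
proof -
  have 1: "((\<lambda>s. normX \<Sigma> (\<lambda>\<zeta>. (x s \<zeta> - x t \<zeta>) /\<^sub>R (s - t) - x' t \<zeta>)) \<longlongrightarrow> 0) (at t within {0..}) \<longleftrightarrow>
      ((\<lambda>s. emb I (x s)) has_vector_derivative emb I (x' t)) (at t within {0..})" if "t \<ge> 0" for t
    unfolding has_vector_derivative_iff_quotient E.tendsto_iff_en
    by (rule tendsto_within_cong) (use that x x' in \<open>simp add: quotient_normX\<close>)
  have 2: "((\<lambda>s. normX \<Sigma> (\<lambda>\<zeta>. x' s \<zeta> - x' t \<zeta>)) \<longlongrightarrow> 0) (at t within {0..}) \<longleftrightarrow>
      ((\<lambda>s. emb I (x' s)) \<longlongrightarrow> emb I (x' t)) (at t within {0..})" if "t \<ge> 0" for t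
    unfolding E.tendsto_iff_en
    by (rule tendsto_within_cong) (use that x' in \<open>simp add: normX_diff\<close>)
  show ?thesis
    unfolding C1_X_def continuous_on_def using 1 2 x x' by auto
qed

text \<open>The derivative is determined almost everywhere by \<open>opL\<close>, so the existential
  quantifier disappears and the condition becomes differentiability of a curve in
  \<open>l2\<close>.\<close>

lemma classical_solution_iff:
  "classical_solution \<Sigma> x u y \<longleftrightarrow>
    continuous_on {0..} u \<and> continuous_on {0..} y \<and>
    (\<forall>t\<ge>0. x t \<in> domL \<Sigma> \<and> opG \<Sigma> (x t) = u t \<and> y t = opK \<Sigma> (x t) \<and>
      ((\<lambda>s. emb I (x s)) has_vector_derivative emb I (opL \<Sigma> (x t))) (at t within {0..})) \<and>
    continuous_on {0..} (\<lambda>t. emb I (opL \<Sigma> (x t)))" (is "?L \<longleftrightarrow> ?R")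
proof
  assume ?L
  then obtain x' where uy: "continuous_on {0..} u" "continuous_on {0..} y" and C: "C1_X \<Sigma> x x'"
    and *: "\<And>t. t \<ge> 0 \<Longrightarrow> x t \<in> domL \<Sigma> \<and> eqX \<Sigma> (x' t) (opL \<Sigma> (x t)) \<and> opG \<Sigma> (x t) = u t \<and> y t = opK \<Sigma> (x t)"
    unfolding classical_solution_def by blast
  have x': "x' t \<in> X \<Sigma>" if "t \<ge> 0" for t using C that by (simp add: C1_X_def)
  have e: "emb I (x' t) = emb I (opL \<Sigma> (x t))" if "t \<ge> 0" for t
    using *[OF that] eqX_iff[OF x'[OF that] opL_X] by blast
  have C': "\<forall>t\<ge>0. ((\<lambda>s. emb I (x s)) has_vector_derivative emb I (x' t)) (at t within {0..})"
    "continuous_on {0..} (\<lambda>t. emb I (x' t))"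
    using C C1_X_iff[of x x'] * x' domL_X by blast+
  have "continuous_on {0..} (\<lambda>t. emb I (opL \<Sigma> (x t)))"
    using C'(2) by (rule continuous_on_eq) (simp add: e)
  then show ?R using uy * C'(1) e by auto
next
  assume R: ?R
  have "C1_X \<Sigma> x (\<lambda>t. opL \<Sigma> (x t))"
    using R by (subst C1_X_iff) (auto intro: domL_X opL_X)
  then show ?L using R unfolding classical_solution_def eqX_def by (auto intro!: exI[of _ "\<lambda>t. opL \<Sigma> (x t)"])
qed

lemma classical_D:
  assumes "classical_solution \<Sigma> x u y"
  shows "continuous_on {0..} u" "continuous_on {0..} y"
    "t \<ge> 0 \<Longrightarrow> x t \<in> domL \<Sigma>" "t \<ge> 0 \<Longrightarrow> opG \<Sigma> (x t) = u t" "t \<ge> 0 \<Longrightarrow> opK \<Sigma> (x t) = y t"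
    "t \<ge> 0 \<Longrightarrow> ((\<lambda>s. emb I (x s)) has_vector_derivative emb I (opL \<Sigma> (x t))) (at t within {0..})"
    "continuous_on {0..} (\<lambda>t. emb I (opL \<Sigma> (x t)))" "t \<ge> 0 \<Longrightarrow> x t \<in> X \<Sigma>"
  using assms domL_X unfolding classical_solution_iff by auto

lemma classical_add:
  assumes 1: "classical_solution \<Sigma> x u y" and 2: "classical_solution \<Sigma> x2 u2 y2"
  shows "classical_solution \<Sigma> (\<lambda>t \<zeta>. x t \<zeta> + x2 t \<zeta>) (\<lambda>t. u t + u2 t) (\<lambda>t. y t + y2 t)"
proof -
  note D1 = classical_D[OF 1] and D2 = classical_D[OF 2]
  have L: "emb I (opL \<Sigma> (\<lambda>\<zeta>. x t \<zeta> + x2 t \<zeta>)) = emb I (opL \<Sigma> (x t)) + emb I (opL \<Sigma> (x2 t))" if t: "t \<ge> 0" for t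
  proof -
    note d = domL_add[OF D1(3)[OF t] D2(3)[OF t]]
    show ?thesis
      using d(3) t by (simp add: eqX_iff[OF opL_X[OF d(1)] X_add[OF opL_X[OF D1(3)[OF t]] opL_X[OF D2(3)[OF t]]]] emb_X_simps opL_X D1 D2)
  qed
  have der: "((\<lambda>s. emb I (\<lambda>\<zeta>. x s \<zeta> + x2 s \<zeta>)) has_vector_derivative emb I (opL \<Sigma> (\<lambda>\<zeta>. x t \<zeta> + x2 t \<zeta>))) (at t within {0..})" if t: "t \<ge> 0" for t
    unfolding L[OF t]
    by (rule has_vector_derivative_transform[OF _ _ has_vector_derivative_add[OF D1(6)[OF t] D2(6)[OF t]]])
      (use t D1(8) D2(8) in \<open>auto simp: emb_X_simps\<close>)
  have c: "continuous_on {0..} (\<lambda>t. emb I (opL \<Sigma> (\<lambda>\<zeta>. x t \<zeta> + x2 t \<zeta>)))"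
    by (rule continuous_on_eq[OF continuous_on_add[OF D1(7) D2(7)]]) (simp add: L)
  show ?thesis
    unfolding classical_solution_iff
    using der c D1 D2 by (auto intro!: continuous_on_add domL_add simp: opG_add opK_add)
qed

lemma classical_scale:
  assumes 1: "classical_solution \<Sigma> x u y"
  shows "classical_solution \<Sigma> (\<lambda>t \<zeta>. c *s x t \<zeta>) (\<lambda>t. c *s u t) (\<lambda>t. c *s y t)"
proof -
  note D1 = classical_D[OF 1]
  \<comment> \<open>\<open>l2\<close> is a real space. Multiplication by the complex scalar is
    realized as a bounded real-linear map, through which derivatives and continuity pass.\<close>
  define m where "m F = emb I (\<lambda>\<zeta>. c *s rep_l2 F \<zeta>)" for F :: "(complex^'n) l2"
  have m: "m (emb I f) = emb I (\<lambda>\<zeta>. c *s f \<zeta>)" if "f \<in> X \<Sigma>" for f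
  proof -
    have "AE \<zeta> in lebesgue_on I. rep_l2 (emb I f) \<zeta> = f \<zeta>" using that by (intro rep_emb) (auto simp: X_L2)
    then have "eqX \<Sigma> (\<lambda>\<zeta>. c *s rep_l2 (emb I f) \<zeta>) (\<lambda>\<zeta>. c *s f \<zeta>)" unfolding eqX_def by eventually_elim simp
    then show ?thesis using that by (simp add: m_def eqX_iff X_scale)
  qed
  have bl: "bounded_linear m"
  proof (rule bounded_linear_intro[of _ "norm c"])
    fix F G :: "(complex^'n) l2" and r :: real
    have "AE \<zeta> in lebesgue_on I. rep_l2 (F + G) \<zeta> = rep_l2 F \<zeta> + rep_l2 G \<zeta>" by (rule AE_lebesgue_imp_on[OF I_sets rep_l2_add])
    then have "eqX \<Sigma> (\<lambda>\<zeta>. c *s rep_l2 (F + G) \<zeta>) (\<lambda>\<zeta>. c *s rep_l2 F \<zeta> + c *s rep_l2 G \<zeta>)"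
      unfolding eqX_def by eventually_elim (simp add: vector_add_ldistrib)
    then show "m (F + G) = m F + m G" by (simp add: m_def eqX_iff X_scale X_add emb_X_simps)
    have "AE \<zeta> in lebesgue_on I. rep_l2 (r *\<^sub>R F) \<zeta> = r *\<^sub>R rep_l2 F \<zeta>" by (rule AE_lebesgue_imp_on[OF I_sets rep_l2_scaleR])
    then have "AE \<zeta> in lebesgue_on I. c *s rep_l2 (r *\<^sub>R F) \<zeta> = r *\<^sub>R (c *s rep_l2 F \<zeta>)"
      by eventually_elim (simp add: of_real_scale[symmetric] mult.commute)
    then show "m (r *\<^sub>R F) = r *\<^sub>R m F"
      unfolding m_def emb_X_simps(3)[OF X_scale[OF rep_X], symmetric]
      by (subst emb_eq_iff[OF I_sets]) (auto intro!: L2_scaleR L2_linear[OF bounded_linear_scale] rep_L2)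
    have "norm (m F) \<le> norm c * norm (emb I (rep_l2 F))"
      unfolding m_def
    proof (rule emb_norm_le[OF I_sets L2_linear[OF bounded_linear_scale rep_L2[OF I_sets]] rep_L2[OF I_sets]])
      have "norm (c *s v) = norm c * norm v" for v :: "complex^'n"
        by (simp add: norm_vec_def L2_set_def norm_mult power_mult_distrib sum_distrib_left[symmetric] real_sqrt_mult)
      then show "AE t in lebesgue_on I. norm (c *s rep_l2 F t) \<le> norm c * norm (rep_l2 F t)" by simp
    qed simp
    then show "norm (m F) \<le> norm F * norm c"
      using mult_left_mono[OF norm_emb_rep_le[of F] norm_ge_zero[of c]] by (simp add: mult.commute)
  qed
  have L: "emb I (opL \<Sigma> (\<lambda>\<zeta>. c *s x t \<zeta>)) = m (emb I (opL \<Sigma> (x t)))" if t: "t \<ge> 0" for t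
  proof -
    note d = domL_scale[OF D1(3)[OF t], of c]
    show ?thesis
      using d(3) t by (simp add: eqX_iff[OF opL_X[OF d(1)] X_scale[OF opL_X[OF D1(3)[OF t]]]] m opL_X D1)
  qed
  have der: "((\<lambda>s. emb I (\<lambda>\<zeta>. c *s x s \<zeta>)) has_vector_derivative emb I (opL \<Sigma> (\<lambda>\<zeta>. c *s x t \<zeta>))) (at t within {0..})" if t: "t \<ge> 0" for t
    unfolding L[OF t]
    by (rule has_vector_derivative_transform[OF _ _ bounded_linear.has_vector_derivative[OF bl D1(6)[OF t]]])
      (use t D1(8) in \<open>auto simp: m\<close>)
  have c: "continuous_on {0..} (\<lambda>t. emb I (opL \<Sigma> (\<lambda>\<zeta>. c *s x t \<zeta>)))"
    by (rule continuous_on_eq[OF bounded_linear.continuous_on[OF bl D1(7)]]) (simp add: L)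
  show ?thesis
    unfolding classical_solution_iff
    using der c D1 by (auto intro!: bounded_linear.continuous_on[OF bounded_linear_scale] domL_scale simp: opG_scale opK_scale)
qed

lemma classical_diff:
  assumes 1: "classical_solution \<Sigma> x u y" and 2: "classical_solution \<Sigma> x2 u2 y2"
  shows "classical_solution \<Sigma> (\<lambda>t \<zeta>. x t \<zeta> - x2 t \<zeta>) (\<lambda>t. u t - u2 t) (\<lambda>t. y t - y2 t)"
  using classical_add[OF 1 classical_scale[OF 2, of "-1"]] by (simp add: vector_sneg_minus1[symmetric])

lemma classical_shift:
  assumes 1: "classical_solution \<Sigma> x u y" and r: "r \<ge> 0"
  shows "classical_solution \<Sigma> (\<lambda>t. x (r + t)) (\<lambda>t. u (r + t)) (\<lambda>t. y (r + t))"
proof -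
  note D1 = classical_D[OF 1]
  have c: "continuous_on {0..} (\<lambda>t. r + t)" "(\<lambda>t. r + t) ` {0..} \<subseteq> {0..}"
    using r by (auto intro!: continuous_intros)
  have der: "((\<lambda>s. emb I (x (r + s))) has_vector_derivative emb I (opL \<Sigma> (x (r + t)))) (at t within {0..})" if t: "t \<ge> 0" for t
  proof -
    have "((\<lambda>s. r + s) has_vector_derivative 1) (at t within {0..})"
      by (auto intro!: derivative_eq_intros simp: has_real_derivative_iff_has_vector_derivative[symmetric])
    moreover have "((\<lambda>s. emb I (x s)) has_vector_derivative emb I (opL \<Sigma> (x (r + t)))) (at (r + t) within (\<lambda>s. r + s) ` {0..})"
      by (rule has_vector_derivative_within_subset[OF D1(6) c(2)]) (use r t in simp)
    ultimately show ?thesis using vector_diff_chain_within[of "\<lambda>s. r + s" 1 t "{0..}" "\<lambda>s. emb I (x s)"] by (simp add: o_def)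
  qed
  show ?thesis
    unfolding classical_solution_iff
    using der D1 r continuous_on_compose2[OF D1(1) c] continuous_on_compose2[OF D1(2) c] continuous_on_compose2[OF D1(7) c]
    by auto
qed

lemma classical_energy_derivative:
  assumes 1: "classical_solution \<Sigma> x u y" and t: "t \<ge> 0"
  shows "((\<lambda>s. (normX \<Sigma> (x s))\<^sup>2) has_real_derivative 2 * Re (innerX \<Sigma> (opL \<Sigma> (x t)) (x t))) (at t within {0..})"
proof -
  note D1 = classical_D[OF 1]
  have "((\<lambda>s. ip (emb I (x s)) (emb I (x s))) has_vector_derivative
      ip (emb I (x t)) (emb I (opL \<Sigma> (x t))) + ip (emb I (opL \<Sigma> (x t))) (emb I (x t))) (at t within {0..})"
    by (rule bounded_bilinear.has_vector_derivative[OF E.bil D1(6)[OF t] D1(6)[OF t]])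
  moreover have "ip (emb I (x t)) (emb I (opL \<Sigma> (x t))) + ip (emb I (opL \<Sigma> (x t))) (emb I (x t))
      = 2 * Re (innerX \<Sigma> (opL \<Sigma> (x t)) (x t))"
    using E.sym[of "emb I (x t)"] ip_emb[OF opL_X[OF D1(3)[OF t]] D1(8)[OF t]] by simp
  ultimately have "((\<lambda>s. ip (emb I (x s)) (emb I (x s))) has_vector_derivative 2 * Re (innerX \<Sigma> (opL \<Sigma> (x t)) (x t))) (at t within {0..})"
    by simp
  then have "((\<lambda>s. (normX \<Sigma> (x s))\<^sup>2) has_vector_derivative 2 * Re (innerX \<Sigma> (opL \<Sigma> (x t)) (x t))) (at t within {0..})"
    by (rule has_vector_derivative_transform[rotated 2]) (use t D1(8) in \<open>auto simp: en_emb[symmetric] E.en_sq\<close>)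
  then show ?thesis by (simp add: has_real_derivative_iff_has_vector_derivative)
qed

lemma classical_energy_integral:
  assumes 1: "classical_solution \<Sigma> x u y" and t: "t \<ge> 0"
  shows "((\<lambda>s. 2 * Re (innerX \<Sigma> (opL \<Sigma> (x s)) (x s))) has_integral (normX \<Sigma> (x t))\<^sup>2 - (normX \<Sigma> (x 0))\<^sup>2) {0..t}"
    "((\<lambda>s. (norm (u s))\<^sup>2 - (norm (y s))\<^sup>2) has_integral
      integral {0..t} (\<lambda>s. (norm (u s))\<^sup>2) - integral {0..t} (\<lambda>s. (norm (y s))\<^sup>2)) {0..t}"
proof -
  note D1 = classical_D[OF 1]
  have cu: "continuous_on {0..t} (\<lambda>s. (norm (u s))\<^sup>2)" and cy: "continuous_on {0..t} (\<lambda>s. (norm (y s))\<^sup>2)"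
    by (intro continuous_intros continuous_on_subset[OF D1(1)] continuous_on_subset[OF D1(2)]; auto)+
  show "((\<lambda>s. (norm (u s))\<^sup>2 - (norm (y s))\<^sup>2) has_integral
      integral {0..t} (\<lambda>s. (norm (u s))\<^sup>2) - integral {0..t} (\<lambda>s. (norm (y s))\<^sup>2)) {0..t}"
    by (intro has_integral_diff integrable_integral integrable_continuous_real cu cy)
  show "((\<lambda>s. 2 * Re (innerX \<Sigma> (opL \<Sigma> (x s)) (x s))) has_integral (normX \<Sigma> (x t))\<^sup>2 - (normX \<Sigma> (x 0))\<^sup>2) {0..t}"
  proof (rule fundamental_theorem_of_calculus[OF t])
    fix s assume "s \<in> {0..t}"
    then have "((\<lambda>s. (normX \<Sigma> (x s))\<^sup>2) has_real_derivative 2 * Re (innerX \<Sigma> (opL \<Sigma> (x s)) (x s))) (at s within {0..t})"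
      by (intro DERIV_subset[OF classical_energy_derivative[OF 1]]) auto
    then show "((\<lambda>s. (normX \<Sigma> (x s))\<^sup>2) has_vector_derivative 2 * Re (innerX \<Sigma> (opL \<Sigma> (x s)) (x s))) (at s within {0..t})"
      by (simp add: has_real_derivative_iff_has_vector_derivative)
  qed
qed

lemma classical_energy:
  assumes 1: "classical_solution \<Sigma> x u y" and t: "t \<ge> 0"
  shows "(normX \<Sigma> (x t))\<^sup>2 + integral {0..t} (\<lambda>s. (norm (y s))\<^sup>2) \<le> (normX \<Sigma> (x 0))\<^sup>2 + integral {0..t} (\<lambda>s. (norm (u s))\<^sup>2)"
proof -
  have "2 * Re (innerX \<Sigma> (opL \<Sigma> (x s)) (x s)) \<le> (norm (u s))\<^sup>2 - (norm (y s))\<^sup>2" if "s \<in> {0..t}" for s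
    using dissipation[OF classical_D(3)[OF 1, of s]] classical_D(4,5)[OF 1, of s] that by simp
  from has_integral_le[OF classical_energy_integral[OF 1 t] this] show ?thesis by simp
qed

lemma bdry_diff:
  assumes "x \<in> domL \<Sigma>" "y \<in> domL \<Sigma>"
  shows "(\<lambda>\<zeta>. x \<zeta> - y \<zeta>) \<in> domL \<Sigma>" "bdry \<Sigma> (\<lambda>\<zeta>. x \<zeta> - y \<zeta>) = bdry \<Sigma> x - bdry \<Sigma> y"
    "emb I (opL \<Sigma> (\<lambda>\<zeta>. x \<zeta> - y \<zeta>)) = emb I (opL \<Sigma> x) - emb I (opL \<Sigma> y)"
proof -
  have m: "(\<lambda>\<zeta>. x \<zeta> + (-1) *s y \<zeta>) = (\<lambda>\<zeta>. x \<zeta> - y \<zeta>)" by (simp add: vector_sneg_minus1[symmetric])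
  note s = domL_scale[OF assms(2), of "-1"]
  note a = domL_add[OF assms(1) s(1), unfolded m]
  show "(\<lambda>\<zeta>. x \<zeta> - y \<zeta>) \<in> domL \<Sigma>" by (rule a(1))
  show "bdry \<Sigma> (\<lambda>\<zeta>. x \<zeta> - y \<zeta>) = bdry \<Sigma> x - bdry \<Sigma> y"
    using a(2) s(2) by (simp add: vector_sneg_minus1[symmetric])
  have "eqX \<Sigma> (opL \<Sigma> (\<lambda>\<zeta>. x \<zeta> - y \<zeta>)) (\<lambda>\<zeta>. opL \<Sigma> x \<zeta> - opL \<Sigma> y \<zeta>)"
    using a(3) s(3) unfolding eqX_def by eventually_elim (simp add: vector_sneg_minus1[symmetric])
  then show "emb I (opL \<Sigma> (\<lambda>\<zeta>. x \<zeta> - y \<zeta>)) = emb I (opL \<Sigma> x) - emb I (opL \<Sigma> y)"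
    using assms a(1) by (simp add: eqX_iff opL_X X_diff emb_X_simps)
qed

text \<open>The trace bound is applied to the difference of the states at two times, which again
  lies in the domain.\<close>

lemma bdry_continuous:
  fixes x :: "real \<Rightarrow> real \<Rightarrow> complex^'n"
  assumes x: "\<And>t. t \<ge> 0 \<Longrightarrow> x t \<in> domL \<Sigma>"
    and c: "continuous_on {0..} (\<lambda>t. emb I (x t))" "continuous_on {0..} (\<lambda>t. emb I (opL \<Sigma> (x t)))"
  shows "continuous_on {0..} (\<lambda>t. bdry \<Sigma> (x t))"
  unfolding continuous_on_def
proof (rule ballI)
  fix t :: real assume t: "t \<in> {0..}"
  obtain C where C: "\<And>x. x \<in> domL \<Sigma> \<Longrightarrow> norm (bdry \<Sigma> x) \<le> C * (norm (emb I x) + norm (emb I (opL \<Sigma> x)))"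
    using trace_bound by blast
  have "((\<lambda>s. C * (norm (emb I (x s) - emb I (x t)) + norm (emb I (opL \<Sigma> (x s)) - emb I (opL \<Sigma> (x t))))) \<longlongrightarrow> C * (0 + 0)) (at t within {0..})"
    using c t unfolding continuous_on_def
    by (intro tendsto_mult tendsto_const tendsto_add tendsto_norm_zero LIM_zero) auto
  then have lim: "((\<lambda>s. C * (norm (emb I (x s) - emb I (x t)) + norm (emb I (opL \<Sigma> (x s)) - emb I (opL \<Sigma> (x t))))) \<longlongrightarrow> 0) (at t within {0..})"
    by simp
  have "\<forall>\<^sub>F s in at t within {0..}. norm (bdry \<Sigma> (x s) - bdry \<Sigma> (x t))
      \<le> C * (norm (emb I (x s) - emb I (x t)) + norm (emb I (opL \<Sigma> (x s)) - emb I (opL \<Sigma> (x t))))"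
    unfolding eventually_at_filter
  proof (rule always_eventually, intro allI impI)
    fix s :: real assume s: "s \<in> {0..}"
    note b = bdry_diff[OF x[of s] x[of t]]
    show "norm (bdry \<Sigma> (x s) - bdry \<Sigma> (x t))
      \<le> C * (norm (emb I (x s) - emb I (x t)) + norm (emb I (opL \<Sigma> (x s)) - emb I (opL \<Sigma> (x t))))"
      using C[OF b(1)] s t b(2,3) by (simp add: emb_X_simps domL_X x)
  qed
  from Lim_null_comparison[OF this lim] show "((\<lambda>s. bdry \<Sigma> (x s)) \<longlongrightarrow> bdry \<Sigma> (x t)) (at t within {0..})"
    by (simp add: LIM_zero_iff)
qed

lemma classical_from_orbit:
  assumes x: "\<And>t. t \<ge> 0 \<Longrightarrow> x t \<in> domL \<Sigma>" "\<And>t. t \<ge> 0 \<Longrightarrow> opG \<Sigma> (x t) = 0"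
    and d: "\<And>t. t \<ge> 0 \<Longrightarrow> ((\<lambda>s. emb I (x s)) has_vector_derivative emb I (opL \<Sigma> (x t))) (at t within {0..})"
    and c: "continuous_on {0..} (\<lambda>t. emb I (opL \<Sigma> (x t)))"
  shows "classical_solution \<Sigma> x (\<lambda>t. 0) (\<lambda>t. opK \<Sigma> (x t))"
proof -
  have "continuous_on {0..} (\<lambda>t. emb I (x t))"
    by (rule continuous_on_vector_derivative[of _ _ "\<lambda>t. emb I (opL \<Sigma> (x t))"]) (use d in auto)
  from bdry_continuous[OF x(1) this c]
  have "continuous_on {0..} (\<lambda>t. opK \<Sigma> (x t))"
    unfolding opK_def by (rule bounded_linear.continuous_on[OF bounded_linear_mv])
  then show ?thesis unfolding classical_solution_iff using x d c by auto
qed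

lemma bounded_linear_emb_rep: "bounded_linear (\<lambda>F. emb I (rep_l2 F :: real \<Rightarrow> complex^'n))"
  by (rule bounded_linear_intro[of _ 1]) (simp_all add: emb_rep_add emb_rep_scaleR norm_emb_rep_le)

text \<open>The abstract orbit lives on the whole line; its restriction to the interval is the
  solution, since \<open>A0\<close> only sees and only produces that part.\<close>

lemma classical_exists:
  assumes F: "F \<in> D0" "A0 F \<in> D0"
  shows "\<exists>x y. classical_solution \<Sigma> x (\<lambda>t. 0) y \<and> emb I (x 0) = emb I (rep_l2 F)"
proof -
  obtain U where U: "U 0 = F" "\<And>t. t \<ge> 0 \<Longrightarrow> U t \<in> D0"
    "\<And>t. t \<ge> 0 \<Longrightarrow> (U has_vector_derivative A0 (U t)) (at t within {0..})" "continuous_on {0..} (\<lambda>t. A0 (U t))"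
    using A.orbit_exists[OF F] by blast
  define x where "x t = rep_l2 (U t)" for t
  have x: "x t \<in> domL \<Sigma>" "opG \<Sigma> (x t) = 0" if "t \<ge> 0" for t
    using U(2)[OF that] by (auto simp: x_def D0_def)
  have A0x: "emb I (opL \<Sigma> (x t)) = A0 (U t)" for t by (simp add: x_def A0_def)
  have "((\<lambda>s. emb I (x s)) has_vector_derivative emb I (opL \<Sigma> (x t))) (at t within {0..})" if t: "t \<ge> 0" for t
  proof -
    have "((\<lambda>s. emb I (rep_l2 (U s))) has_vector_derivative emb I (rep_l2 (A0 (U t)))) (at t within {0..})"
      by (rule bounded_linear.has_vector_derivative[OF bounded_linear_emb_rep U(3)[OF t]])
    moreover have "emb I (rep_l2 (A0 (U t))) = emb I (opL \<Sigma> (x t))"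
      unfolding A0x[symmetric] by (rule emb_X_simps(4)[OF opL_X[OF x(1)[OF t]]])
    ultimately show ?thesis by (simp add: x_def)
  qed
  from classical_from_orbit[OF x this] U(4)
  have "classical_solution \<Sigma> x (\<lambda>t. 0) (\<lambda>t. opK \<Sigma> (x t))" by (simp add: A0x)
  moreover have "emb I (x 0) = emb I (rep_l2 F)" by (simp add: x_def U)
  ultimately show ?thesis by blast
qed

end

section \<open>Convergence in the mean, uniform limits and scaling of norms\<close>

lemma L2_lim_iff:
  assumes S: "S \<in> sets lebesgue" and f: "\<And>m. f m \<in> L2 S" and g: "g \<in> L2 S"
  shows "(\<lambda>m. LINT t|lebesgue_on S. (norm (f m t - g t))\<^sup>2) \<longlonglongrightarrow> 0 \<longleftrightarrow> (\<lambda>m. emb S (f m)) \<longlonglongrightarrow> emb S g"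
proof -
  have e: "(LINT t|lebesgue_on S. (norm (f m t - g t))\<^sup>2) = (norm (emb S (f m) - emb S g))\<^sup>2" for m
    using emb_norm[OF S L2_diff[OF f g]] by (simp add: emb_diff[OF S f g])
  have "(\<lambda>m. (norm (emb S (f m) - emb S g))\<^sup>2) \<longlonglongrightarrow> 0 \<longleftrightarrow> (\<lambda>m. norm (emb S (f m) - emb S g)) \<longlonglongrightarrow> 0"
    by (simp add: power_tendsto_0_iff)
  then show ?thesis unfolding e by (simp add: tendsto_norm_zero_iff LIM_zero_iff)
qed

lemma uniform_limit_transform:
  assumes f: "uniform_limit S f l F" and "\<And>n t. t \<in> S \<Longrightarrow> f n t = g n t" "\<And>t. t \<in> S \<Longrightarrow> l t = k t"
  shows "uniform_limit S g k F"
  using f unfolding uniform_limit_iff by (simp add: assms(2,3))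

lemma uniform_limit_mult_zero:
  fixes f :: "nat \<Rightarrow> 'a \<Rightarrow> real"
  assumes f: "uniform_limit S f (\<lambda>t. 0) sequentially"
  shows "uniform_limit S (\<lambda>m t. k * f m t) (\<lambda>t. 0) sequentially"
proof (rule uniform_limitI)
  fix e :: real assume "e > 0"
  then have "e / (\<bar>k\<bar> + 1) > 0" by simp
  from uniform_limitD[OF f this]
  show "\<forall>\<^sub>F m in sequentially. \<forall>t\<in>S. dist (k * f m t) 0 < e"
  proof eventually_elim
    case (elim m)
    show ?case
    proof
      fix t assume "t \<in> S"
      then have "\<bar>f m t\<bar> < e / (\<bar>k\<bar> + 1)" using elim by (auto simp: dist_norm)
      then have "(\<bar>k\<bar> + 1) * \<bar>f m t\<bar> < e" by (simp add: pos_less_divide_eq mult.commute)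
      then show "dist (k * f m t) 0 < e" by (simp add: dist_norm abs_mult algebra_simps)
    qed
  qed
qed

lemma norm_scale: "norm (c *s v) = norm c * norm v" for v :: "complex^'z"
  by (simp add: norm_vec_def L2_set_def norm_mult power_mult_distrib sum_distrib_left[symmetric] real_sqrt_mult)

context port_hamiltonian_node
begin

section \<open>Generalized solutions\<close>

lemma continuous_L2_Icc: "continuous_on {0..} f \<Longrightarrow> f \<in> L2 {0..T}" for f :: "real \<Rightarrow> 'e::euclidean_space"
  by (rule continuous_imp_L2, rule continuous_on_subset) auto

lemma continuous_LINT_eq:
  fixes f :: "real \<Rightarrow> 'e::euclidean_space"
  assumes "continuous_on {0..} f"
  shows "(LINT t|lebesgue_on {0..T}. (norm (f t))\<^sup>2) = integral {0..T} (\<lambda>t. (norm (f t))\<^sup>2)"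
  by (rule lebesgue_integral_eq_integral[OF L2_integrable[OF continuous_L2_Icc[OF assms]]]) simp

lemma uniform_limit_normX:
  assumes xs: "\<And>m t. t \<ge> 0 \<Longrightarrow> xs m t \<in> X \<Sigma>" and x: "\<And>t. t \<ge> 0 \<Longrightarrow> x t \<in> X \<Sigma>"
  shows "uniform_limit {0..T} (\<lambda>m t. normX \<Sigma> (\<lambda>\<zeta>. xs m t \<zeta> - x t \<zeta>)) (\<lambda>t. 0) sequentially \<longleftrightarrow>
    uniform_limit {0..T} (\<lambda>m t. emb I (xs m t)) (\<lambda>t. emb I (x t)) sequentially"
proof
  obtain C where C: "C > 0" "\<And>x. norm x \<le> C * E.en x" using E.norm_le_en by blast
  assume L: "uniform_limit {0..T} (\<lambda>m t. normX \<Sigma> (\<lambda>\<zeta>. xs m t \<zeta> - x t \<zeta>)) (\<lambda>t. 0) sequentially"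
  show "uniform_limit {0..T} (\<lambda>m t. emb I (xs m t)) (\<lambda>t. emb I (x t)) sequentially"
  proof (rule uniform_limitI)
    fix e :: real assume "e > 0"
    then have "e / C > 0" using C(1) by simp
    from uniform_limitD[OF L this]
    show "\<forall>\<^sub>F m in sequentially. \<forall>t\<in>{0..T}. dist (emb I (xs m t)) (emb I (x t)) < e"
    proof eventually_elim
      case (elim m)
      show ?case
      proof
        fix t assume t: "t \<in> {0..T}"
        have "E.en (emb I (xs m t) - emb I (x t)) < e / C"
          using elim t xs x by (auto simp: normX_diff dist_norm)
        then have "C * E.en (emb I (xs m t) - emb I (x t)) < e" using C(1) by (simp add: field_simps)
        then show "dist (emb I (xs m t)) (emb I (x t)) < e"
          using C(2)[of "emb I (xs m t) - emb I (x t)"] by (simp add: dist_norm)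
      qed
    qed
  qed
next
  obtain C where C: "C > 0" "\<And>x. E.en x \<le> C * norm x" using E.en_le_norm by blast
  assume L: "uniform_limit {0..T} (\<lambda>m t. emb I (xs m t)) (\<lambda>t. emb I (x t)) sequentially"
  show "uniform_limit {0..T} (\<lambda>m t. normX \<Sigma> (\<lambda>\<zeta>. xs m t \<zeta> - x t \<zeta>)) (\<lambda>t. 0) sequentially"
  proof (rule uniform_limitI)
    fix e :: real assume "e > 0"
    then have "e / C > 0" using C(1) by simp
    from uniform_limitD[OF L this]
    show "\<forall>\<^sub>F m in sequentially. \<forall>t\<in>{0..T}. dist (normX \<Sigma> (\<lambda>\<zeta>. xs m t \<zeta> - x t \<zeta>)) 0 < e"
    proof eventually_elim
      case (elim m)
      show ?case
      proof
        fix t assume t: "t \<in> {0..T}"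
        have "norm (emb I (xs m t) - emb I (x t)) < e / C" using elim t by (auto simp: dist_norm)
        then have "C * norm (emb I (xs m t) - emb I (x t)) < e" using C(1) by (simp add: field_simps)
        then show "dist (normX \<Sigma> (\<lambda>\<zeta>. xs m t \<zeta> - x t \<zeta>)) 0 < e"
          using C(2)[of "emb I (xs m t) - emb I (x t)"] t xs x by (simp add: normX_diff)
      qed
    qed
  qed
qed

lemma generalized_solution_iff:
  "generalized_solution \<Sigma> x u y \<longleftrightarrow>
     (\<forall>t\<ge>0. x t \<in> X \<Sigma>) \<and> (\<forall>\<tau>\<ge>0. u \<in> L2 {0..\<tau>} \<and> y \<in> L2 {0..\<tau>}) \<and>
     (\<exists>xs us ys. (\<forall>m::nat. classical_solution \<Sigma> (xs m) (us m) (ys m)) \<and>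
        (\<forall>\<tau>\<ge>0. uniform_limit {0..\<tau>} (\<lambda>m t. emb I (xs m t)) (\<lambda>t. emb I (x t)) sequentially \<and>
           (\<lambda>m. emb {0..\<tau>} (us m)) \<longlonglongrightarrow> emb {0..\<tau>} u \<and> (\<lambda>m. emb {0..\<tau>} (ys m)) \<longlonglongrightarrow> emb {0..\<tau>} y))"
proof -
  have *: "(uniform_limit {0..\<tau>} (\<lambda>m t. normX \<Sigma> (\<lambda>\<zeta>. xs m t \<zeta> - x t \<zeta>)) (\<lambda>t. 0) sequentially \<and>
      (\<lambda>m. LINT t|lebesgue_on {0..\<tau>}. (norm (us m t - u t))\<^sup>2) \<longlonglongrightarrow> 0 \<and>
      (\<lambda>m. LINT t|lebesgue_on {0..\<tau>}. (norm (ys m t - y t))\<^sup>2) \<longlonglongrightarrow> 0) \<longleftrightarrow>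
    (uniform_limit {0..\<tau>} (\<lambda>m t. emb I (xs m t)) (\<lambda>t. emb I (x t)) sequentially \<and>
           (\<lambda>m. emb {0..\<tau>} (us m)) \<longlonglongrightarrow> emb {0..\<tau>} u \<and> (\<lambda>m. emb {0..\<tau>} (ys m)) \<longlonglongrightarrow> emb {0..\<tau>} y)"
    if c: "\<forall>m::nat. classical_solution \<Sigma> (xs m) (us m) (ys m)" and x: "\<forall>t\<ge>0. x t \<in> X \<Sigma>"
      and uy: "\<forall>\<tau>\<ge>0. u \<in> L2 {0..\<tau>} \<and> y \<in> L2 {0..\<tau>}" and \<tau>: "\<tau> \<ge> 0" for xs us ys \<tau>
  proof -
    have usL: "us m \<in> L2 {0..\<tau>}" and ysL: "ys m \<in> L2 {0..\<tau>}" and xsX: "t \<ge> 0 \<Longrightarrow> xs m t \<in> X \<Sigma>" for m t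
      using classical_D[OF spec[OF c, of m]] by (auto intro: continuous_L2_Icc)
    have "u \<in> L2 {0..\<tau>}" "y \<in> L2 {0..\<tau>}" using uy \<tau> by auto
    then show ?thesis
      using x xsX by (simp add: uniform_limit_normX L2_lim_iff usL ysL)
  qed
  show ?thesis
    unfolding generalized_solution_def
  proof (rule conj_cong[OF refl], rule conj_cong[OF refl], rule iff_exI, rule iff_exI, rule iff_exI, rule conj_cong[OF refl])
    fix xs us ys
    assume "\<forall>t\<ge>0. x t \<in> X \<Sigma>" "\<forall>\<tau>\<ge>0. u \<in> L2 {0..\<tau>} \<and> y \<in> L2 {0..\<tau>}"
      "\<forall>m::nat. classical_solution \<Sigma> (xs m) (us m) (ys m)"
    from *[OF this(3,1,2)]
    show "(\<forall>\<tau>\<ge>0. uniform_limit {0..\<tau>} (\<lambda>m t. normX \<Sigma> (\<lambda>\<zeta>. xs m t \<zeta> - x t \<zeta>)) (\<lambda>t. 0) sequentially \<and>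
        (\<lambda>m. LINT t|lebesgue_on {0..\<tau>}. (norm (us m t - u t))\<^sup>2) \<longlonglongrightarrow> 0 \<and>
        (\<lambda>m. LINT t|lebesgue_on {0..\<tau>}. (norm (ys m t - y t))\<^sup>2) \<longlonglongrightarrow> 0) \<longleftrightarrow>
      (\<forall>\<tau>\<ge>0. uniform_limit {0..\<tau>} (\<lambda>m t. emb I (xs m t)) (\<lambda>t. emb I (x t)) sequentially \<and>
        (\<lambda>m. emb {0..\<tau>} (us m)) \<longlonglongrightarrow> emb {0..\<tau>} u \<and> (\<lambda>m. emb {0..\<tau>} (ys m)) \<longlonglongrightarrow> emb {0..\<tau>} y)"
      by simp
  qed
qed

lemma generalized_L2_measurable:
  assumes "generalized_solution \<Sigma> x u y"
  shows "u \<in> borel_measurable (lebesgue_on {0..})" "y \<in> borel_measurable (lebesgue_on {0..})"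
proof -
  have "u \<in> L2 {0..T}" "y \<in> L2 {0..T}" if "T \<ge> 0" for T
    using assms that unfolding generalized_solution_iff by auto
  then show "u \<in> borel_measurable (lebesgue_on {0..})" "y \<in> borel_measurable (lebesgue_on {0..})"
    by (auto intro: nn_integral_Ici_SUP(1))
qed

lemma generalized_add:
  assumes 1: "generalized_solution \<Sigma> x u y" and 2: "generalized_solution \<Sigma> x2 u2 y2"
  shows "generalized_solution \<Sigma> (\<lambda>t \<zeta>. x t \<zeta> + x2 t \<zeta>) (\<lambda>t. u t + u2 t) (\<lambda>t. y t + y2 t)"
proof -
  obtain xs us ys where c1: "\<And>m::nat. classical_solution \<Sigma> (xs m) (us m) (ys m)"
    and l1: "\<And>\<tau>. \<tau> \<ge> 0 \<Longrightarrow> uniform_limit {0..\<tau>} (\<lambda>m t. emb I (xs m t)) (\<lambda>t. emb I (x t)) sequentially"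
      "\<And>\<tau>. \<tau> \<ge> 0 \<Longrightarrow> (\<lambda>m. emb {0..\<tau>} (us m)) \<longlonglongrightarrow> emb {0..\<tau>} u" "\<And>\<tau>. \<tau> \<ge> 0 \<Longrightarrow> (\<lambda>m. emb {0..\<tau>} (ys m)) \<longlonglongrightarrow> emb {0..\<tau>} y"
    and m1: "\<And>t. t \<ge> 0 \<Longrightarrow> x t \<in> X \<Sigma>" "\<And>\<tau>. \<tau> \<ge> 0 \<Longrightarrow> u \<in> L2 {0..\<tau>}" "\<And>\<tau>. \<tau> \<ge> 0 \<Longrightarrow> y \<in> L2 {0..\<tau>}"
    using 1 unfolding generalized_solution_iff by blast
  obtain xs2 us2 ys2 where c2: "\<And>m::nat. classical_solution \<Sigma> (xs2 m) (us2 m) (ys2 m)"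
    and l2: "\<And>\<tau>. \<tau> \<ge> 0 \<Longrightarrow> uniform_limit {0..\<tau>} (\<lambda>m t. emb I (xs2 m t)) (\<lambda>t. emb I (x2 t)) sequentially"
      "\<And>\<tau>. \<tau> \<ge> 0 \<Longrightarrow> (\<lambda>m. emb {0..\<tau>} (us2 m)) \<longlonglongrightarrow> emb {0..\<tau>} u2" "\<And>\<tau>. \<tau> \<ge> 0 \<Longrightarrow> (\<lambda>m. emb {0..\<tau>} (ys2 m)) \<longlonglongrightarrow> emb {0..\<tau>} y2"
    and m2: "\<And>t. t \<ge> 0 \<Longrightarrow> x2 t \<in> X \<Sigma>" "\<And>\<tau>. \<tau> \<ge> 0 \<Longrightarrow> u2 \<in> L2 {0..\<tau>}" "\<And>\<tau>. \<tau> \<ge> 0 \<Longrightarrow> y2 \<in> L2 {0..\<tau>}"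
    using 2 unfolding generalized_solution_iff by blast
  note C1 = classical_D[OF c1] and C2 = classical_D[OF c2]
  show ?thesis
    unfolding generalized_solution_iff
  proof (intro conjI allI impI)
    show "(\<lambda>\<zeta>. x t \<zeta> + x2 t \<zeta>) \<in> X \<Sigma>" if "0 \<le> t" for t by (rule X_add[OF m1(1)[OF that] m2(1)[OF that]])
    show "(\<lambda>t. u t + u2 t) \<in> L2 {0..\<tau>}" if "0 \<le> \<tau>" for \<tau> by (rule L2_add[OF m1(2)[OF that] m2(2)[OF that]])
    show "(\<lambda>t. y t + y2 t) \<in> L2 {0..\<tau>}" if "0 \<le> \<tau>" for \<tau> by (rule L2_add[OF m1(3)[OF that] m2(3)[OF that]])
    have U: "uniform_limit {0..\<tau>} (\<lambda>m t. emb I (\<lambda>\<zeta>. xs m t \<zeta> + xs2 m t \<zeta>)) (\<lambda>t. emb I (\<lambda>\<zeta>. x t \<zeta> + x2 t \<zeta>)) sequentially" if "0 \<le> \<tau>" for \<tau>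
      by (rule uniform_limit_transform[OF uniform_limit_add[OF l1(1)[OF that] l2(1)[OF that]]])
        (simp_all add: emb_X_simps m1 m2 C1 C2)
    have V: "(\<lambda>m. emb {0..\<tau>} (\<lambda>t. us m t + us2 m t)) \<longlonglongrightarrow> emb {0..\<tau>} (\<lambda>t. u t + u2 t)"
      "(\<lambda>m. emb {0..\<tau>} (\<lambda>t. ys m t + ys2 m t)) \<longlonglongrightarrow> emb {0..\<tau>} (\<lambda>t. y t + y2 t)" if "0 \<le> \<tau>" for \<tau>
      using tendsto_add[OF l1(2)[OF that] l2(2)[OF that]] tendsto_add[OF l1(3)[OF that] l2(3)[OF that]]
      by (simp_all add: emb_add m1 m2 that continuous_L2_Icc C1 C2)
    show "\<exists>xs us ys. (\<forall>m::nat. classical_solution \<Sigma> (xs m) (us m) (ys m)) \<and>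
        (\<forall>\<tau>\<ge>0. uniform_limit {0..\<tau>} (\<lambda>m t. emb I (xs m t)) (\<lambda>t. emb I (\<lambda>\<zeta>. x t \<zeta> + x2 t \<zeta>)) sequentially \<and>
           (\<lambda>m. emb {0..\<tau>} (us m)) \<longlonglongrightarrow> emb {0..\<tau>} (\<lambda>t. u t + u2 t) \<and> (\<lambda>m. emb {0..\<tau>} (ys m)) \<longlonglongrightarrow> emb {0..\<tau>} (\<lambda>t. y t + y2 t))"
      by (rule exI[of _ "\<lambda>m t \<zeta>. xs m t \<zeta> + xs2 m t \<zeta>"], rule exI[of _ "\<lambda>m t. us m t + us2 m t"],
          rule exI[of _ "\<lambda>m t. ys m t + ys2 m t"])
        (use classical_add[OF c1 c2] U V in blast)
  qed
qed

lemma generalized_scale: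
  assumes 1: "generalized_solution \<Sigma> x u y"
  shows "generalized_solution \<Sigma> (\<lambda>t \<zeta>. c *s x t \<zeta>) (\<lambda>t. c *s u t) (\<lambda>t. c *s y t)"
proof -
  obtain xs us ys where c1: "\<And>m::nat. classical_solution \<Sigma> (xs m) (us m) (ys m)"
    and l1: "\<And>\<tau>. \<tau> \<ge> 0 \<Longrightarrow> uniform_limit {0..\<tau>} (\<lambda>m t. normX \<Sigma> (\<lambda>\<zeta>. xs m t \<zeta> - x t \<zeta>)) (\<lambda>t. 0) sequentially"
    and l2: "\<And>\<tau>. \<tau> \<ge> 0 \<Longrightarrow> (\<lambda>m. LINT t|lebesgue_on {0..\<tau>}. (norm (us m t - u t))\<^sup>2) \<longlonglongrightarrow> 0"
      "\<And>\<tau>. \<tau> \<ge> 0 \<Longrightarrow> (\<lambda>m. LINT t|lebesgue_on {0..\<tau>}. (norm (ys m t - y t))\<^sup>2) \<longlonglongrightarrow> 0"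
    and m1: "\<And>t. t \<ge> 0 \<Longrightarrow> x t \<in> X \<Sigma>" "\<And>\<tau>. \<tau> \<ge> 0 \<Longrightarrow> u \<in> L2 {0..\<tau>}" "\<And>\<tau>. \<tau> \<ge> 0 \<Longrightarrow> y \<in> L2 {0..\<tau>}"
    using 1 unfolding generalized_solution_def by blast
  have d: "(norm (c *s v - c *s w))\<^sup>2 = (norm c)\<^sup>2 * (norm (v - w))\<^sup>2" for v w :: "complex^'z"
    by (simp only: vector_ssub_ldistrib[symmetric] norm_scale power_mult_distrib)
  have nX: "normX \<Sigma> (\<lambda>\<zeta>. c *s f \<zeta> - c *s g \<zeta>) = norm c * normX \<Sigma> (\<lambda>\<zeta>. f \<zeta> - g \<zeta>)" for f g
  proof -
    have "innerX \<Sigma> (\<lambda>\<zeta>. c *s (f \<zeta> - g \<zeta>)) (\<lambda>\<zeta>. c *s (f \<zeta> - g \<zeta>)) = (c * cnj c) * innerX \<Sigma> (\<lambda>\<zeta>. f \<zeta> - g \<zeta>) (\<lambda>\<zeta>. f \<zeta> - g \<zeta>)"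
      by (simp only: innerX_scale_left innerX_scale_right mult.assoc)
    also have "c * cnj c = complex_of_real ((norm c)\<^sup>2)" by (rule complex_norm_square[symmetric])
    finally have "Re (innerX \<Sigma> (\<lambda>\<zeta>. c *s (f \<zeta> - g \<zeta>)) (\<lambda>\<zeta>. c *s (f \<zeta> - g \<zeta>))) = (norm c)\<^sup>2 * Re (innerX \<Sigma> (\<lambda>\<zeta>. f \<zeta> - g \<zeta>) (\<lambda>\<zeta>. f \<zeta> - g \<zeta>))"
      by (simp del: of_real_power)
    then show ?thesis by (simp only: normX_def vector_ssub_ldistrib[symmetric] real_sqrt_mult real_sqrt_abs abs_norm_cancel)
  qed
  show ?thesis
    unfolding generalized_solution_def
  proof (intro conjI allI impI)
    show "(\<lambda>\<zeta>. c *s x t \<zeta>) \<in> X \<Sigma>" if "0 \<le> t" for t by (rule X_scale[OF m1(1)[OF that]])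
    show "(\<lambda>t. c *s u t) \<in> L2 {0..\<tau>}" if "0 \<le> \<tau>" for \<tau> by (rule L2_linear[OF bounded_linear_scale m1(2)[OF that]])
    show "(\<lambda>t. c *s y t) \<in> L2 {0..\<tau>}" if "0 \<le> \<tau>" for \<tau> by (rule L2_linear[OF bounded_linear_scale m1(3)[OF that]])
    have U: "uniform_limit {0..\<tau>} (\<lambda>m t. normX \<Sigma> (\<lambda>\<zeta>. c *s xs m t \<zeta> - c *s x t \<zeta>)) (\<lambda>t. 0) sequentially" if "0 \<le> \<tau>" for \<tau>
      unfolding nX by (rule uniform_limit_mult_zero[OF l1[OF that]])
    have V: "(\<lambda>m. LINT t|lebesgue_on {0..\<tau>}. (norm (c *s us m t - c *s u t))\<^sup>2) \<longlonglongrightarrow> 0"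
      "(\<lambda>m. LINT t|lebesgue_on {0..\<tau>}. (norm (c *s ys m t - c *s y t))\<^sup>2) \<longlonglongrightarrow> 0" if "0 \<le> \<tau>" for \<tau>
    proof -
      have "(\<lambda>m. LINT t|lebesgue_on {0..\<tau>}. (norm c)\<^sup>2 * (norm (us m t - u t))\<^sup>2) \<longlonglongrightarrow> 0"
        "(\<lambda>m. LINT t|lebesgue_on {0..\<tau>}. (norm c)\<^sup>2 * (norm (ys m t - y t))\<^sup>2) \<longlonglongrightarrow> 0"
        using tendsto_mult_right_zero[OF l2(1)[OF that]] tendsto_mult_right_zero[OF l2(2)[OF that]] by simp_all
      then show "(\<lambda>m. LINT t|lebesgue_on {0..\<tau>}. (norm (c *s us m t - c *s u t))\<^sup>2) \<longlonglongrightarrow> 0"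
        "(\<lambda>m. LINT t|lebesgue_on {0..\<tau>}. (norm (c *s ys m t - c *s y t))\<^sup>2) \<longlonglongrightarrow> 0"
        by (simp_all only: d)
    qed
    show "\<exists>xs us ys. (\<forall>m::nat. classical_solution \<Sigma> (xs m) (us m) (ys m)) \<and>
        (\<forall>\<tau>\<ge>0. uniform_limit {0..\<tau>} (\<lambda>m t. normX \<Sigma> (\<lambda>\<zeta>. xs m t \<zeta> - c *s x t \<zeta>)) (\<lambda>t. 0) sequentially \<and>
           (\<lambda>m. LINT t|lebesgue_on {0..\<tau>}. (norm (us m t - c *s u t))\<^sup>2) \<longlonglongrightarrow> 0 \<and>
           (\<lambda>m. LINT t|lebesgue_on {0..\<tau>}. (norm (ys m t - c *s y t))\<^sup>2) \<longlonglongrightarrow> 0)"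
      by (rule exI[of _ "\<lambda>m t \<zeta>. c *s xs m t \<zeta>"], rule exI[of _ "\<lambda>m t. c *s us m t"],
          rule exI[of _ "\<lambda>m t. c *s ys m t"])
        (use classical_scale[OF c1] U V in blast)
  qed
qed

text \<open>The difference is a solution with zero input, so its energy inequality bounds the
  distance of the states and that of the outputs at once.\<close>

lemma zero_input_difference:
  assumes 1: "classical_solution \<Sigma> x (\<lambda>t. 0) y" and 2: "classical_solution \<Sigma> x2 (\<lambda>t. 0) y2" and t: "t \<ge> 0"
  shows "E.en (emb I (x t) - emb I (x2 t)) \<le> E.en (emb I (x 0) - emb I (x2 0))"
    "integral {0..t} (\<lambda>s. (norm (y s - y2 s))\<^sup>2) \<le> (E.en (emb I (x 0) - emb I (x2 0)))\<^sup>2"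
proof -
  have c: "continuous_on {0..t} (\<lambda>s. (norm (y s - y2 s))\<^sup>2)"
    by (intro continuous_intros continuous_on_subset[OF classical_D(2)[OF 1]] continuous_on_subset[OF classical_D(2)[OF 2]]; auto)
  have nn: "0 \<le> integral {0..t} (\<lambda>s. (norm (y s - y2 s))\<^sup>2)"
    by (rule integral_nonneg[OF integrable_continuous_real[OF c]]) simp
  have e: "(E.en (emb I (x t) - emb I (x2 t)))\<^sup>2 + integral {0..t} (\<lambda>s. (norm (y s - y2 s))\<^sup>2)
      \<le> (E.en (emb I (x 0) - emb I (x2 0)))\<^sup>2"
    using classical_energy[OF classical_diff[OF 1 2] t] classical_D(8)[OF 1] classical_D(8)[OF 2] t
    by (simp add: normX_diff)
  have "(E.en (emb I (x t) - emb I (x2 t)))\<^sup>2 \<le> (E.en (emb I (x 0) - emb I (x2 0)))\<^sup>2" using e nn by linarith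
  then show "E.en (emb I (x t) - emb I (x2 t)) \<le> E.en (emb I (x 0) - emb I (x2 0))"
    by (rule power2_le_imp_le) simp
  have "0 \<le> (E.en (emb I (x t) - emb I (x2 t)))\<^sup>2" by simp
  then show "integral {0..t} (\<lambda>s. (norm (y s - y2 s))\<^sup>2) \<le> (E.en (emb I (x 0) - emb I (x2 0)))\<^sup>2"
    using e by linarith
qed

text \<open>Since the input vanishes, the energy bound does not grow with time: convergence of the
  initial states makes the states uniformly Cauchy on the whole half-line and the outputs Cauchy in
  its L2 space. The bound for the output energy passes to the limit.\<close>

lemma zero_input_limit:
  assumes c: "\<And>m::nat. classical_solution \<Sigma> (xs m) (\<lambda>t. 0) (ys m)" and x0: "x0 \<in> X \<Sigma>"
    and lim: "(\<lambda>m. emb I (xs m 0)) \<longlonglongrightarrow> emb I x0"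
  shows "\<exists>x y. generalized_solution \<Sigma> x (\<lambda>t. 0) y \<and> eqX \<Sigma> (x 0) x0 \<and>
    (\<integral>\<^sup>+t. ennreal ((norm (y t))\<^sup>2) \<partial>lebesgue_on {0..}) \<le> ennreal ((normX \<Sigma> x0)\<^sup>2)"
proof -
  note C = classical_D[OF c]
  define f where "f m = emb I (xs m 0)" for m
  have f: "f \<longlonglongrightarrow> emb I x0" using lim by (simp add: f_def[abs_def])
  have fC: "\<exists>N. \<forall>m\<ge>N. \<forall>n\<ge>N. E.en (f m - f n) < e" if "e > 0" for e by (rule A.tendsto_Cauchy_en[OF f that])
  define G where "G t = lim (\<lambda>m. emb I (xs m t))" for t
  have U: "uniform_limit {0..} (\<lambda>m t. emb I (xs m t)) G sequentially"
    unfolding G_def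
  proof (rule A.uniform_limit_en_Cauchy)
    fix e :: real assume "e > 0"
    then obtain N where N: "\<forall>m\<ge>N. \<forall>n\<ge>N. E.en (f m - f n) < e" using fC by blast
    show "\<exists>N. \<forall>m\<ge>N. \<forall>n\<ge>N. \<forall>t\<in>{0..}. E.en (emb I (xs m t) - emb I (xs n t)) < e"
    proof (rule exI[of _ N], intro allI impI ballI)
      fix m n and t :: real assume "m \<ge> N" "n \<ge> N" "t \<in> {0..}"
      then show "E.en (emb I (xs m t) - emb I (xs n t)) < e"
        using N zero_input_difference(1)[OF c c, of t m n] unfolding f_def by force
    qed
  qed
  have Gt: "(\<lambda>m. emb I (xs m t)) \<longlonglongrightarrow> G t" if "t \<ge> 0" for t
    using tendsto_uniform_limitI[OF U, of t] that by simp
  define x where "x t = rep_l2 (G t)" for t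
  have ex: "emb I (x t) = G t" if "t \<ge> 0" for t
    unfolding x_def by (rule L2_closed_emb[OF I_sets _ Gt[OF that]]) (use C(8)[OF that] in \<open>simp add: X_L2\<close>)
  have Ux: "uniform_limit {0..\<tau>} (\<lambda>m t. emb I (xs m t)) (\<lambda>t. emb I (x t)) sequentially" for \<tau>
    by (rule uniform_limit_transform[OF uniform_limit_on_subset[OF U]]) (auto simp: ex)
  have G0: "G 0 = emb I x0" using LIMSEQ_unique[OF Gt[of 0] lim] by simp
  have x0': "eqX \<Sigma> (x 0) x0" by (simp add: eqX_iff x_def[of 0] x0) (simp add: x_def[symmetric] ex G0 emb_X_simps(4)[OF x0])
  have S: "{0..} \<in> sets (lebesgue :: real measure)" by simp
  have ysL: "ys m \<in> L2 {0..}" "(LINT t|lebesgue_on {0..}. (norm (ys m t))\<^sup>2) \<le> (normX \<Sigma> (xs m 0))\<^sup>2" for m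
  proof -
    have le: "(LINT t|lebesgue_on {0..T}. (norm (ys m t))\<^sup>2) \<le> (normX \<Sigma> (xs m 0))\<^sup>2" if "T \<ge> 0" for T
    proof -
      have "0 \<le> (normX \<Sigma> (xs m T))\<^sup>2" by simp
      moreover have "integral {0..T} (\<lambda>s. (norm ((0::complex^'p)))\<^sup>2) = 0" by simp
      ultimately show ?thesis
        using classical_energy[OF c that, of m] unfolding continuous_LINT_eq[OF C(2)] by linarith
    qed
    show "ys m \<in> L2 {0..}" "(LINT t|lebesgue_on {0..}. (norm (ys m t))\<^sup>2) \<le> (normX \<Sigma> (xs m 0))\<^sup>2"
      using L2_Ici_I[of "ys m", OF continuous_L2_Icc[OF C(2)] le] by simp_all
  qed
  have yd: "norm (emb {0..} (ys m) - emb {0..} (ys n)) \<le> E.en (f m - f n)" for m n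
  proof (rule power2_le_imp_le)
    have cd: "continuous_on {0..} (\<lambda>t. ys m t - ys n t)" by (intro continuous_on_diff C(2))
    have "(norm (emb {0..} (ys m) - emb {0..} (ys n)))\<^sup>2 = (LINT t|lebesgue_on {0..}. (norm (ys m t - ys n t))\<^sup>2)"
      unfolding emb_diff[OF S ysL(1) ysL(1), symmetric] by (rule emb_norm[OF S L2_diff[OF ysL(1) ysL(1)]])
    also have "\<dots> \<le> (E.en (f m - f n))\<^sup>2"
    proof (rule L2_Ici_I(2)[OF continuous_L2_Icc[OF cd]])
      show "(LINT t|lebesgue_on {0..T}. (norm (ys m t - ys n t))\<^sup>2) \<le> (E.en (f m - f n))\<^sup>2" if "T \<ge> 0" for T
        unfolding continuous_LINT_eq[OF cd] f_def by (rule zero_input_difference(2)[OF c c that])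
    qed simp
    finally show "(norm (emb {0..} (ys m) - emb {0..} (ys n)))\<^sup>2 \<le> (E.en (f m - f n))\<^sup>2" .
  qed simp
  have "Cauchy (\<lambda>m. emb {0..} (ys m))"
  proof (rule CauchyI)
    fix e :: real assume "e > 0"
    then obtain N where N: "\<forall>m\<ge>N. \<forall>n\<ge>N. E.en (f m - f n) < e" using fC by blast
    show "\<exists>M. \<forall>m\<ge>M. \<forall>n\<ge>M. norm (emb {0..} (ys m) - emb {0..} (ys n)) < e"
    proof (rule exI[of _ N], intro allI impI)
      fix m n assume "m \<ge> N" "n \<ge> N"
      then have "E.en (f m - f n) < e" using N by blast
      then show "norm (emb {0..} (ys m) - emb {0..} (ys n)) < e" using yd[of m n] by linarith
    qed
  qed
  then obtain Yl where Yl: "(\<lambda>m. emb {0..} (ys m)) \<longlonglongrightarrow> Yl" by (auto simp: Cauchy_convergent_iff convergent_def)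
  define y where "y = rep_l2 Yl"
  have yL: "y \<in> L2 S" if "S \<in> sets lebesgue" for S unfolding y_def by (rule rep_L2[OF that])
  have ey: "emb {0..} y = Yl" unfolding y_def by (rule L2_closed_emb[OF S ysL(1) Yl])
  have yl: "(\<lambda>m. emb {0..\<tau>} (ys m)) \<longlonglongrightarrow> emb {0..\<tau>} y" if "\<tau> \<ge> 0" for \<tau> :: real
  proof -
    have sub: "{0..\<tau>} \<subseteq> {0..}" "{0..\<tau>} \<in> sets (lebesgue :: real measure)" by auto
    have "(\<lambda>m. LINT t|lebesgue_on {0..}. (norm (ys m t - y t))\<^sup>2) \<longlonglongrightarrow> 0"
      using Yl ey by (subst L2_lim_iff[OF S ysL(1) yL[OF S]]) simp
    then have "(\<lambda>m. LINT t|lebesgue_on {0..\<tau>}. (norm (ys m t - y t))\<^sup>2) \<longlonglongrightarrow> 0"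
      by (rule Lim_null_comparison[rotated]) (use L2_LINT_mono[OF L2_diff[OF ysL(1) yL[OF S]] sub S] in simp)
    then show ?thesis
      by (subst (asm) L2_lim_iff[OF sub(2) continuous_L2_Icc[OF C(2)] yL[OF sub(2)]])
  qed
  have "generalized_solution \<Sigma> x (\<lambda>t. 0) y"
    unfolding generalized_solution_iff
  proof (intro conjI allI impI)
    show "x t \<in> X \<Sigma>" for t by (simp add: x_def)
    show "(\<lambda>t. 0) \<in> L2 {0..\<tau>}" "y \<in> L2 {0..\<tau>}" for \<tau> :: real by (simp_all add: yL)
    show "\<exists>xs us ys. (\<forall>m::nat. classical_solution \<Sigma> (xs m) (us m) (ys m)) \<and>
        (\<forall>\<tau>\<ge>0. uniform_limit {0..\<tau>} (\<lambda>m t. emb I (xs m t)) (\<lambda>t. emb I (x t)) sequentially \<and>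
           (\<lambda>m. emb {0..\<tau>} (us m)) \<longlonglongrightarrow> emb {0..\<tau>} (\<lambda>t. 0) \<and> (\<lambda>m. emb {0..\<tau>} (ys m)) \<longlonglongrightarrow> emb {0..\<tau>} y)"
      by (rule exI[of _ xs], rule exI[of _ "\<lambda>m t. 0"], rule exI[of _ ys]) (use c Ux yl in auto)
  qed
  moreover have "(\<integral>\<^sup>+t. ennreal ((norm (y t))\<^sup>2) \<partial>lebesgue_on {0..}) \<le> ennreal ((normX \<Sigma> x0)\<^sup>2)"
  proof -
    have "(\<integral>\<^sup>+t. ennreal ((norm (y t))\<^sup>2) \<partial>lebesgue_on {0..}) = ennreal (LINT t|lebesgue_on {0..}. (norm (y t))\<^sup>2)"
      by (rule nn_integral_eq_integral[OF L2_integrable[OF yL[OF S]]]) simp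
    also have "(LINT t|lebesgue_on {0..}. (norm (y t))\<^sup>2) = (norm Yl)\<^sup>2"
      using emb_norm[OF S yL[OF S]] ey by simp
    also have "(norm Yl)\<^sup>2 \<le> (E.en (emb I x0))\<^sup>2"
    proof (rule LIMSEQ_le)
      show "(\<lambda>m. (norm (emb {0..} (ys m)))\<^sup>2) \<longlonglongrightarrow> (norm Yl)\<^sup>2" by (intro tendsto_power tendsto_norm Yl)
      show "(\<lambda>m. (E.en (f m))\<^sup>2) \<longlonglongrightarrow> (E.en (emb I x0))\<^sup>2" by (intro tendsto_power E.tendsto_en f)
      show "\<exists>N. \<forall>n\<ge>N. (norm (emb {0..} (ys n)))\<^sup>2 \<le> (E.en (f n))\<^sup>2"
      proof (rule exI[of _ 0], intro allI impI)
        show "(norm (emb {0..} (ys n)))\<^sup>2 \<le> (E.en (f n))\<^sup>2" for n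
          unfolding emb_norm[OF S ysL(1)] f_def en_emb[OF C(8)[OF order_refl]] by (rule ysL(2))
      qed
    qed
    finally show ?thesis using x0 by (simp add: en_emb ennreal_leI)
  qed
  ultimately show ?thesis using x0' by blast
qed

text \<open>Initial data that start classical solutions are dense for the energy. Approximants are
  picked in \<open>l2\<close>, and restriction to the interval preserves their convergence.\<close>

lemma zero_input_exists:
  assumes x0: "x0 \<in> X \<Sigma>"
  shows "\<exists>x y. generalized_solution \<Sigma> x (\<lambda>t. 0) y \<and> eqX \<Sigma> (x 0) x0 \<and>
    (\<integral>\<^sup>+t. ennreal ((norm (y t))\<^sup>2) \<partial>lebesgue_on {0..}) \<le> ennreal ((normX \<Sigma> x0)\<^sup>2)"
proof -
  have ex: "\<exists>F. F \<in> D0 \<and> A0 F \<in> D0 \<and> E.en (emb I x0 - F) < 1 / real (Suc m)" for m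
  proof -
    have "0 < 1 / real (Suc m)" by simp
    from A.dense_orbit_data[OF this, of "emb I x0"] show ?thesis by blast
  qed
  define F where "F m = (SOME F. F \<in> D0 \<and> A0 F \<in> D0 \<and> E.en (emb I x0 - F) < 1 / real (Suc m))" for m
  have F: "F m \<in> D0" "A0 (F m) \<in> D0" "E.en (emb I x0 - F m) < 1 / real (Suc m)" for m
    using someI_ex[OF ex[of m]] unfolding F_def by blast+
  define z where "z m = (SOME p. classical_solution \<Sigma> (fst p) (\<lambda>t. 0) (snd p) \<and> emb I (fst p 0) = emb I (rep_l2 (F m)))" for m
  define xs ys where "xs m = fst (z m)" and "ys m = snd (z m)" for m
  have xs: "classical_solution \<Sigma> (xs m) (\<lambda>t. 0) (ys m)" "emb I (xs m 0) = emb I (rep_l2 (F m))" for m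
  proof -
    have "\<exists>p. classical_solution \<Sigma> (fst p) (\<lambda>t. 0) (snd p) \<and> emb I (fst p 0) = emb I (rep_l2 (F m))"
      using classical_exists[OF F(1,2)[of m]] by auto
    from someI_ex[OF this]
    show "classical_solution \<Sigma> (xs m) (\<lambda>t. 0) (ys m)" "emb I (xs m 0) = emb I (rep_l2 (F m))"
      unfolding xs_def ys_def z_def by blast+
  qed
  have "(\<lambda>m. E.en (F m - emb I x0)) \<longlonglongrightarrow> 0"
  proof (rule Lim_null_comparison)
    show "(\<lambda>m. 1 / real (Suc m)) \<longlonglongrightarrow> 0" by (rule LIMSEQ_Suc[OF lim_1_over_n])
    show "\<forall>\<^sub>F m in sequentially. norm (E.en (F m - emb I x0)) \<le> 1 / real (Suc m)"
      using F(3) by (intro always_eventually) (auto simp: E.en_diff_commute[of "F _"] intro: less_imp_le)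
  qed
  then have "F \<longlonglongrightarrow> emb I x0" by (simp add: E.tendsto_iff_en)
  from bounded_linear.tendsto[OF bounded_linear_emb_rep this]
  have "(\<lambda>m. emb I (xs m 0)) \<longlonglongrightarrow> emb I x0" using x0 by (simp add: xs emb_X_simps)
  from zero_input_limit[OF xs(1) x0 this] show ?thesis .
qed

section \<open>The optimal cost\<close>

lemma eqX_cong: "eqX \<Sigma> f g \<Longrightarrow> eqX \<Sigma> h f \<longleftrightarrow> eqX \<Sigma> h g"
  unfolding eqX_def by (auto elim: AE_mp)

lemma optimal_cost_eqX: "eqX \<Sigma> f g \<Longrightarrow> optimal_cost \<Sigma> f = optimal_cost \<Sigma> g"
  unfolding optimal_cost_def cost_def by (simp only: eqX_cong)

lemma cost_le:
  assumes "generalized_solution \<Sigma> x u y" "eqX \<Sigma> (x 0) x0"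
  shows "cost \<Sigma> x0 u \<le> (\<integral>\<^sup>+t. ennreal ((norm (u t))\<^sup>2 + (norm (y t))\<^sup>2) \<partial>lebesgue_on {0..})"
  unfolding cost_def by (rule INF_lower2[of "(x, y)"]) (use assms in auto)

lemma optimal_cost_le:
  assumes "generalized_solution \<Sigma> x u y" "eqX \<Sigma> (x 0) x0" "u \<in> L2 {0..}"
  shows "optimal_cost \<Sigma> x0 \<le> (\<integral>\<^sup>+t. ennreal ((norm (u t))\<^sup>2 + (norm (y t))\<^sup>2) \<partial>lebesgue_on {0..})"
  unfolding optimal_cost_def by (rule INF_lower2[of u]) (fact assms(3), rule cost_le[OF assms(1,2)])

lemma cost_zero_le:
  assumes x0: "x0 \<in> X \<Sigma>"
  shows "cost \<Sigma> x0 (\<lambda>t. 0) \<le> ennreal ((normX \<Sigma> x0)\<^sup>2)"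
proof -
  obtain x y where "generalized_solution \<Sigma> x (\<lambda>t. 0) y" "eqX \<Sigma> (x 0) x0"
    and le: "(\<integral>\<^sup>+t. ennreal ((norm (y t))\<^sup>2) \<partial>lebesgue_on {0..}) \<le> ennreal ((normX \<Sigma> x0)\<^sup>2)"
    using zero_input_exists[OF x0] by blast
  from cost_le[OF this(1,2)] le show ?thesis by simp
qed

lemma optimal_cost_le_normX: "x0 \<in> X \<Sigma> \<Longrightarrow> optimal_cost \<Sigma> x0 \<le> ennreal ((normX \<Sigma> x0)\<^sup>2)"
  unfolding optimal_cost_def by (rule INF_lower2[of "\<lambda>t. 0"]) (simp, rule cost_zero_le)

text \<open>\<open>enn2real\<close> sends an infinite value to 0. This does not occur for states in
  \<open>X\<close>, where the cost is bounded by the energy.\<close>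

definition minimal_cost :: "(real \<Rightarrow> complex^'n) \<Rightarrow> real" where
  "minimal_cost x0 = enn2real (optimal_cost \<Sigma> x0)"

lemma minimal_cost_nonneg: "0 \<le> minimal_cost x0" by (simp add: minimal_cost_def)

lemma optimal_cost_eq: "x0 \<in> X \<Sigma> \<Longrightarrow> optimal_cost \<Sigma> x0 = ennreal (minimal_cost x0)"
  using order.strict_trans1[OF optimal_cost_le_normX ennreal_less_top] unfolding minimal_cost_def
  by (simp add: ennreal_enn2real)

lemma minimal_cost_le: "x0 \<in> X \<Sigma> \<Longrightarrow> minimal_cost x0 \<le> (normX \<Sigma> x0)\<^sup>2"
  using optimal_cost_le_normX[of x0] by (simp add: optimal_cost_eq)

lemma minimal_cost_eqX: "eqX \<Sigma> f g \<Longrightarrow> minimal_cost f = minimal_cost g"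
  by (simp add: minimal_cost_def optimal_cost_eqX)

lemma minimal_cost_approx:
  assumes x0: "x0 \<in> X \<Sigma>" and e: "e > 0"
  shows "\<exists>x u y. generalized_solution \<Sigma> x u y \<and> eqX \<Sigma> (x 0) x0 \<and> u \<in> L2 {0..} \<and>
    (\<integral>\<^sup>+t. ennreal ((norm (u t))\<^sup>2 + (norm (y t))\<^sup>2) \<partial>lebesgue_on {0..}) < ennreal (minimal_cost x0 + e)"
proof -
  have "optimal_cost \<Sigma> x0 < ennreal (minimal_cost x0 + e)"
    using x0 e minimal_cost_nonneg[of x0] by (simp add: optimal_cost_eq ennreal_lessI)
  then obtain u where u: "u \<in> L2 {0..}" "cost \<Sigma> x0 u < ennreal (minimal_cost x0 + e)"
    unfolding optimal_cost_def by (auto simp: INF_less_iff)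
  from u(2) show ?thesis unfolding cost_def using u(1) by (auto simp: INF_less_iff)
qed

lemma minimal_cost_scale_le:
  assumes x0: "x0 \<in> X \<Sigma>"
  shows "minimal_cost (\<lambda>\<zeta>. c *s x0 \<zeta>) \<le> (norm c)\<^sup>2 * minimal_cost x0"
proof (rule field_le_epsilon)
  fix e :: real assume e: "e > 0"
  \<comment> \<open>Makes the scaled error at most e; the summand 1 avoids division by zero when c =
    0.\<close>
  define d where "d = e / ((norm c)\<^sup>2 + 1)"
  have c1: "(norm c)\<^sup>2 + 1 > 0" by (simp add: add_nonneg_pos)
  then have d: "d > 0" using e by (simp add: d_def)
  obtain x u y where g: "generalized_solution \<Sigma> x u y" and 0: "eqX \<Sigma> (x 0) x0" and u: "u \<in> L2 {0..}"
    and lt: "(\<integral>\<^sup>+t. ennreal ((norm (u t))\<^sup>2 + (norm (y t))\<^sup>2) \<partial>lebesgue_on {0..}) < ennreal (minimal_cost x0 + d)"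
    using minimal_cost_approx[OF x0 d] by blast
  note [measurable] = generalized_L2_measurable[OF g]
  have "eqX \<Sigma> (\<lambda>\<zeta>. c *s x 0 \<zeta>) (\<lambda>\<zeta>. c *s x0 \<zeta>)" using 0 unfolding eqX_def by (auto elim: AE_mp)
  from optimal_cost_le[OF generalized_scale[OF g] this L2_linear[OF bounded_linear_scale u]]
  have "optimal_cost \<Sigma> (\<lambda>\<zeta>. c *s x0 \<zeta>)
      \<le> (\<integral>\<^sup>+t. ennreal ((norm c)\<^sup>2) * ennreal ((norm (u t))\<^sup>2 + (norm (y t))\<^sup>2) \<partial>lebesgue_on {0..})"
    by (simp add: norm_scale power_mult_distrib ennreal_mult[symmetric] distrib_left)
  also have "\<dots> = ennreal ((norm c)\<^sup>2) * (\<integral>\<^sup>+t. ennreal ((norm (u t))\<^sup>2 + (norm (y t))\<^sup>2) \<partial>lebesgue_on {0..})"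
    by (rule nn_integral_cmult) measurable
  also have "\<dots> \<le> ennreal ((norm c)\<^sup>2) * ennreal (minimal_cost x0 + d)"
    using lt by (intro mult_left_mono) simp_all
  also have "\<dots> = ennreal ((norm c)\<^sup>2 * (minimal_cost x0 + d))"
    using d minimal_cost_nonneg[of x0] by (simp add: ennreal_mult)
  finally have "minimal_cost (\<lambda>\<zeta>. c *s x0 \<zeta>) \<le> (norm c)\<^sup>2 * (minimal_cost x0 + d)"
    using d minimal_cost_nonneg[of x0] x0 by (simp add: optimal_cost_eq X_scale)
  also have "(norm c)\<^sup>2 * d \<le> ((norm c)\<^sup>2 + 1) * d" using d by (intro mult_right_mono) auto
  then have "(norm c)\<^sup>2 * (minimal_cost x0 + d) \<le> (norm c)\<^sup>2 * minimal_cost x0 + e"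
    using c1 by (simp add: distrib_left d_def)
  finally show "minimal_cost (\<lambda>\<zeta>. c *s x0 \<zeta>) \<le> (norm c)\<^sup>2 * minimal_cost x0 + e" .
qed

text \<open>The converse inequality is the one for the inverse scalar.\<close>

lemma minimal_cost_scale:
  assumes x0: "x0 \<in> X \<Sigma>"
  shows "minimal_cost (\<lambda>\<zeta>. c *s x0 \<zeta>) = (norm c)\<^sup>2 * minimal_cost x0"
proof (rule antisym)
  show "minimal_cost (\<lambda>\<zeta>. c *s x0 \<zeta>) \<le> (norm c)\<^sup>2 * minimal_cost x0" by (rule minimal_cost_scale_le[OF x0])
  show "(norm c)\<^sup>2 * minimal_cost x0 \<le> minimal_cost (\<lambda>\<zeta>. c *s x0 \<zeta>)"
  proof (cases "c = 0")
    case True then show ?thesis using minimal_cost_nonneg by simp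
  next
    case False
    have "minimal_cost x0 \<le> (norm (inverse c))\<^sup>2 * minimal_cost (\<lambda>\<zeta>. c *s x0 \<zeta>)"
      using minimal_cost_scale_le[OF X_scale[OF x0, of c], of "inverse c"] False by (simp add: vector_smult_assoc)
    then have "(norm c)\<^sup>2 * minimal_cost x0 \<le> (norm c)\<^sup>2 * ((norm (inverse c))\<^sup>2 * minimal_cost (\<lambda>\<zeta>. c *s x0 \<zeta>))"
      by (rule mult_left_mono) simp
    also have "\<dots> = minimal_cost (\<lambda>\<zeta>. c *s x0 \<zeta>)"
      using False by (simp add: norm_inverse power_inverse)
    finally show ?thesis .
  qed
qed

text \<open>Sum and difference of nearly optimal solutions are admissible for the sum and the
  difference of the states, and their integrands satisfy the parallelogram identity
  pointwise.\<close>

lemma minimal_cost_parallelogram_le: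
  assumes f: "f \<in> X \<Sigma>" and g: "g \<in> X \<Sigma>"
  shows "minimal_cost (\<lambda>\<zeta>. f \<zeta> + g \<zeta>) + minimal_cost (\<lambda>\<zeta>. f \<zeta> - g \<zeta>) \<le> 2 * minimal_cost f + 2 * minimal_cost g"
proof (rule field_le_epsilon)
  fix e :: real assume "e > 0"
  \<comment> \<open>Both approximation errors enter twice, so each is taken as a quarter of
    \<open>e\<close>.\<close>
  then have e: "e / 4 > 0" by simp
  obtain x u y where s1: "generalized_solution \<Sigma> x u y" and x: "eqX \<Sigma> (x 0) f" and u: "u \<in> L2 {0..}"
    and lt1: "(\<integral>\<^sup>+t. ennreal ((norm (u t))\<^sup>2 + (norm (y t))\<^sup>2) \<partial>lebesgue_on {0..}) < ennreal (minimal_cost f + e / 4)"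
    using minimal_cost_approx[OF f e] by blast
  obtain x2 u2 y2 where s2: "generalized_solution \<Sigma> x2 u2 y2" and x2: "eqX \<Sigma> (x2 0) g" and u2: "u2 \<in> L2 {0..}"
    and lt2: "(\<integral>\<^sup>+t. ennreal ((norm (u2 t))\<^sup>2 + (norm (y2 t))\<^sup>2) \<partial>lebesgue_on {0..}) < ennreal (minimal_cost g + e / 4)"
    using minimal_cost_approx[OF g e] by blast
  note [measurable] = generalized_L2_measurable[OF s1] generalized_L2_measurable[OF s2]
  have neg: "generalized_solution \<Sigma> (\<lambda>t \<zeta>. x t \<zeta> - x2 t \<zeta>) (\<lambda>t. u t - u2 t) (\<lambda>t. y t - y2 t)"
    using generalized_add[OF s1 generalized_scale[OF s2, of "-1"]] by simp
  have "eqX \<Sigma> (\<lambda>\<zeta>. x 0 \<zeta> + x2 0 \<zeta>) (\<lambda>\<zeta>. f \<zeta> + g \<zeta>)" "eqX \<Sigma> (\<lambda>\<zeta>. x 0 \<zeta> - x2 0 \<zeta>) (\<lambda>\<zeta>. f \<zeta> - g \<zeta>)"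
    using x x2 unfolding eqX_def by (eventually_elim, simp)+
  from optimal_cost_le[OF generalized_add[OF s1 s2] this(1) L2_add[OF u u2]]
    optimal_cost_le[OF neg this(2) L2_diff[OF u u2]]
  have "optimal_cost \<Sigma> (\<lambda>\<zeta>. f \<zeta> + g \<zeta>) + optimal_cost \<Sigma> (\<lambda>\<zeta>. f \<zeta> - g \<zeta>)
      \<le> (\<integral>\<^sup>+t. ennreal ((norm (u t + u2 t))\<^sup>2 + (norm (y t + y2 t))\<^sup>2) \<partial>lebesgue_on {0..})
        + (\<integral>\<^sup>+t. ennreal ((norm (u t - u2 t))\<^sup>2 + (norm (y t - y2 t))\<^sup>2) \<partial>lebesgue_on {0..})"
    by (rule add_mono)
  also have "\<dots> = (\<integral>\<^sup>+t. ennreal ((norm (u t + u2 t))\<^sup>2 + (norm (y t + y2 t))\<^sup>2)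
        + ennreal ((norm (u t - u2 t))\<^sup>2 + (norm (y t - y2 t))\<^sup>2) \<partial>lebesgue_on {0..})"
    by (rule nn_integral_add[symmetric]) measurable
  also have "\<dots> = (\<integral>\<^sup>+t. 2 * ennreal ((norm (u t))\<^sup>2 + (norm (y t))\<^sup>2)
        + 2 * ennreal ((norm (u2 t))\<^sup>2 + (norm (y2 t))\<^sup>2) \<partial>lebesgue_on {0..})"
  proof (rule arg_cong2[where f = nn_integral], rule refl, rule ext)
    fix t
    have p: "(norm (v + w))\<^sup>2 + (norm (v - w))\<^sup>2 = 2 * (norm v)\<^sup>2 + 2 * (norm w)\<^sup>2" for v w :: "complex^'z"
      by (simp add: power2_norm_eq_inner inner_add_left inner_add_right inner_diff_left inner_diff_right inner_commute)
    have 2: "2 * ennreal r = ennreal (2 * r)" for r by (simp add: ennreal_mult'[of 2])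
    show "ennreal ((norm (u t + u2 t))\<^sup>2 + (norm (y t + y2 t))\<^sup>2)
        + ennreal ((norm (u t - u2 t))\<^sup>2 + (norm (y t - y2 t))\<^sup>2)
      = 2 * ennreal ((norm (u t))\<^sup>2 + (norm (y t))\<^sup>2) + 2 * ennreal ((norm (u2 t))\<^sup>2 + (norm (y2 t))\<^sup>2)"
      unfolding 2 using p[of "u t" "u2 t"] p[of "y t" "y2 t"]
      by (simp add: ennreal_plus[symmetric] del: ennreal_plus)
  qed
  also have "\<dots> = 2 * (\<integral>\<^sup>+t. ennreal ((norm (u t))\<^sup>2 + (norm (y t))\<^sup>2) \<partial>lebesgue_on {0..})
        + 2 * (\<integral>\<^sup>+t. ennreal ((norm (u2 t))\<^sup>2 + (norm (y2 t))\<^sup>2) \<partial>lebesgue_on {0..})"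
    by (simp add: nn_integral_add nn_integral_cmult del: ennreal_plus)
  also have "\<dots> \<le> 2 * ennreal (minimal_cost f + e / 4) + 2 * ennreal (minimal_cost g + e / 4)"
    using lt1 lt2 by (intro add_mono mult_left_mono) simp_all
  also have "\<dots> = ennreal (2 * (minimal_cost f + e / 4) + 2 * (minimal_cost g + e / 4))"
  proof -
    have 2: "2 * ennreal r = ennreal (2 * r)" for r by (simp add: ennreal_mult'[of 2])
    show ?thesis unfolding 2 using e minimal_cost_nonneg[of f] minimal_cost_nonneg[of g] by (subst ennreal_plus[symmetric]) simp_all
  qed
  finally have "ennreal (minimal_cost (\<lambda>\<zeta>. f \<zeta> + g \<zeta>) + minimal_cost (\<lambda>\<zeta>. f \<zeta> - g \<zeta>)) \<le> ennreal (2 * (minimal_cost f + e / 4) + 2 * (minimal_cost g + e / 4))"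
    using f g by (simp add: optimal_cost_eq X_add X_diff minimal_cost_nonneg ennreal_plus)
  moreover have "0 \<le> 2 * (minimal_cost f + e / 4) + 2 * (minimal_cost g + e / 4)" using e minimal_cost_nonneg[of f] minimal_cost_nonneg[of g] by simp
  ultimately have "minimal_cost (\<lambda>\<zeta>. f \<zeta> + g \<zeta>) + minimal_cost (\<lambda>\<zeta>. f \<zeta> - g \<zeta>) \<le> 2 * (minimal_cost f + e / 4) + 2 * (minimal_cost g + e / 4)"
    by (simp only: ennreal_le_iff)
  then show "minimal_cost (\<lambda>\<zeta>. f \<zeta> + g \<zeta>) + minimal_cost (\<lambda>\<zeta>. f \<zeta> - g \<zeta>) \<le> 2 * minimal_cost f + 2 * minimal_cost g + e" by simp
qed

text \<open>Applying the inequality to f + g and f - g gives the reverse one, because doubling a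
  state multiplies its cost by 4.\<close>

lemma minimal_cost_parallelogram:
  assumes f: "f \<in> X \<Sigma>" and g: "g \<in> X \<Sigma>"
  shows "minimal_cost (\<lambda>\<zeta>. f \<zeta> + g \<zeta>) + minimal_cost (\<lambda>\<zeta>. f \<zeta> - g \<zeta>) = 2 * minimal_cost f + 2 * minimal_cost g"
proof (rule antisym[OF minimal_cost_parallelogram_le[OF f g]])
  have two: "v + w + (v - w) = 2 *s v" "v + w - (v - w) = 2 *s w" for v w :: "complex^'n"
    by (simp_all add: vec_eq_iff)
  show "2 * minimal_cost f + 2 * minimal_cost g \<le> minimal_cost (\<lambda>\<zeta>. f \<zeta> + g \<zeta>) + minimal_cost (\<lambda>\<zeta>. f \<zeta> - g \<zeta>)"
    using minimal_cost_parallelogram_le[OF X_add[OF f g] X_diff[OF f g]] minimal_cost_scale[OF f, of 2] minimal_cost_scale[OF g, of 2]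
    unfolding two by simp
qed

section \<open>The optimal cost operator\<close>

lemma emb_rep_diff: "emb I (rep_l2 (F - G)) = emb I (rep_l2 F) - emb I (rep_l2 G :: real \<Rightarrow> complex^'n)"
  by (rule linear_diff[OF bounded_linear.linear[OF bounded_linear_emb_rep]])

lemma en_emb_rep_le: "E.en (emb I (rep_l2 F)) \<le> E.en F"
proof -
  have "(LINT \<zeta>|lebesgue_on I. rep_l2 F \<zeta> \<bullet> rep_l2 F \<zeta>) = (norm (emb I (rep_l2 F)))\<^sup>2"
    using emb_norm[OF I_sets rep_L2[OF I_sets], of F] by (simp add: power2_norm_eq_inner)
  also have "\<dots> \<le> F \<bullet> F"
    unfolding power2_norm_eq_inner[symmetric] by (rule power_mono[OF norm_emb_rep_le]) simp
  finally have "(LINT \<zeta>|lebesgue_on I. rep_l2 F \<zeta> \<bullet> HX \<Sigma> (rep_l2 F) \<zeta>) \<le> ip F F" by (simp add: ip_alt)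
  moreover have "ip (emb I (rep_l2 F)) (emb I (rep_l2 F)) = (LINT \<zeta>|lebesgue_on I. rep_l2 F \<zeta> \<bullet> HX \<Sigma> (rep_l2 F) \<zeta>)"
    by (simp add: ip_emb Re_innerX)
  ultimately show ?thesis by (simp add: E.en_def)
qed

lemma minimal_cost_operator:
  "\<exists>P. bounded_linear P \<and> (\<forall>F G. ip F (P G) = ip (P F) G) \<and> (\<forall>F. ip F (P F) = minimal_cost (rep_l2 F))"
proof (rule E.quadratic_form_operator)
  show "minimal_cost (rep_l2 (F + G)) + minimal_cost (rep_l2 (F - G)) = 2 * minimal_cost (rep_l2 F) + 2 * minimal_cost (rep_l2 G)" for F G
  proof -
    have "eqX \<Sigma> (rep_l2 (F + G)) (\<lambda>\<zeta>. rep_l2 F \<zeta> + rep_l2 G \<zeta>)" "eqX \<Sigma> (rep_l2 (F - G)) (\<lambda>\<zeta>. rep_l2 F \<zeta> - rep_l2 G \<zeta>)"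
      by (simp_all add: eqX_iff X_add X_diff emb_X_simps emb_rep_add emb_rep_diff)
    from this[THEN minimal_cost_eqX] show ?thesis by (simp add: minimal_cost_parallelogram)
  qed
  show "0 \<le> minimal_cost (rep_l2 F)" for F by (rule minimal_cost_nonneg)
  show "minimal_cost (rep_l2 F) \<le> ip F F" for F
  proof -
    have "minimal_cost (rep_l2 F) \<le> (E.en (emb I (rep_l2 F)))\<^sup>2"
      using minimal_cost_le[of "rep_l2 F"] by (simp add: en_emb)
    also have "\<dots> \<le> (E.en F)\<^sup>2" by (rule power_mono[OF en_emb_rep_le]) simp
    finally show ?thesis by (simp add: E.en_sq)
  qed
qed

lemma normX_sq: "f \<in> X \<Sigma> \<Longrightarrow> (normX \<Sigma> f)\<^sup>2 = Re (innerX \<Sigma> f f)"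
  by (simp add: en_emb[symmetric] E.en_sq ip_emb)

lemma Re_innerX_rep:
  assumes "f \<in> X \<Sigma>"
  shows "Re (innerX \<Sigma> f (rep_l2 H)) = ip (emb I f) H"
proof -
  have "Re (innerX \<Sigma> f (rep_l2 H)) = ip (emb I (rep_l2 H)) (emb I f)"
    unfolding E.sym[of "emb I (rep_l2 H)" "emb I f"] using assms by (simp add: ip_emb)
  also have "\<dots> = (LINT \<zeta>|lebesgue_on I. rep_l2 H \<zeta> \<bullet> HX \<Sigma> f \<zeta>)"
    by (simp only: ip_emb[OF rep_X assms] Re_innerX[OF rep_X assms])
  also have "\<dots> = ip H (emb I f)" by (rule ip_emb_right[OF assms, symmetric])
  finally show ?thesis by (simp add: E.sym[of H "emb I f"])
qed

lemma emb_scale: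
  assumes f: "f \<in> X \<Sigma>"
  shows "emb I (\<lambda>\<zeta>. c *s f \<zeta>) = Re c *\<^sub>R emb I f + Im c *\<^sub>R emb I (\<lambda>\<zeta>. \<i> *s f \<zeta>)"
proof -
  have v: "c *s v = Re c *\<^sub>R v + Im c *\<^sub>R (\<i> *s v)" for v :: "complex^'n"
    by (simp add: vec_eq_iff complex_eq_iff)
  have X: "(\<lambda>\<zeta>. r *\<^sub>R g \<zeta>) \<in> X \<Sigma>" if "g \<in> X \<Sigma>" for r g using that by (simp add: X_L2 L2_scaleR)
  have "emb I (\<lambda>\<zeta>. c *s f \<zeta>) = emb I (\<lambda>\<zeta>. Re c *\<^sub>R f \<zeta> + Im c *\<^sub>R (\<i> *s f \<zeta>))" by (subst v) (rule refl)
  also have "\<dots> = emb I (\<lambda>\<zeta>. Re c *\<^sub>R f \<zeta>) + emb I (\<lambda>\<zeta>. Im c *\<^sub>R (\<i> *s f \<zeta>))"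
    by (rule emb_X_simps(1)[OF X[OF f] X[OF X_scale[OF f]]])
  finally show ?thesis by (simp only: emb_X_simps(3)[OF f] emb_X_simps(3)[OF X_scale[OF f]])
qed

text \<open>Real parts suffice as tests: with h = f - g they already give the vanishing of the
  energy of f - g.\<close>

lemma eqX_weak:
  assumes f: "f \<in> X \<Sigma>" and g: "g \<in> X \<Sigma>"
    and w: "\<And>h. h \<in> X \<Sigma> \<Longrightarrow> Re (innerX \<Sigma> h f) = Re (innerX \<Sigma> h g)"
  shows "eqX \<Sigma> f g"
proof -
  define h where "h = (\<lambda>\<zeta>. f \<zeta> - g \<zeta>)"
  have h: "h \<in> X \<Sigma>" "emb I h = emb I f - emb I g" using f g by (simp_all add: h_def X_diff emb_X_simps)
  have "ip (emb I h) (emb I h) = ip (emb I h) (emb I f) - ip (emb I h) (emb I g)"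
    by (simp only: h(2) E.ip_simps)
  also have "\<dots> = 0" using w[OF h(1)] f g h(1) by (simp add: ip_emb)
  finally show ?thesis using f g h(2) by (simp add: eqX_iff)
qed

lemma innerX_combine_right:
  assumes "f \<in> X \<Sigma>" "g \<in> X \<Sigma>" "h \<in> X \<Sigma>"
  shows "Re (innerX \<Sigma> h (\<lambda>\<zeta>. c *s f \<zeta> + d *s g \<zeta>))
    = Re (innerX \<Sigma> (\<lambda>\<zeta>. cnj c *s h \<zeta>) f) + Re (innerX \<Sigma> (\<lambda>\<zeta>. cnj d *s h \<zeta>) g)"
proof -
  have "Re (innerX \<Sigma> h (\<lambda>\<zeta>. c *s f \<zeta> + d *s g \<zeta>)) = ip (emb I h) (emb I (\<lambda>\<zeta>. c *s f \<zeta>)) + ip (emb I h) (emb I (\<lambda>\<zeta>. d *s g \<zeta>))"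
    using assms by (simp add: ip_emb[symmetric] X_add X_scale emb_X_simps E.ip_simps)
  also have "\<dots> = Re (cnj c * innerX \<Sigma> h f) + Re (cnj d * innerX \<Sigma> h g)"
    using assms by (simp only: ip_emb X_scale innerX_scale_right)
  finally show ?thesis by (simp only: innerX_scale_left)
qed

text \<open>The operator found on \<open>l2\<close> is only real-linear and acts on the whole line.
  Choosing representatives brings it back to \<open>X\<close>; complex linearity and complex
  symmetry are read off from its real form \<open>B\<close>.\<close>

theorem optimal_cost_operator_exists: "\<exists>Popt. optimal_cost_operator \<Sigma> Popt"
proof -
  obtain P where P: "bounded_linear P" "\<And>F G. ip F (P G) = ip (P F) G" "\<And>F. ip F (P F) = minimal_cost (rep_l2 F)"
    using minimal_cost_operator by blast
  interpret P: bounded_linear P by (rule P(1))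
  define Popt where "Popt f = rep_l2 (P (emb I f))" for f :: "real \<Rightarrow> complex^'n"
  have PX: "Popt f \<in> X \<Sigma>" for f by (simp add: Popt_def)
  define B where "B f g = ip (emb I f) (P (emb I g))" for f g :: "real \<Rightarrow> complex^'n"
  have B: "Re (innerX \<Sigma> f (Popt g)) = B f g" if "f \<in> X \<Sigma>" for f g
    unfolding B_def Popt_def by (rule Re_innerX_rep[OF that])
  have Bsym: "B f g = B g f" for f g
    unfolding B_def P(2)[of "emb I f"] by (rule E.sym)
  have Bself: "B f f = minimal_cost f" if f: "f \<in> X \<Sigma>" for f
    unfolding B_def P(3) by (rule minimal_cost_eqX) (use f in \<open>simp add: eqX_iff emb_X_simps\<close>)
  have Badd: "B h (\<lambda>\<zeta>. f \<zeta> + g \<zeta>) = B h f + B h g" if "f \<in> X \<Sigma>" "g \<in> X \<Sigma>" for f g h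
    using that by (simp add: B_def emb_X_simps P.add E.ip_simps)
  \<comment> \<open>Expresses \<open>B\<close> by the cost alone, so that invariance of the cost
    under \<i> becomes invariance of \<open>B\<close>.\<close>
  have pol: "2 * B f g = minimal_cost (\<lambda>\<zeta>. f \<zeta> + g \<zeta>) - minimal_cost f - minimal_cost g" if f: "f \<in> X \<Sigma>" and g: "g \<in> X \<Sigma>" for f g
    using Bself[OF X_add[OF f g]] Bself[OF f] Bself[OF g] Bsym[of f g]
      Badd[OF f g, of "\<lambda>\<zeta>. f \<zeta> + g \<zeta>"] Bsym[of "\<lambda>\<zeta>. f \<zeta> + g \<zeta>" f] Bsym[of "\<lambda>\<zeta>. f \<zeta> + g \<zeta>" g]
      Badd[OF f g, of f] Badd[OF f g, of g] by linarith
  have Bi: "B (\<lambda>\<zeta>. \<i> *s f \<zeta>) (\<lambda>\<zeta>. \<i> *s g \<zeta>) = B f g" if f: "f \<in> X \<Sigma>" and g: "g \<in> X \<Sigma>" for f g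
  proof -
    have "minimal_cost (\<lambda>\<zeta>. \<i> *s f \<zeta> + \<i> *s g \<zeta>) = minimal_cost (\<lambda>\<zeta>. f \<zeta> + g \<zeta>)"
      using minimal_cost_scale[OF X_add[OF f g], of \<i>] by (simp add: vector_add_ldistrib)
    moreover have "minimal_cost (\<lambda>\<zeta>. \<i> *s f \<zeta>) = minimal_cost f" "minimal_cost (\<lambda>\<zeta>. \<i> *s g \<zeta>) = minimal_cost g"
      using minimal_cost_scale[OF f, of \<i>] minimal_cost_scale[OF g, of \<i>] by simp_all
    ultimately show ?thesis
      using pol[OF X_scale[OF f, of \<i>] X_scale[OF g, of \<i>]] pol[OF f g] by linarith
  qed
  \<comment> \<open>Inserting \<i> f in \<open>Bi\<close> and using that \<i> (\<i> f) is - f moves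
    \<i> across the form with a change of sign. Real and imaginary parts then give every
    scalar.\<close>
  have Bc: "B f (\<lambda>\<zeta>. c *s g \<zeta>) = B (\<lambda>\<zeta>. cnj c *s f \<zeta>) g" if f: "f \<in> X \<Sigma>" and g: "g \<in> X \<Sigma>" for f g c
  proof -
    have "B (\<lambda>\<zeta>. \<i> *s (\<i> *s f \<zeta>)) (\<lambda>\<zeta>. \<i> *s g \<zeta>) = B (\<lambda>\<zeta>. \<i> *s f \<zeta>) g"
      by (rule Bi[OF X_scale[OF f] g])
    moreover have "emb I (\<lambda>\<zeta>. \<i> *s (\<i> *s f \<zeta>)) = - emb I f"
      using emb_scale[OF f, of "-1"] by (simp add: vector_smult_assoc)
    ultimately have "B f (\<lambda>\<zeta>. \<i> *s g \<zeta>) = - B (\<lambda>\<zeta>. \<i> *s f \<zeta>) g" by (simp add: B_def E.ip_simps)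
    then show ?thesis
      unfolding B_def emb_scale[OF f, of "cnj c"] emb_scale[OF g, of c]
      by (simp add: P.add P.scaleR E.ip_simps)
  qed
  have "optimal_cost_operator \<Sigma> Popt"
    unfolding optimal_cost_operator_def bounded_linear_X_def
  proof (intro conjI ballI allI)
    show "Popt f \<in> X \<Sigma>" for f by (rule PX)
    fix f g assume f: "f \<in> X \<Sigma>" and g: "g \<in> X \<Sigma>"
    show "eqX \<Sigma> (Popt (\<lambda>\<zeta>. c *s f \<zeta> + d *s g \<zeta>)) (\<lambda>\<zeta>. c *s Popt f \<zeta> + d *s Popt g \<zeta>)" for c d
    proof (rule eqX_weak)
      show "Popt (\<lambda>\<zeta>. c *s f \<zeta> + d *s g \<zeta>) \<in> X \<Sigma>" "(\<lambda>\<zeta>. c *s Popt f \<zeta> + d *s Popt g \<zeta>) \<in> X \<Sigma>"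
        by (simp_all add: PX X_add X_scale)
      fix h assume h: "h \<in> X \<Sigma>"
      show "Re (innerX \<Sigma> h (Popt (\<lambda>\<zeta>. c *s f \<zeta> + d *s g \<zeta>))) = Re (innerX \<Sigma> h (\<lambda>\<zeta>. c *s Popt f \<zeta> + d *s Popt g \<zeta>))"
        unfolding innerX_combine_right[OF PX PX h] B[OF h] B[OF X_scale[OF h]] Badd[OF X_scale[OF f] X_scale[OF g]]
          Bc[OF h f] Bc[OF h g] by (rule refl)
    qed
    show "innerX \<Sigma> f (Popt g) = innerX \<Sigma> (Popt f) g"
    proof (rule complex_eqI)
      have r: "Re (innerX \<Sigma> (Popt f) k) = B k f" if "k \<in> X \<Sigma>" for k
        using arg_cong[OF cnj_innerX[OF that PX, of f], of Re] B[OF that] by simp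
      show "Re (innerX \<Sigma> f (Popt g)) = Re (innerX \<Sigma> (Popt f) g)" using f g Bsym[of f g] by (simp add: B r)
      \<comment> \<open>The imaginary part of z is the real part of - \<i> z, so symmetry of the
        complex form reduces to statements about \<open>B\<close>.\<close>
      have "Im (innerX \<Sigma> f (Popt g)) = Re (innerX \<Sigma> (\<lambda>\<zeta>. - \<i> *s f \<zeta>) (Popt g))"
        unfolding innerX_scale_left by simp
      also have "\<dots> = B (\<lambda>\<zeta>. - \<i> *s f \<zeta>) g" by (rule B[OF X_scale[OF f]])
      also have "\<dots> = B f (\<lambda>\<zeta>. \<i> *s g \<zeta>)" unfolding Bc[OF f g] by simp
      also have "\<dots> = Re (innerX \<Sigma> (Popt f) (\<lambda>\<zeta>. \<i> *s g \<zeta>))" unfolding r[OF X_scale[OF g]] by (rule Bsym)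
      also have "\<dots> = Im (innerX \<Sigma> (Popt f) g)" unfolding innerX_scale_right by simp
      finally show "Im (innerX \<Sigma> f (Popt g)) = Im (innerX \<Sigma> (Popt f) g)" .
    qed
    show "ereal (Re (innerX \<Sigma> f (Popt f))) = enn2ereal (optimal_cost \<Sigma> f)"
      using f by (simp add: B Bself optimal_cost_eq minimal_cost_nonneg enn2ereal_ennreal)
  next
    obtain K where K: "K > 0" "\<And>F. norm (P F) \<le> norm F * K" using P.pos_bounded by blast
    obtain C1 where C1: "C1 > 0" "\<And>x. norm x \<le> C1 * E.en x" using E.norm_le_en by blast
    obtain C2 where C2: "C2 > 0" "\<And>x. E.en x \<le> C2 * norm x" using E.en_le_norm by blast
    have "normX \<Sigma> (Popt f) \<le> C2 * (C1 * K) * normX \<Sigma> f" if f: "f \<in> X \<Sigma>" for f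
    proof -
      have "normX \<Sigma> (Popt f) = E.en (emb I (Popt f))" by (simp add: en_emb PX)
      also have "\<dots> \<le> C2 * norm (emb I (Popt f))" by (rule C2(2))
      also have "\<dots> \<le> C2 * norm (P (emb I f))"
        using C2(1) norm_emb_rep_le[of "P (emb I f)"] by (simp add: Popt_def)
      also have "\<dots> \<le> C2 * (C1 * E.en (emb I f) * K)"
        using C2(1) K(1) order_trans[OF K(2)[of "emb I f"] mult_right_mono[OF C1(2)[of "emb I f"], of K]] by simp
      finally show ?thesis using f by (simp add: en_emb mult_ac)
    qed
    then show "\<exists>C. \<forall>f\<in>X \<Sigma>. normX \<Sigma> (Popt f) \<le> C * normX \<Sigma> f" by blast
  qed
  then show ?thesis by blast
qed

lemma optimal_cost_operator_le:
  assumes P: "optimal_cost_operator \<Sigma> Popt" and x0: "x0 \<in> X \<Sigma>"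
  shows "Re (innerX \<Sigma> x0 (Popt x0)) \<le> (normX \<Sigma> x0)\<^sup>2"
proof -
  have "ereal (Re (innerX \<Sigma> x0 (Popt x0))) = enn2ereal (optimal_cost \<Sigma> x0)"
    using P x0 unfolding optimal_cost_operator_def by blast
  also have "\<dots> = ereal (minimal_cost x0)" using x0 by (simp add: optimal_cost_eq minimal_cost_nonneg enn2ereal_ennreal)
  finally show ?thesis using minimal_cost_le[OF x0] by simp
qed

lemma finite_cost: "finite_cost_condition \<Sigma>"
  unfolding finite_cost_condition_def
  using cost_zero_le ennreal_less_top order.strict_trans1 by (metis infinity_ennreal_def)

end

section \<open>Orbits of strongly continuous semigroups\<close>

lemma tendsto_within_Ici:
  fixes f :: "real \<Rightarrow> 'a::topological_space"
  assumes r: "((\<lambda>h. f (t + h)) \<longlongrightarrow> L) (at_right 0)" and l: "t > 0 \<Longrightarrow> ((\<lambda>h. f (t - h)) \<longlongrightarrow> L) (at_right 0)"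
    and t: "t \<ge> 0"
  shows "(f \<longlongrightarrow> L) (at t within {0..})"
proof -
  have R: "(f \<longlongrightarrow> L) (at_right t)" using r by (simp add: filterlim_at_right_to_0[of f _ t] add.commute)
  show ?thesis
  proof (cases "t = 0")
    case True then show ?thesis using R by (simp add: at_within_Ici_at_right)
  next
    case False
    then have "(f \<longlongrightarrow> L) (at_left t)"
      using l t by (simp add: filterlim_at_left_to_right filterlim_at_right_to_0[of _ _ "- t"])
    from filterlim_split_at[OF this R] show ?thesis by (rule tendsto_within_subset) simp
  qed
qed

text \<open>\<open>S 0\<close> is only required to be idempotent, because a state space of functions on an interval
  is embedded as a proper subspace.\<close>

locale c0_semigroup =
  fixes S :: "real \<Rightarrow> 'a::banach \<Rightarrow> 'a"
  assumes bounded_linear: "t \<ge> 0 \<Longrightarrow> bounded_linear (S t)"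
    and semigroup: "s \<ge> 0 \<Longrightarrow> t \<ge> 0 \<Longrightarrow> S (s + t) x = S s (S t x)"
    and right_continuous: "((\<lambda>t. S t x) \<longlongrightarrow> S 0 x) (at_right 0)"
begin

lemma diff: "t \<ge> 0 \<Longrightarrow> S t (x - y) = S t x - S t y"
  by (rule linear_diff[OF bounded_linear.linear[OF bounded_linear]])

lemma scaleR: "t \<ge> 0 \<Longrightarrow> S t (r *\<^sub>R x) = r *\<^sub>R S t x"
  by (rule linear_scale[OF bounded_linear.linear[OF bounded_linear]])

text \<open>Otherwise there are times tending to 0 at which the operators have no common bound. But
  by right continuity at 0 every orbit is bounded along these times, against the uniform boundedness
  principle.\<close>

lemma local_bound: "\<exists>\<delta>>0. \<exists>M. \<forall>t\<in>{0..\<delta>}. \<forall>x. norm (S t x) \<le> M * norm x"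
proof (rule ccontr)
  assume neg: "\<not> ?thesis"
  have "\<exists>t. t \<in> {0..1 / real (Suc n)} \<and> (\<exists>x. real n * norm x < norm (S t x))" for n
  proof (rule ccontr)
    assume "\<not> ?thesis"
    then have "\<forall>t\<in>{0..1 / real (Suc n)}. \<forall>x. norm (S t x) \<le> real n * norm x" by (auto simp: not_less)
    moreover have "0 < 1 / real (Suc n)" by simp
    ultimately show False using neg by blast
  qed
  then obtain \<tau> where \<tau>: "\<And>n. \<tau> n \<in> {0..1 / real (Suc n)}" "\<And>n. \<exists>x. real n * norm x < norm (S (\<tau> n) x)"
    using choice[of "\<lambda>n t. t \<in> {0..1 / real (Suc n)} \<and> (\<exists>x. real n * norm x < norm (S t x))"] by blast
  have nn: "\<tau> n \<ge> 0" for n using \<tau>(1)[of n] by simp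
  have lim: "\<tau> \<longlonglongrightarrow> 0"
    by (rule real_tendsto_sandwich[OF _ _ tendsto_const LIMSEQ_Suc[OF lim_1_over_n]])
      (use \<tau>(1) in \<open>simp_all add: always_eventually\<close>)
  have "\<exists>K. \<forall>n. norm (S (\<tau> n) x) \<le> K" for x
  proof -
    have "continuous (at 0 within {0..}) (\<lambda>t. S t x)"
      using right_continuous[of x] by (simp add: continuous_within at_within_Ici_at_right)
    from continuous_within_tendsto_compose'[OF this _ lim]
    have "(\<lambda>n. S (\<tau> n) x) \<longlonglongrightarrow> S 0 x" using nn by simp
    from convergentI[OF this] have "Bseq (\<lambda>n. S (\<tau> n) x)" by (rule convergent_imp_Bseq)
    then show ?thesis by (auto elim!: BseqE)
  qed
  from uniform_boundedness[of "\<lambda>n. S (\<tau> n)", OF bounded_linear[OF nn] this]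
  obtain M where M: "\<And>n x. norm (S (\<tau> n) x) \<le> M * norm x" by blast
  obtain n :: nat where n: "M \<le> real n" using real_arch_simple by blast
  obtain x where x: "real n * norm x < norm (S (\<tau> n) x)" using \<tau>(2) by blast
  have "M * norm x \<le> real n * norm x" by (rule mult_right_mono[OF n]) simp
  then show False using x M[of n x] by linarith
qed

text \<open>\<open>S (t - h)\<close> applied to the difference of \<open>S 0 (k h)\<close> and
  \<open>S h L\<close> is the error. To bound this operator with the local bound alone, it is split
  as \<open>S (\<delta> - h)\<close> after the fixed \<open>S (t - \<delta>)\<close>. The argument
  may vary with h, so the lemma serves continuity and differentiability.\<close>

lemma tendsto_left:
  assumes k: "(k \<longlongrightarrow> L) (at_right 0)" and t: "t > 0"
  shows "((\<lambda>h. S (t - h) (k h)) \<longlongrightarrow> S t L) (at_right 0)"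
proof -
  obtain \<delta>0 M where d0: "\<delta>0 > 0" "\<forall>s\<in>{0..\<delta>0}. \<forall>x. norm (S s x) \<le> M * norm x" using local_bound by blast
  define \<delta> where "\<delta> = min \<delta>0 t"
  have d: "\<delta> > 0" "\<delta> \<le> t" and M: "norm (S s x) \<le> M * norm x" if "s \<in> {0..\<delta>}" for s x
    using d0 t that by (auto simp: \<delta>_def)
  have d: "\<delta> > 0" "\<delta> \<le> t" using d0(1) t by (auto simp: \<delta>_def)
  obtain K where K: "K > 0" "\<And>x. norm (S (t - \<delta>) x) \<le> norm x * K"
    using bounded_linear.pos_bounded[OF bounded_linear[of "t - \<delta>"]] d(2) by auto
  have "((\<lambda>h. S 0 (k h) - S h L) \<longlongrightarrow> S 0 L - S 0 L) (at_right 0)"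
    by (rule tendsto_diff[OF bounded_linear.tendsto[OF bounded_linear[OF order_refl] k] right_continuous])
  then have "((\<lambda>h. \<bar>M\<bar> * (norm (S 0 (k h) - S h L) * K)) \<longlongrightarrow> \<bar>M\<bar> * (norm (S 0 L - S 0 L) * K)) (at_right 0)"
    by (intro tendsto_mult tendsto_const tendsto_norm)
  then have z: "((\<lambda>h. \<bar>M\<bar> * (norm (S 0 (k h) - S h L) * K)) \<longlongrightarrow> 0) (at_right 0)" by simp
  have "((\<lambda>h. S (t - h) (k h) - S t L) \<longlongrightarrow> 0) (at_right 0)"
  proof (rule Lim_null_comparison[OF _ z])
    have "\<forall>\<^sub>F h in at_right 0. h \<in> {0<..<\<delta>}" using d(1) by (rule eventually_at_right_real)
    then show "\<forall>\<^sub>F h in at_right 0. norm (S (t - h) (k h) - S t L) \<le> \<bar>M\<bar> * (norm (S 0 (k h) - S h L) * K)"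
    proof eventually_elim
      case (elim h)
      then have h: "0 \<le> h" "h \<le> \<delta>" "0 \<le> t - h" "0 \<le> t - \<delta>" "0 \<le> \<delta> - h" using d by auto
      define v where "v = S 0 (k h) - S h L"
      have "S (t - h) (k h) - S t L = S (t - h) v"
        using semigroup[OF h(3) order_refl, of "k h"] semigroup[OF h(3,1), of L] by (simp add: v_def diff[OF h(3)])
      also have "\<dots> = S (\<delta> - h) (S (t - \<delta>) v)" using semigroup[OF h(5,4), of v] by simp
      finally have "norm (S (t - h) (k h) - S t L) \<le> M * norm (S (t - \<delta>) v)" using M[of "\<delta> - h"] h by simp
      also have "\<dots> \<le> \<bar>M\<bar> * norm (S (t - \<delta>) v)" by (rule mult_right_mono) simp_all
      also have "\<dots> \<le> \<bar>M\<bar> * (norm v * K)" by (rule mult_left_mono[OF K(2)]) simp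
      finally show ?case by (simp add: v_def)
    qed
  qed
  then show ?thesis by (rule LIM_zero_cancel)
qed

lemma tendsto_right:
  assumes k: "(k \<longlongrightarrow> L) (at_right 0)" and t: "t \<ge> 0"
  shows "((\<lambda>h. S t (k h)) \<longlongrightarrow> S t L) (at_right 0)"
  by (rule bounded_linear.tendsto[OF bounded_linear[OF t] k])

lemma orbit_continuous: "continuous_on {0..} (\<lambda>t. S t x)"
  unfolding continuous_on_def
proof
  fix t :: real assume "t \<in> {0..}"
  then have t: "t \<ge> 0" by simp
  show "((\<lambda>t. S t x) \<longlongrightarrow> S t x) (at t within {0..})"
  proof (rule tendsto_within_Ici[OF _ _ t])
    have "((\<lambda>h. S t (S h x)) \<longlongrightarrow> S t (S 0 x)) (at_right 0)" by (rule tendsto_right[OF right_continuous t])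
    moreover have "\<forall>\<^sub>F h in at_right 0. S t (S h x) = S (t + h) x"
      using eventually_at_right_less[of "0::real"] by eventually_elim (simp add: semigroup t)
    ultimately show "((\<lambda>h. S (t + h) x) \<longlongrightarrow> S t x) (at_right 0)"
      using semigroup[OF t order_refl, of x] by (simp add: tendsto_cong)
    show "((\<lambda>h. S (t - h) x) \<longlongrightarrow> S t x) (at_right 0)" if "t > 0" by (rule tendsto_left[OF tendsto_const that])
  qed
qed

text \<open>The generator gives only the right derivative at 0. Difference quotients at t are images
  of the one at 0, under \<open>S t\<close> from the right and under \<open>S (t - h)\<close> from
  the left.\<close>

lemma orbit_derivative:
  assumes g: "((\<lambda>h. (S h x - S 0 x) /\<^sub>R h) \<longlongrightarrow> y) (at_right 0)" and t: "t \<ge> 0"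
  shows "((\<lambda>s. S s x) has_vector_derivative S t y) (at t within {0..})"
  unfolding has_vector_derivative_iff_quotient
proof (rule tendsto_within_Ici[OF _ _ t])
  have pos: "\<forall>\<^sub>F h in at_right (0::real). 0 < h" by (rule eventually_at_right_less)
  have "\<forall>\<^sub>F h in at_right 0. S t ((S h x - S 0 x) /\<^sub>R h) = (S (t + h) x - S t x) /\<^sub>R (t + h - t)"
    using pos
  proof eventually_elim
    case (elim h)
    then show ?case
      using semigroup[OF t, of h x] semigroup[OF t order_refl, of x] by (simp add: scaleR[OF t] diff[OF t])
  qed
  from Lim_transform_eventually[OF tendsto_right[OF g t] this]
  show "((\<lambda>h. (S (t + h) x - S t x) /\<^sub>R (t + h - t)) \<longlongrightarrow> S t y) (at_right 0)" .
  assume t: "t > 0"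
  have "\<forall>\<^sub>F h in at_right 0. h \<in> {0<..<t}" using t by (rule eventually_at_right_real)
  then have "\<forall>\<^sub>F h in at_right 0. S (t - h) ((S h x - S 0 x) /\<^sub>R h) = (S (t - h) x - S t x) /\<^sub>R (t - h - t)"
  proof eventually_elim
    case (elim h)
    then have h: "0 \<le> t - h" "0 \<le> h" by auto
    show ?case
      using semigroup[OF h, of x] semigroup[OF h(1) order_refl, of x] by (simp add: scaleR[OF h(1)] diff[OF h(1)] algebra_simps)
  qed
  from Lim_transform_eventually[OF tendsto_left[OF g t] this]
  show "((\<lambda>h. (S (t - h) x - S t x) /\<^sub>R (t - h - t)) \<longlongrightarrow> S t y) (at_right 0)" .
qed

end

context port_hamiltonian_node
begin

section \<open>Solutions and input energy\<close>

lemma generalized_approx: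
  assumes "generalized_solution \<Sigma> x u y"
  shows "\<exists>xs us ys. (\<forall>m::nat. classical_solution \<Sigma> (xs m) (us m) (ys m)) \<and>
    (\<forall>t\<ge>0. (\<lambda>m. emb I (xs m t)) \<longlonglongrightarrow> emb I (x t) \<and>
      (\<lambda>m. integral {0..t} (\<lambda>s. (norm (us m s))\<^sup>2)) \<longlonglongrightarrow> (LINT s|lebesgue_on {0..t}. (norm (u s))\<^sup>2) \<and>
      (\<lambda>m. integral {0..t} (\<lambda>s. (norm (ys m s))\<^sup>2)) \<longlonglongrightarrow> (LINT s|lebesgue_on {0..t}. (norm (y s))\<^sup>2))"
proof -
  obtain xs us ys where c: "\<And>m::nat. classical_solution \<Sigma> (xs m) (us m) (ys m)"
    and l: "\<And>\<tau>. \<tau> \<ge> 0 \<Longrightarrow> uniform_limit {0..\<tau>} (\<lambda>m t. emb I (xs m t)) (\<lambda>t. emb I (x t)) sequentially"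
      "\<And>\<tau>. \<tau> \<ge> 0 \<Longrightarrow> (\<lambda>m. emb {0..\<tau>} (us m)) \<longlonglongrightarrow> emb {0..\<tau>} u" "\<And>\<tau>. \<tau> \<ge> 0 \<Longrightarrow> (\<lambda>m. emb {0..\<tau>} (ys m)) \<longlonglongrightarrow> emb {0..\<tau>} y"
    and uy: "\<And>\<tau>. \<tau> \<ge> 0 \<Longrightarrow> u \<in> L2 {0..\<tau>}" "\<And>\<tau>. \<tau> \<ge> 0 \<Longrightarrow> y \<in> L2 {0..\<tau>}"
    using assms unfolding generalized_solution_iff by blast
  have S: "{0..t} \<in> sets (lebesgue :: real measure)" for t by simp
  have lim: "(\<lambda>m. integral {0..t} (\<lambda>s. (norm (g m s))\<^sup>2)) \<longlonglongrightarrow> (LINT s|lebesgue_on {0..t}. (norm (h s))\<^sup>2)"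
    if g: "\<And>m. continuous_on {0..} (g m)" and h: "h \<in> L2 {0..t}" and gh: "(\<lambda>m. emb {0..t} (g m)) \<longlonglongrightarrow> emb {0..t} h"
    for g :: "nat \<Rightarrow> real \<Rightarrow> 'e::euclidean_space" and h t
  proof -
    have "(\<lambda>m. (norm (emb {0..t} (g m)))\<^sup>2) \<longlonglongrightarrow> (norm (emb {0..t} h))\<^sup>2" by (intro tendsto_power tendsto_norm gh)
    then show ?thesis
      by (simp only: emb_norm[OF S continuous_L2_Icc[OF g]] emb_norm[OF S h] continuous_LINT_eq[OF g])
  qed
  show ?thesis
  proof (rule exI[of _ xs], rule exI[of _ us], rule exI[of _ ys], intro conjI allI impI)
    show "classical_solution \<Sigma> (xs m) (us m) (ys m)" for m by (rule c)
    fix t :: real assume t: "t \<ge> 0"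
    show "(\<lambda>m. emb I (xs m t)) \<longlonglongrightarrow> emb I (x t)" by (rule tendsto_uniform_limitI[OF l(1)[OF t]]) (use t in simp)
    show "(\<lambda>m. integral {0..t} (\<lambda>s. (norm (us m s))\<^sup>2)) \<longlonglongrightarrow> (LINT s|lebesgue_on {0..t}. (norm (u s))\<^sup>2)"
      by (rule lim[OF classical_D(1)[OF c] uy(1)[OF t] l(2)[OF t]])
    show "(\<lambda>m. integral {0..t} (\<lambda>s. (norm (ys m s))\<^sup>2)) \<longlonglongrightarrow> (LINT s|lebesgue_on {0..t}. (norm (y s))\<^sup>2)"
      by (rule lim[OF classical_D(2)[OF c] uy(2)[OF t] l(3)[OF t]])
  qed
qed

text \<open>The shifted solution minus \<open>z\<close> is a classical solution whose input is the
  shifted \<open>u\<close>. Its energy inequality is used without the nonnegative output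
  term.\<close>

lemma classical_compare:
  assumes x: "classical_solution \<Sigma> x u y" and z: "classical_solution \<Sigma> z (\<lambda>t. 0) w" and s: "s \<ge> 0" and t: "t \<ge> 0"
  shows "(E.en (emb I (x (s + t)) - emb I (z t)))\<^sup>2 \<le> (E.en (emb I (x s) - emb I (z 0)))\<^sup>2
    + (integral {0..s + t} (\<lambda>r. (norm (u r))\<^sup>2) - integral {0..s} (\<lambda>r. (norm (u r))\<^sup>2))"
proof -
  note D = classical_D[OF x] and Z = classical_D[OF z]
  have cy: "continuous_on {0..t} (\<lambda>r. (norm (y (s + r) - w r))\<^sup>2)"
    by (intro continuous_intros continuous_on_compose2[OF D(2)] continuous_on_subset[OF Z(2)]) (use s in auto)
  have nn: "0 \<le> integral {0..t} (\<lambda>r. (norm (y (s + r) - w r))\<^sup>2)"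
    by (rule integral_nonneg[OF integrable_continuous_real[OF cy]]) simp
  have "continuous_on {0..s + t} (\<lambda>r. (norm (u r))\<^sup>2)"
    by (intro continuous_intros continuous_on_subset[OF D(1)]) auto
  from Henstock_Kurzweil_Integration.integral_combine[OF s _ integrable_continuous_real[OF this]]
  have "integral {0..s} (\<lambda>r. (norm (u r))\<^sup>2) + integral {s..s + t} (\<lambda>r. (norm (u r))\<^sup>2) = integral {0..s + t} (\<lambda>r. (norm (u r))\<^sup>2)"
    using t by simp
  moreover have "integral {0..t} (\<lambda>r. (norm (u (s + r)))\<^sup>2) = integral {s..s + t} (\<lambda>r. (norm (u r))\<^sup>2)"
    using integral_shift_Icc_real[of 0 t "\<lambda>r. (norm (u r))\<^sup>2" s] by (simp add: o_def add.commute)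
  ultimately show ?thesis
    using classical_energy[OF classical_diff[OF classical_shift[OF x s] z] t] nn D(8)[of s] D(8)[of "s + t"] Z(8)[of 0] Z(8)[of t] s t
    by (simp add: normX_diff)
qed

lemma generalized_compare:
  assumes x: "generalized_solution \<Sigma> x u y" and z: "classical_solution \<Sigma> z (\<lambda>t. 0) w" and s: "s \<ge> 0" and t: "t \<ge> 0"
  shows "(E.en (emb I (x (s + t)) - emb I (z t)))\<^sup>2 \<le> (E.en (emb I (x s) - emb I (z 0)))\<^sup>2
    + ((LINT r|lebesgue_on {0..s + t}. (norm (u r))\<^sup>2) - (LINT r|lebesgue_on {0..s}. (norm (u r))\<^sup>2))"
proof -
  have st: "s + t \<ge> 0" using s t by simp
  obtain xs us ys where c: "\<And>m::nat. classical_solution \<Sigma> (xs m) (us m) (ys m)"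
    and l: "\<And>t. t \<ge> 0 \<Longrightarrow> (\<lambda>m. emb I (xs m t)) \<longlonglongrightarrow> emb I (x t)"
      "\<And>t. t \<ge> 0 \<Longrightarrow> (\<lambda>m. integral {0..t} (\<lambda>s. (norm (us m s))\<^sup>2)) \<longlonglongrightarrow> (LINT s|lebesgue_on {0..t}. (norm (u s))\<^sup>2)"
    using generalized_approx[OF x] by blast
  show ?thesis
  proof (rule LIMSEQ_le)
    show "(\<lambda>m. (E.en (emb I (xs m (s + t)) - emb I (z t)))\<^sup>2) \<longlonglongrightarrow> (E.en (emb I (x (s + t)) - emb I (z t)))\<^sup>2"
      by (intro tendsto_power E.tendsto_en tendsto_diff l(1)[OF st] tendsto_const)
    show "(\<lambda>m. (E.en (emb I (xs m s) - emb I (z 0)))\<^sup>2 + (integral {0..s + t} (\<lambda>r. (norm (us m r))\<^sup>2) - integral {0..s} (\<lambda>r. (norm (us m r))\<^sup>2)))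
      \<longlonglongrightarrow> (E.en (emb I (x s) - emb I (z 0)))\<^sup>2 + ((LINT r|lebesgue_on {0..s + t}. (norm (u r))\<^sup>2) - (LINT r|lebesgue_on {0..s}. (norm (u r))\<^sup>2))"
      by (intro tendsto_add tendsto_power E.tendsto_en tendsto_diff l(1)[OF s] l(2)[OF st] l(2)[OF s] tendsto_const)
  qed (rule exI[of _ 0], use classical_compare[OF c z s t] in blast)
qed

text \<open>\<open>bounded_linear_X\<close> does not ask for compatibility with equality almost
  everywhere. It follows from boundedness and linearity at a difference of zero norm.\<close>

lemma bounded_linear_X_cong:
  assumes A: "bounded_linear_X \<Sigma> A" and f: "f \<in> X \<Sigma>" and g: "g \<in> X \<Sigma>" and eq: "emb I f = emb I g"
  shows "emb I (A f) = emb I (A g)"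
proof -
  obtain C where C: "\<forall>f\<in>X \<Sigma>. normX \<Sigma> (A f) \<le> C * normX \<Sigma> f" and AX: "\<And>f. f \<in> X \<Sigma> \<Longrightarrow> A f \<in> X \<Sigma>"
    and lin: "eqX \<Sigma> (A (\<lambda>\<zeta>. 1 *s f \<zeta> + (-1) *s g \<zeta>)) (\<lambda>\<zeta>. 1 *s A f \<zeta> + (-1) *s A g \<zeta>)"
    using A f g unfolding bounded_linear_X_def by blast
  have d: "(\<lambda>\<zeta>. f \<zeta> - g \<zeta>) \<in> X \<Sigma>" by (rule X_diff[OF f g])
  have "emb I (A f) - emb I (A g) = emb I (A (\<lambda>\<zeta>. f \<zeta> - g \<zeta>))"
    using lin AX[OF d] AX[OF f] AX[OF g] by (simp add: eqX_iff X_diff emb_X_simps)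
  moreover have "normX \<Sigma> (\<lambda>\<zeta>. f \<zeta> - g \<zeta>) = 0" using f g eq by (simp add: normX_diff)
  then have "E.en (emb I (A (\<lambda>\<zeta>. f \<zeta> - g \<zeta>))) = 0"
    using bspec[OF C d] E.en_nonneg[of "emb I (A (\<lambda>\<zeta>. f \<zeta> - g \<zeta>))"] en_emb[OF AX[OF d]] by simp
  then have "ip (emb I (A (\<lambda>\<zeta>. f \<zeta> - g \<zeta>))) (emb I (A (\<lambda>\<zeta>. f \<zeta> - g \<zeta>))) = 0" by (simp add: E.en_sq[symmetric])
  ultimately show ?thesis by simp
qed

lemma emb_of_real_scale: "f \<in> X \<Sigma> \<Longrightarrow> emb I (\<lambda>\<zeta>. complex_of_real r *s f \<zeta>) = r *\<^sub>R emb I f"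
  by (simp only: of_real_scale emb_X_simps(3))

lemma bounded_linear_X_emb:
  assumes A: "bounded_linear_X \<Sigma> A"
  shows "bounded_linear (\<lambda>F. emb I (A (rep_l2 F)))"
proof -
  obtain C where C: "\<forall>f\<in>X \<Sigma>. normX \<Sigma> (A f) \<le> C * normX \<Sigma> f" and AX: "\<And>f. f \<in> X \<Sigma> \<Longrightarrow> A f \<in> X \<Sigma>"
    and lin: "\<And>f g c d. f \<in> X \<Sigma> \<Longrightarrow> g \<in> X \<Sigma> \<Longrightarrow> eqX \<Sigma> (A (\<lambda>\<zeta>. c *s f \<zeta> + d *s g \<zeta>)) (\<lambda>\<zeta>. c *s A f \<zeta> + d *s A g \<zeta>)"
    using A unfolding bounded_linear_X_def by blast
  obtain C1 where C1: "C1 > 0" "\<And>x. norm x \<le> C1 * E.en x" using E.norm_le_en by blast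
  obtain C2 where C2: "C2 > 0" "\<And>x. E.en x \<le> C2 * norm x" using E.en_le_norm by blast
  show ?thesis
  proof (rule bounded_linear_intro)
    fix F G :: "(complex^'n) l2" and r :: real
    have "emb I (A (rep_l2 (F + G))) = emb I (A (\<lambda>\<zeta>. 1 *s rep_l2 F \<zeta> + 1 *s rep_l2 G \<zeta>))"
      by (rule bounded_linear_X_cong[OF A]) (simp_all add: X_add emb_rep_add emb_X_simps)
    also have "\<dots> = emb I (\<lambda>\<zeta>. 1 *s A (rep_l2 F) \<zeta> + 1 *s A (rep_l2 G) \<zeta>)"
      using lin[OF rep_X rep_X, of 1 F 1 G] by (simp add: eqX_iff AX X_add)
    finally show "emb I (A (rep_l2 (F + G))) = emb I (A (rep_l2 F)) + emb I (A (rep_l2 G))"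
      by (simp add: AX emb_X_simps)
    have "emb I (A (rep_l2 (r *\<^sub>R F))) = emb I (A (\<lambda>\<zeta>. complex_of_real r *s rep_l2 F \<zeta> + 0 *s rep_l2 F \<zeta>))"
      by (rule bounded_linear_X_cong[OF A]) (simp_all add: X_scale emb_rep_scaleR emb_of_real_scale)
    also have "\<dots> = emb I (\<lambda>\<zeta>. complex_of_real r *s A (rep_l2 F) \<zeta> + 0 *s A (rep_l2 F) \<zeta>)"
      using lin[OF rep_X rep_X, of "complex_of_real r" F 0 F] by (simp add: eqX_iff AX X_scale)
    finally show "emb I (A (rep_l2 (r *\<^sub>R F))) = r *\<^sub>R emb I (A (rep_l2 F))"
      by (simp add: AX emb_of_real_scale)
    have "normX \<Sigma> (A (rep_l2 F)) \<le> C * normX \<Sigma> (rep_l2 F)" using C by simp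
    also have "\<dots> \<le> \<bar>C\<bar> * E.en (emb I (rep_l2 F))"
      unfolding en_emb[OF rep_X, symmetric] by (rule mult_right_mono) simp_all
    also have "\<dots> \<le> \<bar>C\<bar> * (C2 * norm F)"
      by (rule mult_left_mono[OF order_trans[OF en_emb_rep_le C2(2)]]) simp
    finally have "C1 * normX \<Sigma> (A (rep_l2 F)) \<le> C1 * (\<bar>C\<bar> * (C2 * norm F))"
      using C1(1) by (intro mult_left_mono) simp_all
    then show "norm (emb I (A (rep_l2 F))) \<le> norm F * (C1 * (\<bar>C\<bar> * C2))"
      using C1(2)[of "emb I (A (rep_l2 F))"] by (simp add: en_emb AX mult_ac)
  qed
qed

lemma normX_emb_cong: "f \<in> X \<Sigma> \<Longrightarrow> g \<in> X \<Sigma> \<Longrightarrow> eqX \<Sigma> f g \<Longrightarrow> normX \<Sigma> f = normX \<Sigma> g"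
  by (simp add: eqX_iff en_emb[symmetric])

end

section \<open>The lossless and strongly stable case\<close>

text \<open>\<open>skew\<close> annihilates the interior term of the power balance, so that a
  lossless boundary makes the whole system lossless.\<close>

locale lossless_stable_node = port_hamiltonian_node \<Sigma>
  for \<Sigma> :: "('n::finite, 'p::finite, 'k::finite) phs" +
  assumes skew: "cadjoint (P0 \<Sigma>) = - P0 \<Sigma>"
    and lossless: "\<And>g. (WB2 \<Sigma> ** matrix_inv (R0 \<Sigma>)) *v g = 0 \<Longrightarrow>
        complex_of_real ((norm ((WB1 \<Sigma> ** matrix_inv (R0 \<Sigma>)) *v g))\<^sup>2
          - (norm ((WC \<Sigma> ** matrix_inv (R0 \<Sigma>)) *v g))\<^sup>2)
        = cinner (Xi *v g) g"
    and stable: "strongly_stable \<Sigma>"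
begin

lemma energy_balance:
  assumes x: "x \<in> domL \<Sigma>"
  shows "2 * Re (innerX \<Sigma> (opL \<Sigma> x) x) = (norm (opG \<Sigma> x))\<^sup>2 - (norm (opK \<Sigma> x))\<^sup>2"
proof -
  have "WB2 \<Sigma> *v bdry \<Sigma> x = 0" using x by (simp add: domL_def)
  then have "complex_of_real ((norm (opG \<Sigma> x))\<^sup>2 - (norm (opK \<Sigma> x))\<^sup>2)
      = cinner (Xi *v (R0 \<Sigma> *v bdry \<Sigma> x)) (R0 \<Sigma> *v bdry \<Sigma> x)"
    using lossless[of "R0 \<Sigma> *v bdry \<Sigma> x"] by (simp only: R0_inv_mv opG_def opK_def)
  from arg_cong[OF this, of Re]
  have "Re (cinner (Xi *v (R0 \<Sigma> *v bdry \<Sigma> x)) (R0 \<Sigma> *v bdry \<Sigma> x)) = (norm (opG \<Sigma> x))\<^sup>2 - (norm (opK \<Sigma> x))\<^sup>2"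
    by (simp only: Re_complex_of_real)
  \<comment> \<open>Moving \<open>P0\<close> to the other side reverses the sign, so the real part
    equals its own negative.\<close>
  moreover have "Re (cinner (P0 \<Sigma> *v v) v) = 0" for v
  proof -
    have "Re (cinner (P0 \<Sigma> *v v) v) = v \<bullet> (- P0 \<Sigma> *v v)"
      unfolding cinner_cadjoint skew by (rule Re_cinner)
    also have "\<dots> = - (v \<bullet> (P0 \<Sigma> *v v))" by (simp add: matrix_vector_mult_def sum_negf inner_vec_def inner_minus_right)
    also have "v \<bullet> (P0 \<Sigma> *v v) = Re (cinner (P0 \<Sigma> *v v) v)" by (simp add: Re_cinner inner_commute)
    finally show ?thesis by simp
  qed
  ultimately show ?thesis using power_balance[OF x] by simp
qed

lemma generalized_energy_balance:
  assumes x: "generalized_solution \<Sigma> x u y" and t: "t \<ge> 0"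
  shows "(normX \<Sigma> (x t))\<^sup>2 + (LINT s|lebesgue_on {0..t}. (norm (y s))\<^sup>2)
    = (normX \<Sigma> (x 0))\<^sup>2 + (LINT s|lebesgue_on {0..t}. (norm (u s))\<^sup>2)"
proof -
  obtain xs us ys where c: "\<And>m::nat. classical_solution \<Sigma> (xs m) (us m) (ys m)"
    and l: "\<And>t. t \<ge> 0 \<Longrightarrow> (\<lambda>m. emb I (xs m t)) \<longlonglongrightarrow> emb I (x t)"
      "\<And>t. t \<ge> 0 \<Longrightarrow> (\<lambda>m. integral {0..t} (\<lambda>s. (norm (us m s))\<^sup>2)) \<longlonglongrightarrow> (LINT s|lebesgue_on {0..t}. (norm (u s))\<^sup>2)"
      "\<And>t. t \<ge> 0 \<Longrightarrow> (\<lambda>m. integral {0..t} (\<lambda>s. (norm (ys m s))\<^sup>2)) \<longlonglongrightarrow> (LINT s|lebesgue_on {0..t}. (norm (y s))\<^sup>2)"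
    using generalized_approx[OF x] by blast
  have xX: "x s \<in> X \<Sigma>" if "s \<ge> 0" for s using x that unfolding generalized_solution_iff by blast
  have en: "(\<lambda>m. (normX \<Sigma> (xs m s))\<^sup>2) \<longlonglongrightarrow> (normX \<Sigma> (x s))\<^sup>2" if s: "s \<ge> 0" for s
    using tendsto_power[OF E.tendsto_en[OF l(1)[OF s]], of 2] by (simp add: en_emb xX[OF s] classical_D(8)[OF c s])
  have eq: "(normX \<Sigma> (xs m t))\<^sup>2 + integral {0..t} (\<lambda>s. (norm (ys m s))\<^sup>2)
      = (normX \<Sigma> (xs m 0))\<^sup>2 + integral {0..t} (\<lambda>s. (norm (us m s))\<^sup>2)" for m
  proof -
    have "2 * Re (innerX \<Sigma> (opL \<Sigma> (xs m s)) (xs m s)) = (norm (us m s))\<^sup>2 - (norm (ys m s))\<^sup>2" if "s \<in> {0..t}" for s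
      using energy_balance[OF classical_D(3)[OF c, of s]] classical_D(4,5)[OF c, of s] that by simp
    from has_integral_unique[OF has_integral_eq[OF this classical_energy_integral(1)[OF c t]] classical_energy_integral(2)[OF c t]]
    show ?thesis by simp
  qed
  have "(\<lambda>m. (normX \<Sigma> (xs m 0))\<^sup>2 + integral {0..t} (\<lambda>s. (norm (us m s))\<^sup>2)) \<longlonglongrightarrow>
      (normX \<Sigma> (x t))\<^sup>2 + (LINT s|lebesgue_on {0..t}. (norm (y s))\<^sup>2)"
    unfolding eq[symmetric] by (intro tendsto_add en l(3) t)
  moreover have "(\<lambda>m. (normX \<Sigma> (xs m 0))\<^sup>2 + integral {0..t} (\<lambda>s. (norm (us m s))\<^sup>2)) \<longlonglongrightarrow>
      (normX \<Sigma> (x 0))\<^sup>2 + (LINT s|lebesgue_on {0..t}. (norm (u s))\<^sup>2)"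
    by (intro tendsto_add en l(2) t order_refl)
  ultimately show ?thesis by (rule LIMSEQ_unique)
qed

text \<open>\<open>strongly_stable\<close> supplies some semigroup with the prescribed generator.
  Its orbits from the domain are shown to be classical solutions directly, so no comparison with the
  Yosida orbits is required.\<close>

lemma stable_orbit:
  assumes f: "f \<in> domL \<Sigma>" "opG \<Sigma> f = 0"
  shows "\<exists>z w. classical_solution \<Sigma> z (\<lambda>t. 0) w \<and> emb I (z 0) = emb I f \<and> ((\<lambda>t. normX \<Sigma> (z t)) \<longlongrightarrow> 0) at_top"
proof -
  obtain T where sg: "C0_semigroup \<Sigma> T"
    and gen: "generator_graph \<Sigma> T = {(f, g). f \<in> domL \<Sigma> \<and> opG \<Sigma> f = 0 \<and> g \<in> X \<Sigma> \<and> eqX \<Sigma> g (opL \<Sigma> f)}"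
    and decay: "\<And>f. f \<in> X \<Sigma> \<Longrightarrow> ((\<lambda>t. normX \<Sigma> (T t f)) \<longlongrightarrow> 0) at_top"
    using stable unfolding strongly_stable_def by blast
  have bl: "bounded_linear_X \<Sigma> (T t)" if "t \<ge> 0" for t using sg that unfolding C0_semigroup_def by blast
  have TX: "T t g \<in> X \<Sigma>" if "t \<ge> 0" "g \<in> X \<Sigma>" for t g using bl[OF that(1)] that(2) unfolding bounded_linear_X_def by blast
  have T0: "emb I (T 0 g) = emb I g" if "g \<in> X \<Sigma>" for g
  proof -
    have "eqX \<Sigma> (T 0 g) g" using sg that unfolding C0_semigroup_def by blast
    then show ?thesis by (simp only: eqX_iff[OF TX[OF order_refl that] that])
  qed
  have Tadd: "emb I (T (s + t) g) = emb I (T s (T t g))" if "s \<ge> 0" "t \<ge> 0" "g \<in> X \<Sigma>" for s t g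
  proof -
    have "eqX \<Sigma> (T (s + t) g) (T s (T t g))" using sg that unfolding C0_semigroup_def by blast
    then show ?thesis using eqX_iff[OF TX[OF add_nonneg_nonneg[OF that(1,2)] that(3)] TX[OF that(1) TX[OF that(2,3)]]] by simp
  qed
  have Tc: "((\<lambda>t. normX \<Sigma> (\<lambda>\<zeta>. T t g \<zeta> - g \<zeta>)) \<longlongrightarrow> 0) (at_right 0)" if "g \<in> X \<Sigma>" for g
    using sg that unfolding C0_semigroup_def by blast
  define S where "S t F = emb I (T t (rep_l2 F))" for t F
  have S_emb: "S t (emb I g) = emb I (T t g)" if "t \<ge> 0" "g \<in> X \<Sigma>" for t g
    unfolding S_def by (rule bounded_linear_X_cong[OF bl[OF that(1)] rep_X that(2) emb_X_simps(4)[OF that(2)]])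
  have pos: "\<forall>\<^sub>F h in at_right (0::real). 0 < h" by (rule eventually_at_right_less)
  have sgS: "c0_semigroup S"
  proof (rule c0_semigroup.intro)
    show "bounded_linear (S t)" if "t \<ge> 0" for t unfolding S_def by (rule bounded_linear_X_emb[OF bl[OF that]])
    show "S (s + t) F = S s (S t F)" if "s \<ge> 0" "t \<ge> 0" for s t F
      unfolding S_def[of "s + t"] S_def[of t] using that by (simp add: S_emb TX Tadd)
    fix F
    have "\<forall>\<^sub>F t in at_right 0. normX \<Sigma> (\<lambda>\<zeta>. T t (rep_l2 F) \<zeta> - rep_l2 F \<zeta>) = E.en (S t F - S 0 F)"
      using pos by eventually_elim (simp add: normX_diff TX S_def T0)
    then have "((\<lambda>t. E.en (S t F - S 0 F)) \<longlongrightarrow> 0) (at_right 0)"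
      by (rule Lim_transform_eventually[rotated]) (rule Tc, rule rep_X)
    then show "((\<lambda>t. S t F) \<longlongrightarrow> S 0 F) (at_right 0)" by (simp only: E.tendsto_iff_en)
  qed
  have fX: "f \<in> X \<Sigma>" and LfX: "opL \<Sigma> f \<in> X \<Sigma>" by (rule domL_X[OF f(1)], rule opL_X[OF f(1)])
  define F G where "F = emb I f" and "G = emb I (opL \<Sigma> f)"
  have SF: "S t F = emb I (T t f)" and SG: "S t G = emb I (T t (opL \<Sigma> f))" if "t \<ge> 0" for t
    using that by (simp_all add: F_def G_def S_emb fX LfX)
  have S0: "S 0 F = F" by (simp add: SF T0 fX) (simp add: F_def)
  have lim: "((\<lambda>h. (S h F - S 0 F) /\<^sub>R h) \<longlongrightarrow> G) (at_right 0)"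
  proof -
    have "(f, opL \<Sigma> f) \<in> generator_graph \<Sigma> T" unfolding gen using f LfX by (simp add: eqX_iff)
    then have "((\<lambda>t. normX \<Sigma> (\<lambda>\<zeta>. (T t f \<zeta> - f \<zeta>) /\<^sub>R t - opL \<Sigma> f \<zeta>)) \<longlongrightarrow> 0) (at_right 0)"
      by (simp add: generator_graph_def)
    moreover have "\<forall>\<^sub>F h in at_right 0. normX \<Sigma> (\<lambda>\<zeta>. (T h f \<zeta> - f \<zeta>) /\<^sub>R h - opL \<Sigma> f \<zeta>) = E.en ((S h F - S 0 F) /\<^sub>R h - G)"
      using pos by eventually_elim (simp add: quotient_normX TX fX LfX SF S0, simp add: F_def G_def)
    ultimately have "((\<lambda>h. E.en ((S h F - S 0 F) /\<^sub>R h - G)) \<longlongrightarrow> 0) (at_right 0)" by (rule Lim_transform_eventually)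
    then show ?thesis by (simp only: E.tendsto_iff_en)
  qed
  \<comment> \<open>Commuting \<open>S t\<close> with the difference quotient shows that the orbit
    stays in the domain of the generator. The prescribed graph then yields the boundary conditions
    and identifies \<open>opL \<Sigma> (T t f)\<close>.\<close>
  have dom: "T t f \<in> domL \<Sigma>" "opG \<Sigma> (T t f) = 0" "emb I (opL \<Sigma> (T t f)) = S t G" if t: "t \<ge> 0" for t
  proof -
    have "((\<lambda>h. S t ((S h F - S 0 F) /\<^sub>R h)) \<longlongrightarrow> S t G) (at_right 0)" by (rule c0_semigroup.tendsto_right[OF sgS lim t])
    then have "((\<lambda>h. E.en (S t ((S h F - S 0 F) /\<^sub>R h) - S t G)) \<longlongrightarrow> 0) (at_right 0)" by (simp only: E.tendsto_iff_en)
    moreover have "\<forall>\<^sub>F h in at_right 0. E.en (S t ((S h F - S 0 F) /\<^sub>R h) - S t G)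
        = normX \<Sigma> (\<lambda>\<zeta>. (T h (T t f) \<zeta> - T t f \<zeta>) /\<^sub>R h - T t (opL \<Sigma> f) \<zeta>)"
      using pos
    proof eventually_elim
      case (elim h)
      then have h: "h \<ge> 0" by simp
      have "S t (S h F) = S h (S t F)" using c0_semigroup.semigroup[OF sgS t h, of F] c0_semigroup.semigroup[OF sgS h t, of F] by (simp add: add.commute)
      then show ?case
        using t h by (simp add: quotient_normX TX fX LfX c0_semigroup.scaleR[OF sgS t] c0_semigroup.diff[OF sgS t] S0 SF SG S_emb)
    qed
    ultimately have "((\<lambda>h. normX \<Sigma> (\<lambda>\<zeta>. (T h (T t f) \<zeta> - T t f \<zeta>) /\<^sub>R h - T t (opL \<Sigma> f) \<zeta>)) \<longlongrightarrow> 0) (at_right 0)"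
      by (rule Lim_transform_eventually)
    then have "(T t f, T t (opL \<Sigma> f)) \<in> generator_graph \<Sigma> T"
      by (simp add: generator_graph_def TX t fX LfX)
    then have *: "T t f \<in> domL \<Sigma>" "opG \<Sigma> (T t f) = 0" "eqX \<Sigma> (T t (opL \<Sigma> f)) (opL \<Sigma> (T t f))" unfolding gen by auto
    then show "T t f \<in> domL \<Sigma>" "opG \<Sigma> (T t f) = 0" by simp_all
    show "emb I (opL \<Sigma> (T t f)) = S t G" using *(3) by (simp add: SG t eqX_iff TX LfX opL_X[OF *(1)])
  qed
  have "classical_solution \<Sigma> (\<lambda>t. T t f) (\<lambda>t. 0) (\<lambda>t. opK \<Sigma> (T t f))"
  proof (rule classical_from_orbit)
    show "T t f \<in> domL \<Sigma>" "opG \<Sigma> (T t f) = 0" if "t \<ge> 0" for t by (rule dom(1,2)[OF that])+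
    show "((\<lambda>s. emb I (T s f)) has_vector_derivative emb I (opL \<Sigma> (T t f))) (at t within {0..})" if t: "t \<ge> 0" for t
      unfolding dom(3)[OF t]
      by (rule has_vector_derivative_transform[OF _ _ c0_semigroup.orbit_derivative[OF sgS lim t]]) (use t in \<open>simp_all add: SF\<close>)
    show "continuous_on {0..} (\<lambda>t. emb I (opL \<Sigma> (T t f)))"
      by (rule continuous_on_eq[OF c0_semigroup.orbit_continuous[OF sgS, of G]]) (simp add: dom(3))
  qed
  with T0[OF fX] decay[OF fX] show ?thesis by blast
qed

text \<open>Late in time the input can hardly act: the solution stays close to a zero-input orbit
  that starts near its state at a late time s, and that orbit decays.\<close>

lemma square_integrable_input_decay:
  assumes x: "generalized_solution \<Sigma> x u y" and u: "u \<in> L2 {0..}"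
  shows "((\<lambda>t. normX \<Sigma> (x t)) \<longlongrightarrow> 0) at_top"
proof (rule tendstoI)
  fix e :: real assume "e > 0"
  then have d: "e / 4 > 0" by simp
  \<comment> \<open>The final estimate spends 2 d on the distance to the orbit and d on the orbit
    itself, and 3 d < e.\<close>
  define d where "d = e / 4"
  have xX: "x s \<in> X \<Sigma>" if "s \<ge> 0" for s using x that unfolding generalized_solution_iff by blast
  define U where "U T = (LINT s|lebesgue_on {0..T}. (norm (u s))\<^sup>2)" for T :: real
  have bdd: "bdd_above (U ` {0..})"
    by (rule bdd_aboveI2[of _ _ "LINT s|lebesgue_on {0..}. (norm (u s))\<^sup>2"]) (auto simp: U_def intro!: L2_LINT_mono[OF u])
  have "Sup (U ` {0..}) - d\<^sup>2 < Sup (U ` {0..})" using d by (simp add: d_def)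
  \<comment> \<open>The input energy still to come after s is at most d^2, uniformly in the later
    time.\<close>
  then obtain s where s: "s \<ge> 0" "Sup (U ` {0..}) - d\<^sup>2 < U s"
    by (subst (asm) less_cSUP_iff) (use bdd in auto)
  have Us: "U (s + t) - U s \<le> d\<^sup>2" if "t \<ge> 0" for t
  proof -
    have "U (s + t) \<le> Sup (U ` {0..})" by (rule cSUP_upper[OF _ bdd]) (use s that in simp)
    then show ?thesis using s by linarith
  qed
  \<comment> \<open>\<open>x s\<close> need not lie in the domain of the generator, so the decaying
    orbit starts from a nearby element that does.\<close>
  obtain F where F: "F \<in> D0" "E.en (emb I (x s) - F) < d" using A.dense_approx[of d "emb I (x s)"] d by (auto simp: d_def)
  have "rep_l2 F \<in> domL \<Sigma>" "opG \<Sigma> (rep_l2 F) = 0" using F(1) by (auto simp: D0_def)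
  from stable_orbit[OF this] obtain z w where z: "classical_solution \<Sigma> z (\<lambda>t. 0) w" "emb I (z 0) = emb I (rep_l2 F)"
    and zd: "((\<lambda>t. normX \<Sigma> (z t)) \<longlongrightarrow> 0) at_top" by blast
  have "E.en (emb I (x s) - emb I (z 0)) = E.en (emb I (rep_l2 (emb I (x s) - F)))"
    by (simp add: z(2) emb_rep_diff emb_X_simps xX[OF s(1)])
  also have "\<dots> \<le> d" using en_emb_rep_le[of "emb I (x s) - F"] F(2) by linarith
  finally have close: "(E.en (emb I (x s) - emb I (z 0)))\<^sup>2 \<le> d\<^sup>2" by (rule power_mono) simp
  have diff: "E.en (emb I (x (s + t)) - emb I (z t)) \<le> 2 * d" if t: "t \<ge> 0" for t
  proof (rule power2_le_imp_le)
    have "(E.en (emb I (x (s + t)) - emb I (z t)))\<^sup>2 \<le> d\<^sup>2 + d\<^sup>2"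
      using generalized_compare[OF x z(1) s(1) t] Us[OF t] close unfolding U_def by linarith
    also have "\<dots> \<le> (2 * d)\<^sup>2" by (simp add: power_mult_distrib)
    finally show "(E.en (emb I (x (s + t)) - emb I (z t)))\<^sup>2 \<le> (2 * d)\<^sup>2" .
  qed (use d in \<open>simp add: d_def\<close>)
  have "\<forall>\<^sub>F t in at_top. normX \<Sigma> (z t) < d" using order_tendstoD(2)[OF zd, of d] d by (simp add: d_def)
  then obtain N where N: "\<And>t. t \<ge> N \<Longrightarrow> normX \<Sigma> (z t) < d" by (auto simp: eventually_at_top_linorder)
  have "normX \<Sigma> (x r) < e" if r: "r \<ge> s + max N 0" for r
  proof -
    have t: "r - s \<ge> 0" "r - s \<ge> N" using r by auto
    have "E.en (emb I (x r)) \<le> E.en (emb I (x r) - emb I (z (r - s))) + E.en (emb I (z (r - s)))"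
      using E.en_triangle[of "emb I (x r) - emb I (z (r - s))" "emb I (z (r - s))"] by simp
    also have "\<dots> < 2 * d + d"
      using diff[OF t(1)] N[OF t(2)] by (simp add: en_emb classical_D(8)[OF z(1) t(1)])
    also have "\<dots> < e" using d by (simp add: d_def)
    finally show ?thesis using xX[of r] s(1) t(1) by (simp add: en_emb)
  qed
  then have "\<forall>\<^sub>F r in at_top. normX \<Sigma> (x r) < e" unfolding eventually_at_top_linorder by blast
  moreover have "\<forall>\<^sub>F r in at_top. (0::real) \<le> r" by (rule eventually_ge_at_top)
  ultimately show "\<forall>\<^sub>F r in at_top. dist (normX \<Sigma> (x r)) 0 < e"
    by eventually_elim (simp add: en_emb[symmetric] xX)
qed

text \<open>The balance on [0, n] is kept free of subtraction, so it passes to the limit in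
  \<open>ennreal\<close> without knowing beforehand that the output is square-integrable. The state
  term vanishes in the limit.\<close>

lemma output_energy:
  assumes x: "generalized_solution \<Sigma> x u y" and x0: "eqX \<Sigma> (x 0) x0" "x0 \<in> X \<Sigma>" and u: "u \<in> L2 {0..}"
  shows "(\<integral>\<^sup>+t. ennreal ((norm (y t))\<^sup>2) \<partial>lebesgue_on {0..})
    = ennreal ((normX \<Sigma> x0)\<^sup>2) + (\<integral>\<^sup>+t. ennreal ((norm (u t))\<^sup>2) \<partial>lebesgue_on {0..})"
proof -
  define U Y where "U n = (LINT s|lebesgue_on {0..real n}. (norm (u s))\<^sup>2)"
    and "Y n = (LINT s|lebesgue_on {0..real n}. (norm (y s))\<^sup>2)" for n :: nat
  have L: "x T \<in> X \<Sigma>" "u \<in> L2 {0..T}" "y \<in> L2 {0..T}" if "T \<ge> 0" for T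
    using x that unfolding generalized_solution_iff by blast+
  have inc: "incseq (\<lambda>n. ennreal (LINT s|lebesgue_on {0..real n}. (norm (g s))\<^sup>2))" if "\<And>T. T \<ge> 0 \<Longrightarrow> g \<in> L2 {0..T}"
    for g :: "real \<Rightarrow> 'e::euclidean_space"
  proof (rule incseq_SucI, rule ennreal_leI)
    show "(LINT s|lebesgue_on {0..real n}. (norm (g s))\<^sup>2) \<le> (LINT s|lebesgue_on {0..real (Suc n)}. (norm (g s))\<^sup>2)" for n
      by (rule L2_LINT_mono) (auto intro: that)
  qed
  have sup: "(\<integral>\<^sup>+t. ennreal ((norm (u t))\<^sup>2) \<partial>lebesgue_on {0..}) = (SUP n. ennreal (U n))"
    "(\<integral>\<^sup>+t. ennreal ((norm (y t))\<^sup>2) \<partial>lebesgue_on {0..}) = (SUP n. ennreal (Y n))"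
    unfolding U_def Y_def by (rule nn_integral_Ici_SUP(2), rule L(2), assumption) (rule nn_integral_Ici_SUP(2), rule L(3), assumption)
  have "incseq (\<lambda>n. ennreal (U n))" "incseq (\<lambda>n. ennreal (Y n))"
    unfolding U_def Y_def by (rule inc, rule L(2), assumption) (rule inc, rule L(3), assumption)
  from this[THEN LIMSEQ_SUP]
  have lim: "(\<lambda>n. ennreal (U n)) \<longlonglongrightarrow> (\<integral>\<^sup>+t. ennreal ((norm (u t))\<^sup>2) \<partial>lebesgue_on {0..})"
    "(\<lambda>n. ennreal (Y n)) \<longlonglongrightarrow> (\<integral>\<^sup>+t. ennreal ((norm (y t))\<^sup>2) \<partial>lebesgue_on {0..})"
    by (simp_all only: sup)
  have "(\<lambda>n. normX \<Sigma> (x (real n))) \<longlonglongrightarrow> 0"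
    using square_integrable_input_decay[OF x u] filterlim_real_sequentially by (rule filterlim_compose)
  from tendsto_power[OF this, of 2] have "(\<lambda>n. ennreal ((normX \<Sigma> (x (real n)))\<^sup>2)) \<longlonglongrightarrow> ennreal 0"
    by (intro tendsto_ennrealI) simp
  from tendsto_add[OF this lim(2)]
  have "(\<lambda>n. ennreal ((normX \<Sigma> (x (real n)))\<^sup>2) + ennreal (Y n)) \<longlonglongrightarrow> (\<integral>\<^sup>+t. ennreal ((norm (y t))\<^sup>2) \<partial>lebesgue_on {0..})" by simp
  moreover have "ennreal ((normX \<Sigma> (x (real n)))\<^sup>2) + ennreal (Y n) = ennreal ((normX \<Sigma> x0)\<^sup>2) + ennreal (U n)" for n
  proof -
    have "0 \<le> U n" "0 \<le> Y n" by (simp_all add: U_def Y_def)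
    moreover have "(normX \<Sigma> (x (real n)))\<^sup>2 + Y n = (normX \<Sigma> x0)\<^sup>2 + U n"
      using generalized_energy_balance[OF x, of "real n"] normX_emb_cong[OF L(1)[OF order_refl] x0(2,1)]
      by (simp add: U_def Y_def)
    ultimately show ?thesis by (simp add: ennreal_plus[symmetric] del: ennreal_plus)
  qed
  ultimately have "(\<lambda>n. ennreal ((normX \<Sigma> x0)\<^sup>2) + ennreal (U n)) \<longlonglongrightarrow> (\<integral>\<^sup>+t. ennreal ((norm (y t))\<^sup>2) \<partial>lebesgue_on {0..})"
    by simp
  moreover have "(\<lambda>n. ennreal ((normX \<Sigma> x0)\<^sup>2) + ennreal (U n)) \<longlonglongrightarrow>
      ennreal ((normX \<Sigma> x0)\<^sup>2) + (\<integral>\<^sup>+t. ennreal ((norm (u t))\<^sup>2) \<partial>lebesgue_on {0..})"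
    by (intro tendsto_add tendsto_const lim(1))
  ultimately show ?thesis by (rule LIMSEQ_unique)
qed

text \<open>Replacing the output energy by the balance gives this value for every solution. It is
  stated as a lower bound because the cost is infinite if no solution has the input
  \<open>u\<close>.\<close>

lemma cost_ge:
  assumes x0: "x0 \<in> X \<Sigma>" and u: "u \<in> L2 {0..}"
  shows "ennreal ((normX \<Sigma> x0)\<^sup>2) + 2 * (\<integral>\<^sup>+t. ennreal ((norm (u t))\<^sup>2) \<partial>lebesgue_on {0..}) \<le> cost \<Sigma> x0 u"
  unfolding cost_def
proof (rule INF_greatest)
  fix p assume "p \<in> {(x, y). generalized_solution \<Sigma> x u y \<and> eqX \<Sigma> (x 0) x0}"
  then obtain x y where p: "p = (x, y)" and x: "generalized_solution \<Sigma> x u y" "eqX \<Sigma> (x 0) x0" by auto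
  note [measurable] = generalized_L2_measurable[OF x(1)]
  have "(\<integral>\<^sup>+t. ennreal ((norm (u t))\<^sup>2 + (norm (y t))\<^sup>2) \<partial>lebesgue_on {0..})
      = (\<integral>\<^sup>+t. ennreal ((norm (u t))\<^sup>2) \<partial>lebesgue_on {0..}) + (\<integral>\<^sup>+t. ennreal ((norm (y t))\<^sup>2) \<partial>lebesgue_on {0..})"
    by (simp add: nn_integral_add)
  then show "ennreal ((normX \<Sigma> x0)\<^sup>2) + 2 * (\<integral>\<^sup>+t. ennreal ((norm (u t))\<^sup>2) \<partial>lebesgue_on {0..})
      \<le> (case p of (x, y) \<Rightarrow> \<integral>\<^sup>+t. ennreal ((norm (u t))\<^sup>2 + (norm (y t))\<^sup>2) \<partial>lebesgue_on {0..})"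
    unfolding p output_energy[OF x x0 u] by (simp add: mult_2 add_ac)
qed

lemma optimal_cost_eq_normX:
  assumes x0: "x0 \<in> X \<Sigma>"
  shows "optimal_cost \<Sigma> x0 = ennreal ((normX \<Sigma> x0)\<^sup>2)"
proof (rule antisym[OF optimal_cost_le_normX[OF x0]])
  show "ennreal ((normX \<Sigma> x0)\<^sup>2) \<le> optimal_cost \<Sigma> x0"
    unfolding optimal_cost_def
  proof (rule INF_greatest)
    fix u :: "real \<Rightarrow> complex^'p" assume "u \<in> L2 {0..}"
    from order_trans[OF _ cost_ge[OF x0 this]] show "ennreal ((normX \<Sigma> x0)\<^sup>2) \<le> cost \<Sigma> x0 u" by simp
  qed
qed

lemma optimal_control_zero:
  assumes x0: "x0 \<in> X \<Sigma>"
  shows "optimal_control \<Sigma> x0 (\<lambda>t. 0)"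
proof -
  have "cost \<Sigma> x0 (\<lambda>t. 0) = ennreal ((normX \<Sigma> x0)\<^sup>2)"
    using cost_ge[OF x0 L2_zero] by (intro antisym[OF cost_zero_le[OF x0]]) simp
  then show ?thesis by (simp add: optimal_control_def optimal_cost_eq_normX[OF x0])
qed

text \<open>An optimal input cannot exceed the cost of the zero input, so the extra term, twice its
  energy, is 0. The energy of the state is finite and can be cancelled.\<close>

lemma optimal_control_unique:
  assumes x0: "x0 \<in> X \<Sigma>" and u: "optimal_control \<Sigma> x0 u"
  shows "AE t in lebesgue_on {0..}. u t = 0"
proof -
  have uL: "u \<in> L2 {0..}" and c: "cost \<Sigma> x0 u = ennreal ((normX \<Sigma> x0)\<^sup>2)"
    using u by (simp_all add: optimal_control_def optimal_cost_eq_normX[OF x0])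
  note [measurable] = L2_measurable[OF uL]
  have "ennreal ((normX \<Sigma> x0)\<^sup>2) + 2 * (\<integral>\<^sup>+t. ennreal ((norm (u t))\<^sup>2) \<partial>lebesgue_on {0..}) \<le> ennreal ((normX \<Sigma> x0)\<^sup>2) + 0"
    using cost_ge[OF x0 uL] c by simp
  then have "2 * (\<integral>\<^sup>+t. ennreal ((norm (u t))\<^sup>2) \<partial>lebesgue_on {0..}) \<le> 0"
    by (simp only: ennreal_add_left_cancel_le) simp
  then have "(\<integral>\<^sup>+t. ennreal ((norm (u t))\<^sup>2) \<partial>lebesgue_on {0..}) = 0" by simp
  then show ?thesis by (subst (asm) nn_integral_0_iff_AE) simp_all
qed

lemma optimal_cost_operator_id: "optimal_cost_operator \<Sigma> (\<lambda>x. x)"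
  unfolding optimal_cost_operator_def bounded_linear_X_def
proof (intro conjI ballI allI)
  show "\<exists>C. \<forall>f\<in>X \<Sigma>. normX \<Sigma> f \<le> C * normX \<Sigma> f" by (rule exI[of _ 1]) simp
  show "ereal (Re (innerX \<Sigma> f f)) = enn2ereal (optimal_cost \<Sigma> f)" if "f \<in> X \<Sigma>" for f
    using that by (simp add: optimal_cost_eq_normX enn2ereal_ennreal normX_sq[symmetric])
qed (simp_all add: eqX_def)

text \<open>\<open>Popt\<close> and the identity have the same quadratic form. Both are symmetric,
  so polarization makes their bilinear forms agree.\<close>

lemma optimal_cost_operator_unique:
  assumes P: "optimal_cost_operator \<Sigma> Popt" and f: "f \<in> X \<Sigma>"
  shows "eqX \<Sigma> (Popt f) f"
proof -
  have PX: "\<And>f. f \<in> X \<Sigma> \<Longrightarrow> Popt f \<in> X \<Sigma>"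
    and lin: "\<And>f g c d. f \<in> X \<Sigma> \<Longrightarrow> g \<in> X \<Sigma> \<Longrightarrow> eqX \<Sigma> (Popt (\<lambda>\<zeta>. c *s f \<zeta> + d *s g \<zeta>)) (\<lambda>\<zeta>. c *s Popt f \<zeta> + d *s Popt g \<zeta>)"
    and sa: "\<And>f g. f \<in> X \<Sigma> \<Longrightarrow> g \<in> X \<Sigma> \<Longrightarrow> innerX \<Sigma> f (Popt g) = innerX \<Sigma> (Popt f) g"
    and opt: "\<And>f. f \<in> X \<Sigma> \<Longrightarrow> ereal (Re (innerX \<Sigma> f (Popt f))) = enn2ereal (optimal_cost \<Sigma> f)"
    using P unfolding optimal_cost_operator_def bounded_linear_X_def by blast+
  have q: "ip (emb I g) (emb I (Popt g)) = ip (emb I g) (emb I g)" if g: "g \<in> X \<Sigma>" for g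
  proof -
    have "Re (innerX \<Sigma> g (Popt g)) = (normX \<Sigma> g)\<^sup>2"
      using opt[OF g] by (simp add: optimal_cost_eq_normX[OF g] enn2ereal_ennreal)
    then show ?thesis using g by (simp add: ip_emb PX normX_sq)
  qed
  show ?thesis
  proof (rule eqX_weak[OF PX[OF f] f])
    fix h assume h: "h \<in> X \<Sigma>"
    have "emb I (Popt (\<lambda>\<zeta>. h \<zeta> + f \<zeta>)) = emb I (Popt h) + emb I (Popt f)"
      using lin[OF h f, of 1 1] h f by (simp add: eqX_iff PX X_add emb_X_simps)
    then have "ip (emb I h + emb I f) (emb I (Popt h) + emb I (Popt f)) = ip (emb I h + emb I f) (emb I h + emb I f)"
      using q[OF X_add[OF h f]] h f by (simp add: emb_X_simps)
    moreover have "ip (emb I f) (emb I (Popt h)) = ip (emb I h) (emb I (Popt f))"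
    proof -
      have "ip (emb I f) (emb I (Popt h)) = ip (emb I (Popt f)) (emb I h)"
        using arg_cong[OF sa[OF f h], of Re] f h by (simp add: ip_emb PX)
      then show ?thesis by (simp only: E.sym[of "emb I (Popt f)" "emb I h"])
    qed
    ultimately have "ip (emb I h) (emb I (Popt f)) = ip (emb I h) (emb I f)"
      using q[OF h] q[OF f] E.sym[of "emb I f" "emb I h"] by (simp add: E.ip_simps)
    then show "Re (innerX \<Sigma> h (Popt f)) = Re (innerX \<Sigma> h f)" using h f by (simp add: ip_emb PX)
  qed
qed

text \<open>By the energy balance the inner products contribute the squared norm of
  \<open>opG\<close> minus that of \<open>opK\<close>. The output terms cancel and the input term
  doubles, which is the origin of the factor sqrt 2.\<close>

lemma riccati_id: "boundary_node_Riccati \<Sigma> (\<lambda>x. x) (\<lambda>x. sqrt 2 *\<^sub>R (WB1 \<Sigma> *v bdry \<Sigma> x))"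
  unfolding boundary_node_Riccati_def
proof
  fix x assume x: "x \<in> domL \<Sigma>"
  have "innerX \<Sigma> (opL \<Sigma> x) x + innerX \<Sigma> x (opL \<Sigma> x) = of_real (2 * Re (innerX \<Sigma> (opL \<Sigma> x) x))"
    unfolding cnj_innerX[OF opL_X[OF x] domL_X[OF x], symmetric] by (rule complex_add_cnj)
  also have "\<dots> = of_real ((norm (opG \<Sigma> x))\<^sup>2 - (norm (opK \<Sigma> x))\<^sup>2)" by (simp only: energy_balance[OF x])
  finally show "innerX \<Sigma> (opL \<Sigma> x) x + innerX \<Sigma> x (opL \<Sigma> x) + of_real ((norm (opG \<Sigma> x))\<^sup>2) + of_real ((norm (opK \<Sigma> x))\<^sup>2)
      = of_real ((norm (sqrt 2 *\<^sub>R (WB1 \<Sigma> *v bdry \<Sigma> x)))\<^sup>2)"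
    by (simp add: opG_def[symmetric] power_mult_distrib)
qed

end

text \<open>As functions, optimal cost operators are determined only up to equality almost
  everywhere, so the bound and the identification with the identity are stated for all of them. The
  separate existence claim keeps the bound from being vacuous.\<close>

theorem theorem8:
  fixes \<Sigma> :: "('n::finite, 'p::finite, 'k::finite) phs"
  assumes "port_hamiltonian \<Sigma>"
    and "standing_assumption \<Sigma>"
    and "\<And>v. Re (cinner (P0 \<Sigma> *v v) v) \<le> 0"
    and "\<And>g. (WB2 \<Sigma> ** matrix_inv (R0 \<Sigma>)) *v g = 0 \<Longrightarrow>
           (norm ((WB1 \<Sigma> ** matrix_inv (R0 \<Sigma>)) *v g))\<^sup>2
             - (norm ((WC \<Sigma> ** matrix_inv (R0 \<Sigma>)) *v g))\<^sup>2
           \<ge> Re (cinner (Xi *v g) g)"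
  shows "finite_cost_condition \<Sigma> \<and>
    (\<exists>Popt. optimal_cost_operator \<Sigma> Popt) \<and>
    (\<forall>Popt. optimal_cost_operator \<Sigma> Popt \<longrightarrow>
       (\<forall>x0\<in>X \<Sigma>. Re (innerX \<Sigma> x0 (Popt x0)) \<le> (normX \<Sigma> x0)\<^sup>2)) \<and>
    (cadjoint (P0 \<Sigma>) = - P0 \<Sigma> \<and>
     (\<forall>g. (WB2 \<Sigma> ** matrix_inv (R0 \<Sigma>)) *v g = 0 \<longrightarrow>
        complex_of_real ((norm ((WB1 \<Sigma> ** matrix_inv (R0 \<Sigma>)) *v g))\<^sup>2
          - (norm ((WC \<Sigma> ** matrix_inv (R0 \<Sigma>)) *v g))\<^sup>2)
        = cinner (Xi *v g) g) \<and>
     strongly_stable \<Sigma> \<longrightarrow>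
       optimal_cost_operator \<Sigma> (\<lambda>x. x) \<and>
       (\<forall>Popt. optimal_cost_operator \<Sigma> Popt \<longrightarrow> (\<forall>x0\<in>X \<Sigma>. eqX \<Sigma> (Popt x0) x0)) \<and>
       (\<forall>x0\<in>X \<Sigma>. optimal_control \<Sigma> x0 (\<lambda>t. 0) \<and>
          (\<forall>u. optimal_control \<Sigma> x0 u \<longrightarrow> (AE t in lebesgue_on {0..}. u t = 0))) \<and>
       boundary_node_Riccati \<Sigma> (\<lambda>x. x) (\<lambda>x. sqrt 2 *\<^sub>R (WB1 \<Sigma> *v bdry \<Sigma> x)))"
proof -
  have node: "port_hamiltonian_node \<Sigma>"
    by (rule port_hamiltonian_node.intro) (fact assms)+
  show ?thesis
  proof (intro conjI impI)
    show "finite_cost_condition \<Sigma>" by (rule port_hamiltonian_node.finite_cost[OF node])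
    show "\<exists>Popt. optimal_cost_operator \<Sigma> Popt" by (rule port_hamiltonian_node.optimal_cost_operator_exists[OF node])
    show "\<forall>Popt. optimal_cost_operator \<Sigma> Popt \<longrightarrow>
       (\<forall>x0\<in>X \<Sigma>. Re (innerX \<Sigma> x0 (Popt x0)) \<le> (normX \<Sigma> x0)\<^sup>2)"
      by (intro allI impI ballI port_hamiltonian_node.optimal_cost_operator_le[OF node])
  next
    assume *: "cadjoint (P0 \<Sigma>) = - P0 \<Sigma> \<and>
     (\<forall>g. (WB2 \<Sigma> ** matrix_inv (R0 \<Sigma>)) *v g = 0 \<longrightarrow>
        complex_of_real ((norm ((WB1 \<Sigma> ** matrix_inv (R0 \<Sigma>)) *v g))\<^sup>2
          - (norm ((WC \<Sigma> ** matrix_inv (R0 \<Sigma>)) *v g))\<^sup>2)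
        = cinner (Xi *v g) g) \<and>
     strongly_stable \<Sigma>"
    have S: "lossless_stable_node \<Sigma>"
    proof (rule lossless_stable_node.intro[OF node], rule lossless_stable_node_axioms.intro)
      show "cadjoint (P0 \<Sigma>) = - P0 \<Sigma>" using * by (rule conjunct1)
      show "strongly_stable \<Sigma>" using * by (elim conjE)
      show "complex_of_real ((norm ((WB1 \<Sigma> ** matrix_inv (R0 \<Sigma>)) *v g))\<^sup>2
          - (norm ((WC \<Sigma> ** matrix_inv (R0 \<Sigma>)) *v g))\<^sup>2) = cinner (Xi *v g) g"
        if "(WB2 \<Sigma> ** matrix_inv (R0 \<Sigma>)) *v g = 0" for g
        by (rule mp[OF spec[OF conjunct1[OF conjunct2[OF *]]] that])
    qed
    show "optimal_cost_operator \<Sigma> (\<lambda>x. x)" by (rule lossless_stable_node.optimal_cost_operator_id[OF S])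
    show "\<forall>Popt. optimal_cost_operator \<Sigma> Popt \<longrightarrow> (\<forall>x0\<in>X \<Sigma>. eqX \<Sigma> (Popt x0) x0)"
      by (intro allI impI ballI lossless_stable_node.optimal_cost_operator_unique[OF S])
    show "\<forall>x0\<in>X \<Sigma>. optimal_control \<Sigma> x0 (\<lambda>t. 0) \<and>
          (\<forall>u. optimal_control \<Sigma> x0 u \<longrightarrow> (AE t in lebesgue_on {0..}. u t = 0))"
      by (intro ballI conjI allI impI lossless_stable_node.optimal_control_zero[OF S]
          lossless_stable_node.optimal_control_unique[OF S])
    show "boundary_node_Riccati \<Sigma> (\<lambda>x. x) (\<lambda>x. sqrt 2 *\<^sub>R (WB1 \<Sigma> *v bdry \<Sigma> x))"
      by (rule lossless_stable_node.riccati_id[OF S])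
  qed
qed

end
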